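(* Let $q>1$ and let $\Omega\subset\mathbb R^N$ be a domain with nonempty bounded boundary $\partial\Omega$ satisfying the parabolic Wiener criterion. Then for every nonnegative $f\in C(\partial\Omega\times[0,\infty))$ there exists a unique positive function $u\in C(\overline\Omega\times(0,\infty))\cap C^{2,1}(\Omega\times(0,\infty))$ satisfying $$\partial_tu-\Delta u+|u|^{q-1}u=0\ \text{in }\Omega\times(0,\infty),\qquad u=f\ \text{on }\partial\Omega\times(0,\infty),\qquad \lim_{t\to0}u(x,t)=\infty\ \text{locally uniformly in }\Omega.$$
   Context: PWC (parabolic Wiener criterion): every point of $\partial\Omega\times(0,\infty)$ is regular for the Dirichlet problem for the heat equation in $\Omega\times(0,\infty)$, so that the Dirichlet problem with any continuous lateral data is solvable with continuous attainment of the boundary values. *)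

theory Defs
  imports "HOL-Analysis.Analysis"
begin

definition pdx :: "'a::euclidean_space \<Rightarrow> ('a \<times> real \<Rightarrow> real) \<Rightarrow> 'a \<times> real \<Rightarrow> real" where
  "pdx i u p = deriv (\<lambda>s. u (fst p + s *\<^sub>R i, snd p)) 0"

definition pdt :: "('a \<times> real \<Rightarrow> real) \<Rightarrow> 'a \<times> real \<Rightarrow> real" where
  "pdt u p = deriv (\<lambda>s. u (fst p, snd p + s)) 0"

definition has_pdx :: "'a::euclidean_space \<Rightarrow> ('a \<times> real \<Rightarrow> real) \<Rightarrow> 'a \<times> real \<Rightarrow> bool" where
  "has_pdx i u p \<longleftrightarrow> (\<exists>d. ((\<lambda>s. u (fst p + s *\<^sub>R i, snd p)) has_real_derivative d) (at 0))"

definition has_pdt :: "('a \<times> real \<Rightarrow> real) \<Rightarrow> 'a \<times> real \<Rightarrow> bool" where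
  "has_pdt u p \<longleftrightarrow> (\<exists>d. ((\<lambda>s. u (fst p, snd p + s)) has_real_derivative d) (at 0))"

definition lap :: "('a::euclidean_space \<times> real \<Rightarrow> real) \<Rightarrow> 'a \<times> real \<Rightarrow> real" where
  "lap u p = (\<Sum>i\<in>Basis. pdx i (pdx i u) p)"

definition C21_on :: "('a::euclidean_space \<times> real) set \<Rightarrow> ('a \<times> real \<Rightarrow> real) \<Rightarrow> bool" where
  "C21_on D u \<longleftrightarrow>
     continuous_on D u \<and>
     (\<forall>p\<in>D. has_pdt u p \<and> (\<forall>i\<in>Basis. has_pdx i u p \<and> (\<forall>j\<in>Basis. has_pdx j (pdx i u) p))) \<and>
     continuous_on D (pdt u) \<and>
     (\<forall>i\<in>Basis. continuous_on D (pdx i u) \<and> (\<forall>j\<in>Basis. continuous_on D (pdx j (pdx i u))))"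

text \<open>Parabolic Wiener criterion: every point of frontier Omega x (0,oo) is regular for the
  heat equation in Omega x (0,oo), expressed as solvability of the Dirichlet problem
  (bounded solution, zero initial data) for every continuous lateral datum supported in a
  time window [delta,T] with delta > 0, with continuous attainment of the boundary values.\<close>
definition PWC :: "'a::euclidean_space set \<Rightarrow> bool" where
  "PWC \<Omega> \<longleftrightarrow>
     (\<forall>g \<delta> T. continuous_on (frontier \<Omega> \<times> {0<..}) g \<and> 0 < \<delta> \<and>
        (\<forall>x t. t \<le> \<delta> \<or> T \<le> t \<longrightarrow> g (x, t) = 0) \<longrightarrow>
        (\<exists>v. continuous_on (closure \<Omega> \<times> {0..}) v \<and> bounded (v ` (closure \<Omega> \<times> {0..})) \<and>
             C21_on (\<Omega> \<times> {0<..}) v \<and>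
             (\<forall>p\<in>\<Omega> \<times> {0<..}. pdt v p - lap v p = 0) \<and>
             (\<forall>p\<in>frontier \<Omega> \<times> {0<..}. v p = g p) \<and>
             (\<forall>x\<in>closure \<Omega>. v (x, 0) = 0)))"

end

theory Submission
  imports Defs "HOL-Probability.Probability"
begin

text \<open>Existence: for a bounded absorption term, solutions with constant initial values are obtained by
  Picard iteration, where each linear problem is split into an explicit heat potential and a problem
  with zero right-hand side and zero initial values, which the Wiener criterion solves. Cut-offs of the
  absorption are removed by monotonicity, and limits of solutions are again solutions because of
  interior derivative estimates, which follow from the maximum principle by Brandt's device. The
  solution of the theorem is the decreasing limit of the solutions that start at times tending to zero
  with large constant values; on small balls it is bounded below by a subsolution that blows up
  like the flat solution \<open>((q - 1) t) powr (- 1 / (q - 1))\<close>.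

  Uniqueness: for two solutions \<open>u\<close> and \<open>v\<close>, the shifted solution \<open>v (x, t + \<tau>)\<close> is locally bounded
  at \<open>t = 0\<close>, so for small \<open>t\<close> it can exceed \<open>u\<close> only in a thin layer at the frontier. A sum of
  Gaussians of small total mass dominates the excess there, and a stationary solution exploding on a
  large sphere controls the behaviour at infinity. Hence \<open>v (x, t + \<tau>)\<close> exceeds \<open>u\<close> by at most a small
  error, and \<open>\<tau>\<close> tends to zero.\<close>

subsection \<open>Directional derivatives and the heat operator at a point\<close>

text \<open>\<open>PWC\<close> only provides the homogeneous heat equation with zero initial values
  and lateral data that vanish near the initial time. Every problem is therefore brought to constant
  initial values with lateral data equal to the same constant for a short while, and right-hand
  sides have to be C^1 with compact support in the open cylinder; the cut-offs in front of the
  absorption provide this. Solutions obtained from \<open>PWC\<close> come without bounds on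
  derivatives. Second derivatives of limits are controlled by applying the gradient estimate to
  difference quotients, which requires bounded space derivatives of the right-hand side; as this is
  \<open>- (\<kappa> p * g (u p))\<close>, a gradient bound for \<open>u\<close> supplies them.

  For uniqueness the difficulty sits at \<open>frontier \<Omega> \<times> {0}\<close>: the data are
  finite there while solutions explode inside, and the explosion is uniform only on compact subsets
  of \<Omega>. In the layer left over, the difference of two solutions is not known to be small;
  only the volume of the layer is, and diffusion turns this into a small contribution at every fixed
  later time.\<close>

definition dd :: "'e::real_normed_vector \<Rightarrow> ('e \<Rightarrow> real) \<Rightarrow> 'e \<Rightarrow> real \<Rightarrow> bool" where
  "dd e u p d \<longleftrightarrow> ((\<lambda>s. u (p + s *\<^sub>R e)) has_real_derivative d) (at 0)"

text \<open>The first derivative has to exist on a neighbourhood, the second only at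
  \<open>p\<close>. The first derivative is named by \<open>v\<close>, so that the calculus rules
  can exhibit it explicitly.\<close>

definition dd2 :: "'e::real_normed_vector \<Rightarrow> ('e \<Rightarrow> real) \<Rightarrow> 'e \<Rightarrow> real \<Rightarrow> bool" where
  "dd2 e u p d \<longleftrightarrow> (\<exists>U v. open U \<and> p \<in> U \<and> (\<forall>q\<in>U. dd e u q (v q)) \<and> dd e v p d)"

text \<open>\<open>hop u p h\<close> says that the time derivative minus the Laplacian of \<open>u\<close> equals \<open>h\<close> at the
  single point \<open>p\<close>. Nothing is required of mixed derivatives or of continuity, which makes it easy to
  verify for barriers and still suffices for the maximum principle.\<close>

definition hop :: "('a::euclidean_space \<times> real \<Rightarrow> real) \<Rightarrow> 'a \<times> real \<Rightarrow> real \<Rightarrow> bool" where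
  "hop u p h \<longleftrightarrow> (\<exists>ut uxx. dd (0,1) u p ut \<and> (\<forall>i\<in>Basis. dd2 (i,0) u p (uxx i)) \<and>
     h = ut - (\<Sum>i\<in>Basis. uxx i))"

lemma dd_unique: "dd e u p a \<Longrightarrow> dd e u p b \<Longrightarrow> a = b"
  unfolding dd_def by (rule DERIV_unique)

lemma dd_const: "dd e (\<lambda>_. c) p 0"
  unfolding dd_def by simp

lemma dd_add: "dd e u p a \<Longrightarrow> dd e v p b \<Longrightarrow> dd e (\<lambda>q. u q + v q) p (a + b)"
  unfolding dd_def by (rule DERIV_add)

lemma dd_diff: "dd e u p a \<Longrightarrow> dd e v p b \<Longrightarrow> dd e (\<lambda>q. u q - v q) p (a - b)"
  unfolding dd_def by (rule DERIV_diff)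

lemma dd_cmult: "dd e u p a \<Longrightarrow> dd e (\<lambda>q. c * u q) p (c * a)"
  unfolding dd_def by (rule DERIV_cmult)

lemma dd_minus: "dd e u p a \<Longrightarrow> dd e (\<lambda>q. - u q) p (- a)"
  unfolding dd_def by (rule DERIV_minus)

lemma dd_mult: "dd e u p a \<Longrightarrow> dd e v p b \<Longrightarrow> dd e (\<lambda>q. u q * v q) p (a * v p + b * u p)"
  unfolding dd_def using DERIV_mult[of "\<lambda>s. u (p + s *\<^sub>R e)" a 0 UNIV "\<lambda>s. v (p + s *\<^sub>R e)" b]
  by simp

lemma dd_compose:
  assumes "(G has_real_derivative g) (at (u p))" "dd e u p a"
  shows "dd e (\<lambda>q. G (u q)) p (g * a)"
  unfolding dd_def using DERIV_chain2[of G g "\<lambda>s. u (p + s *\<^sub>R e)" 0 a UNIV] assms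
  unfolding dd_def by simp

lemma dd_cong_open:
  assumes "dd e u p d" "open U" "p \<in> U" "\<And>q. q \<in> U \<Longrightarrow> v q = u q"
  shows "dd e v p d"
proof -
  have "((\<lambda>s::real. p + s *\<^sub>R e) \<longlongrightarrow> p + 0 *\<^sub>R e) (nhds 0)"
    by (intro tendsto_intros filterlim_ident)
  then have "\<forall>\<^sub>F s in nhds (0::real). p + s *\<^sub>R e \<in> U"
    using assms(2,3) by (intro topological_tendstoD) auto
  then have "\<forall>\<^sub>F s in nhds (0::real). u (p + s *\<^sub>R e) = v (p + s *\<^sub>R e)"
    by eventually_elim (use assms(4) in simp)
  then show ?thesis
    using assms(1) unfolding dd_def by (subst DERIV_cong_ev[OF refl _ refl]) (auto elim: eventually_mono)
qed

lemma dd_along: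
  assumes "dd e u (p + s *\<^sub>R e) d"
  shows "((\<lambda>s. u (p + s *\<^sub>R e)) has_real_derivative d) (at s)"
  using assms DERIV_shift[of "\<lambda>s. u (p + s *\<^sub>R e)" d 0 s] unfolding dd_def
  by (simp add: algebra_simps)

lemma dd_translate: "dd e u (p + a) d \<Longrightarrow> dd e (\<lambda>q. u (q + a)) p d"
  unfolding dd_def by (simp add: algebra_simps)

lemma dd2_const: "dd2 e (\<lambda>_. c) p 0"
  unfolding dd2_def using dd_const by (intro exI[of _ UNIV] exI[of _ "\<lambda>_. 0"]) auto

lemma dd2_add:
  assumes "dd2 e u p a" "dd2 e v p b"
  shows "dd2 e (\<lambda>q. u q + v q) p (a + b)"
proof -
  obtain U u' where 1: "open U" "p \<in> U" "\<forall>q\<in>U. dd e u q (u' q)" "dd e u' p a"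
    using assms(1) unfolding dd2_def by blast
  obtain V v' where 2: "open V" "p \<in> V" "\<forall>q\<in>V. dd e v q (v' q)" "dd e v' p b"
    using assms(2) unfolding dd2_def by blast
  show ?thesis unfolding dd2_def
    using 1 2 by (intro exI[of _ "U \<inter> V"] exI[of _ "\<lambda>q. u' q + v' q"]) (auto intro: dd_add)
qed

lemma dd2_cmult:
  assumes "dd2 e u p a" shows "dd2 e (\<lambda>q. c * u q) p (c * a)"
proof -
  obtain U u' where 1: "open U" "p \<in> U" "\<forall>q\<in>U. dd e u q (u' q)" "dd e u' p a"
    using assms(1) unfolding dd2_def by blast
  show ?thesis unfolding dd2_def
    using 1 by (intro exI[of _ U] exI[of _ "\<lambda>q. c * u' q"]) (auto intro: dd_cmult)
qed

lemma dd2_translate: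
  assumes "dd2 e u (p + a) d" shows "dd2 e (\<lambda>q. u (q + a)) p d"
proof -
  obtain U u' where 1: "open U" "p + a \<in> U" "\<forall>q\<in>U. dd e u q (u' q)" "dd e u' (p + a) d"
    using assms(1) unfolding dd2_def by blast
  have "open ((\<lambda>q. q + a) -` U)"
    by (intro open_vimage 1 continuous_intros)
  then show ?thesis unfolding dd2_def
    using 1 by (intro exI[of _ "(\<lambda>q. q + a) -` U"] exI[of _ "\<lambda>q. u' (q + a)"]) (auto intro: dd_translate)
qed

text \<open>At the maximum \<open>v p = 0\<close>. If \<open>d > 0\<close>, then \<open>v\<close> is
  positive just to the right of \<open>p\<close>, and the mean value theorem makes \<open>u\<close>
  grow there. The argument runs along the line through \<open>p\<close>, so pointwise existence of
  the second derivative is enough.\<close>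

lemma dd2_max:
  assumes "dd2 e u p d" "open U" "p \<in> U" "\<And>s. p + s *\<^sub>R e \<in> U \<Longrightarrow> u (p + s *\<^sub>R e) \<le> u p"
  shows "d \<le> 0"
proof (rule ccontr)
  assume "\<not> d \<le> 0"
  obtain V v where 1: "open V" "p \<in> V" "\<forall>q\<in>V. dd e u q (v q)" "dd e v p d"
    using assms(1) unfolding dd2_def by blast
  have "((\<lambda>s::real. p + s *\<^sub>R e) \<longlongrightarrow> p + 0 *\<^sub>R e) (nhds 0)"
    by (intro tendsto_intros filterlim_ident)
  then have "\<forall>\<^sub>F s in nhds (0::real). p + s *\<^sub>R e \<in> U \<inter> V"
    using assms(2,3) 1 by (intro topological_tendstoD) auto
  then obtain r where r: "r > 0" "\<And>s. \<bar>s\<bar> < r \<Longrightarrow> p + s *\<^sub>R e \<in> U \<inter> V"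
    unfolding eventually_nhds_metric by (auto simp: dist_real_def)
  have der: "((\<lambda>s. u (p + s *\<^sub>R e)) has_real_derivative v (p + s *\<^sub>R e)) (at s)" if "\<bar>s\<bar> < r" for s
    using r(2)[OF that] 1 by (intro dd_along) auto
  have v0: "v p = 0"
    using DERIV_local_max[OF der[of 0] r(1)] r assms(4) by auto
  obtain k where k: "k > 0" "\<And>h. 0 < h \<Longrightarrow> h < k \<Longrightarrow> v p < v (p + h *\<^sub>R e)"
    using has_real_derivative_pos_inc_right[OF 1(4)[unfolded dd_def]] \<open>\<not> d \<le> 0\<close> by auto
  define h where "h = min k r / 2"
  have h: "0 < h" "h < k" "h < r" using k r by (auto simp: h_def)
  obtain z where z: "0 < z" "z < h" "u (p + h *\<^sub>R e) - u (p + 0 *\<^sub>R e) = (h - 0) * v (p + z *\<^sub>R e)"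
    using MVT2[OF h(1), of "\<lambda>s. u (p + s *\<^sub>R e)" "\<lambda>s. v (p + s *\<^sub>R e)"] der h by auto
  have "v (p + z *\<^sub>R e) > 0" using k(2)[of z] z h v0 by auto
  then have "u (p + h *\<^sub>R e) > u p" using z h by (simp add: algebra_simps)
  moreover have "u (p + h *\<^sub>R e) \<le> u p" using r(2)[of h] h assms(4) by auto
  ultimately show False by simp
qed

lemma hop_const: "hop (\<lambda>_. c) p 0"
  unfolding hop_def using dd_const dd2_const
  by (intro exI[of _ 0] exI[of _ "\<lambda>_. 0"]) auto

lemma hop_add:
  assumes "hop u p a" "hop v p b" shows "hop (\<lambda>q. u q + v q) p (a + b)"
proof -
  obtain ut uxx where 1: "dd (0,1) u p ut" "\<forall>i\<in>Basis. dd2 (i,0) u p (uxx i)" "a = ut - sum uxx Basis"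
    using assms(1) unfolding hop_def by blast
  obtain vt vxx where 2: "dd (0,1) v p vt" "\<forall>i\<in>Basis. dd2 (i,0) v p (vxx i)" "b = vt - sum vxx Basis"
    using assms(2) unfolding hop_def by blast
  show ?thesis unfolding hop_def
    using 1 2 by (intro exI[of _ "ut + vt"] exI[of _ "\<lambda>i. uxx i + vxx i"])
      (auto intro: dd_add dd2_add simp: sum.distrib)
qed

lemma hop_cmult:
  assumes "hop u p a" shows "hop (\<lambda>q. c * u q) p (c * a)"
proof -
  obtain ut uxx where 1: "dd (0,1) u p ut" "\<forall>i\<in>Basis. dd2 (i,0) u p (uxx i)" "a = ut - sum uxx Basis"
    using assms(1) unfolding hop_def by blast
  show ?thesis unfolding hop_def
    using 1 by (intro exI[of _ "c * ut"] exI[of _ "\<lambda>i. c * uxx i"])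
      (auto intro: dd_cmult dd2_cmult simp: sum_distrib_left algebra_simps)
qed

lemma hop_minus: "hop u p a \<Longrightarrow> hop (\<lambda>q. - u q) p (- a)"
  using hop_cmult[of u p a "-1"] by simp

lemma hop_diff: "hop u p a \<Longrightarrow> hop v p b \<Longrightarrow> hop (\<lambda>q. u q - v q) p (a - b)"
  using hop_add[of u p a "\<lambda>q. - v q" "- b"] hop_minus[of v p b] by simp

lemma hop_sum:
  assumes "finite I" "\<And>i. i \<in> I \<Longrightarrow> hop (u i) p (h i)"
  shows "hop (\<lambda>q. \<Sum>i\<in>I. u i q) p (\<Sum>i\<in>I. h i)"
  using assms by (induction I rule: finite_induct) (auto intro: hop_const hop_add)

lemma hop_translate: "hop u (p + a) h \<Longrightarrow> hop (\<lambda>q. u (q + a)) p h"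
  unfolding hop_def using dd_translate dd2_translate by blast

text \<open>Only points not later than \<open>p\<close> are compared, so that the maximum may lie at
  the final time of a cylinder. In time this leaves a one-sided condition, hence
  \<open>ut \<ge> 0\<close> rather than \<open>ut = 0\<close>.\<close>

lemma hop_max:
  assumes "hop u p h" "open U" "p \<in> U" "\<And>q. q \<in> U \<Longrightarrow> snd q \<le> snd p \<Longrightarrow> u q \<le> u p"
  shows "h \<ge> 0"
proof -
  obtain ut uxx where 1: "dd (0,1) u p ut" "\<forall>i\<in>Basis. dd2 (i,0) u p (uxx i)" "h = ut - sum uxx Basis"
    using assms(1) unfolding hop_def by blast
  have "uxx i \<le> 0" if "i \<in> Basis" for i
    by (rule dd2_max[of "(i,0)" u p _ U]) (use 1 that assms in auto)
  then have "sum uxx Basis \<le> 0" by (simp add: sum_nonpos)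
  moreover have "ut \<ge> 0"
  proof (rule ccontr)
    assume "\<not> ut \<ge> 0"
    then obtain k where k: "k > 0" "\<And>h. 0 < h \<Longrightarrow> h < k \<Longrightarrow> u p < u (p + (- h) *\<^sub>R (0,1))"
      using has_real_derivative_neg_dec_left[OF 1(1)[unfolded dd_def]]
      by (auto simp: zero_prod_def[symmetric])
    have "((\<lambda>s::real. p + s *\<^sub>R (0,1)) \<longlongrightarrow> p + 0 *\<^sub>R (0,1)) (nhds 0)"
      by (intro tendsto_intros filterlim_ident)
    then have "\<forall>\<^sub>F s in nhds (0::real). p + s *\<^sub>R (0,1) \<in> U"
      using assms(2,3) by (intro topological_tendstoD) (auto simp: zero_prod_def[symmetric])
    then obtain r where r: "r > 0" "\<And>s. \<bar>s\<bar> < r \<Longrightarrow> p + s *\<^sub>R (0,1) \<in> U"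
      unfolding eventually_nhds_metric by (auto simp: dist_real_def)
    define h where "h = min k r / 2"
    have h: "0 < h" "h < k" "h < r" using k r by (auto simp: h_def)
    show False using k(2)[of h] r(2)[of "- h"] h assms(4)[of "p + (- h) *\<^sub>R (0,1)"] by auto
  qed
  ultimately show ?thesis using 1 by simp
qed

lemma hop_time:
  assumes "(\<phi> has_real_derivative d) (at (snd p))"
  shows "hop (\<lambda>q. \<phi> (snd q)) p d"
proof -
  have "dd (0,1) (\<lambda>q. \<phi> (snd q)) p d"
    using assms DERIV_shift[of \<phi> d 0 "snd p"] by (simp add: dd_def add.commute)
  moreover have "dd2 (i,0) (\<lambda>q. \<phi> (snd q)) p 0" for i
    unfolding dd2_def by (intro exI[of _ UNIV] exI[of _ "\<lambda>_. 0"]) (auto simp: dd_def)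
  ultimately show ?thesis unfolding hop_def by (intro exI[of _ d] exI[of _ "\<lambda>_. 0"]) auto
qed

text \<open>With \<rho> the squared distance to \<open>y\<close> and \<open>N\<close> the dimension,
  the Laplacian of \<open>K(\<rho>)\<close> is \<open>4 \<rho> K'' + 2 N K'\<close>. The squared
  distance is smooth also at its centre, so barriers written as functions of it need no separate
  treatment at \<open>y\<close>.\<close>

lemma hop_radial:
  fixes y :: "'a::euclidean_space"
  assumes "open U" "(x, t) \<in> U"
    and "\<And>z s. (z, s) \<in> U \<Longrightarrow> ((\<lambda>r. K r s) has_real_derivative K1 ((norm (z - y))\<^sup>2) s) (at ((norm (z - y))\<^sup>2))"
    and "((\<lambda>r. K1 r t) has_real_derivative K2) (at ((norm (x - y))\<^sup>2))"
    and "((\<lambda>s. K ((norm (x - y))\<^sup>2) s) has_real_derivative Kt) (at t)"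
  shows "hop (\<lambda>q. K ((norm (fst q - y))\<^sup>2) (snd q)) (x, t)
    (Kt - 4 * (norm (x - y))\<^sup>2 * K2 - 2 * real DIM('a) * K1 ((norm (x - y))\<^sup>2) t)"
proof -
  define \<rho> where "\<rho> = (norm (x - y))\<^sup>2"
  have rad: "dd (i,0) (\<lambda>q. (norm (fst q - y))\<^sup>2) q (2 * ((fst q - y) \<bullet> i))" for q :: "'a \<times> real" and i
  proof -
    have "(norm (fst (q + s *\<^sub>R (i,0)) - y))\<^sup>2 = (norm (fst q - y))\<^sup>2 + 2 * s * ((fst q - y) \<bullet> i) + s\<^sup>2 * (i \<bullet> i)" for s
    proof -
      have "fst (q + s *\<^sub>R (i,0)) - y = (fst q - y) + s *\<^sub>R i" by simp
      then show ?thesis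
        by (simp only: power2_norm_eq_inner inner_add_left inner_add_right inner_scaleR_left
            inner_scaleR_right inner_commute[of i "fst q - y"]) (simp add: power2_eq_square algebra_simps)
    qed
    then show ?thesis unfolding dd_def by (auto intro!: derivative_eq_intros)
  qed
  have lin: "dd (i,0) (\<lambda>q. 2 * ((fst q - y) \<bullet> i)) q 2" if "i \<in> Basis" for q :: "'a \<times> real" and i
    unfolding dd_def using that
    by (auto intro!: derivative_eq_intros simp: inner_diff_left inner_add_left)
  have d1: "dd (i,0) (\<lambda>q. K ((norm (fst q - y))\<^sup>2) (snd q)) q
      (K1 ((norm (fst q - y))\<^sup>2) (snd q) * (2 * ((fst q - y) \<bullet> i)))" if "q \<in> U" for q i
  proof -
    have "((\<lambda>r. K r (snd q)) has_real_derivative K1 ((norm (fst q - y))\<^sup>2) (snd q)) (at ((norm (fst q - y))\<^sup>2))"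
      using assms(3)[of "fst q" "snd q"] that by simp
    from dd_compose[of "\<lambda>r. K r (snd q)" _ "\<lambda>q. (norm (fst q - y))\<^sup>2", OF this rad]
    show ?thesis unfolding dd_def by simp
  qed
  have d2: "dd (i,0) (\<lambda>q. K1 ((norm (fst q - y))\<^sup>2) (snd q) * (2 * ((fst q - y) \<bullet> i))) (x,t)
      (K2 * (2 * ((x - y) \<bullet> i)) * (2 * ((x - y) \<bullet> i)) + 2 * K1 \<rho> t)" if "i \<in> Basis" for i
  proof -
    have "dd (i,0) (\<lambda>q. K1 ((norm (fst q - y))\<^sup>2) (snd q)) (x,t) (K2 * (2 * ((x - y) \<bullet> i)))"
      using dd_compose[of "\<lambda>r. K1 r t" K2 "\<lambda>q. (norm (fst q - y))\<^sup>2" "(x,t)", OF _ rad] assms(4)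
      unfolding dd_def by simp
    from dd_mult[OF this lin[OF that]] show ?thesis by (simp add: \<rho>_def)
  qed
  have sums: "(\<Sum>i\<in>Basis. K2 * (2 * ((x - y) \<bullet> i)) * (2 * ((x - y) \<bullet> i)) + 2 * K1 \<rho> t)
      = 4 * \<rho> * K2 + 2 * real DIM('a) * K1 \<rho> t"
  proof -
    have "\<rho> = (\<Sum>i\<in>Basis. ((x - y) \<bullet> i) * ((x - y) \<bullet> i))"
      unfolding \<rho>_def power2_norm_eq_inner using euclidean_inner by blast
    then have "(\<Sum>i\<in>Basis. (4 * K2) * (((x - y) \<bullet> i) * ((x - y) \<bullet> i))) = (4 * K2) * \<rho>"
      by (simp only: sum_distrib_left)
    moreover have "(\<Sum>i\<in>Basis. K2 * (2 * ((x - y) \<bullet> i)) * (2 * ((x - y) \<bullet> i)) + 2 * K1 \<rho> t)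
       = (\<Sum>i\<in>Basis. (4 * K2) * (((x - y) \<bullet> i) * ((x - y) \<bullet> i))) + (\<Sum>i\<in>(Basis::'a set). 2 * K1 \<rho> t)"
      unfolding sum.distrib[symmetric] by (intro sum.cong refl) (simp add: algebra_simps)
    ultimately show ?thesis by simp
  qed
  have tt: "dd (0,1) (\<lambda>q. K ((norm (fst q - y))\<^sup>2) (snd q)) (x,t) Kt"
    using assms(5) DERIV_shift[of "\<lambda>s. K ((norm (x - y))\<^sup>2) s" Kt 0 t] by (simp add: dd_def add.commute)
  have "dd2 (i,0) (\<lambda>q. K ((norm (fst q - y))\<^sup>2) (snd q)) (x,t)
      (K2 * (2 * ((x - y) \<bullet> i)) * (2 * ((x - y) \<bullet> i)) + 2 * K1 \<rho> t)" if "i \<in> Basis" for i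
    unfolding dd2_def using d2[OF that] d1 assms(1,2)
    by (intro exI[of _ U] exI[of _ "\<lambda>q. K1 ((norm (fst q - y))\<^sup>2) (snd q) * (2 * ((fst q - y) \<bullet> i))"]) simp
  then show ?thesis unfolding hop_def
    apply (intro exI[of _ Kt] exI[of _ "\<lambda>i. K2 * (2 * ((x - y) \<bullet> i)) * (2 * ((x - y) \<bullet> i)) + 2 * K1 \<rho> t"])
    using tt sums unfolding \<rho>_def[symmetric] by simp
qed

section \<open>Translation to the partial derivatives of the theorem\<close>

lemma dd_pdt: "dd (0,1) u p d \<Longrightarrow> pdt u p = d \<and> has_pdt u p"
  unfolding pdt_def has_pdt_def dd_def by (cases p) (auto intro: DERIV_imp_deriv)

lemma dd_pdx: "dd (i,0) u p d \<Longrightarrow> pdx i u p = d \<and> has_pdx i u p"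
  unfolding pdx_def has_pdx_def dd_def by (cases p) (auto intro: DERIV_imp_deriv)

lemma has_pdt_dd: "has_pdt u p \<Longrightarrow> dd (0,1) u p (pdt u p)"
  unfolding pdt_def has_pdt_def dd_def by (cases p) (auto simp: DERIV_imp_deriv)

lemma has_pdx_dd: "has_pdx i u p \<Longrightarrow> dd (i,0) u p (pdx i u p)"
  unfolding pdx_def has_pdx_def dd_def by (cases p) (auto simp: DERIV_imp_deriv)

lemma hop_pdt_lap:
  assumes "hop u p h" shows "pdt u p - lap u p = h"
proof -
  obtain ut uxx where 1: "dd (0,1) u p ut" "\<forall>i\<in>Basis. dd2 (i,0) u p (uxx i)" "h = ut - sum uxx Basis"
    using assms(1) unfolding hop_def by blast
  have "pdt u p = ut"
    using 1(1) dd_pdt by blast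
  moreover have "pdx i (pdx i u) p = uxx i" if i: "i \<in> Basis" for i
  proof -
    obtain U v where U: "open U" "p \<in> U" "\<forall>q\<in>U. dd (i,0) u q (v q)" "dd (i,0) v p (uxx i)"
      using 1(2) i unfolding dd2_def by blast
    have "pdx i u q = v q" if "q \<in> U" for q
      using U(3) that dd_pdx by blast
    then have "dd (i,0) (pdx i u) p (uxx i)"
      using dd_cong_open[OF U(4,1,2)] by blast
    then show ?thesis using dd_pdx by blast
  qed
  ultimately show ?thesis using 1 by (simp add: lap_def)
qed

subsection \<open>Functions of class $C^{2,1}$\<close>

text \<open>The derivatives are arguments instead of \<open>pdt u\<close> and
  \<open>pdx i u\<close>: sums, differences, translates and limits then carry explicit derivatives,
  and estimates can be stated for these.\<close>

definition W21 :: "('a::euclidean_space \<times> real) set \<Rightarrow> ('a \<times> real \<Rightarrow> real) \<Rightarrow> ('a \<times> real \<Rightarrow> real) \<Rightarrow>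
    ('a \<Rightarrow> 'a \<times> real \<Rightarrow> real) \<Rightarrow> ('a \<Rightarrow> 'a \<Rightarrow> 'a \<times> real \<Rightarrow> real) \<Rightarrow> bool" where
  "W21 D u ut ux uxx \<longleftrightarrow> continuous_on D u \<and> continuous_on D ut \<and>
     (\<forall>i\<in>Basis. continuous_on D (ux i) \<and> (\<forall>j\<in>Basis. continuous_on D (uxx i j))) \<and>
     (\<forall>p\<in>D. dd (0,1) u p (ut p) \<and> (\<forall>i\<in>Basis. dd (i,0) u p (ux i p) \<and>
        (\<forall>j\<in>Basis. dd (j,0) (ux i) p (uxx i j p))))"

lemma C21_W21:
  assumes "C21_on D u"
  shows "W21 D u (pdt u) (\<lambda>i. pdx i u) (\<lambda>i j. pdx j (pdx i u))"
  using assms unfolding C21_on_def W21_def by (auto intro: has_pdt_dd has_pdx_dd)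

lemma W21_C21:
  assumes "open D" "W21 D u ut ux uxx"
  shows "C21_on D u"
proof -
  have t: "pdt u p = ut p" "has_pdt u p" if "p \<in> D" for p
    using assms dd_pdt that unfolding W21_def by blast+
  have x: "pdx i u p = ux i p" "has_pdx i u p" if "p \<in> D" "i \<in> Basis" for p i
    using assms dd_pdx that unfolding W21_def by blast+
  have xx: "dd (j,0) (pdx i u) p (uxx i j p)" if "p \<in> D" "i \<in> Basis" "j \<in> Basis" for p i j
    by (rule dd_cong_open[of _ "ux i" _ _ D]) (use assms that x in \<open>auto simp: W21_def\<close>)
  have xx': "pdx j (pdx i u) p = uxx i j p" "has_pdx j (pdx i u) p" if "p \<in> D" "i \<in> Basis" "j \<in> Basis" for p i j
    using dd_pdx[OF xx[OF that]] by auto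
  show ?thesis unfolding C21_on_def
  proof (intro conjI ballI)
    show "continuous_on D (pdt u)"
      using assms(2) t continuous_on_cong[of D D "pdt u" ut] unfolding W21_def by blast
    show "continuous_on D (pdx i u)" if "i \<in> Basis" for i
      using assms(2) x that continuous_on_cong[of D D "pdx i u" "ux i"] unfolding W21_def by blast
    show "continuous_on D (pdx j (pdx i u))" if "i \<in> Basis" "j \<in> Basis" for i j
      using assms(2) xx' that continuous_on_cong[of D D "pdx j (pdx i u)" "uxx i j"] unfolding W21_def by blast
  qed (use t x xx' assms(2) in \<open>auto simp: W21_def\<close>)
qed

lemma W21_add:
  "W21 D u ut ux uxx \<Longrightarrow> W21 D v vt vx vxx \<Longrightarrow>
   W21 D (\<lambda>p. u p + v p) (\<lambda>p. ut p + vt p) (\<lambda>i p. ux i p + vx i p) (\<lambda>i j p. uxx i j p + vxx i j p)"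
  unfolding W21_def by (auto intro!: continuous_intros dd_add)

lemma W21_cmult:
  "W21 D u ut ux uxx \<Longrightarrow>
   W21 D (\<lambda>p. c * u p) (\<lambda>p. c * ut p) (\<lambda>i p. c * ux i p) (\<lambda>i j p. c * uxx i j p)"
  unfolding W21_def by (auto intro!: continuous_intros dd_cmult)

lemma C21_const: "open D \<Longrightarrow> C21_on D (\<lambda>_. c)"
  by (rule W21_C21[of _ _ "\<lambda>_. 0" "\<lambda>_ _. 0" "\<lambda>_ _ _. 0"]) (auto simp: W21_def intro: dd_const)

lemma C21_add: "open D \<Longrightarrow> C21_on D u \<Longrightarrow> C21_on D v \<Longrightarrow> C21_on D (\<lambda>p. u p + v p)"
  by (rule W21_C21[OF _ W21_add[OF C21_W21 C21_W21]])

lemma C21_cmult: "open D \<Longrightarrow> C21_on D u \<Longrightarrow> C21_on D (\<lambda>p. c * u p)"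
  by (rule W21_C21[OF _ W21_cmult[OF C21_W21]])

lemma C21_diff: "open D \<Longrightarrow> C21_on D u \<Longrightarrow> C21_on D v \<Longrightarrow> C21_on D (\<lambda>p. u p - v p)"
  using C21_add[of D u "\<lambda>p. (-1) * v p"] C21_cmult[of D v "-1"] by simp

lemma C21_subset: "C21_on D u \<Longrightarrow> E \<subseteq> D \<Longrightarrow> C21_on E u"
  unfolding C21_on_def by (meson continuous_on_subset subsetD)

text \<open>Serves limits whose equation is available only on a neighbourhood of each point, of a
  size that depends on the point.\<close>

lemma C21_local:
  assumes "\<And>p. p \<in> D \<Longrightarrow> \<exists>U. open U \<and> p \<in> U \<and> C21_on U u"
  shows "C21_on D u"
proof -
  have c: "continuous_on D f" if "\<And>U. C21_on U u \<Longrightarrow> continuous_on U f" for f :: "'a \<times> real \<Rightarrow> real"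
    unfolding continuous_on_eq_continuous_within
  proof
    fix p assume "p \<in> D"
    then obtain U where "open U" "p \<in> U" "C21_on U u" using assms by blast
    then show "continuous (at p within D) f"
      using that continuous_on_eq_continuous_at continuous_at_imp_continuous_at_within by blast
  qed
  have d: "has_pdt u p" "\<And>i. i \<in> Basis \<Longrightarrow> has_pdx i u p"
      "\<And>i j. i \<in> Basis \<Longrightarrow> j \<in> Basis \<Longrightarrow> has_pdx j (pdx i u) p" if "p \<in> D" for p
    using assms[OF that] unfolding C21_on_def by blast+
  show ?thesis unfolding C21_on_def
    by (intro conjI ballI c d) (auto simp: C21_on_def)
qed

lemma C21_translate:
  assumes "open D" "C21_on D u"
  shows "C21_on ((\<lambda>q. q + a) -` D) (\<lambda>q. u (q + a))"
proof (rule W21_C21)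
  show "open ((\<lambda>q. q + a) -` D)" by (intro open_vimage assms continuous_intros)
  have "continuous_on ((\<lambda>q. q + a) -` D) (\<lambda>q. f (q + a))" if "continuous_on D f" for f :: "'a \<times> real \<Rightarrow> real"
    by (rule continuous_on_compose2[OF that]) (auto intro!: continuous_intros)
  then show "W21 ((\<lambda>q. q + a) -` D) (\<lambda>q. u (q + a)) (\<lambda>q. pdt u (q + a)) (\<lambda>i q. pdx i u (q + a))
      (\<lambda>i j q. pdx j (pdx i u) (q + a))"
    using C21_W21[OF assms(2)] unfolding W21_def by (auto intro: dd_translate)
qed

lemma C21_hop:
  assumes "open D" "C21_on D u" "p \<in> D"
  shows "hop u p (pdt u p - lap u p)"
  unfolding hop_def
  apply (rule exI[of _ "pdt u p"], rule exI[of _ "\<lambda>i. pdx i (pdx i u) p"])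
  using C21_W21[OF assms(2)] assms unfolding W21_def lap_def dd2_def by blast

lemma hop_iff_C21:
  assumes "open D" "C21_on D u" "p \<in> D"
  shows "hop u p h \<longleftrightarrow> pdt u p - lap u p = h"
  using C21_hop[OF assms] hop_pdt_lap by blast

subsection \<open>The comparison principle\<close>

text \<open>\<Omega> may be unbounded, so the supremum of \<open>w\<close> need not be attained;
  subtracting a small multiple of a function that grows at infinity forces a maximum at a finite
  point. That point has positive \<open>w\<close>, so the differential inequality is demanded only
  where \<open>w\<close> is positive.\<close>

lemma comparison:
  fixes w :: "'a::euclidean_space \<times> real \<Rightarrow> real"
  assumes "open \<Omega>" and cont: "continuous_on (closure \<Omega> \<times> {a..b}) w"
    and bdd: "\<And>p. p \<in> closure \<Omega> \<times> {a..b} \<Longrightarrow> w p \<le> C"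
    and init: "\<And>x. x \<in> closure \<Omega> \<Longrightarrow> w (x, a) \<le> 0"
    and lat: "\<And>x t. x \<in> frontier \<Omega> \<Longrightarrow> a \<le> t \<Longrightarrow> t \<le> b \<Longrightarrow> w (x, t) \<le> 0"
    and eq: "\<And>x t. x \<in> \<Omega> \<Longrightarrow> a < t \<Longrightarrow> t \<le> b \<Longrightarrow> 0 < w (x, t) \<Longrightarrow> \<exists>h\<le>0. hop w (x, t) h"
    and p: "p \<in> closure \<Omega> \<times> {a..b}"
  shows "w p \<le> 0"
proof (rule ccontr)
  assume neg: "\<not> w p \<le> 0"
  define N where "N = real DIM('a)"
  \<comment> \<open>The factor \<open>2 * N + 1\<close> exceeds the Laplacian \<open>2 * N\<close>
    of the squared norm by one, so the heat operator of \<open>B\<close> is exactly 1.\<close>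
  define B where "B q = 1 + (norm (fst q - 0))\<^sup>2 + (2 * N + 1) * (snd q - a)" for q :: "'a \<times> real"
  have hopB: "hop B q 1" for q
  proof -
    have "hop (\<lambda>q. (\<lambda>r s. 1 + r + (2 * N + 1) * (s - a)) ((norm (fst q - 0))\<^sup>2) (snd q)) (fst q, snd q)
      ((2 * N + 1) - 4 * (norm (fst q - 0))\<^sup>2 * 0 - 2 * real DIM('a) * (\<lambda>r s. 1) ((norm (fst q - 0))\<^sup>2) (snd q))"
      by (rule hop_radial[of UNIV]) (auto intro!: derivative_eq_intros)
    then show ?thesis by (simp add: B_def[abs_def] N_def)
  qed
  have contB: "continuous_on S B" for S unfolding B_def by (intro continuous_intros)
  have B1: "B q \<ge> 1 + (norm (fst q))\<^sup>2" if "snd q \<ge> a" for q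
    using that by (auto simp: B_def N_def)
  have B0: "B q > 0" if "snd q \<ge> a" for q
    using B1[OF that] zero_le_power2[of "norm (fst q)"] by linarith
  define \<epsilon> where "\<epsilon> = w p / (2 * B p)"
  have Bp: "B p > 0" using B0[of p] p by auto
  have \<epsilon>: "\<epsilon> > 0" "\<epsilon> * B p < w p" using neg Bp by (auto simp: \<epsilon>_def field_simps)
  \<comment> \<open>From this radius on \<open>\<epsilon> * B\<close> exceeds the bound
    \<open>C\<close> of \<open>w\<close>, so a positive maximum cannot lie on the sphere of radius
    \<open>R\<close>.\<close>
  define R where "R = max (norm (fst p)) (sqrt (\<bar>C\<bar> / \<epsilon>))"
  define S where "S = (closure \<Omega> \<inter> cball 0 R) \<times> {a..b}"
  have "compact S" unfolding S_def
    by (intro compact_Times closed_Int_compact closed_closure) auto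
  moreover have "p \<in> S" using p by (auto simp: S_def R_def)
  moreover have "continuous_on S (\<lambda>q. w q - \<epsilon> * B q)"
    by (intro continuous_intros contB continuous_on_subset[OF cont]) (auto simp: S_def)
  ultimately obtain m where m: "m \<in> S" "\<And>q. q \<in> S \<Longrightarrow> w q - \<epsilon> * B q \<le> w m - \<epsilon> * B m"
    using continuous_attains_sup[of S "\<lambda>q. w q - \<epsilon> * B q"] by blast
  have Wm: "w m - \<epsilon> * B m > 0" using m(2)[OF \<open>p \<in> S\<close>] \<epsilon> by simp
  obtain x t where xt: "m = (x, t)" by (cases m)
  have mS: "x \<in> closure \<Omega>" "norm x \<le> R" "a \<le> t" "t \<le> b" using m(1) xt by (auto simp: S_def)
  have Bm: "B m > 0" using B0[of m] mS xt by auto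
  then have wm: "w m > 0" using Wm \<epsilon> by (meson mult_pos_pos diff_gt_0_iff_gt less_trans)
  have t: "a < t" using init[OF mS(1)] wm xt mS(3) by (cases "t = a") auto
  have x: "x \<in> \<Omega>" using lat[of x t] wm xt mS assms(1) by (auto simp: frontier_def interior_open)
  have xR: "norm x < R"
  proof (rule ccontr)
    assume "\<not> norm x < R"
    then have "norm x \<ge> sqrt (\<bar>C\<bar> / \<epsilon>)" by (auto simp: R_def)
    then have "(norm x)\<^sup>2 \<ge> (sqrt (\<bar>C\<bar> / \<epsilon>))\<^sup>2" using \<epsilon> by (intro power_mono) auto
    then have "\<epsilon> * (norm x)\<^sup>2 \<ge> \<bar>C\<bar>" using \<epsilon> by (simp add: field_simps)
    moreover have "\<epsilon> * B m \<ge> \<epsilon> * (1 + (norm x)\<^sup>2)" using B1[of m] xt mS \<epsilon> by (intro mult_left_mono) auto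
    moreover have "w m \<le> C" using bdd[of m] xt mS by auto
    ultimately show False using Wm \<epsilon> by (simp add: algebra_simps)
  qed
  obtain h where h: "h \<le> 0" "hop w m h" using eq[OF x t mS(4)] wm xt by auto
  have "hop (\<lambda>q. w q - \<epsilon> * B q) m (h - \<epsilon> * 1)"
    by (intro hop_diff hop_cmult h hopB)
  then have "h - \<epsilon> * 1 \<ge> 0"
  proof (rule hop_max)
    show "open ((\<Omega> \<inter> ball 0 R) \<times> {a<..})" by (intro open_Times open_Int assms) auto
    show "m \<in> (\<Omega> \<inter> ball 0 R) \<times> {a<..}" using xt x t xR by auto
    show "w q - \<epsilon> * B q \<le> w m - \<epsilon> * B m" if "q \<in> (\<Omega> \<inter> ball 0 R) \<times> {a<..}" "snd q \<le> snd m" for q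
      using that xt mS closure_subset[of \<Omega>] by (intro m(2)) (auto simp: S_def)
  qed
  then show False using h \<epsilon> by simp
qed

subsection \<open>Interior gradient estimate\<close>

lemma DERIV_half_diff:
  fixes f g k :: "real \<Rightarrow> real"
  assumes "(f has_real_derivative a) (at s)" "(g has_real_derivative b) (at s)" "(k has_real_derivative c) (at s)"
  shows "((\<lambda>s. (f s - g s) / 2 - k s) has_real_derivative (a - b) / 2 - c) (at s)"
  by (intro DERIV_diff DERIV_cdivide assms)

lemma dd_real: "dd 1 f y d \<longleftrightarrow> (f has_real_derivative d) (at y)"
  using DERIV_shift[of f d 0 y] by (simp add: dd_def add.commute)

text \<open>Brandt's device: the odd difference \<open>u (x + y e, t) - u (x - y e, t)\<close> is compared with a
  quadratic barrier that vanishes for \<open>y = 0\<close>.\<close>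

lemma gradient_estimate_upper:
  fixes u :: "'a::euclidean_space \<times> real \<Rightarrow> real"
  assumes Q: "open Q" "cball x0 (2 * r) \<times> {t0 - r\<^sup>2..t0} \<subseteq> Q" and r: "r > 0" and e: "e \<in> Basis"
    and u: "W21 Q u ut ux uxx" and M: "M > 0" "\<And>p. p \<in> Q \<Longrightarrow> \<bar>u p\<bar> \<le> M"
    and F: "\<And>p. p \<in> Q \<Longrightarrow> \<bar>ut p - (\<Sum>i\<in>Basis. uxx i i p)\<bar> \<le> \<Phi>"
  shows "ux e (x0, t0) \<le> 2 * r * ((2 * real DIM('a) + 1) * M / r\<^sup>2 + \<Phi>)"
proof -
  define N where "N = real DIM('a)"
  have N: "N \<ge> 1" unfolding N_def using DIM_positive[where 'a='a] by (simp add: Suc_le_eq)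
  define A where "A = (2 * N + 1) * M / r\<^sup>2 + \<Phi>"
  have e1: "norm e = 1" using e by simp
  have inQ: "(x + y *\<^sub>R e, t) \<in> Q" if "dist x x0 \<le> r" "\<bar>y\<bar> \<le> r" "t0 - r\<^sup>2 \<le> t" "t \<le> t0" for x y t
  proof -
    have "norm (x + y *\<^sub>R e - x0) \<le> norm (x - x0) + norm (y *\<^sub>R e)"
      using norm_triangle_ineq[of "x - x0" "y *\<^sub>R e"] by (simp add: algebra_simps)
    then have "dist x0 (x + y *\<^sub>R e) \<le> 2 * r" using that e1 by (simp add: dist_norm norm_minus_commute)
    then show ?thesis using Q that by auto
  qed
  have \<Phi>: "\<Phi> \<ge> 0" using F[OF inQ[of x0 0 t0]] r by (simp add: order_trans[OF abs_ge_zero])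
  have A: "A > 0" unfolding A_def using N M r \<Phi> by (intro add_pos_nonneg) auto
  have AM: "A * r\<^sup>2 \<ge> M"
  proof -
    have "M \<le> (2 * N + 1) * M" using N M by simp
    also have "\<dots> \<le> A * r\<^sup>2" using r \<Phi> unfolding A_def distrib_right by simp
    finally show ?thesis .
  qed
  \<comment> \<open>On the sphere \<open>dist x x0 = r\<close> and at the initial time the first
    summand is at least \<open>M\<close>; for \<open>y = r\<close> the second is
    \<open>A r^2 \<ge> M\<close>. As \<open>w \<le> M\<close>, and \<open>w\<close> vanishes for
    \<open>y = 0\<close>, a positive maximum of \<open>w - \<psi>\<close> can only be interior or at
    the final time.\<close>
  define \<psi> where "\<psi> x y t = M / r\<^sup>2 * ((norm (x - x0))\<^sup>2 + (t0 - t)) + A * y * (2 * r - y)" for x :: 'a and y t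
  define w where "w x y t = (u (x + y *\<^sub>R e, t) - u (x + (- y) *\<^sub>R e, t)) / 2" for x :: 'a and y t
  define S where "S = cball x0 r \<times> {0..r} \<times> {t0 - r\<^sup>2..t0}"
  define Z where "Z q = w (fst q) (fst (snd q)) (snd (snd q)) - \<psi> (fst q) (fst (snd q)) (snd (snd q))" for q
  have uc: "continuous_on Q u" using u by (simp add: W21_def)
  have "compact S" unfolding S_def by (intro compact_Times) auto
  moreover have "S \<noteq> {}" unfolding S_def using r by auto
  moreover have "continuous_on S Z" unfolding Z_def w_def \<psi>_def
    by (intro continuous_intros continuous_on_compose2[OF uc])
       (auto simp: S_def r dist_commute intro!: inQ inQ[of _ "- _", simplified])
  ultimately obtain m where m: "m \<in> S" "\<And>q. q \<in> S \<Longrightarrow> Z q \<le> Z m"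
    using continuous_attains_sup[of S Z] by blast
  have Zm: "Z m \<le> 0"
  proof (rule ccontr)
    assume "\<not> Z m \<le> 0"
    obtain x y t where xyt: "m = (x, y, t)" by (cases m)
    have S1: "dist x x0 \<le> r" "0 \<le> y" "y \<le> r" "t0 - r\<^sup>2 \<le> t" "t \<le> t0"
      using m(1) by (auto simp: S_def xyt dist_commute)
    have Zp: "w x y t > \<psi> x y t" using \<open>\<not> Z m \<le> 0\<close> by (simp add: Z_def xyt)
    have wM: "w x y t \<le> M"
      using M(2)[OF inQ[of x y t]] M(2)[OF inQ[of x "- y" t]] S1 by (simp add: w_def)
    have p1: "M / r\<^sup>2 * ((norm (x - x0))\<^sup>2 + (t0 - t)) \<ge> 0" using M S1 by simp
    have p2: "A * y * (2 * r - y) \<ge> 0" using A S1 r by simp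
    have y0: "y > 0" using Zp S1 p1 by (cases "y = 0") (auto simp: w_def \<psi>_def)
    have yr: "y < r"
    proof (rule ccontr)
      assume "\<not> y < r"
      then have "y = r" using S1 by simp
      then show False using p1 AM Zp wM by (simp add: \<psi>_def power2_eq_square)
    qed
    have xr: "dist x x0 < r"
    proof (rule ccontr)
      assume "\<not> dist x x0 < r"
      then have "norm (x - x0) = r" using S1 by (simp add: dist_norm)
      then have "M / r\<^sup>2 * ((norm (x - x0))\<^sup>2 + (t0 - t)) \<ge> M / r\<^sup>2 * r\<^sup>2"
        using S1 M by (intro mult_left_mono) auto
      then show False using p2 Zp wM r by (simp add: \<psi>_def)
    qed
    have tr: "t > t0 - r\<^sup>2"
    proof (rule ccontr)
      assume "\<not> t > t0 - r\<^sup>2"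
      then have "M / r\<^sup>2 * ((norm (x - x0))\<^sup>2 + (t0 - t)) \<ge> M / r\<^sup>2 * r\<^sup>2"
        using S1 M by (intro mult_left_mono) auto
      then show False using p2 Zp wM r by (simp add: \<psi>_def)
    qed
    define P where "P = (x + y *\<^sub>R e, t)"
    define P' where "P' = (x + (- y) *\<^sub>R e, t)"
    have PQ: "P \<in> Q" "P' \<in> Q" using inQ[of x y t] inQ[of x "- y" t] S1 by (auto simp: P_def P'_def)
    have dt: "(ut P - ut P') / 2 \<ge> - M / r\<^sup>2"
    proof -
      have "dd (0,1) u P (ut P)" "dd (0,1) u P' (ut P')" using u PQ unfolding W21_def by blast+
      then have "((\<lambda>s. u (x + y *\<^sub>R e, t + s)) has_real_derivative ut P) (at 0)"
        "((\<lambda>s. u (x + (- y) *\<^sub>R e, t + s)) has_real_derivative ut P') (at 0)"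
        unfolding dd_def P_def P'_def by simp_all
      then have "((\<lambda>s. (u (x + y *\<^sub>R e, t + s) - u (x + (- y) *\<^sub>R e, t + s)) / 2 -
          (c * ((norm (x - x0))\<^sup>2 + (t0 - (t + s))) + A * y * (2 * r - y)))
          has_real_derivative (ut P - ut P') / 2 - (c * (- 1))) (at 0)" for c
        by (auto intro!: derivative_eq_intros simp: field_simps)
      note d = this[of "M / r\<^sup>2"]
      have "0 \<le> (ut P - ut P') / 2 - (M / r\<^sup>2 * (- 1))"
      proof (rule ccontr)
        assume "\<not> ?thesis"
        then obtain k where k: "k > 0" "\<And>h. 0 < h \<Longrightarrow> h < k \<Longrightarrow> Z (x, y, t) < Z (x, y, t - h)"
          using has_real_derivative_neg_dec_left[OF d] by (auto simp: Z_def w_def \<psi>_def)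
        define h where "h = min k (t - (t0 - r\<^sup>2)) / 2"
        have h: "0 < h" "h < k" "t0 - r\<^sup>2 \<le> t - h" using k tr by (auto simp: h_def min_def field_simps)
        have "Z (x, y, t - h) \<le> Z m" using h S1 by (intro m(2)) (auto simp: S_def dist_commute)
        then show False using k(2)[OF h(1,2)] xyt by simp
      qed
      then show ?thesis using minus_divide_left[of M "r\<^sup>2"] by linarith
    qed
    \<comment> \<open>Moving \<open>y\<close> shifts the two points in opposite directions along
      \<open>e\<close>, so the second \<open>y\<close>-derivative of \<open>w\<close> is the half
      difference of the second \<open>e\<close>-derivatives of \<open>u\<close>. The direction
      \<open>e\<close> is therefore estimated through \<open>y\<close>, where the barrier has second
      derivative \<open>- 2 A\<close>, and only the remaining directions through
      \<open>x\<close>.\<close>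
    have dy: "(uxx e e P - uxx e e P') / 2 + 2 * A \<le> 0"
    proof -
      let ?f = "\<lambda>y. Z (x, y, t)"
      let ?f' = "\<lambda>y. (ux e (x + y *\<^sub>R e, t) + ux e (x + (- y) *\<^sub>R e, t)) / 2 - A * (2 * r - 2 * y)"
      have du: "((\<lambda>s. u (x + s *\<^sub>R e, t)) has_real_derivative ux e (x + s *\<^sub>R e, t)) (at s)"
        "((\<lambda>s. ux e (x + s *\<^sub>R e, t)) has_real_derivative uxx e e (x + s *\<^sub>R e, t)) (at s)" if "\<bar>s\<bar> < r" for s
        using dd_along[of "(e,0)" u "(x,t)" s] dd_along[of "(e,0)" "ux e" "(x,t)" s] u e inQ[of x s t] S1 that
        unfolding W21_def by auto
      have du': "((\<lambda>s. u (x + (- s) *\<^sub>R e, t)) has_real_derivative - ux e (x + (- s) *\<^sub>R e, t)) (at s)"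
        "((\<lambda>s. ux e (x + (- s) *\<^sub>R e, t)) has_real_derivative - uxx e e (x + (- s) *\<^sub>R e, t)) (at s)" if "\<bar>s\<bar> < r" for s
        using DERIV_mirror[THEN iffD1, OF du(1)[of "- s"]] DERIV_mirror[THEN iffD1, OF du(2)[of "- s"]] that
        by auto
      have "dd2 1 ?f y ((uxx e e P - uxx e e P') / 2 + 2 * A)"
        unfolding dd2_def
      proof (intro exI conjI ballI)
        show "open {0<..<r}" "y \<in> {0<..<r}" using y0 yr by auto
        show "dd 1 ?f y' (?f' y')" if "y' \<in> {0<..<r}" for y'
        proof -
          have "(?f has_real_derivative ?f' y') (at y')"
            unfolding Z_def w_def \<psi>_def
          proof -
            have "((\<lambda>z. M / r\<^sup>2 * ((norm (x - x0))\<^sup>2 + (t0 - t)) + A * z * (2 * r - z)) has_real_derivative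
                A * (2 * r - 2 * y')) (at y')"
              by (auto intro!: derivative_eq_intros simp: algebra_simps)
            from DERIV_half_diff[OF du(1)[of y'] du'(1)[of y'] this] that
            show "((\<lambda>y. (u (fst (x, y, t) + fst (snd (x, y, t)) *\<^sub>R e, snd (snd (x, y, t))) -
               u (fst (x, y, t) + - fst (snd (x, y, t)) *\<^sub>R e, snd (snd (x, y, t)))) / 2 -
               (M / r\<^sup>2 * ((norm (fst (x, y, t) - x0))\<^sup>2 + (t0 - snd (snd (x, y, t)))) +
                A * fst (snd (x, y, t)) * (2 * r - fst (snd (x, y, t))))) has_real_derivative ?f' y') (at y')"
              by simp
          qed
          then show ?thesis unfolding dd_real .
        qed
        have "(?f' has_real_derivative (uxx e e P - uxx e e P') / 2 + 2 * A) (at y)"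
        proof -
          have "((\<lambda>y. A * (2 * r - 2 * y)) has_real_derivative - 2 * A) (at y)"
            by (auto intro!: derivative_eq_intros)
          from DERIV_half_diff[OF du(2)[of y] DERIV_minus[OF du'(2)[of y]] this] y0 yr
          show ?thesis by (simp add: P_def P'_def)
        qed
        then show "dd 1 ?f' y ((uxx e e P - uxx e e P') / 2 + 2 * A)"
          unfolding dd_real .
      qed
      then show ?thesis
      proof (rule dd2_max)
        show "open {0<..<r}" "y \<in> {0<..<r}" using y0 yr by auto
        show "Z (x, y + s *\<^sub>R 1, t) \<le> Z (x, y, t)" if "y + s *\<^sub>R 1 \<in> {0<..<r}" for s
          using m(2)[of "(x, y + s, t)"] that S1 by (auto simp: S_def dist_commute xyt)
      qed
    qed
    have dx: "(uxx i i P - uxx i i P') / 2 \<le> 2 * M / r\<^sup>2" if i: "i \<in> Basis" for i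
    proof -
      let ?f = "\<lambda>s. Z (x + s *\<^sub>R i, y, t)"
      have nn: "(norm (x + s *\<^sub>R i - x0))\<^sup>2 = (norm (x - x0))\<^sup>2 + 2 * s * ((x - x0) \<bullet> i) + s\<^sup>2" for s
      proof -
        have "x + s *\<^sub>R i - x0 = (x - x0) + s *\<^sub>R i" by simp
        then show ?thesis using i
          by (simp only: power2_norm_eq_inner inner_add_left inner_add_right inner_scaleR_left
              inner_scaleR_right inner_commute[of i "x - x0"]) (simp add: power2_eq_square algebra_simps)
      qed
      let ?f' = "\<lambda>s. (ux i (P + s *\<^sub>R (i,0)) - ux i (P' + s *\<^sub>R (i,0))) / 2 - M / r\<^sup>2 * (2 * ((x - x0) \<bullet> i) + 2 * s)"
      have fe: "?f = (\<lambda>s. (u (P + s *\<^sub>R (i,0)) - u (P' + s *\<^sub>R (i,0))) / 2 -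
          (M / r\<^sup>2 * ((norm (x - x0))\<^sup>2 + 2 * s * ((x - x0) \<bullet> i) + s\<^sup>2 + (t0 - t)) + A * y * (2 * r - y)))"
        unfolding Z_def w_def \<psi>_def by (simp add: P_def P'_def nn algebra_simps del: scaleR_minus_left)
      define k where "k = r - dist x x0"
      have k: "k > 0" using xr by (simp add: k_def)
      have xs: "dist (x + s *\<^sub>R i) x0 < r" if "\<bar>s\<bar> < k" for s
      proof -
        have "dist (x + s *\<^sub>R i) x0 \<le> dist (x + s *\<^sub>R i) x + dist x x0" by (rule dist_triangle)
        also have "dist (x + s *\<^sub>R i) x = \<bar>s\<bar>" using i by (simp add: dist_norm)
        finally show ?thesis using that by (simp add: k_def)
      qed
      have sQ: "P + s *\<^sub>R (i,0) \<in> Q" "P' + s *\<^sub>R (i,0) \<in> Q" if "\<bar>s\<bar> < k" for s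
        using inQ[of "x + s *\<^sub>R i" y t] inQ[of "x + s *\<^sub>R i" "- y" t] xs[OF that] S1
        by (auto simp: P_def P'_def algebra_simps)
      have du: "((\<lambda>s. u (p + s *\<^sub>R (i,0))) has_real_derivative ux i (p + s *\<^sub>R (i,0))) (at s)"
        "((\<lambda>s. ux i (p + s *\<^sub>R (i,0))) has_real_derivative uxx i i (p + s *\<^sub>R (i,0))) (at s)"
        if "p + s *\<^sub>R (i,0) \<in> Q" for p s
        using dd_along[of "(i,0)" u p s] dd_along[of "(i,0)" "ux i" p s] u i that
        unfolding W21_def by auto
      have "dd2 1 ?f 0 ((uxx i i P - uxx i i P') / 2 - 2 * M / r\<^sup>2)"
        unfolding dd2_def
      proof (intro exI conjI ballI)
        show "open {-k<..<k}" "0 \<in> {-k<..<k}" using k by auto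
        show "dd 1 ?f s (?f' s)" if "s \<in> {-k<..<k}" for s
        proof -
          have "(?f has_real_derivative ?f' s) (at s)"
            unfolding fe
          proof -
            have "((\<lambda>s. c * ((norm (x - x0))\<^sup>2 + 2 * s * ((x - x0) \<bullet> i) + s\<^sup>2 + (t0 - t)) + A * y * (2 * r - y)) has_real_derivative
                c * (2 * ((x - x0) \<bullet> i) + 2 * s)) (at s)" for c
              by (auto intro!: derivative_eq_intros)
            from DERIV_half_diff[OF du(1)[OF sQ(1)] du(1)[OF sQ(2)] this[of "M / r\<^sup>2"]] that
            show "((\<lambda>s. (u (P + s *\<^sub>R (i,0)) - u (P' + s *\<^sub>R (i,0))) / 2 -
               (M / r\<^sup>2 * ((norm (x - x0))\<^sup>2 + 2 * s * ((x - x0) \<bullet> i) + s\<^sup>2 + (t0 - t)) + A * y * (2 * r - y)))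
               has_real_derivative ?f' s) (at s)" by auto
          qed
          then show ?thesis unfolding dd_real .
        qed
        have "(?f' has_real_derivative (uxx i i (P + 0 *\<^sub>R (i,0)) - uxx i i (P' + 0 *\<^sub>R (i,0))) / 2 - M / r\<^sup>2 * 2) (at 0)"
        proof -
          have "((\<lambda>s. c * (2 * ((x - x0) \<bullet> i) + 2 * s)) has_real_derivative c * 2) (at 0)" for c
            by (auto intro!: derivative_eq_intros)
          from DERIV_half_diff[OF du(2)[OF sQ(1)] du(2)[OF sQ(2)] this[of "M / r\<^sup>2"]] k
          show ?thesis by auto
        qed
        then show "dd 1 ?f' 0 ((uxx i i P - uxx i i P') / 2 - 2 * M / r\<^sup>2)"
          unfolding dd_real by (simp add: zero_prod_def[symmetric] mult.commute)
      qed
      then have "(uxx i i P - uxx i i P') / 2 - 2 * M / r\<^sup>2 \<le> 0"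
      proof (rule dd2_max)
        show "open {-k<..<k}" "0 \<in> {-k<..<k}" using k by auto
        show "Z (x + (0 + s *\<^sub>R 1) *\<^sub>R i, y, t) \<le> Z (x + 0 *\<^sub>R i, y, t)" if "0 + s *\<^sub>R 1 \<in> {-k<..<k}" for s
          using m(2)[of "(x + s *\<^sub>R i, y, t)"] xs[of s] that S1 by (auto simp: S_def dist_commute xyt abs_less_iff)
      qed
      then show ?thesis by simp
    qed
    have "(\<Sum>i\<in>Basis. (uxx i i P - uxx i i P') / 2) = (uxx e e P - uxx e e P') / 2 + (\<Sum>i\<in>Basis - {e}. (uxx i i P - uxx i i P') / 2)"
      using e by (subst sum.remove[of _ e]) auto
    also have "\<dots> \<le> - 2 * A + (\<Sum>i\<in>(Basis :: 'a set) - {e}. 2 * M / r\<^sup>2)"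
    proof (intro add_mono sum_mono)
      show "(uxx e e P - uxx e e P') / 2 \<le> - 2 * A" using dy by linarith
    qed (use dx in auto)
    also have "(\<Sum>i\<in>(Basis :: 'a set) - {e}. 2 * M / r\<^sup>2) = (N - 1) * (2 * M / r\<^sup>2)"
      using e DIM_positive[where 'a='a] by (simp add: N_def card_Diff_singleton of_nat_diff Suc_le_eq)
    finally have sum: "(\<Sum>i\<in>Basis. (uxx i i P - uxx i i P') / 2) \<le> - 2 * A + (N - 1) * (2 * M / r\<^sup>2)" .
    have "(\<Sum>i\<in>Basis. (uxx i i P - uxx i i P') / 2) = ((\<Sum>i\<in>Basis. uxx i i P) - (\<Sum>i\<in>Basis. uxx i i P')) / 2"
      by (simp add: sum_divide_distrib[symmetric] sum_subtractf)
    then have "(ut P - ut P') / 2 - (\<Sum>i\<in>Basis. (uxx i i P - uxx i i P') / 2) \<le> \<Phi>"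
      using F[OF PQ(1)] F[OF PQ(2)] unfolding abs_le_iff by (simp add: field_simps)
    \<comment> \<open>The maximum conditions bound \<open>2 A\<close> by
      \<open>\<Phi> + (2 N - 1) M / r^2\<close>, while the choice of \<open>A\<close> gives
      \<open>2 A = 2 \<Phi> + (4 N + 2) M / r^2\<close>.\<close>
    then have "2 * A \<le> \<Phi> + (N - 1) * (2 * M / r\<^sup>2) + M / r\<^sup>2"
      using dt sum minus_divide_left[of M "r\<^sup>2"] by linarith
    moreover have "(N - 1) * (2 * M / r\<^sup>2) + M / r\<^sup>2 = (2 * N - 1) * (M / r\<^sup>2)"
      using r by (simp add: field_simps)
    ultimately have "2 * A \<le> \<Phi> + (2 * N - 1) * (M / r\<^sup>2)" by linarith
    moreover have "2 * A = 2 * \<Phi> + (4 * N + 2) * (M / r\<^sup>2)" by (simp add: A_def field_simps)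
    moreover have "(2 * N - 1) * (M / r\<^sup>2) < (4 * N + 2) * (M / r\<^sup>2)"
      using N M r by (intro mult_strict_right_mono) auto
    ultimately show False using \<Phi> by linarith
  qed
  \<comment> \<open>At \<open>x = x0\<close> and \<open>t = t0\<close> the first summand of \<psi>
    vanishes and the second is at most \<open>2 r A y\<close>; dividing by \<open>y\<close> gives
    the bound for the derivative.\<close>
  have le: "(u (x0 + y *\<^sub>R e, t0) - u (x0 + (- y) *\<^sub>R e, t0)) / 2 \<le> 2 * r * A * y" if "0 \<le> y" "y \<le> r" for y
  proof -
    have "Z (x0, y, t0) \<le> 0" using m(2)[of "(x0, y, t0)"] Zm that r by (auto simp: S_def)
    then have "(u (x0 + y *\<^sub>R e, t0) - u (x0 + (- y) *\<^sub>R e, t0)) / 2 \<le> A * y * (2 * r - y)"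
      by (simp add: Z_def w_def \<psi>_def)
    also have "\<dots> \<le> A * y * (2 * r)" using A that by (intro mult_left_mono) auto
    finally show ?thesis by (simp add: algebra_simps)
  qed
  have "dd (e,0) u (x0,t0) (ux e (x0,t0))" using u inQ[of x0 0 t0] r e unfolding W21_def by auto
  then have d1: "((\<lambda>s. u (x0 + s *\<^sub>R e, t0)) has_real_derivative ux e (x0,t0)) (at 0)"
    by (simp add: dd_def)
  have "((\<lambda>s. u (x0 + (- s) *\<^sub>R e, t0)) has_real_derivative - ux e (x0,t0)) (at 0)"
  proof -
    have m: "(uminus has_real_derivative - 1) (at (0::real))" by (auto intro!: derivative_eq_intros)
    show ?thesis
      using DERIV_chain2[of "\<lambda>s. u (x0 + s *\<^sub>R e, t0)" "ux e (x0,t0)" uminus 0 "-1" UNIV, OF _ m] d1 by simp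
  qed
  with d1 have d: "((\<lambda>s. (u (x0 + s *\<^sub>R e, t0) - u (x0 + (- s) *\<^sub>R e, t0)) / 2 - 2 * r * A * s) has_real_derivative
      (ux e (x0,t0) - - ux e (x0,t0)) / 2 - 2 * r * A) (at 0)"
    by (auto intro!: derivative_eq_intros)
  have "(ux e (x0,t0) - - ux e (x0,t0)) / 2 - 2 * r * A \<le> 0"
  proof (rule ccontr)
    assume "\<not> ?thesis"
    then obtain k where k: "k > 0" "\<And>h. 0 < h \<Longrightarrow> h < k \<Longrightarrow>
        0 < (u (x0 + h *\<^sub>R e, t0) - u (x0 + (- h) *\<^sub>R e, t0)) / 2 - 2 * r * A * h"
      using has_real_derivative_pos_inc_right[OF d] by auto
    define h where "h = min k r / 2"
    have h: "0 < h" "h < k" "h \<le> r" using k r by (auto simp: h_def min_def)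
    show False using k(2)[OF h(1,2)] le[of h] h by simp
  qed
  then show ?thesis by (simp add: A_def N_def)
qed

lemma gradient_estimate:
  fixes u :: "'a::euclidean_space \<times> real \<Rightarrow> real"
  assumes Q: "open Q" "cball x0 (2 * r) \<times> {t0 - r\<^sup>2..t0} \<subseteq> Q" and r: "r > 0" and e: "e \<in> Basis"
    and u: "W21 Q u ut ux uxx" and M: "M > 0" "\<And>p. p \<in> Q \<Longrightarrow> \<bar>u p\<bar> \<le> M"
    and F: "\<And>p. p \<in> Q \<Longrightarrow> \<bar>ut p - (\<Sum>i\<in>Basis. uxx i i p)\<bar> \<le> \<Phi>"
  shows "\<bar>ux e (x0, t0)\<bar> \<le> 2 * r * ((2 * real DIM('a) + 1) * M / r\<^sup>2 + \<Phi>)"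
proof -
  have "(-1) * ux e (x0, t0) \<le> 2 * r * ((2 * real DIM('a) + 1) * M / r\<^sup>2 + \<Phi>)"
    by (rule gradient_estimate_upper[OF Q r e W21_cmult[OF u, of "-1"] M(1)])
      (use M(2) F in \<open>auto simp: sum_negf abs_minus_commute\<close>)
  moreover have "ux e (x0, t0) \<le> 2 * r * ((2 * real DIM('a) + 1) * M / r\<^sup>2 + \<Phi>)"
    by (rule gradient_estimate_upper[OF assms])
  ultimately show ?thesis by simp
qed

subsection \<open>Local estimates for the first and second derivatives\<close>

definition cyl :: "'a::metric_space \<times> real \<Rightarrow> real \<Rightarrow> ('a \<times> real) set" where
  "cyl p e = ball (fst p) e \<times> ball (snd p) e"

lemma open_cyl: "open (cyl p e)"
  unfolding cyl_def by (intro open_Times open_ball)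

lemma cyl_mono: "e \<le> e' \<Longrightarrow> cyl p e \<subseteq> cyl p e'"
  unfolding cyl_def by auto

lemma cyl_centre: "e > 0 \<Longrightarrow> p \<in> cyl p e"
  unfolding cyl_def by (cases p) auto

lemma cyl_subset: "q \<in> cyl p e \<Longrightarrow> e + r \<le> e' \<Longrightarrow> cyl q r \<subseteq> cyl p e'"
proof
  fix x assume q: "q \<in> cyl p e" and e: "e + r \<le> e'" and x: "x \<in> cyl q r"
  have "dist (fst p) (fst x) \<le> dist (fst p) (fst q) + dist (fst q) (fst x)"
    "dist (snd p) (snd x) \<le> dist (snd p) (snd q) + dist (snd q) (snd x)"
    by (rule dist_triangle)+
  moreover have "dist (fst p) (fst q) < e" "dist (fst q) (fst x) < r" "dist (snd p) (snd q) < e" "dist (snd q) (snd x) < r"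
    using q x unfolding cyl_def mem_Times_iff mem_ball by auto
  ultimately show "x \<in> cyl p e'"
    unfolding cyl_def mem_Times_iff mem_ball using e by linarith
qed

lemma open_contains_cyl:
  fixes p :: "'a::metric_space \<times> real"
  assumes "open U" "p \<in> U" shows "\<exists>e>0. cyl p e \<subseteq> U"
proof -
  obtain A B where AB: "open A" "open B" "p \<in> A \<times> B" "A \<times> B \<subseteq> U"
    using open_prod_elim[OF assms] by blast
  obtain a where a: "a > 0" "ball (fst p) a \<subseteq> A" using AB by (auto simp: open_contains_ball)
  obtain b where b: "b > 0" "ball (snd p) b \<subseteq> B" using AB by (auto simp: open_contains_ball)
  show ?thesis
    using a b AB(4) by (intro exI[of _ "min a b"]) (fastforce simp: cyl_def)
qed

lemma W21_subset: "W21 D u ut ux uxx \<Longrightarrow> E \<subseteq> D \<Longrightarrow> W21 E u ut ux uxx"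
  unfolding W21_def by (meson continuous_on_subset subsetD)

lemma W21_translate:
  assumes "W21 D u ut ux uxx" "\<And>q. q \<in> E \<Longrightarrow> q + a \<in> D"
  shows "W21 E (\<lambda>q. u (q + a)) (\<lambda>q. ut (q + a)) (\<lambda>i q. ux i (q + a)) (\<lambda>i j q. uxx i j (q + a))"
proof -
  have "continuous_on E (\<lambda>q. f (q + a))" if "continuous_on D f" for f :: "'a \<times> real \<Rightarrow> real"
    by (rule continuous_on_compose2[OF that]) (use assms(2) in \<open>auto intro!: continuous_intros\<close>)
  then show ?thesis
    using assms unfolding W21_def by (auto intro: dd_translate)
qed

lemma W21_diff:
  "W21 D u ut ux uxx \<Longrightarrow> W21 D v vt vx vxx \<Longrightarrow>
   W21 D (\<lambda>p. u p - v p) (\<lambda>p. ut p - vt p) (\<lambda>i p. ux i p - vx i p) (\<lambda>i j p. uxx i j p - vxx i j p)"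
  unfolding W21_def by (auto intro!: continuous_intros dd_diff)

abbreviation hW :: "('a::euclidean_space \<times> real \<Rightarrow> real) \<Rightarrow> ('a \<Rightarrow> 'a \<Rightarrow> 'a \<times> real \<Rightarrow> real) \<Rightarrow> 'a \<times> real \<Rightarrow> real" where
  "hW ut uxx p \<equiv> ut p - (\<Sum>i\<in>Basis. uxx i i p)"

text \<open>\<open>K\<close> and the smaller radius \<open>e'\<close> do not depend on
  \<open>u\<close>, and the bound is linear in \<open>M\<close>. Hence one constant serves all
  members of a sequence and also their differences, for which \<open>M\<close> is small.\<close>

definition grad_bd where
  "grad_bd U p e i K e' \<longleftrightarrow> (\<forall>u ut ux uxx M. W21 U u ut ux uxx \<longrightarrow> 0 < M \<longrightarrow>
     (\<forall>q\<in>cyl p e. \<bar>u q\<bar> \<le> M \<and> \<bar>hW ut uxx q\<bar> \<le> M) \<longrightarrow> (\<forall>q\<in>cyl p e'. \<bar>ux i q\<bar> \<le> K * M))"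

definition hess_bd where
  "hess_bd U p e i k K e' \<longleftrightarrow> (\<forall>u ut ux uxx Fk M. W21 U u ut ux uxx \<longrightarrow> 0 < M \<longrightarrow>
     (\<forall>q\<in>cyl p e. \<bar>ux k q\<bar> \<le> M \<and> dd (k,0) (hW ut uxx) q (Fk q) \<and> \<bar>Fk q\<bar> \<le> M) \<longrightarrow>
     (\<forall>q\<in>cyl p e'. \<bar>uxx i k q\<bar> \<le> K * M))"

lemma grad_bdD:
  assumes "grad_bd U p e i K e'" "W21 U u ut ux uxx" "0 < M"
    "\<And>q. q \<in> cyl p e \<Longrightarrow> \<bar>u q\<bar> \<le> M \<and> \<bar>hW ut uxx q\<bar> \<le> M" "q \<in> cyl p e'"
  shows "\<bar>ux i q\<bar> \<le> K * M"
  using assms(1)[unfolded grad_bd_def, rule_format, OF assms(2,3) _ assms(5)] assms(4) by blast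

lemma hess_bdD:
  assumes "hess_bd U p e i k K e'" "W21 U u ut ux uxx" "0 < M"
    "\<And>q. q \<in> cyl p e \<Longrightarrow> \<bar>ux k q\<bar> \<le> M \<and> dd (k,0) (hW ut uxx) q (Fk q) \<and> \<bar>Fk q\<bar> \<le> M" "q \<in> cyl p e'"
  shows "\<bar>uxx i k q\<bar> \<le> K * M"
  using assms(1)[unfolded hess_bd_def, rule_format, OF assms(2,3) _ assms(5), of Fk] assms(4) by blast

lemma local_grad:
  fixes p :: "'a::euclidean_space \<times> real"
  assumes "0 < e" "cyl p e \<subseteq> U" "i \<in> Basis"
  shows "\<exists>K e'. 0 < e' \<and> e' \<le> e \<and> 0 < K \<and> grad_bd U p e i K e'"
proof -
  \<comment> \<open>\<open>r \<le> 1\<close> gives \<open>r^2 \<le> r\<close>, so the parabolic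
    cylinder of the gradient estimate fits into one with equal radii in space and time.\<close>
  define r where "r = min 1 (e / 8)"
  define K where "K = 2 * r * ((2 * real DIM('a) + 1) / r\<^sup>2 + 1)"
  have r: "0 < r" "r \<le> 1" "4 * r \<le> e / 2" using assms by (auto simp: r_def)
  have "0 < K" unfolding K_def using r by (intro mult_pos_pos add_nonneg_pos) auto
  moreover have "grad_bd U p e i K (e / 2)"
    unfolding grad_bd_def
  proof (intro allI impI ballI)
  fix u ut ux uxx M q
  assume u: "W21 U u ut ux uxx" and M: "0 < M" and q: "q \<in> cyl p (e / 2)"
    and b: "\<forall>q\<in>cyl p e. \<bar>u q\<bar> \<le> M \<and> \<bar>hW ut uxx q\<bar> \<le> M"
  have sub: "cyl q (4 * r) \<subseteq> cyl p e" using r by (intro cyl_subset[OF q]) simp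
  have "r\<^sup>2 \<le> r" using r by (simp add: power2_eq_square mult_left_le)
  then have "cball (fst q) (2 * r) \<subseteq> ball (fst q) (4 * r)" "{snd q - r\<^sup>2..snd q} \<subseteq> ball (snd q) (4 * r)"
    using r by (auto simp: dist_real_def)
  then have cs: "cball (fst q) (2 * r) \<times> {snd q - r\<^sup>2..snd q} \<subseteq> cyl q (4 * r)"
    unfolding cyl_def by blast
  have sU: "cyl q (4 * r) \<subseteq> U" using sub assms(2) by blast
  have "\<bar>ux i (fst q, snd q)\<bar> \<le> 2 * r * ((2 * real DIM('a) + 1) * M / r\<^sup>2 + M)"
    by (rule gradient_estimate[OF open_cyl cs r(1) assms(3) W21_subset[OF u sU] M]) (use b sub in auto)
  then show "\<bar>ux i q\<bar> \<le> K * M" by (simp add: K_def algebra_simps)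
  qed
  ultimately show ?thesis using assms by (intro exI[of _ K] exI[of _ "e / 2"]) auto
qed

lemma deriv_bound_right:
  fixes f :: "real \<Rightarrow> real"
  assumes "(f has_real_derivative d) (at 0)" "r > 0" "\<And>h. 0 < h \<Longrightarrow> h < r \<Longrightarrow> \<bar>(f h - f 0) / h\<bar> \<le> B"
  shows "\<bar>d\<bar> \<le> B"
proof -
  have "((\<lambda>h. (f h - f 0) / h) \<longlongrightarrow> d) (at_right 0)"
    using assms(1) unfolding has_field_derivative_iff by (simp add: filterlim_at_split)
  then have "((\<lambda>h. \<bar>(f h - f 0) / h\<bar>) \<longlongrightarrow> \<bar>d\<bar>) (at_right 0)" by (rule tendsto_rabs)
  moreover have "\<forall>\<^sub>F h in at_right 0. \<bar>(f h - f 0) / h\<bar> \<le> B"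
    unfolding eventually_at_right_field using assms(2,3) by auto
  ultimately show ?thesis by (intro tendsto_upperbound) auto
qed

lemma diff_quot_bound:
  assumes "0 < h" "\<And>s. 0 \<le> s \<Longrightarrow> s \<le> h \<Longrightarrow> dd e u (q + s *\<^sub>R e) (d s) \<and> \<bar>d s\<bar> \<le> M"
  shows "\<bar>(u (q + h *\<^sub>R e) - u q) / h\<bar> \<le> M"
proof -
  have "((\<lambda>s. u (q + s *\<^sub>R e)) has_real_derivative d s) (at s)" if "0 \<le> s" "s \<le> h" for s
    using assms(2)[OF that] dd_along by blast
  then obtain z where z: "0 < z" "z < h" "u (q + h *\<^sub>R e) - u (q + 0 *\<^sub>R e) = (h - 0) * d z"
    using MVT2[OF assms(1), of "\<lambda>s. u (q + s *\<^sub>R e)" d] by blast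
  then show ?thesis using assms(1) assms(2)[of z] by simp
qed

text \<open>The difference quotients of \<open>u\<close> in direction \<open>k\<close> satisfy the
  heat equation with the difference quotients of the right-hand side. Both are bounded by
  \<open>M\<close> through the mean value theorem, so the gradient estimate holds uniformly in the
  step \<open>h\<close>, which then tends to 0. Third derivatives of \<open>u\<close> never
  appear.\<close>

lemma local_hess:
  fixes p :: "'a::euclidean_space \<times> real"
  assumes "0 < e" "cyl p e \<subseteq> U" "i \<in> Basis" "k \<in> Basis"
  shows "\<exists>K e'. 0 < e' \<and> e' \<le> e \<and> 0 < K \<and> hess_bd U p e i k K e'"
proof -
  obtain K e' where K: "0 < e'" "e' \<le> e / 2" "0 < K" "grad_bd (cyl p (e / 2)) p (e / 2) i K e'"
    using local_grad[of "e / 2" p "cyl p (e / 2)" i] assms by auto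
  have "hess_bd U p e i k K e'"
    unfolding hess_bd_def
  proof (intro allI impI ballI)
    fix u ut ux uxx Fk M q
    assume u: "W21 U u ut ux uxx" and M: "0 < M" and q: "q \<in> cyl p e'"
      and b: "\<forall>q\<in>cyl p e. \<bar>ux k q\<bar> \<le> M \<and> dd (k,0) (hW ut uxx) q (Fk q) \<and> \<bar>Fk q\<bar> \<le> M"
    have shift: "q + s *\<^sub>R (k,0) \<in> cyl p e" if "q \<in> cyl p (e / 2)" "0 \<le> s" "s < e / 2" for q s
    proof -
      have "dist (fst p) (fst q + s *\<^sub>R k) \<le> dist (fst p) (fst q) + dist (fst q) (fst q + s *\<^sub>R k)"
        by (rule dist_triangle)
      also have "dist (fst q) (fst q + s *\<^sub>R k) = s" using assms that by (simp add: dist_norm)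
      finally show ?thesis using that by (auto simp: cyl_def)
    qed
    have est: "\<bar>(ux i (q + h *\<^sub>R (k,0)) - ux i q) / h\<bar> \<le> K * M" if h: "0 < h" "h < e / 2" for h
    proof -
      have sub: "cyl p (e / 2) \<subseteq> U" using assms(1,2) cyl_mono[of "e / 2" e p] by auto
      have inU: "q + h *\<^sub>R (k,0) \<in> U" if "q \<in> cyl p (e / 2)" for q
        using shift[OF that] h assms(2) by auto
      note w = W21_cmult[OF W21_diff[OF W21_translate[OF u inU] W21_subset[OF u sub]], of "1 / h"]
      have "\<bar>1 / h * (ux i (q + h *\<^sub>R (k,0)) - ux i q)\<bar> \<le> K * M"
      proof (rule grad_bdD[OF K(4) w M _ q])
        fix q assume q: "q \<in> cyl p (e / 2)"
        have "\<bar>(u (q + h *\<^sub>R (k,0)) - u q) / h\<bar> \<le> M"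
          using b shift[OF q] u assms h unfolding W21_def
          by (intro diff_quot_bound[of h "(k,0)" u q "\<lambda>s. ux k (q + s *\<^sub>R (k,0))"]) (auto simp: subset_eq)
        moreover have "\<bar>(hW ut uxx (q + h *\<^sub>R (k,0)) - hW ut uxx q) / h\<bar> \<le> M"
          using b shift[OF q] h by (intro diff_quot_bound[of h "(k,0)" _ q "\<lambda>s. Fk (q + s *\<^sub>R (k,0))"]) auto
        moreover have "1 / h * (ut (q + h *\<^sub>R (k,0)) - ut q) -
            (\<Sum>i\<in>Basis. 1 / h * (uxx i i (q + h *\<^sub>R (k,0)) - uxx i i q)) =
            (hW ut uxx (q + h *\<^sub>R (k,0)) - hW ut uxx q) / h"
          by (simp only: sum_distrib_left[symmetric] sum_subtractf) (simp add: divide_inverse algebra_simps)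
        ultimately show "\<bar>1 / h * (u (q + h *\<^sub>R (k,0)) - u q)\<bar> \<le> M \<and>
            \<bar>1 / h * (ut (q + h *\<^sub>R (k,0)) - ut q) - (\<Sum>i\<in>Basis. 1 / h * (uxx i i (q + h *\<^sub>R (k,0)) - uxx i i q))\<bar> \<le> M"
          by simp
      qed
      then show ?thesis by simp
    qed
    have "q \<in> U" using q K(2) assms(1,2) cyl_mono[of e' e p] by auto
    then have "dd (k,0) (ux i) q (uxx i k q)" using u assms unfolding W21_def by blast
    then show "\<bar>uxx i k q\<bar> \<le> K * M"
      unfolding dd_def by (rule deriv_bound_right[of _ _ "e / 2"]) (use est assms in \<open>auto simp: zero_prod_def[symmetric]\<close>)
  qed
  then show ?thesis using K assms(1) by (intro exI[of _ K] exI[of _ e']) auto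
qed

subsection \<open>Sequences that are locally bounded or locally uniformly Cauchy\<close>

definition lbd :: "('a::metric_space \<times> real) set \<Rightarrow> (nat \<Rightarrow> 'a \<times> real \<Rightarrow> real) \<Rightarrow> bool" where
  "lbd U f \<longleftrightarrow> (\<forall>p\<in>U. \<exists>e>0. \<exists>C>0. cyl p e \<subseteq> U \<and> (\<forall>n. \<forall>q\<in>cyl p e. \<bar>f n q\<bar> \<le> C))"

text \<open>The Cauchy form is used because the limits of the derivatives are not known beforehand;
  their existence is part of what has to be shown. The radius \<open>e\<close> does not depend on
  \<epsilon>.\<close>

definition luc :: "('a::metric_space \<times> real) set \<Rightarrow> (nat \<Rightarrow> 'a \<times> real \<Rightarrow> real) \<Rightarrow> bool" where
  "luc U f \<longleftrightarrow> (\<forall>p\<in>U. \<exists>e>0. cyl p e \<subseteq> U \<and>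
     (\<forall>\<epsilon>>0. \<exists>N. \<forall>m\<ge>N. \<forall>n\<ge>N. \<forall>q\<in>cyl p e. \<bar>f m q - f n q\<bar> < \<epsilon>))"

lemma lbdE:
  assumes "lbd U f" "p \<in> U"
  obtains e C where "e > 0" "C > 0" "cyl p e \<subseteq> U" "\<And>n q. q \<in> cyl p e \<Longrightarrow> \<bar>f n q\<bar> \<le> C"
  using assms unfolding lbd_def by meson

lemma lbdE2:
  assumes "lbd U f" "lbd U g" "p \<in> U"
  obtains e C where "e > 0" "C > 0" "cyl p e \<subseteq> U"
    "\<And>n q. q \<in> cyl p e \<Longrightarrow> \<bar>f n q\<bar> \<le> C" "\<And>n q. q \<in> cyl p e \<Longrightarrow> \<bar>g n q\<bar> \<le> C"
proof -
  obtain e C where 1: "e > 0" "C > 0" "cyl p e \<subseteq> U" "\<And>n q. q \<in> cyl p e \<Longrightarrow> \<bar>f n q\<bar> \<le> C"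
    using assms unfolding lbd_def by meson
  obtain e' C' where 2: "e' > 0" "C' > 0" "cyl p e' \<subseteq> U" "\<And>n q. q \<in> cyl p e' \<Longrightarrow> \<bar>g n q\<bar> \<le> C'"
    using assms unfolding lbd_def by meson
  have s: "cyl p (min e e') \<subseteq> cyl p e" "cyl p (min e e') \<subseteq> cyl p e'" by (auto intro!: cyl_mono)
  show ?thesis
  proof (rule that[of "min e e'" "max C C'"])
    show "\<bar>f n q\<bar> \<le> max C C'" if "q \<in> cyl p (min e e')" for n q
      using 1(4)[of q n] that s(1) by (meson max.coboundedI1 subsetD)
    show "\<bar>g n q\<bar> \<le> max C C'" if "q \<in> cyl p (min e e')" for n q
      using 2(4)[of q n] that s(2) by (meson max.coboundedI2 subsetD)
    show "cyl p (min e e') \<subseteq> U" using 1(3) s(1) by blast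
  qed (use 1 2 in auto)
qed

lemma lucE2:
  assumes "luc U f" "luc U g" "p \<in> U"
  obtains e where "e > 0" "cyl p e \<subseteq> U"
    "\<And>\<epsilon>. \<epsilon> > 0 \<Longrightarrow> \<exists>N. \<forall>m\<ge>N. \<forall>n\<ge>N. \<forall>q\<in>cyl p e. \<bar>f m q - f n q\<bar> < \<epsilon> \<and> \<bar>g m q - g n q\<bar> < \<epsilon>"
proof -
  obtain e where 1: "e > 0" "cyl p e \<subseteq> U" "\<And>\<epsilon>. \<epsilon> > 0 \<Longrightarrow> \<exists>N. \<forall>m\<ge>N. \<forall>n\<ge>N. \<forall>q\<in>cyl p e. \<bar>f m q - f n q\<bar> < \<epsilon>"
    using assms unfolding luc_def by meson
  obtain e' where 2: "e' > 0" "cyl p e' \<subseteq> U" "\<And>\<epsilon>. \<epsilon> > 0 \<Longrightarrow> \<exists>N. \<forall>m\<ge>N. \<forall>n\<ge>N. \<forall>q\<in>cyl p e'. \<bar>g m q - g n q\<bar> < \<epsilon>"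
    using assms unfolding luc_def by meson
  have s: "cyl p (min e e') \<subseteq> cyl p e" "cyl p (min e e') \<subseteq> cyl p e'" by (auto intro!: cyl_mono)
  show ?thesis
  proof (rule that[of "min e e'"])
    fix \<epsilon> :: real assume "\<epsilon> > 0"
    obtain N where N: "\<forall>m\<ge>N. \<forall>n\<ge>N. \<forall>q\<in>cyl p e. \<bar>f m q - f n q\<bar> < \<epsilon>" using 1(3)[OF \<open>\<epsilon> > 0\<close>] by blast
    obtain N' where N': "\<forall>m\<ge>N'. \<forall>n\<ge>N'. \<forall>q\<in>cyl p e'. \<bar>g m q - g n q\<bar> < \<epsilon>" using 2(3)[OF \<open>\<epsilon> > 0\<close>] by blast
    show "\<exists>N. \<forall>m\<ge>N. \<forall>n\<ge>N. \<forall>q\<in>cyl p (min e e'). \<bar>f m q - f n q\<bar> < \<epsilon> \<and> \<bar>g m q - g n q\<bar> < \<epsilon>"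
      using N N' s by (intro exI[of _ "max N N'"]) auto
  qed (use 1 2 s in auto)
qed

lemma lbd_add: "lbd U f \<Longrightarrow> lbd U g \<Longrightarrow> lbd U (\<lambda>n q. f n q + g n q)"
  unfolding lbd_def[of U "\<lambda>n q. f n q + g n q"]
proof
  fix p assume fgp: "lbd U f" "lbd U g" "p \<in> U"
  obtain e C where *: "e > 0" "C > 0" "cyl p e \<subseteq> U"
    "\<And>n q. q \<in> cyl p e \<Longrightarrow> \<bar>f n q\<bar> \<le> C" "\<And>n q. q \<in> cyl p e \<Longrightarrow> \<bar>g n q\<bar> \<le> C"
    using lbdE2[OF fgp] by blast
  have "\<bar>f n q + g n q\<bar> \<le> 2 * C" if "q \<in> cyl p e" for n q
    using *(4,5)[OF that, of n] abs_triangle_ineq[of "f n q" "g n q"] by linarith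
  then show "\<exists>e>0. \<exists>C>0. cyl p e \<subseteq> U \<and> (\<forall>n. \<forall>q\<in>cyl p e. \<bar>f n q + g n q\<bar> \<le> C)"
    using * by (intro exI[of _ e] conjI exI[of _ "2 * C"]) auto
qed

lemma lbd_mult: "lbd U f \<Longrightarrow> lbd U g \<Longrightarrow> lbd U (\<lambda>n q. f n q * g n q)"
  unfolding lbd_def[of U "\<lambda>n q. f n q * g n q"]
proof
  fix p assume fgp: "lbd U f" "lbd U g" "p \<in> U"
  obtain e C where *: "e > 0" "C > 0" "cyl p e \<subseteq> U"
    "\<And>n q. q \<in> cyl p e \<Longrightarrow> \<bar>f n q\<bar> \<le> C" "\<And>n q. q \<in> cyl p e \<Longrightarrow> \<bar>g n q\<bar> \<le> C"
    using lbdE2[OF fgp] by blast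
  then show "\<exists>e>0. \<exists>C>0. cyl p e \<subseteq> U \<and> (\<forall>n. \<forall>q\<in>cyl p e. \<bar>f n q * g n q\<bar> \<le> C)"
    by (intro exI[of _ e] conjI exI[of _ "C * C"]) (auto simp: abs_mult intro!: mult_mono)
qed

lemma lbd_fixed: "open U \<Longrightarrow> continuous_on U f \<Longrightarrow> lbd U (\<lambda>n. f)"
  unfolding lbd_def
proof
  fix p assume "open U" "continuous_on U f" "p \<in> U"
  then have "isCont f p" by (simp add: continuous_on_eq_continuous_at)
  then have "\<forall>\<^sub>F q in nhds p. dist (f q) (f p) < 1"
    unfolding isCont_def tendsto_at_iff_tendsto_nhds by (rule tendstoD) simp
  then obtain V where V: "open V" "p \<in> V" "\<And>q. q \<in> V \<Longrightarrow> dist (f q) (f p) < 1"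
    unfolding eventually_nhds by blast
  obtain e where e: "e > 0" "cyl p e \<subseteq> U \<inter> V"
    using open_contains_cyl[OF open_Int[OF \<open>open U\<close> V(1)], of p] V(2) \<open>p \<in> U\<close> by blast
  have "\<bar>f q\<bar> \<le> \<bar>f p\<bar> + 1" if "q \<in> cyl p e" for q
    using V(3)[of q] e that by (auto simp: dist_real_def)
  then show "\<exists>e>0. \<exists>C>0. cyl p e \<subseteq> U \<and> (\<forall>n::nat. \<forall>q\<in>cyl p e. \<bar>f q\<bar> \<le> C)"
    using e by (intro exI[of _ e] conjI exI[of _ "\<bar>f p\<bar> + 1"]) (auto simp: add_nonneg_pos)
qed

lemma lbd_compose:
  assumes "lbd U f" "continuous_on UNIV (g :: real \<Rightarrow> real)"
  shows "lbd U (\<lambda>n q. g (f n q))"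
  unfolding lbd_def
proof
  fix p assume "p \<in> U"
  obtain e C where *: "e > 0" "C > 0" "cyl p e \<subseteq> U" "\<And>n q. q \<in> cyl p e \<Longrightarrow> \<bar>f n q\<bar> \<le> C"
    using lbdE[OF assms(1) \<open>p \<in> U\<close>] by blast
  have "bounded (g ` {-C..C})"
    by (intro compact_imp_bounded compact_continuous_image continuous_on_subset[OF assms(2)]) auto
  then obtain B0 where B0: "\<forall>y\<in>g ` {-C..C}. norm y \<le> B0"
    unfolding bounded_iff by blast
  define B where "B = \<bar>B0\<bar> + 1"
  have B: "B > 0" "\<And>x. x \<in> {-C..C} \<Longrightarrow> \<bar>g x\<bar> \<le> B"
    using B0 by (auto simp: B_def) (metis abs_ge_self atLeastAtMost_iff imageI le_add_same_cancel1 order_trans zero_le_one)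
  have "\<bar>g (f n q)\<bar> \<le> B" if "q \<in> cyl p e" for n q
    using *(4)[OF that, of n] by (intro B) auto
  then show "\<exists>e>0. \<exists>C>0. cyl p e \<subseteq> U \<and> (\<forall>n. \<forall>q\<in>cyl p e. \<bar>g (f n q)\<bar> \<le> C)"
    using * B by blast
qed

lemma lbd_sum:
  assumes "open U" "finite I" "\<And>i. i \<in> I \<Longrightarrow> lbd U (f i)"
  shows "lbd U (\<lambda>n q. \<Sum>i\<in>I. f i n q)"
  using assms(2,3)
  by (induction I rule: finite_induct) (auto intro: assms(1) lbd_add lbd_fixed)

lemma lbd_Suc: "lbd U f \<Longrightarrow> lbd U (\<lambda>n. f (Suc n))"
  unfolding lbd_def by meson

lemma lbd_cong: "lbd U f \<Longrightarrow> (\<And>n q. q \<in> U \<Longrightarrow> g n q = f n q) \<Longrightarrow> lbd U g"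
proof -
  assume f: "lbd U f" and eq: "\<And>n q. q \<in> U \<Longrightarrow> g n q = f n q"
  show "lbd U g" unfolding lbd_def
  proof
    fix p assume "p \<in> U"
    then obtain e C where e: "e > 0" "C > 0" "cyl p e \<subseteq> U" "\<forall>n. \<forall>q\<in>cyl p e. \<bar>f n q\<bar> \<le> C"
      using f unfolding lbd_def by meson
    have "g n q = f n q" if "q \<in> cyl p e" for n q using eq that e by blast
    then show "\<exists>e>0. \<exists>C>0. cyl p e \<subseteq> U \<and> (\<forall>n. \<forall>q\<in>cyl p e. \<bar>g n q\<bar> \<le> C)"
      using e by (intro exI[of _ e] conjI exI[of _ C]) simp_all
  qed
qed

lemma luc_fixed: "open U \<Longrightarrow> luc U (\<lambda>n. f)"
  unfolding luc_def using open_contains_cyl by force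

lemma luc_add: "luc U f \<Longrightarrow> luc U g \<Longrightarrow> luc U (\<lambda>n q. f n q + g n q)"
  unfolding luc_def[of U "\<lambda>n q. f n q + g n q"]
proof
  fix p assume fgp: "luc U f" "luc U g" "p \<in> U"
  obtain e where *: "e > 0" "cyl p e \<subseteq> U"
    "\<And>\<epsilon>. \<epsilon> > 0 \<Longrightarrow> \<exists>N. \<forall>m\<ge>N. \<forall>n\<ge>N. \<forall>q\<in>cyl p e. \<bar>f m q - f n q\<bar> < \<epsilon> \<and> \<bar>g m q - g n q\<bar> < \<epsilon>"
    using lucE2[OF fgp] by blast
  have "\<exists>N. \<forall>m\<ge>N. \<forall>n\<ge>N. \<forall>q\<in>cyl p e. \<bar>f m q + g m q - (f n q + g n q)\<bar> < \<epsilon>" if \<epsilon>: "\<epsilon> > 0" for \<epsilon>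
  proof -
    obtain N where N: "\<forall>m\<ge>N. \<forall>n\<ge>N. \<forall>q\<in>cyl p e. \<bar>f m q - f n q\<bar> < \<epsilon> / 2 \<and> \<bar>g m q - g n q\<bar> < \<epsilon> / 2"
      using *(3)[of "\<epsilon> / 2"] \<epsilon> by auto
    have "\<bar>f m q + g m q - (f n q + g n q)\<bar> < \<epsilon>" if "m \<ge> N" "n \<ge> N" "q \<in> cyl p e" for m n q
    proof -
      have "\<bar>f m q - f n q\<bar> < \<epsilon> / 2" "\<bar>g m q - g n q\<bar> < \<epsilon> / 2" using N that by auto
      then show ?thesis by linarith
    qed
    then show ?thesis by blast
  qed
  then show "\<exists>e>0. cyl p e \<subseteq> U \<and> (\<forall>\<epsilon>>0. \<exists>N. \<forall>m\<ge>N. \<forall>n\<ge>N. \<forall>q\<in>cyl p e. \<bar>f m q + g m q - (f n q + g n q)\<bar> < \<epsilon>)"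
    using * by blast
qed

text \<open>Local boundedness confines the values to a compact interval, on which \<open>g\<close>
  is uniformly continuous.\<close>

lemma luc_compose:
  assumes "luc U f" "lbd U f" "continuous_on UNIV (g :: real \<Rightarrow> real)"
  shows "luc U (\<lambda>n q. g (f n q))"
  unfolding luc_def
proof
  fix p assume p: "p \<in> U"
  obtain e C where 1: "e > 0" "C > 0" "cyl p e \<subseteq> U" "\<And>n q. q \<in> cyl p e \<Longrightarrow> \<bar>f n q\<bar> \<le> C"
    using lbdE[OF assms(2) p] by blast
  obtain e' where 2: "e' > 0" "cyl p e' \<subseteq> U" "\<And>\<epsilon>. \<epsilon> > 0 \<Longrightarrow> \<exists>N. \<forall>m\<ge>N. \<forall>n\<ge>N. \<forall>q\<in>cyl p e'. \<bar>f m q - f n q\<bar> < \<epsilon>"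
    using assms(1) p unfolding luc_def by meson
  have s: "cyl p (min e e') \<subseteq> cyl p e" "cyl p (min e e') \<subseteq> cyl p e'" by (auto intro!: cyl_mono)
  have uc: "uniformly_continuous_on {-C..C} g"
    by (intro compact_uniformly_continuous continuous_on_subset[OF assms(3)]) auto
  have "\<exists>N. \<forall>m\<ge>N. \<forall>n\<ge>N. \<forall>q\<in>cyl p (min e e'). \<bar>g (f m q) - g (f n q)\<bar> < \<epsilon>" if \<epsilon>: "\<epsilon> > 0" for \<epsilon>
  proof -
    obtain d where d: "d > 0" "\<And>x y. x \<in> {-C..C} \<Longrightarrow> y \<in> {-C..C} \<Longrightarrow> dist x y < d \<Longrightarrow> dist (g x) (g y) < \<epsilon>"
      using uc \<epsilon> unfolding uniformly_continuous_on_def by metis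
    obtain N where N: "\<forall>m\<ge>N. \<forall>n\<ge>N. \<forall>q\<in>cyl p e'. \<bar>f m q - f n q\<bar> < d" using 2(3)[OF d(1)] by blast
    have "\<bar>g (f m q) - g (f n q)\<bar> < \<epsilon>" if "m \<ge> N" "n \<ge> N" "q \<in> cyl p (min e e')" for m n q
    proof -
      have q: "q \<in> cyl p e" "q \<in> cyl p e'" using that s by blast+
      have "\<bar>f m q - f n q\<bar> < d" using N that(1,2) q(2) by blast
      then show ?thesis using d(2)[of "f m q" "f n q"] 1(4)[OF q(1), of m] 1(4)[OF q(1), of n]
        by (simp add: dist_real_def abs_le_iff)
    qed
    then show ?thesis by blast
  qed
  then show "\<exists>e>0. cyl p e \<subseteq> U \<and> (\<forall>\<epsilon>>0. \<exists>N. \<forall>m\<ge>N. \<forall>n\<ge>N. \<forall>q\<in>cyl p e. \<bar>g (f m q) - g (f n q)\<bar> < \<epsilon>)"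
    using 1 2 s by (intro exI[of _ "min e e'"]) auto
qed

text \<open>Polarisation: \<open>4 f g = (f + g)^2 - (f - g)^2\<close> reduces products to
  composition with the square function.\<close>

lemma luc_mult:
  assumes "luc U f" "lbd U f" "luc U g" "lbd U g"
  shows "luc U (\<lambda>n q. f n q * g n q)"
proof -
  have cm: "luc U (\<lambda>n q. c * h n q)" if "luc U h" "lbd U h" for c h
    by (rule luc_compose[OF that]) (intro continuous_intros)
  have sq: "luc U (\<lambda>n q. (h n q)\<^sup>2)" if "luc U h" "lbd U h" for h
    by (rule luc_compose[OF that]) (intro continuous_intros)
  have sqb: "lbd U (\<lambda>n q. (h n q)\<^sup>2)" if "lbd U h" for h
    by (rule lbd_compose[OF that]) (intro continuous_intros)
  have cb: "lbd U (\<lambda>n q. c * h n q)" if "lbd U h" for c h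
    by (rule lbd_compose[OF that]) (intro continuous_intros)
  have "luc U (\<lambda>n q. 1/4 * (f n q + g n q)\<^sup>2 + (- 1/4) * (f n q + (- 1) * g n q)\<^sup>2)"
    using assms by (intro luc_add cm sq sqb lbd_add cb)
  then show ?thesis by (simp add: power2_eq_square algebra_simps)
qed

lemma luc_sum:
  assumes "open U" "finite I" "\<And>i. i \<in> I \<Longrightarrow> luc U (f i)"
  shows "luc U (\<lambda>n q. \<Sum>i\<in>I. f i n q)"
  using assms(2,3)
  by (induction I rule: finite_induct) (auto intro: assms(1) luc_add luc_fixed)

lemma luc_Suc: "luc U (\<lambda>n. f (Suc n)) \<longleftrightarrow> luc U f"
proof -
  have "(\<exists>N. \<forall>m\<ge>N. \<forall>n\<ge>N. \<forall>q\<in>A. \<bar>f (Suc m) q - f (Suc n) q\<bar> < \<epsilon>) \<longleftrightarrow>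
        (\<exists>N. \<forall>m\<ge>N. \<forall>n\<ge>N. \<forall>q\<in>A. \<bar>f m q - f n q\<bar> < \<epsilon>)" for A and \<epsilon> :: real
  proof
    assume "\<exists>N. \<forall>m\<ge>N. \<forall>n\<ge>N. \<forall>q\<in>A. \<bar>f (Suc m) q - f (Suc n) q\<bar> < \<epsilon>"
    then obtain N where N: "\<forall>m\<ge>N. \<forall>n\<ge>N. \<forall>q\<in>A. \<bar>f (Suc m) q - f (Suc n) q\<bar> < \<epsilon>" by blast
    show "\<exists>N. \<forall>m\<ge>N. \<forall>n\<ge>N. \<forall>q\<in>A. \<bar>f m q - f n q\<bar> < \<epsilon>"
    proof (intro exI[of _ "Suc N"] allI impI)
      fix m n assume "m \<ge> Suc N" "n \<ge> Suc N"
      then show "\<forall>q\<in>A. \<bar>f m q - f n q\<bar> < \<epsilon>"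
        using N[rule_format, of "m - 1" "n - 1"] by (cases m; cases n) auto
    qed
  next
    assume "\<exists>N. \<forall>m\<ge>N. \<forall>n\<ge>N. \<forall>q\<in>A. \<bar>f m q - f n q\<bar> < \<epsilon>"
    then obtain N where "\<forall>m\<ge>N. \<forall>n\<ge>N. \<forall>q\<in>A. \<bar>f m q - f n q\<bar> < \<epsilon>" by blast
    then show "\<exists>N. \<forall>m\<ge>N. \<forall>n\<ge>N. \<forall>q\<in>A. \<bar>f (Suc m) q - f (Suc n) q\<bar> < \<epsilon>"
      by (intro exI[of _ N]) auto
  qed
  then show ?thesis unfolding luc_def by simp
qed

lemma luc_cong: "luc U f \<Longrightarrow> (\<And>n q. q \<in> U \<Longrightarrow> g n q = f n q) \<Longrightarrow> luc U g"
proof -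
  assume f: "luc U f" and eq: "\<And>n q. q \<in> U \<Longrightarrow> g n q = f n q"
  show "luc U g" unfolding luc_def
  proof
    fix p assume "p \<in> U"
    then obtain e where e: "e > 0" "cyl p e \<subseteq> U"
      "\<forall>\<epsilon>>0. \<exists>N. \<forall>m\<ge>N. \<forall>n\<ge>N. \<forall>q\<in>cyl p e. \<bar>f m q - f n q\<bar> < \<epsilon>"
      using f unfolding luc_def by meson
    have "g n q = f n q" if "q \<in> cyl p e" for n q using eq that e by blast
    then show "\<exists>e>0. cyl p e \<subseteq> U \<and> (\<forall>\<epsilon>>0. \<exists>N. \<forall>m\<ge>N. \<forall>n\<ge>N. \<forall>q\<in>cyl p e. \<bar>g m q - g n q\<bar> < \<epsilon>)"
      using e by (intro exI[of _ e]) simp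
  qed
qed

lemma luc_uniform_limit:
  assumes "luc U f" "p \<in> U" "\<And>q. q \<in> U \<Longrightarrow> (\<lambda>n. f n q) \<longlonglongrightarrow> g q"
  obtains e where "e > 0" "cyl p e \<subseteq> U" "uniform_limit (cyl p e) f g sequentially"
proof -
  obtain e where e: "e > 0" "cyl p e \<subseteq> U" "\<And>\<epsilon>. \<epsilon> > 0 \<Longrightarrow> \<exists>N. \<forall>m\<ge>N. \<forall>n\<ge>N. \<forall>q\<in>cyl p e. \<bar>f m q - f n q\<bar> < \<epsilon>"
    using assms(1,2) unfolding luc_def by meson
  have "uniformly_Cauchy_on (cyl p e) f"
    using e(3) unfolding uniformly_Cauchy_on_def dist_real_def by meson
  then obtain l where l: "uniform_limit (cyl p e) f l sequentially"
    using Cauchy_uniformly_convergent uniformly_convergent_on_def by blast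
  have "l q = g q" if "q \<in> cyl p e" for q
    using tendsto_uniform_limitI[OF l that] assms(3)[of q] e(2) that LIMSEQ_unique by blast
  then have "uniform_limit (cyl p e) f g sequentially"
    using l by (simp cong: uniform_limit_cong')
  then show ?thesis using that e by blast
qed

lemma luc_continuous:
  assumes "luc U f" "\<And>q. q \<in> U \<Longrightarrow> (\<lambda>n. f n q) \<longlonglongrightarrow> g q" "\<And>n. continuous_on U (f n)"
  shows "continuous_on U g"
  unfolding continuous_on_eq_continuous_within
proof
  fix p assume p: "p \<in> U"
  obtain e where e: "e > 0" "cyl p e \<subseteq> U" "uniform_limit (cyl p e) f g sequentially"
    using luc_uniform_limit[OF assms(1) p assms(2)] by blast
  have "continuous_on (cyl p e) g"
    by (rule uniform_limit_theorem[OF _ e(3)]) (auto intro!: always_eventually continuous_on_subset[OF assms(3) e(2)])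
  then have "isCont g p" using open_cyl cyl_centre[OF e(1)] continuous_on_eq_continuous_at by blast
  then show "continuous (at p within U) g" by (rule continuous_at_imp_continuous_at_within)
qed

lemma luc_convergent: "luc U f \<Longrightarrow> p \<in> U \<Longrightarrow> convergent (\<lambda>n. f n p)"
proof -
  assume "luc U f" "p \<in> U"
  then obtain e where e: "e > 0" "\<forall>\<epsilon>>0. \<exists>N. \<forall>m\<ge>N. \<forall>n\<ge>N. \<forall>q\<in>cyl p e. \<bar>f m q - f n q\<bar> < \<epsilon>"
    unfolding luc_def by meson
  have "Cauchy (\<lambda>n. f n p)"
    unfolding Cauchy_def dist_real_def
  proof (intro allI impI)
    fix \<epsilon> :: real assume "\<epsilon> > 0"
    then obtain N where "\<forall>m\<ge>N. \<forall>n\<ge>N. \<forall>q\<in>cyl p e. \<bar>f m q - f n q\<bar> < \<epsilon>" using e(2) by blast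
    then show "\<exists>M. \<forall>m\<ge>M. \<forall>n\<ge>M. \<bar>f m p - f n p\<bar> < \<epsilon>" using cyl_centre[OF e(1), of p] by blast
  qed
  then show ?thesis by (rule real_Cauchy_convergent)
qed

text \<open>Restriction to the line through \<open>p\<close> in direction \<open>e\<close> turns
  this into termwise differentiation in one real variable, where local uniform convergence of the
  derivatives suffices.\<close>

lemma dd_limit:
  assumes "luc U f'" "open U" "\<And>n q. q \<in> U \<Longrightarrow> dd e (f n) q (f' n q)"
    "\<And>q. q \<in> U \<Longrightarrow> (\<lambda>n. f n q) \<longlonglongrightarrow> g q" "\<And>q. q \<in> U \<Longrightarrow> (\<lambda>n. f' n q) \<longlonglongrightarrow> g' q" "p \<in> U"
  shows "dd e g p (g' p)"
proof -
  obtain r where r: "r > 0" "cyl p r \<subseteq> U" "uniform_limit (cyl p r) f' g' sequentially"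
    using luc_uniform_limit[OF assms(1,6,5)] by blast
  have "((\<lambda>s::real. p + s *\<^sub>R e) \<longlongrightarrow> p + 0 *\<^sub>R e) (nhds 0)"
    by (intro tendsto_intros filterlim_ident)
  then have "\<forall>\<^sub>F s in nhds (0::real). p + s *\<^sub>R e \<in> cyl p r"
    using cyl_centre[OF r(1), of p] open_cyl[of p r] by (intro topological_tendstoD) auto
  then obtain k where k: "k > 0" "\<And>s. \<bar>s\<bar> < k \<Longrightarrow> p + s *\<^sub>R e \<in> cyl p r"
    unfolding eventually_nhds_metric by (auto simp: dist_real_def)
  let ?S = "{-k<..<k}"
  have "\<exists>h. \<forall>s\<in>?S. (\<lambda>n. f n (p + s *\<^sub>R e)) \<longlonglongrightarrow> h s \<and>
      (h has_derivative (\<lambda>x. x * g' (p + s *\<^sub>R e))) (at s within ?S)"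
  proof (rule has_derivative_sequence)
    show "convex ?S" by simp
    show "((\<lambda>s. f n (p + s *\<^sub>R e)) has_derivative (\<lambda>x. x * f' n (p + s *\<^sub>R e))) (at s within ?S)" if "s \<in> ?S" for n s
    proof -
      have "p + s *\<^sub>R e \<in> U" using k(2)[of s] that r(2) by auto
      then have "((\<lambda>s. f n (p + s *\<^sub>R e)) has_real_derivative f' n (p + s *\<^sub>R e)) (at s)"
        by (intro dd_along assms)
      then show ?thesis
        unfolding has_field_derivative_def using has_derivative_at_withinI by (simp add: mult_commute_abs)
    qed
    show "\<forall>\<^sub>F n in sequentially. \<forall>s\<in>?S. \<forall>h. norm (h * f' n (p + s *\<^sub>R e) - h * g' (p + s *\<^sub>R e)) \<le> \<epsilon> * norm h"
      if "\<epsilon> > 0" for \<epsilon>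
      using uniform_limitD[OF r(3) that]
    proof eventually_elim
      case (elim n)
      show ?case
      proof (intro ballI allI)
        fix s h assume "s \<in> ?S"
        then have "\<bar>f' n (p + s *\<^sub>R e) - g' (p + s *\<^sub>R e)\<bar> \<le> \<epsilon>"
          using elim k(2)[of s] by (force simp: dist_real_def)
        then have "\<bar>h\<bar> * \<bar>f' n (p + s *\<^sub>R e) - g' (p + s *\<^sub>R e)\<bar> \<le> \<bar>h\<bar> * \<epsilon>"
          by (intro mult_left_mono) auto
        then show "norm (h * f' n (p + s *\<^sub>R e) - h * g' (p + s *\<^sub>R e)) \<le> \<epsilon> * norm h"
          by (simp add: abs_mult[symmetric] algebra_simps)
      qed
    qed
    show "0 \<in> ?S" using k by simp
    show "(\<lambda>n. f n (p + 0 *\<^sub>R e)) \<longlonglongrightarrow> g p" using assms by simp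
  qed
  then obtain h where h: "\<And>s. s \<in> ?S \<Longrightarrow> (\<lambda>n. f n (p + s *\<^sub>R e)) \<longlonglongrightarrow> h s"
    "\<And>s. s \<in> ?S \<Longrightarrow> (h has_derivative (\<lambda>x. x * g' (p + s *\<^sub>R e))) (at s within ?S)" by blast
  have hg: "h s = g (p + s *\<^sub>R e)" if "s \<in> ?S" for s
    using LIMSEQ_unique[OF h(1)[OF that] assms(4)] k(2)[of s] that r(2) by (auto simp: abs_less_iff)
  have "(h has_real_derivative g' p) (at 0)"
    using h(2)[of 0] k unfolding has_field_derivative_def
    by (simp add: at_within_open[of 0 ?S] mult_commute_abs)
  then have "((\<lambda>s. g (p + s *\<^sub>R e)) has_real_derivative g' p) (at 0)"
    by (rule has_field_derivative_transform_within[of _ _ _ _ k]) (use k hg in \<open>auto simp: dist_real_def abs_less_iff\<close>)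
  then show ?thesis by (simp add: dd_def)
qed

section \<open>Interior estimates along sequences\<close>

lemma lbd_grad:
  assumes "open U" "\<And>n. W21 U (f n) (ft n) (fx n) (fxx n)" "lbd U f" "lbd U (\<lambda>n. hW (ft n) (fxx n))"
    and i: "i \<in> Basis"
  shows "lbd U (\<lambda>n. fx n i)"
  unfolding lbd_def
proof
  fix p assume "p \<in> U"
  obtain e C where e: "e > 0" "C > 0" "cyl p e \<subseteq> U"
    "\<And>n q. q \<in> cyl p e \<Longrightarrow> \<bar>f n q\<bar> \<le> C" "\<And>n q. q \<in> cyl p e \<Longrightarrow> \<bar>hW (ft n) (fxx n) q\<bar> \<le> C"
    using lbdE2[OF assms(3,4) \<open>p \<in> U\<close>] by blast
  obtain K e' where K: "0 < e'" "e' \<le> e" "0 < K" "grad_bd U p e i K e'"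
    using local_grad[OF e(1,3) i] by blast
  have "\<bar>fx n i q\<bar> \<le> K * C" if "q \<in> cyl p e'" for n q
    by (rule grad_bdD[OF K(4) assms(2) e(2) _ that]) (use e in auto)
  moreover have "cyl p e' \<subseteq> U" using cyl_mono[OF K(2)] e by blast
  ultimately show "\<exists>e>0. \<exists>C>0. cyl p e \<subseteq> U \<and> (\<forall>n. \<forall>q\<in>cyl p e. \<bar>fx n i q\<bar> \<le> C)"
    using K e by (intro exI[of _ e'] conjI exI[of _ "K * C"]) auto
qed

text \<open>The heat operator is linear, so the gradient estimate is applied to
  \<open>f m - f n\<close> with a small bound \<delta>.\<close>

lemma luc_grad:
  assumes "open U" "\<And>n. W21 U (f n) (ft n) (fx n) (fxx n)" "luc U f" "luc U (\<lambda>n. hW (ft n) (fxx n))"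
    and i: "i \<in> Basis"
  shows "luc U (\<lambda>n. fx n i)"
  unfolding luc_def
proof
  fix p assume "p \<in> U"
  obtain e where e: "e > 0" "cyl p e \<subseteq> U"
    "\<And>\<epsilon>. \<epsilon> > 0 \<Longrightarrow> \<exists>N. \<forall>m\<ge>N. \<forall>n\<ge>N. \<forall>q\<in>cyl p e. \<bar>f m q - f n q\<bar> < \<epsilon> \<and>
      \<bar>hW (ft m) (fxx m) q - hW (ft n) (fxx n) q\<bar> < \<epsilon>"
    using lucE2[OF assms(3,4) \<open>p \<in> U\<close>] by blast
  obtain K e' where K: "0 < e'" "e' \<le> e" "0 < K" "grad_bd U p e i K e'"
    using local_grad[OF e(1,2) i] by blast
  have "\<exists>N. \<forall>m\<ge>N. \<forall>n\<ge>N. \<forall>q\<in>cyl p e'. \<bar>fx m i q - fx n i q\<bar> < \<epsilon>" if \<epsilon>: "\<epsilon> > 0" for \<epsilon>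
  proof -
    define \<delta> where "\<delta> = \<epsilon> / (2 * K)"
    have \<delta>: "\<delta> > 0" "K * \<delta> < \<epsilon>" using \<epsilon> K by (auto simp: \<delta>_def)
    obtain N where N: "\<forall>m\<ge>N. \<forall>n\<ge>N. \<forall>q\<in>cyl p e. \<bar>f m q - f n q\<bar> < \<delta> \<and>
      \<bar>hW (ft m) (fxx m) q - hW (ft n) (fxx n) q\<bar> < \<delta>" using e(3)[OF \<delta>(1)] by blast
    have "\<bar>fx m i q - fx n i q\<bar> \<le> K * \<delta>" if mn: "m \<ge> N" "n \<ge> N" and q: "q \<in> cyl p e'" for m n q
    proof (rule grad_bdD[OF K(4) W21_diff[OF assms(2)[of m] assms(2)[of n]] \<delta>(1) _ q])
      fix q assume "q \<in> cyl p e"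
      then have "\<bar>f m q - f n q\<bar> < \<delta>" "\<bar>hW (ft m) (fxx m) q - hW (ft n) (fxx n) q\<bar> < \<delta>" using N mn by auto
      then show "\<bar>f m q - f n q\<bar> \<le> \<delta> \<and> \<bar>ft m q - ft n q - (\<Sum>i\<in>Basis. fxx m i i q - fxx n i i q)\<bar> \<le> \<delta>"
        by (simp add: sum_subtractf algebra_simps)
    qed
    then have "\<bar>fx m i q - fx n i q\<bar> < \<epsilon>" if "m \<ge> N" "n \<ge> N" and q: "q \<in> cyl p e'" for m n q
      using \<delta> that by fastforce
    then show ?thesis by blast
  qed
  moreover have "cyl p e' \<subseteq> U" using cyl_mono[OF K(2)] e by blast
  ultimately show "\<exists>e>0. cyl p e \<subseteq> U \<and> (\<forall>\<epsilon>>0. \<exists>N. \<forall>m\<ge>N. \<forall>n\<ge>N. \<forall>q\<in>cyl p e. \<bar>fx m i q - fx n i q\<bar> < \<epsilon>)"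
    using K by blast
qed

lemma lbd_hess:
  assumes "open U" "\<And>n. W21 U (f n) (ft n) (fx n) (fxx n)" "lbd U (\<lambda>n. fx n k)" "lbd U Fk"
    and i: "i \<in> Basis" "k \<in> Basis" and d: "\<And>n q. q \<in> U \<Longrightarrow> dd (k,0) (hW (ft n) (fxx n)) q (Fk n q)"
  shows "lbd U (\<lambda>n. fxx n i k)"
  unfolding lbd_def
proof
  fix p assume "p \<in> U"
  obtain e C where e: "e > 0" "C > 0" "cyl p e \<subseteq> U"
    "\<And>n q. q \<in> cyl p e \<Longrightarrow> \<bar>fx n k q\<bar> \<le> C" "\<And>n q. q \<in> cyl p e \<Longrightarrow> \<bar>Fk n q\<bar> \<le> C"
    using lbdE2[OF assms(3,4) \<open>p \<in> U\<close>] by blast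
  obtain K e' where K: "0 < e'" "e' \<le> e" "0 < K" "hess_bd U p e i k K e'"
    using local_hess[OF e(1,3) i] by blast
  have "\<bar>fxx n i k q\<bar> \<le> K * C" if "q \<in> cyl p e'" for n q
    by (rule hess_bdD[where Fk="Fk n", OF K(4) assms(2) e(2) _ that]) (use e d in auto)
  moreover have "cyl p e' \<subseteq> U" using cyl_mono[OF K(2)] e by blast
  ultimately show "\<exists>e>0. \<exists>C>0. cyl p e \<subseteq> U \<and> (\<forall>n. \<forall>q\<in>cyl p e. \<bar>fxx n i k q\<bar> \<le> C)"
    using K e by (intro exI[of _ e'] conjI exI[of _ "K * C"]) auto
qed

lemma luc_hess:
  assumes "open U" "\<And>n. W21 U (f n) (ft n) (fx n) (fxx n)" "luc U (\<lambda>n. fx n k)" "luc U Fk"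
    and i: "i \<in> Basis" "k \<in> Basis" and d: "\<And>n q. q \<in> U \<Longrightarrow> dd (k,0) (hW (ft n) (fxx n)) q (Fk n q)"
  shows "luc U (\<lambda>n. fxx n i k)"
  unfolding luc_def
proof
  fix p assume "p \<in> U"
  obtain e where e: "e > 0" "cyl p e \<subseteq> U"
    "\<And>\<epsilon>. \<epsilon> > 0 \<Longrightarrow> \<exists>N. \<forall>m\<ge>N. \<forall>n\<ge>N. \<forall>q\<in>cyl p e. \<bar>fx m k q - fx n k q\<bar> < \<epsilon> \<and> \<bar>Fk m q - Fk n q\<bar> < \<epsilon>"
    using lucE2[OF assms(3,4) \<open>p \<in> U\<close>] by blast
  obtain K e' where K: "0 < e'" "e' \<le> e" "0 < K" "hess_bd U p e i k K e'"
    using local_hess[OF e(1,2) i] by blast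
  have "\<exists>N. \<forall>m\<ge>N. \<forall>n\<ge>N. \<forall>q\<in>cyl p e'. \<bar>fxx m i k q - fxx n i k q\<bar> < \<epsilon>" if \<epsilon>: "\<epsilon> > 0" for \<epsilon>
  proof -
    define \<delta> where "\<delta> = \<epsilon> / (2 * K)"
    have \<delta>: "\<delta> > 0" "K * \<delta> < \<epsilon>" using \<epsilon> K by (auto simp: \<delta>_def)
    obtain N where N: "\<forall>m\<ge>N. \<forall>n\<ge>N. \<forall>q\<in>cyl p e. \<bar>fx m k q - fx n k q\<bar> < \<delta> \<and> \<bar>Fk m q - Fk n q\<bar> < \<delta>"
      using e(3)[OF \<delta>(1)] by blast
    have "\<bar>fxx m i k q - fxx n i k q\<bar> \<le> K * \<delta>" if mn: "m \<ge> N" "n \<ge> N" and q: "q \<in> cyl p e'" for m n q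
    proof (rule hess_bdD[where Fk="\<lambda>q. Fk m q - Fk n q", OF K(4) W21_diff[OF assms(2)[of m] assms(2)[of n]] \<delta>(1) _ q])
      fix q assume q: "q \<in> cyl p e"
      then have 1: "\<bar>fx m k q - fx n k q\<bar> < \<delta>" "\<bar>Fk m q - Fk n q\<bar> < \<delta>" using N mn by auto
      have "dd (k,0) (\<lambda>q. hW (ft m) (fxx m) q - hW (ft n) (fxx n) q) q (Fk m q - Fk n q)"
        by (intro dd_diff d) (use q e in blast)+
      moreover have "(\<lambda>q. hW (ft m) (fxx m) q - hW (ft n) (fxx n) q) =
          (\<lambda>p. ft m p - ft n p - (\<Sum>i\<in>Basis. fxx m i i p - fxx n i i p))"
        by (simp add: sum_subtractf algebra_simps fun_eq_iff)
      ultimately show "\<bar>fx m k q - fx n k q\<bar> \<le> \<delta> \<and>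
          dd (k,0) (\<lambda>p. ft m p - ft n p - (\<Sum>i\<in>Basis. fxx m i i p - fxx n i i p)) q (Fk m q - Fk n q) \<and>
          \<bar>Fk m q - Fk n q\<bar> \<le> \<delta>"
        using 1 by simp
    qed
    then have "\<bar>fxx m i k q - fxx n i k q\<bar> < \<epsilon>" if "m \<ge> N" "n \<ge> N" and q: "q \<in> cyl p e'" for m n q
      using \<delta> that by fastforce
    then show ?thesis by blast
  qed
  moreover have "cyl p e' \<subseteq> U" using cyl_mono[OF K(2)] e by blast
  ultimately show "\<exists>e>0. cyl p e \<subseteq> U \<and> (\<forall>\<epsilon>>0. \<exists>N. \<forall>m\<ge>N. \<forall>n\<ge>N. \<forall>q\<in>cyl p e. \<bar>fxx m i k q - fxx n i k q\<bar> < \<epsilon>)"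
    using K by blast
qed

text \<open>The increment is split into its coordinates, and \<open>f\<close> changes by at most
  \<open>C\<close> times the length on each segment. Every partial sum of coordinates has norm at
  most the dimension times \<open>norm c < 2 * r\<close>, which is why the path stays in the ball of
  radius \<open>e\<close>.\<close>

lemma lipschitz_of_partials:
  fixes f :: "'e::euclidean_space \<Rightarrow> real"
  assumes d: "\<And>q b. q \<in> ball p e \<Longrightarrow> b \<in> Basis \<Longrightarrow> dd b f q (f' b q) \<and> \<bar>f' b q\<bar> \<le> C"
    and r: "r * (1 + 2 * real DIM('e)) \<le> e" and q: "q \<in> ball p r" "q' \<in> ball p r"
  shows "\<bar>f q' - f q\<bar> \<le> C * real DIM('e) * norm (q' - q)"
proof -
  define c where "c = q' - q"
  have "0 \<le> dist p q" "dist p q < r" using q by auto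
  then have r0: "r > 0" by linarith
  have C: "C \<ge> 0"
  proof -
    have "r \<le> r * (1 + 2 * real DIM('e))" using r0 by simp
    then have "q \<in> ball p e" using q r by auto
    then show ?thesis using d[of q "SOME b. b \<in> Basis"] by (metis SOME_Basis abs_ge_zero order_trans)
  qed
  have c: "norm c < 2 * r"
    using q dist_triangle[of q q' p] unfolding c_def by (simp add: dist_norm norm_minus_commute dist_commute)
  have inb: "q + v \<in> ball p e" if "norm v \<le> real DIM('e) * norm c" for v
  proof -
    have "dist p (q + v) \<le> dist p q + norm v" using dist_triangle[of p "q + v" q] by (simp add: dist_norm)
    also have "\<dots> < r + real DIM('e) * (2 * r)"
    proof -
      have "real DIM('e) * norm c \<le> real DIM('e) * (2 * r)" using c by (intro mult_left_mono) auto
      moreover have "dist p q < r" using q by simp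
      ultimately show ?thesis using that by linarith
    qed
    also have "\<dots> \<le> e" using r by (simp add: algebra_simps)
    finally show ?thesis by simp
  qed
  have step: "\<bar>f (z + s *\<^sub>R b) - f z\<bar> \<le> C * \<bar>s\<bar>" if b: "b \<in> Basis"
    and z: "\<And>\<tau>. \<bar>\<tau>\<bar> \<le> \<bar>s\<bar> \<Longrightarrow> z + \<tau> *\<^sub>R b \<in> ball p e" for z s b
  proof -
    consider "s = 0" | "s > 0" | "s < 0" by linarith
    then show ?thesis
    proof cases
      case 2
      have "\<bar>(f (z + s *\<^sub>R b) - f z) / s\<bar> \<le> C"
        using d z b 2 by (intro diff_quot_bound[of s b f z "\<lambda>\<tau>. f' b (z + \<tau> *\<^sub>R b)"]) auto
      then show ?thesis using 2 by (simp add: abs_divide field_simps)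
    next
      case 3
      have zz: "z + s *\<^sub>R b + \<tau> *\<^sub>R b = z + (s + \<tau>) *\<^sub>R b" for \<tau> by (simp add: algebra_simps)
      have "\<bar>(f (z + s *\<^sub>R b + (- s) *\<^sub>R b) - f (z + s *\<^sub>R b)) / (- s)\<bar> \<le> C"
        using d z b 3 by (intro diff_quot_bound[of "- s" b f "z + s *\<^sub>R b" "\<lambda>\<tau>. f' b (z + s *\<^sub>R b + \<tau> *\<^sub>R b)"]) (auto simp: zz)
      then have "\<bar>f z - f (z + s *\<^sub>R b)\<bar> \<le> C * \<bar>s\<bar>" using 3 by (simp add: abs_divide field_simps)
      then show ?thesis by (simp add: abs_minus_commute)
    qed simp
  qed
  have part: "norm (\<Sum>b\<in>S. (c \<bullet> b) *\<^sub>R b) \<le> real (card S) * norm c" if "S \<subseteq> Basis" for S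
  proof -
    have "norm (\<Sum>b\<in>S. (c \<bullet> b) *\<^sub>R b) \<le> (\<Sum>b\<in>S. norm c)"
      by (rule sum_norm_le) (use that Basis_le_norm in fastforce)
    then show ?thesis by simp
  qed
  have "\<bar>f (q + (\<Sum>b\<in>S. (c \<bullet> b) *\<^sub>R b)) - f q\<bar> \<le> C * real (card S) * norm c" if "S \<subseteq> Basis" for S
    using finite_subset[OF that finite_Basis] that
  proof (induction S rule: finite_induct)
    case (insert b S)
    let ?z = "q + (\<Sum>b\<in>S. (c \<bullet> b) *\<^sub>R b)"
    have cb: "\<bar>c \<bullet> b\<bar> \<le> norm c" using insert by (auto intro: Basis_le_norm)
    have card: "real (card S) + 1 \<le> real DIM('e)"
      using card_mono[OF finite_Basis, of "insert b S"] insert by simp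
    have "\<bar>f (?z + (c \<bullet> b) *\<^sub>R b) - f ?z\<bar> \<le> C * \<bar>c \<bullet> b\<bar>"
    proof (rule step)
      fix \<tau> assume \<tau>: "\<bar>\<tau>\<bar> \<le> \<bar>c \<bullet> b\<bar>"
      have "norm ((\<Sum>b\<in>S. (c \<bullet> b) *\<^sub>R b) + \<tau> *\<^sub>R b) \<le> real (card S) * norm c + norm c"
        using insert cb \<tau> part[of S] by (intro norm_triangle_le add_mono) auto
      also have "\<dots> = (real (card S) + 1) * norm c" by (simp add: algebra_simps)
      also have "\<dots> \<le> real DIM('e) * norm c" using card by (intro mult_right_mono) auto
      finally show "?z + \<tau> *\<^sub>R b \<in> ball p e" using inb by (simp add: add.assoc)
    qed (use insert in auto)
    also have "\<dots> \<le> C * norm c" using cb C by (intro mult_left_mono) auto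
    finally have "\<bar>f (?z + (c \<bullet> b) *\<^sub>R b) - f ?z\<bar> \<le> C * norm c" .
    moreover have "\<bar>f ?z - f q\<bar> \<le> C * real (card S) * norm c" using insert by auto
    moreover have "q + (\<Sum>b\<in>insert b S. (c \<bullet> b) *\<^sub>R b) = ?z + (c \<bullet> b) *\<^sub>R b"
      using insert by (simp add: algebra_simps)
    ultimately show ?case using insert by (simp add: algebra_simps)
  qed simp
  from this[of Basis] show ?thesis by (simp add: euclidean_representation c_def)
qed

text \<open>Equicontinuity plus pointwise convergence, as in the theorem of Arzela and Ascoli:
  bounded partial derivatives make the sequence uniformly Lipschitz near \<open>p\<close>, so
  convergence at the finitely many points of a \<delta>-net controls all points.\<close>

lemma luc_of_partials:
  fixes f :: "nat \<Rightarrow> 'a::euclidean_space \<times> real \<Rightarrow> real"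
  assumes "open U" "\<And>n q b. q \<in> U \<Longrightarrow> b \<in> Basis \<Longrightarrow> dd b (f n) q (f' b n q)"
    and bd: "\<And>b. b \<in> Basis \<Longrightarrow> lbd U (f' b)" and lim: "\<And>q. q \<in> U \<Longrightarrow> (\<lambda>n. f n q) \<longlonglongrightarrow> g q"
  shows "luc U f"
  unfolding luc_def
proof
  fix p assume p: "p \<in> U"
  define D where "D = real DIM('a \<times> real)"
  have "lbd U (\<lambda>n q. \<Sum>b\<in>Basis. \<bar>f' b n q\<bar>)"
    using assms(1) bd by (intro lbd_sum lbd_compose[where g=abs] continuous_intros) auto
  then obtain e C where e: "e > 0" "C > 0" "cyl p e \<subseteq> U" "\<And>n q. q \<in> cyl p e \<Longrightarrow> (\<Sum>b\<in>Basis. \<bar>f' b n q\<bar>) \<le> C"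
    using p unfolding lbd_def by (meson abs_le_D1)
  have bC: "\<bar>f' b n q\<bar> \<le> C" if "q \<in> cyl p e" "b \<in> Basis" for b n q
    using e(4)[OF that(1), of n] member_le_sum[of b Basis "\<lambda>b. \<bar>f' b n q\<bar>"] that by auto
  have sub: "ball p e \<subseteq> cyl p e"
    by (auto simp: cyl_def) (metis dist_fst_le dist_snd_le fst_conv snd_conv order.strict_trans1)+
  define r where "r = e / (1 + 2 * D)"
  have D: "D \<ge> 0" by (simp add: D_def)
  have r: "r > 0" "r * (1 + 2 * D) \<le> e" using e D by (auto simp: r_def)
  have lip: "\<bar>f n q' - f n q\<bar> \<le> C * D * norm (q' - q)" if "q \<in> ball p r" "q' \<in> ball p r" for n q q'
    unfolding D_def
  proof (rule lipschitz_of_partials[of p e "f n" "\<lambda>b. f' b n" C r])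
    show "dd b (f n) q (f' b n q) \<and> \<bar>f' b n q\<bar> \<le> C" if "q \<in> ball p e" "b \<in> Basis" for q b
      using assms(2) bC sub e(3) that by blast
    show "r * (1 + 2 * real DIM('a \<times> real)) \<le> e" using r(2) unfolding D_def .
  qed (rule that)+
  \<comment> \<open>A point of \<open>K\<close> has distance at most \<open>r / 4 + r / 4\<close>
    from \<open>p\<close> in the product metric, so it lies in the ball where the Lipschitz bound
    holds.\<close>
  define K where "K = cball (fst p) (r / 4) \<times> cball (snd p) (r / 4)"
  have Kb: "K \<subseteq> ball p r"
  proof
    fix q assume "q \<in> K"
    then have "dist (fst p) (fst q) \<le> r / 4" "dist (snd p) (snd q) \<le> r / 4" by (auto simp: K_def)
    moreover have "dist p q \<le> dist (fst p) (fst q) + dist (snd p) (snd q)"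
      unfolding dist_prod_def by (rule sqrt_sum_squares_le_sum) auto
    ultimately show "q \<in> ball p r" using r by auto
  qed
  have cK: "cyl p (r / 4) \<subseteq> K" by (auto simp: cyl_def K_def)
  have cU: "cyl p (r / 4) \<subseteq> U"
  proof -
    have "r * 1 \<le> r * (1 + 2 * D)" using r D by (intro mult_left_mono) auto
    then have "r / 4 \<le> e" using r by linarith
    then show ?thesis using cyl_mono[of "r / 4" e p] e by auto
  qed
  have KU: "ball p r \<subseteq> U"
  proof -
    have "r * 1 \<le> r * (1 + 2 * D)" using r D by (intro mult_left_mono) auto
    then have "r \<le> e" using r by linarith
    then show ?thesis using sub e(3) subset_ball[of r e p] by blast
  qed
  have "\<exists>N. \<forall>m\<ge>N. \<forall>n\<ge>N. \<forall>q\<in>cyl p (r / 4). \<bar>f m q - f n q\<bar> < \<epsilon>" if \<epsilon>: "\<epsilon> > 0" for \<epsilon>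
  proof -
    define \<delta> where "\<delta> = \<epsilon> / (4 * (C * D + 1))"
    have CD: "C * D \<ge> 0" using e D by simp
    have \<delta>: "\<delta> > 0" "C * D * \<delta> < \<epsilon> / 4" using \<epsilon> CD by (auto simp: \<delta>_def field_simps add_pos_nonneg)
    have "compact K" unfolding K_def by (intro compact_Times) auto
    then obtain k where k: "finite k" "k \<subseteq> K" "K \<subseteq> (\<Union>x\<in>k. ball x \<delta>)"
      using seq_compact_imp_totally_bounded[of K] \<delta> by (auto simp: compact_imp_seq_compact)
    have "\<forall>\<^sub>F n in sequentially. \<forall>c\<in>k. dist (f n c) (g c) < \<epsilon> / 4"
      using k Kb KU \<epsilon> by (intro eventually_ball_finite ballI tendstoD[OF lim]) auto
    then obtain N where N: "\<And>n c. n \<ge> N \<Longrightarrow> c \<in> k \<Longrightarrow> dist (f n c) (g c) < \<epsilon> / 4"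
      unfolding eventually_sequentially by blast
    have "\<bar>f m q - f n q\<bar> < \<epsilon>" if mn: "m \<ge> N" "n \<ge> N" and q: "q \<in> cyl p (r / 4)" for m n q
    proof -
      obtain c where c: "c \<in> k" "dist c q < \<delta>" using k cK q by auto
      have cq: "c \<in> ball p r" "q \<in> ball p r" using c k Kb cK q by auto
      have "C * D * norm (q - c) \<le> C * D * \<delta>"
        using c CD by (intro mult_left_mono) (auto simp: dist_norm norm_minus_commute)
      then have "\<bar>f l q - f l c\<bar> < \<epsilon> / 4" for l using lip[OF cq, of l] \<delta> by linarith
      from this[of m] this[of n] N[OF mn(1) c(1)] N[OF mn(2) c(1)]
      have "f m q - f n q < \<epsilon>" "f n q - f m q < \<epsilon>" unfolding dist_real_def abs_less_iff by linarith+
      then show ?thesis by (simp add: abs_less_iff)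
    qed
    then show ?thesis by blast
  qed
  then show "\<exists>e>0. cyl p e \<subseteq> U \<and> (\<forall>\<epsilon>>0. \<exists>N. \<forall>m\<ge>N. \<forall>n\<ge>N. \<forall>q\<in>cyl p e. \<bar>f m q - f n q\<bar> < \<epsilon>)"
    using cU r by (intro exI[of _ "r / 4"]) auto
qed

subsection \<open>Limits of solutions\<close>

lemma W21_hop:
  assumes "open D" "W21 D u ut ux uxx" "p \<in> D" shows "hop u p (hW ut uxx p)"
  unfolding hop_def
  apply (rule exI[of _ "ut p"], rule exI[of _ "\<lambda>i. uxx i i p"])
  using assms unfolding W21_def dd2_def by blast

lemma C21_limit:
  assumes U: "open U" and W: "\<And>n. W21 U (f n) (ft n) (fx n) (fxx n)"
    and l: "luc U f" "luc U ft" "\<And>i. i \<in> Basis \<Longrightarrow> luc U (\<lambda>n. fx n i)"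
      "\<And>i j. i \<in> Basis \<Longrightarrow> j \<in> Basis \<Longrightarrow> luc U (\<lambda>n. fxx n i j)"
    and lim: "\<And>q. q \<in> U \<Longrightarrow> (\<lambda>n. f n q) \<longlonglongrightarrow> g q"
      "\<And>q. q \<in> U \<Longrightarrow> (\<lambda>n. hW (ft n) (fxx n) q) \<longlonglongrightarrow> G q"
  shows "C21_on U g \<and> (\<forall>p\<in>U. hop g p (G p))"
proof -
  define gt where "gt q = lim (\<lambda>n. ft n q)" for q
  define gx where "gx i q = lim (\<lambda>n. fx n i q)" for i q
  define gxx where "gxx i j q = lim (\<lambda>n. fxx n i j q)" for i j q
  have L: "(\<lambda>n. ft n q) \<longlonglongrightarrow> gt q" "i \<in> Basis \<Longrightarrow> (\<lambda>n. fx n i q) \<longlonglongrightarrow> gx i q"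
    "i \<in> Basis \<Longrightarrow> j \<in> Basis \<Longrightarrow> (\<lambda>n. fxx n i j q) \<longlonglongrightarrow> gxx i j q" if "q \<in> U" for q i j
    using luc_convergent[OF l(2) that] luc_convergent[OF l(3) that] luc_convergent[OF l(4) that]
    by (auto simp: gt_def gx_def gxx_def convergent_LIMSEQ_iff)
  have w: "W21 U g gt gx gxx"
    unfolding W21_def
  proof (intro conjI ballI)
    show "continuous_on U g" using luc_continuous[OF l(1) lim(1)] W unfolding W21_def by blast
    show "continuous_on U gt" using luc_continuous[OF l(2) L(1)] W unfolding W21_def by blast
    show "continuous_on U (gx i)" if "i \<in> Basis" for i
      using luc_continuous[OF l(3)[OF that] L(2)] W that unfolding W21_def by blast
    show "continuous_on U (gxx i j)" if "i \<in> Basis" "j \<in> Basis" for i j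
      using luc_continuous[OF l(4)[OF that] L(3)] W that unfolding W21_def by blast
    fix p assume p: "p \<in> U"
    show "dd (0,1) g p (gt p)"
      by (rule dd_limit[OF l(2) U _ lim(1) L(1) p]) (use W in \<open>auto simp: W21_def\<close>)
    fix i :: 'a assume i: "i \<in> Basis"
    show "dd (i,0) g p (gx i p)"
      by (rule dd_limit[OF l(3)[OF i] U _ lim(1) L(2) p]) (use W i in \<open>auto simp: W21_def\<close>)
    fix j :: 'a assume j: "j \<in> Basis"
    show "dd (j,0) (gx i) p (gxx i j p)"
      by (rule dd_limit[OF l(4)[OF i j] U _ L(2) L(3) p]) (use W i j in \<open>auto simp: W21_def\<close>)
  qed
  have "hop g p (G p)" if p: "p \<in> U" for p
  proof -
    have "(\<lambda>n. hW (ft n) (fxx n) p) \<longlonglongrightarrow> hW gt gxx p"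
      by (intro tendsto_intros L p)
    then have "hW gt gxx p = G p" using lim(2)[OF p] LIMSEQ_unique by blast
    then show ?thesis using W21_hop[OF U w p] by simp
  qed
  then show ?thesis using W21_C21[OF U w] by blast
qed

text \<open>A bootstrap from local bounds and pointwise convergence. Bounds on \<open>u\<close>
  bound the right-hand side, then the gradients, then the space derivatives of the right-hand side,
  then the second derivatives and, through the equation, the time derivative. The sequence is now
  equi-Lipschitz, hence locally uniformly Cauchy, and the same chain is run again for differences.
  The alternative for \<open>v\<close> covers Picard iterates, where the absorption is taken from
  the previous iterate, as well as sequences of genuine solutions.\<close>

lemma closure_nonlinear:
  fixes u :: "nat \<Rightarrow> 'a::euclidean_space \<times> real \<Rightarrow> real"
  assumes U: "open U" and C: "\<And>n. C21_on U (u n)"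
    and \<kappa>: "continuous_on U \<kappa>" "\<And>k. k \<in> Basis \<Longrightarrow> continuous_on U (\<kappa>x k)"
      "\<And>k q. k \<in> Basis \<Longrightarrow> q \<in> U \<Longrightarrow> dd (k,0) \<kappa> q (\<kappa>x k q)"
    and g: "\<And>s. (g has_real_derivative g' s) (at s)" "continuous_on UNIV g'"
    and v: "v = u \<or> v = (\<lambda>n. u (Suc n))"
    and eq: "\<And>n p. p \<in> U \<Longrightarrow> hop (u (Suc n)) p (- (\<kappa> p * g (v n p)))"
    and bd: "lbd U u" and lim: "\<And>p. p \<in> U \<Longrightarrow> (\<lambda>n. u n p) \<longlonglongrightarrow> w p"
  shows "C21_on U w \<and> (\<forall>p\<in>U. hop w p (- (\<kappa> p * g (w p))))"
proof -
  define b where "b n = u (Suc n)" for n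
  define bt where "bt n = pdt (b n)" for n
  define bx where "bx n i = pdx i (b n)" for n i
  define bxx where "bxx n i j = pdx j (pdx i (b n))" for n i j
  have W: "W21 U (b n) (bt n) (bx n) (bxx n)" for n
    using C21_W21[OF C[of "Suc n"]] by (simp add: b_def bt_def bx_def[abs_def] bxx_def[abs_def])
  have hWb: "hW (bt n) (bxx n) q = - (\<kappa> q * g (v n q))" if "q \<in> U" for n q
    using hop_iff_C21[OF U C that, of "Suc n"] eq[OF that, of n] by (simp add: b_def bt_def bxx_def lap_def)
  have gc: "continuous_on UNIV g" using g(1) by (intro DERIV_continuous_on) auto
  have \<kappa>b: "lbd U (\<lambda>n. \<kappa>)" "k \<in> Basis \<Longrightarrow> lbd U (\<lambda>n. \<kappa>x k)" for k using \<kappa> U by (auto intro: lbd_fixed)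
  have neg_b: "lbd U (\<lambda>n q. - h n q)" if "lbd U h" for h
    by (rule lbd_compose[OF that]) (intro continuous_intros)
  have neg_c: "luc U (\<lambda>n q. - h n q)" if "luc U h" "lbd U h" for h
    by (rule luc_compose[OF that]) (intro continuous_intros)
  have bb: "lbd U b" using lbd_Suc[OF bd] by (simp add: b_def[abs_def])
  have vb: "lbd U v" using v bd lbd_Suc[OF bd] by auto
  have Fb: "lbd U (\<lambda>n. hW (bt n) (bxx n))"
    by (rule lbd_cong[of _ "\<lambda>n q. - (\<kappa> q * g (v n q))"]) (use hWb \<kappa>b vb gc in \<open>auto intro!: neg_b lbd_mult lbd_compose[where g=g]\<close>)
  have bxb: "lbd U (\<lambda>n. bx n i)" if "i \<in> Basis" for i
    by (rule lbd_grad[OF U W bb Fb that])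
  \<comment> \<open>The function inside \<open>g\<close> must itself have a gradient bound, which
    needs an equation, and \<open>u 0\<close> has none. The chain is therefore run one index later,
    where the right-hand side contains \<open>y n = v (Suc n)\<close>.\<close>
  define y where "y = (if v = u then b else (\<lambda>n. b (Suc n)))"
  define yx where "yx n k = (if v = u then bx n k else bx (Suc n) k)" for n k
  have yv: "v (Suc n) = y n" for n using v by (auto simp: y_def b_def)
  have yb: "lbd U y" using bb lbd_Suc[OF bb] by (auto simp: y_def)
  have yxb: "lbd U (\<lambda>n. yx n k)" if "k \<in> Basis" for k
    using bxb[OF that] lbd_Suc[OF bxb[OF that]] by (cases "v = u") (simp_all add: yx_def)
  define F where "F n q = - (\<kappa> q * g (y n q))" for n q
  define Fx where "Fx k n q = - (\<kappa>x k q * g (y n q) + (g' (y n q) * yx n k q) * \<kappa> q)" for k n q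
  have hWa: "hW (bt (Suc n)) (bxx (Suc n)) q = F n q" if "q \<in> U" for n q
    using hWb[OF that, of "Suc n"] by (simp add: F_def yv)
  have dF: "dd (k,0) (hW (bt (Suc n)) (bxx (Suc n))) q (Fx k n q)" if "q \<in> U" "k \<in> Basis" for k n q
  proof (rule dd_cong_open[OF _ U that(1) hWa])
    have "dd (k,0) (y n) q (yx n k q)" using W that by (auto simp: y_def yx_def W21_def)
    then have "dd (k,0) (\<lambda>q. g (y n q)) q (g' (y n q) * yx n k q)" by (intro dd_compose g(1))
    from dd_minus[OF dd_mult[OF \<kappa>(3)[OF that(2,1)] this]] show "dd (k,0) (F n) q (Fx k n q)"
      by (simp add: F_def[abs_def] Fx_def)
  qed
  have gyb: "lbd U (\<lambda>n q. g (y n q))" "lbd U (\<lambda>n q. g' (y n q))"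
    using yb gc g(2) by (auto intro: lbd_compose[where g=g] lbd_compose[where g=g'])
  have Fxb: "lbd U (Fx k)" if "k \<in> Basis" for k
    unfolding Fx_def[abs_def] by (intro neg_b lbd_add lbd_mult gyb \<kappa>b yxb that)
  have Wa: "W21 U (b (Suc n)) (bt (Suc n)) (bx (Suc n)) (bxx (Suc n))" for n by (rule W)
  have axb: "lbd U (\<lambda>n. bx (Suc n) k)" if "k \<in> Basis" for k
    using lbd_Suc[OF bxb[OF that]] .
  have axxb: "lbd U (\<lambda>n. bxx (Suc n) i k)" if "i \<in> Basis" "k \<in> Basis" for i k
    by (rule lbd_hess[OF U Wa axb Fxb that(1) _ dF]) (use that in auto)
  have at_eq: "bt (Suc n) q = F n q + (\<Sum>i\<in>Basis. bxx (Suc n) i i q)" if "q \<in> U" for n q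
    using hWa[OF that, of n] by simp
  have Fab: "lbd U F" unfolding F_def[abs_def] by (intro neg_b lbd_mult gyb \<kappa>b)
  have atb: "lbd U (\<lambda>n. bt (Suc n))"
    by (rule lbd_cong[OF lbd_add[OF Fab lbd_sum[OF U finite_Basis axxb]]]) (use at_eq in auto)
  have lima: "(\<lambda>n. b (Suc n) q) \<longlonglongrightarrow> w q" if "q \<in> U" for q
    unfolding b_def using LIMSEQ_Suc[OF LIMSEQ_Suc[OF lim[OF that]]] .
  have ac: "luc U (\<lambda>n. b (Suc n))"
  proof (rule luc_of_partials[OF U _ _ lima, where f'="\<lambda>d n. if snd d = 0 then bx (Suc n) (fst d) else bt (Suc n)"])
    fix n q and d :: "'a \<times> real" assume "q \<in> U" "d \<in> Basis"
    then show "dd d (b (Suc n)) q ((if snd d = 0 then bx (Suc n) (fst d) else bt (Suc n)) q)"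
      using W[of "Suc n"] by (auto simp: W21_def Basis_prod_def)
  next
    fix d :: "'a \<times> real" assume "d \<in> Basis"
    then show "lbd U (\<lambda>n. if snd d = 0 then bx (Suc n) (fst d) else bt (Suc n))"
      using axb atb by (auto simp: Basis_prod_def)
  qed
  have bc: "luc U b" using ac luc_Suc[of U b] by simp
  have yc: "luc U y" using ac bc by (auto simp: y_def)
  have gyc: "luc U (\<lambda>n q. g (y n q))" "luc U (\<lambda>n q. g' (y n q))"
    using yb yc gc g(2) by (auto intro: luc_compose[where g=g] luc_compose[where g=g'])
  have \<kappa>c: "luc U (\<lambda>n. \<kappa>)" "luc U (\<lambda>n. \<kappa>x k)" for k using U by (auto intro: luc_fixed)
  have Fc: "luc U F" unfolding F_def[abs_def] by (intro neg_c luc_mult lbd_mult gyb gyc \<kappa>b \<kappa>c)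
  have Fac: "luc U (\<lambda>n. hW (bt (Suc n)) (bxx (Suc n)))"
    by (rule luc_cong[OF Fc]) (use hWa in auto)
  have axc: "luc U (\<lambda>n. bx (Suc n) k)" if "k \<in> Basis" for k
    by (rule luc_grad[OF U Wa ac Fac that])
  have bxc: "luc U (\<lambda>n. bx n k)" if "k \<in> Basis" for k
    using axc[OF that] luc_Suc[of U "\<lambda>n. bx n k"] by simp
  have yxc: "luc U (\<lambda>n. yx n k)" if "k \<in> Basis" for k
    using bxc[OF that] axc[OF that] by (cases "v = u") (simp_all add: yx_def)
  have Fxc: "luc U (Fx k)" if "k \<in> Basis" for k
    unfolding Fx_def[abs_def]
    by (intro neg_c luc_add luc_mult lbd_add lbd_mult gyb gyc \<kappa>b \<kappa>c yxb yxc that)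
  have axxc: "luc U (\<lambda>n. bxx (Suc n) i k)" if "i \<in> Basis" "k \<in> Basis" for i k
    by (rule luc_hess[OF U Wa axc Fxc that(1) _ dF]) (use that in auto)
  have atc: "luc U (\<lambda>n. bt (Suc n))"
    by (rule luc_cong[OF luc_add[OF Fc luc_sum[OF U finite_Basis axxc]]]) (use at_eq in auto)
  have "C21_on U w \<and> (\<forall>p\<in>U. hop w p (- (\<kappa> p * g (w p))))"
  proof (rule C21_limit[OF U Wa ac atc axc axxc lima])
    fix q assume q: "q \<in> U"
    have yl: "(\<lambda>n. y n q) \<longlonglongrightarrow> w q"
      using lima[OF q] lim[OF q] LIMSEQ_Suc[OF lim[OF q]] by (auto simp: y_def b_def)
    have "isCont g (w q)" using g(1) DERIV_isCont by blast
    then have "(\<lambda>n. g (y n q)) \<longlonglongrightarrow> g (w q)" by (rule isCont_tendsto_compose[OF _ yl])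
    then have "(\<lambda>n. F n q) \<longlonglongrightarrow> - (\<kappa> q * g (w q))" unfolding F_def by (intro tendsto_intros)
    then show "(\<lambda>n. hW (bt (Suc n)) (bxx (Suc n)) q) \<longlonglongrightarrow> - (\<kappa> q * g (w q))"
      using hWa[OF q] by simp
  qed
  then show ?thesis .
qed

subsection \<open>The Gaussian measure and the heat potential\<close>

definition gdens :: "'a::euclidean_space \<Rightarrow> real" where
  "gdens z = (\<Prod>b\<in>Basis. std_normal_density (z \<bullet> b))"

text \<open>The standard normal law. Scaled by \<sigma> it has as density the heat kernel at time
  \<open>\<sigma>^2 / 2\<close>.\<close>

definition gm :: "'a::euclidean_space measure" where
  "gm = density lborel (\<lambda>z. ennreal (gdens z))"

lemma gdens_pos: "gdens z > 0"
  unfolding gdens_def by (intro prod_pos) (auto intro: normal_density_pos)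

lemma gdens_cont: "continuous_on S gdens"
  unfolding gdens_def std_normal_density_def by (intro continuous_intros) auto

lemma gdens_measurable [measurable]: "gdens \<in> borel_measurable borel"
  by (intro borel_measurable_continuous_onI gdens_cont)

lemma sets_gm [measurable_cong, simp]: "sets gm = sets borel"
  and space_gm [simp]: "space gm = UNIV"
  by (auto simp: gm_def)

text \<open>The density is a product over the coordinates, so Fubini's theorem reduces the total
  mass and the first moments to one-dimensional integrals.\<close>

lemma nn_integral_gm_prod:
  assumes [measurable]: "\<And>b. b \<in> Basis \<Longrightarrow> f b \<in> borel_measurable borel"
  shows "(\<integral>\<^sup>+z. (\<Prod>b\<in>Basis. f b (z \<bullet> b)) \<partial>(gm :: 'a::euclidean_space measure)) =
    (\<Prod>b\<in>(Basis :: 'a set). \<integral>\<^sup>+x. ennreal (std_normal_density x) * f b x \<partial>lborel)"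
proof -
  have "(\<integral>\<^sup>+z. (\<Prod>b\<in>Basis. f b (z \<bullet> b)) \<partial>(gm :: 'a measure)) =
      (\<integral>\<^sup>+z. ennreal (gdens z) * (\<Prod>b\<in>Basis. f b (z \<bullet> b)) \<partial>(lborel :: 'a measure))"
    unfolding gm_def by (subst nn_integral_density) auto
  also have "\<dots> = (\<integral>\<^sup>+z. (\<Prod>b\<in>Basis. ennreal (std_normal_density (z \<bullet> b)) * f b (z \<bullet> b)) \<partial>(lborel :: 'a measure))"
    unfolding gdens_def by (subst prod_ennreal[symmetric]) (auto simp: prod.distrib)
  also have "\<dots> = (\<Prod>b\<in>(Basis :: 'a set). \<integral>\<^sup>+x. ennreal (std_normal_density x) * f b x \<partial>lborel)"
    by (subst nn_integral_lborel_prod[where f="\<lambda>b x. ennreal (std_normal_density x) * f b x"]) auto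
  finally show ?thesis .
qed

lemma nn_integral_std_normal: "(\<integral>\<^sup>+x. ennreal (std_normal_density x) \<partial>lborel) = 1"
  using prob_space.emeasure_space_1[OF prob_space_normal_density[of 1 0]]
  by (simp add: emeasure_density)

lemma prob_space_gm: "prob_space (gm :: 'a::euclidean_space measure)"
proof
  have "emeasure (gm :: 'a measure) (space gm) = (\<integral>\<^sup>+z. (\<Prod>b\<in>Basis. (\<lambda>_ _. 1) b (z \<bullet> b)) \<partial>(gm :: 'a measure))"
    by simp
  also have "\<dots> = 1" by (subst nn_integral_gm_prod) (auto simp: nn_integral_std_normal)
  finally show "emeasure (gm :: 'a measure) (space gm) = 1" .
qed

lemma integrable_gm_coord:
  fixes i :: "'a::euclidean_space"
  assumes i: "i \<in> Basis"
  shows "integrable gm (\<lambda>z. z \<bullet> i)"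
proof (rule integrableI_bounded)
  have "(\<integral>\<^sup>+z. ennreal (norm (z \<bullet> i)) \<partial>(gm :: 'a measure)) =
      (\<integral>\<^sup>+z. (\<Prod>b\<in>Basis. (\<lambda>b x. if b = i then ennreal \<bar>x\<bar> else 1) b (z \<bullet> b)) \<partial>(gm :: 'a measure))"
  proof (rule nn_integral_cong)
    fix z :: 'a
    have "(\<Prod>b\<in>Basis. (\<lambda>b x. if b = i then ennreal \<bar>x\<bar> else 1) b (z \<bullet> b)) = (if i \<in> Basis then ennreal \<bar>z \<bullet> i\<bar> else 1)"
      using prod.delta[OF finite_Basis, of i "\<lambda>b. ennreal \<bar>z \<bullet> b\<bar>"] by simp
    then show "ennreal (norm (z \<bullet> i)) = (\<Prod>b\<in>Basis. (\<lambda>b x. if b = i then ennreal \<bar>x\<bar> else 1) b (z \<bullet> b))"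
      using i by simp
  qed
  also have "\<dots> = (\<Prod>b\<in>(Basis :: 'a set). \<integral>\<^sup>+x. ennreal (std_normal_density x) * (if b = i then ennreal \<bar>x\<bar> else 1) \<partial>lborel)"
    by (subst nn_integral_gm_prod) auto
  also have "\<dots> < \<infinity>"
  proof -
    have "(\<integral>\<^sup>+x. ennreal (std_normal_density x) * ennreal \<bar>x\<bar> \<partial>lborel) < \<infinity>"
      using integrable_std_normal_moment_abs[of 1] unfolding integrable_iff_bounded
      by (simp add: abs_mult ennreal_mult' abs_of_nonneg)
    then have fin: "(\<integral>\<^sup>+x. ennreal (std_normal_density x) * (if b = i then ennreal \<bar>x\<bar> else 1) \<partial>lborel) < \<infinity>" for b
      by (cases "b = i") (auto simp: nn_integral_std_normal)
    have pr: "(\<Prod>b\<in>A. f b) < \<infinity>" if "\<And>b. f b < \<infinity>" for A and f :: "'a \<Rightarrow> ennreal"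
      using that by (induction A rule: infinite_finite_induct) (auto simp: ennreal_mult_less_top)
    show ?thesis by (rule pr[OF fin])
  qed
  finally show "(\<integral>\<^sup>+z. ennreal (norm (z \<bullet> i)) \<partial>(gm :: 'a measure)) < \<infinity>" .
qed simp

section \<open>Integration by parts against the Gaussian\<close>

lemma compact_bound:
  fixes f :: "'e::metric_space \<Rightarrow> real"
  assumes "compact S" "continuous_on S f"
  obtains B where "B > 0" "\<And>z. z \<in> S \<Longrightarrow> \<bar>f z\<bar> \<le> B"
proof -
  have "bounded (f ` S)" by (intro compact_imp_bounded compact_continuous_image assms)
  then obtain b where "b > 0" "\<forall>x\<in>f ` S. norm x \<le> b" unfolding bounded_pos by blast
  then show ?thesis by (intro that[of b]) auto
qed

text \<open>By translation invariance of Lebesgue measure every difference quotient of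
  \<open>k\<close> has integral 0, and dominated convergence passes to the derivative.\<close>

lemma integral_deriv_zero:
  fixes k :: "'e::euclidean_space \<Rightarrow> real"
  assumes "continuous_on UNIV k" "continuous_on UNIV k'" "\<And>z. dd e k z (k' z)" "norm e = 1"
    and supp: "\<And>z. norm z > R \<Longrightarrow> k z = 0" "\<And>z. norm z > R \<Longrightarrow> k' z = 0"
  shows "(\<integral>z. k' z \<partial>lborel) = 0"
proof -
  \<comment> \<open>Steps of size at most 1 keep all difference quotients supported in the ball of
    radius \<open>R + 1\<close>, which yields an integrable majorant.\<close>
  define h where "h n = 1 / real (Suc n)" for n
  have h: "h n > 0" "h n \<le> 1" for n by (auto simp: h_def)
  have hlim: "h \<longlonglongrightarrow> 0" unfolding h_def using lim_inverse_n' LIMSEQ_Suc by (fastforce simp: field_simps)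
  obtain B where B: "B > 0" "\<And>z. z \<in> cball 0 R \<Longrightarrow> \<bar>k' z\<bar> \<le> B"
    using compact_bound[OF compact_cball continuous_on_subset[OF assms(2) subset_UNIV]] by blast
  have B': "\<bar>k' z\<bar> \<le> B" for z using B supp(2)[of z] by (cases "norm z > R") auto
  have ik: "integrable lborel k"
  proof -
    have "integrable lborel (\<lambda>x. indicator (cball 0 R) x *\<^sub>R k x)"
      by (intro borel_integrable_compact continuous_on_subset[OF assms(1)]) auto
    moreover have "(\<lambda>x. indicator (cball 0 R) x *\<^sub>R k x) = k"
      using supp(1) by (auto simp: indicator_def fun_eq_iff not_le)
    ultimately show ?thesis by simp
  qed
  have tr: "integrable lborel (\<lambda>z. k (c + z))" "(\<integral>z. k (c + z) \<partial>lborel) = (\<integral>z. k z \<partial>lborel)" for c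
  proof -
    have [measurable]: "k \<in> borel_measurable borel" using assms(1) by (rule borel_measurable_continuous_onI)
    show "(\<integral>z. k (c + z) \<partial>lborel) = (\<integral>z. k z \<partial>lborel)"
      using integral_distr[of "(+) c" lborel borel k] by (simp add: lborel_distr_plus)
    show "integrable lborel (\<lambda>z. k (c + z))"
      using integrable_distr_eq[of "(+) c" lborel borel k] ik by (simp add: lborel_distr_plus)
  qed
  have zero: "(\<integral>z. (k (z + h n *\<^sub>R e) - k z) / h n \<partial>lborel) = 0" for n
    using tr[of "h n *\<^sub>R e"] ik by (simp add: add.commute)
  have "(\<lambda>n. \<integral>z. (k (z + h n *\<^sub>R e) - k z) / h n \<partial>lborel) \<longlonglongrightarrow> (\<integral>z. k' z \<partial>lborel)"
  proof (rule integral_dominated_convergence[where w="\<lambda>z. B * indicator (cball 0 (R + 1)) z"])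
    show "k' \<in> borel_measurable lborel" "(\<lambda>z. (k (z + h n *\<^sub>R e) - k z) / h n) \<in> borel_measurable lborel" for n
    proof -
      have [measurable]: "k \<in> borel_measurable borel" "k' \<in> borel_measurable borel"
        using assms(1,2) by (auto intro: borel_measurable_continuous_onI)
      show "k' \<in> borel_measurable lborel" "(\<lambda>z. (k (z + h n *\<^sub>R e) - k z) / h n) \<in> borel_measurable lborel" by measurable
    qed
    show "integrable lborel (\<lambda>z::'e. B * indicator (cball 0 (R + 1)) z :: real)"
      by (intro integrable_mult_right integrable_real_indicator) (use emeasure_bounded_finite[OF bounded_cball[of "0::'e" "R + 1"]] in simp_all)
    show "AE z in lborel. (\<lambda>n. (k (z + h n *\<^sub>R e) - k z) / h n) \<longlonglongrightarrow> k' z"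
    proof (rule AE_I2)
      fix z
      have "((\<lambda>s. (k (z + s *\<^sub>R e) - k (z + 0 *\<^sub>R e)) / (s - 0)) \<longlongrightarrow> k' z) (at 0)"
        using assms(3)[of z] unfolding dd_def has_field_derivative_iff by simp
      moreover have "filterlim h (at 0) sequentially"
        using hlim h(1) by (auto simp: filterlim_at intro!: always_eventually less_imp_neq[symmetric])
      ultimately show "(\<lambda>n. (k (z + h n *\<^sub>R e) - k z) / h n) \<longlonglongrightarrow> k' z"
        by (auto dest: filterlim_compose)
    qed
    show "AE z in lborel. norm ((k (z + h n *\<^sub>R e) - k z) / h n) \<le> B * indicator (cball 0 (R + 1)) z" for n
    proof (rule AE_I2)
      fix z
      show "norm ((k (z + h n *\<^sub>R e) - k z) / h n) \<le> B * indicator (cball 0 (R + 1)) z"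
      proof (cases "norm z \<le> R + 1")
        case True
        then show ?thesis using diff_quot_bound[where h="h n" and e=e and u=k and q=z and d="\<lambda>s. k' (z + s *\<^sub>R e)" and M=B] h(1)[of n] assms(3) B' by simp
      next
        case False
        have "norm z \<le> norm (z + h n *\<^sub>R e) + norm (h n *\<^sub>R e)"
          using norm_triangle_ineq4[of "z + h n *\<^sub>R e" "h n *\<^sub>R e"] by simp
        then have "norm (z + h n *\<^sub>R e) > R" using False h[of n] assms(4) by simp
        then show ?thesis using False supp(1) B(1) by simp
      qed
    qed
  qed
  then show ?thesis unfolding zero by (simp add: LIMSEQ_const_iff)
qed

lemma gdens_dd:
  assumes "i \<in> Basis" shows "dd i gdens z (- (z \<bullet> i) * gdens z)"
proof -
  define c where "c = (\<Prod>b\<in>Basis - {i}. std_normal_density (z \<bullet> b))"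
  have eq: "gdens (z + s *\<^sub>R i) = std_normal_density (z \<bullet> i + s) * c" for s
  proof -
    have "gdens (z + s *\<^sub>R i) = std_normal_density ((z + s *\<^sub>R i) \<bullet> i) * (\<Prod>b\<in>Basis - {i}. std_normal_density ((z + s *\<^sub>R i) \<bullet> b))"
      unfolding gdens_def using assms by (subst prod.remove[of _ i]) auto
    also have "(\<Prod>b\<in>Basis - {i}. std_normal_density ((z + s *\<^sub>R i) \<bullet> b)) = c"
      unfolding c_def using assms by (intro prod.cong) (auto simp: inner_add_left inner_Basis)
    finally show ?thesis using assms by (simp add: inner_add_left)
  qed
  have "((\<lambda>s. k * exp (- (z \<bullet> i + s)\<^sup>2 / 2) * c) has_real_derivative - (z \<bullet> i) * (k * exp (- (z \<bullet> i)\<^sup>2 / 2) * c)) (at 0)" for k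
    by (auto intro!: derivative_eq_intros)
  from this[of "1 / sqrt (2 * pi)"]
  have "((\<lambda>s. std_normal_density (z \<bullet> i + s) * c) has_real_derivative - (z \<bullet> i) * (std_normal_density (z \<bullet> i) * c)) (at 0)"
    unfolding std_normal_density_def .
  then show ?thesis unfolding dd_def using eq[of 0] by (simp add: eq)
qed

text \<open>Gaussian integration by parts (Stein's identity): the derivative of
  \<open>gdens * h\<close> integrates to 0, and differentiating \<open>gdens\<close> produces the
  factor \<open>- (z \<bullet> i)\<close>.\<close>

lemma stein:
  fixes h :: "'a::euclidean_space \<Rightarrow> real"
  assumes i: "i \<in> Basis" and h: "continuous_on UNIV h" "continuous_on UNIV h'" "\<And>z. dd i h z (h' z)"
    and supp: "\<And>z. norm z > R \<Longrightarrow> h z = 0" "\<And>z. norm z > R \<Longrightarrow> h' z = 0"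
  shows "(\<integral>z. h' z \<partial>gm) = (\<integral>z. (z \<bullet> i) * h z \<partial>gm)"
proof -
  have [measurable]: "h \<in> borel_measurable borel" "h' \<in> borel_measurable borel"
    using h(1,2) by (auto intro: borel_measurable_continuous_onI)
  have int: "integrable lborel (\<lambda>z. gdens z * f z)" if f: "continuous_on UNIV f" "\<And>z. norm z > R \<Longrightarrow> f z = 0"
    for f :: "'a \<Rightarrow> real"
  proof -
    have "integrable lborel (\<lambda>x. indicator (cball 0 R) x *\<^sub>R (gdens x * f x))"
      by (intro borel_integrable_compact continuous_intros gdens_cont continuous_on_subset[OF f(1)]) auto
    moreover have "(\<lambda>x. indicator (cball 0 R) x *\<^sub>R (gdens x * f x)) = (\<lambda>z. gdens z * f z)"
      using f(2) by (auto simp: indicator_def fun_eq_iff not_le)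
    ultimately show ?thesis by simp
  qed
  have "(\<integral>z. gdens z * h' z - gdens z * ((z \<bullet> i) * h z) \<partial>lborel) = 0"
  proof (rule integral_deriv_zero[of "\<lambda>z. gdens z * h z" _ i R])
    show "dd i (\<lambda>z. gdens z * h z) z (gdens z * h' z - gdens z * ((z \<bullet> i) * h z))" for z
      using dd_mult[OF gdens_dd[OF i, of z] h(3)[of z]] by (simp add: algebra_simps)
  qed (use i supp in \<open>auto intro!: continuous_intros gdens_cont h(1,2)\<close>)
  moreover have "(\<integral>z. gdens z * h' z - gdens z * ((z \<bullet> i) * h z) \<partial>lborel) =
      (\<integral>z. gdens z * h' z \<partial>lborel) - (\<integral>z. gdens z * ((z \<bullet> i) * h z) \<partial>lborel)"
    by (intro Bochner_Integration.integral_diff int continuous_intros h(1,2)) (use supp in auto)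
  moreover have "(\<integral>z. f z \<partial>gm) = (\<integral>z. gdens z * f z \<partial>lborel)" if "f \<in> borel_measurable borel" for f :: "'a \<Rightarrow> real"
    unfolding gm_def using that by (subst integral_density) (auto intro: less_imp_le gdens_pos)
  ultimately show ?thesis by simp
qed

lemma sum_Basis_pair:
  fixes f :: "'a::euclidean_space \<times> real \<Rightarrow> 'b::comm_monoid_add"
  shows "sum f Basis = (\<Sum>i\<in>Basis. f (i, 0)) + f (0, 1)"
proof -
  have "sum f Basis = sum f ((\<lambda>u. (u, 0)) ` Basis) + sum f ((\<lambda>v. (0, v)) ` (Basis :: real set))"
    unfolding Basis_prod_def by (intro sum.union_disjoint) auto
  also have "sum f ((\<lambda>u. (u, 0)) ` Basis) = (\<Sum>i\<in>Basis. f (i, 0))"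
    by (subst sum.reindex) (auto simp: inj_on_def)
  finally show ?thesis by simp
qed

text \<open>After the linear part at \<open>p\<close> is subtracted, the partial derivatives of the
  remainder \<open>G\<close> are small near \<open>p\<close>, and
  \<open>lipschitz_of_partials\<close> bounds the change of \<open>G\<close> by a small multiple of
  the distance.\<close>

lemma C1_has_derivative:
  fixes f :: "'e::euclidean_space \<Rightarrow> real"
  assumes d: "\<And>q b. b \<in> Basis \<Longrightarrow> dd b f q (f' b q)"
    and c: "\<And>b. b \<in> Basis \<Longrightarrow> continuous_on UNIV (f' b)"
  shows "(f has_derivative (\<lambda>v. \<Sum>b\<in>Basis. (v \<bullet> b) * f' b p)) (at p)"
  unfolding has_derivative_at_alt
proof (intro conjI allI impI)
  show "bounded_linear (\<lambda>v. \<Sum>b\<in>Basis. (v \<bullet> b) * f' b p)"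
    by (intro bounded_linear_sum bounded_linear_mult_const bounded_linear_inner_left)
  fix \<epsilon> :: real assume \<epsilon>: "\<epsilon> > 0"
  define D where "D = real DIM('e)"
  have D: "D > 0" by (simp add: D_def)
  have "\<forall>\<^sub>F q in nhds p. \<forall>b\<in>Basis. dist (f' b q) (f' b p) < \<epsilon> / D"
  proof (intro eventually_ball_finite ballI finite_Basis)
    fix b :: 'e assume "b \<in> Basis"
    then have "isCont (f' b) p" using c by (simp add: continuous_on_eq_continuous_at)
    then show "\<forall>\<^sub>F q in nhds p. dist (f' b q) (f' b p) < \<epsilon> / D"
      unfolding isCont_def tendsto_at_iff_tendsto_nhds using \<epsilon> D by (intro tendstoD) auto
  qed
  then obtain e where e: "e > 0" "\<And>q b. dist q p < e \<Longrightarrow> b \<in> Basis \<Longrightarrow> dist (f' b q) (f' b p) < \<epsilon> / D"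
    unfolding eventually_nhds_metric by blast
  define r where "r = e / (1 + 2 * D)"
  have r: "r > 0" "r * (1 + 2 * D) \<le> e" using e D by (auto simp: r_def)
  define G where "G q = f q - (\<Sum>b\<in>Basis. (q \<bullet> b) * f' b p)" for q
  have "\<bar>G y - G p\<bar> \<le> \<epsilon> / D * D * norm (y - p)" if "norm (y - p) < r" for y
    unfolding D_def
  proof (rule lipschitz_of_partials[of p e G "\<lambda>b q. f' b q - f' b p" _ r])
    fix q b :: 'e assume q: "q \<in> ball p e" and b: "b \<in> Basis"
    have "(\<Sum>b'\<in>Basis. ((q + s *\<^sub>R b) \<bullet> b') * f' b' p) = (\<Sum>b'\<in>Basis. (q \<bullet> b') * f' b' p) + s * f' b p" for s
    proof -
      have "(\<Sum>b'\<in>Basis. ((q + s *\<^sub>R b) \<bullet> b') * f' b' p) =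
          (\<Sum>b'\<in>Basis. (q \<bullet> b') * f' b' p + (if b' = b then s * f' b' p else 0))"
        using b by (intro sum.cong) (auto simp: inner_add_left inner_Basis algebra_simps)
      then show ?thesis using b by (simp add: sum.distrib sum.delta)
    qed
    then have "dd b (\<lambda>q. \<Sum>b'\<in>Basis. (q \<bullet> b') * f' b' p) q (f' b p)"
      unfolding dd_def by (auto intro!: derivative_eq_intros)
    from dd_diff[OF d[OF b] this] have "dd b G q (f' b q - f' b p)" by (simp add: G_def[abs_def])
    then show "dd b G q (f' b q - f' b p) \<and> \<bar>f' b q - f' b p\<bar> \<le> \<epsilon> / real DIM('e)"
      using e(2)[of q b] q b by (simp add: dist_real_def D_def dist_commute)
  qed (use r that in \<open>auto simp: D_def dist_norm norm_minus_commute\<close>)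
  moreover have "G y - G p = f y - f p - (\<Sum>b\<in>Basis. ((y - p) \<bullet> b) * f' b p)" for y
    by (simp add: G_def inner_diff_left left_diff_distrib sum_subtractf)
  ultimately show "\<exists>d>0. \<forall>y. norm (y - p) < d \<longrightarrow>
      norm (f y - f p - (\<Sum>b\<in>Basis. ((y - p) \<bullet> b) * f' b p)) \<le> \<epsilon> * norm (y - p)"
    using r D by (intro exI[of _ r]) auto
qed

text \<open>With the time lag written as \<open>\<sigma>\<^sup>2 / 2\<close> and space rescaled by \<open>\<sigma>\<close>, Duhamel's formula becomes the
  integral of \<open>\<sigma> F (x - \<sigma> z, t - \<sigma>\<^sup>2 / 2)\<close> over the finite measure \<open>Tm S\<close> in \<open>(z, \<sigma>)\<close>. One
  integration by parts in \<open>z\<close> then trades a space derivative of \<open>F\<close> and the factor \<open>\<sigma>\<close> for the weight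
  \<open>z\<close>, so that no singular kernel ever occurs.\<close>

definition Tm :: "real \<Rightarrow> ('a::euclidean_space \<times> real) measure" where
  "Tm S = gm \<Otimes>\<^sub>M restrict_space lborel {0..S}"

definition shp :: "'a::euclidean_space \<times> real \<Rightarrow> 'a \<times> real \<Rightarrow> 'a \<times> real" where
  "shp p \<omega> = p - (snd \<omega> *\<^sub>R fst \<omega>, (snd \<omega>)\<^sup>2 / 2)"

text \<open>Since \<open>d(\<sigma>^2 / 2) = \<sigma> d\<sigma>\<close>, the weight
  \<open>snd\<close> gives Duhamel's integral; the weight \<open>- (z \<bullet> i)\<close> gives its
  derivative in direction \<open>i\<close> after integration by parts.\<close>

definition TT :: "real \<Rightarrow> ('a::euclidean_space \<times> real \<Rightarrow> real) \<Rightarrow> ('a \<times> real \<Rightarrow> real) \<Rightarrow> 'a \<times> real \<Rightarrow> real" where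
  "TT S w H p = (\<integral>\<omega>. w \<omega> * H (shp p \<omega>) \<partial>Tm S)"

section \<open>Continuity and differentiation of the integrals \<open>TT\<close>\<close>

lemma finite_time: "finite_measure (restrict_space lborel {0..S::real})"
  by (rule finite_measureI) (auto simp: space_restrict_space emeasure_restrict_space emeasure_lborel_Icc_eq)

lemma finite_Tm: "finite_measure (Tm S :: ('a::euclidean_space \<times> real) measure)"
  unfolding Tm_def
  by (intro finite_measure_pair_measure finite_time prob_space.finite_measure prob_space_gm)

lemma pair_Tm: "pair_sigma_finite (gm :: 'a::euclidean_space measure) (restrict_space lborel {0..S::real})"
proof -
  interpret A: prob_space "gm :: 'a measure" by (rule prob_space_gm)
  interpret B: finite_measure "restrict_space lborel {0..S::real}" by (rule finite_time)
  show ?thesis ..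
qed

lemma meas_Tm [measurable]: "fst \<in> Tm S \<rightarrow>\<^sub>M borel" "snd \<in> Tm S \<rightarrow>\<^sub>M borel"
proof -
  have "fst \<in> Tm S \<rightarrow>\<^sub>M gm" unfolding Tm_def by (rule measurable_fst)
  then show "fst \<in> Tm S \<rightarrow>\<^sub>M borel" by (simp cong: measurable_cong_sets)
  have "snd \<in> Tm S \<rightarrow>\<^sub>M restrict_space lborel {0..S}" unfolding Tm_def by (rule measurable_snd)
  moreover have "(\<lambda>x. x) \<in> restrict_space lborel {0..S} \<rightarrow>\<^sub>M (borel :: real measure)"
    by (intro measurable_restrict_space1) auto
  ultimately show "snd \<in> Tm S \<rightarrow>\<^sub>M borel" by (rule measurable_compose)
qed

lemma meas_shp: "shp p \<in> Tm S \<rightarrow>\<^sub>M borel"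
proof -
  have "(\<lambda>\<omega>. (fst p - snd \<omega> *\<^sub>R fst \<omega>, snd p - (snd \<omega>)\<^sup>2 / 2)) \<in> Tm S \<rightarrow>\<^sub>M borel"
    by (intro borel_measurable_Pair) measurable
  then show ?thesis by (simp add: shp_def[abs_def] minus_prod_def)
qed

lemma meas_H: "continuous_on UNIV H \<Longrightarrow> (\<lambda>\<omega>. H (shp p \<omega>)) \<in> borel_measurable (Tm S)" for H :: "'a::euclidean_space \<times> real \<Rightarrow> real"
  by (rule measurable_compose[OF meas_shp borel_measurable_continuous_onI])

lemma TT_integrable:
  fixes H :: "'a::euclidean_space \<times> real \<Rightarrow> real"
  assumes "integrable (Tm S) w" "continuous_on UNIV H" "\<And>q. \<bar>H q\<bar> \<le> B"
  shows "integrable (Tm S) (\<lambda>\<omega>. w \<omega> * H (shp p \<omega>))"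
proof (rule Bochner_Integration.integrable_bound[of _ "\<lambda>\<omega>. \<bar>B\<bar> * w \<omega>"])
  show "(\<lambda>\<omega>. w \<omega> * H (shp p \<omega>)) \<in> borel_measurable (Tm S)"
    using assms(1) meas_H[OF assms(2)] by (intro borel_measurable_times) auto
  show "AE \<omega> in Tm S. norm (w \<omega> * H (shp p \<omega>)) \<le> norm (\<bar>B\<bar> * w \<omega>)"
  proof (rule AE_I2)
    fix \<omega> show "norm (w \<omega> * H (shp p \<omega>)) \<le> norm (\<bar>B\<bar> * w \<omega>)"
      using mult_right_mono[OF order_trans[OF assms(3)[of "shp p \<omega>"] abs_ge_self[of B]], of "\<bar>w \<omega>\<bar>"]
      by (simp add: abs_mult mult.commute)
  qed
qed (use assms in auto)

lemma TT_bound: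
  fixes H :: "'a::euclidean_space \<times> real \<Rightarrow> real"
  assumes "integrable (Tm S) w" "continuous_on UNIV H" "\<And>q. \<bar>H q\<bar> \<le> B"
  shows "\<bar>TT S w H p\<bar> \<le> (\<integral>\<omega>. \<bar>B\<bar> * \<bar>w \<omega>\<bar> \<partial>Tm S)"
proof -
  have "norm (\<integral>\<omega>. w \<omega> * H (shp p \<omega>) \<partial>Tm S) \<le> (\<integral>\<omega>. \<bar>B\<bar> * \<bar>w \<omega>\<bar> \<partial>Tm S)"
  proof (rule Bochner_Integration.integral_norm_bound_integral[OF TT_integrable[OF assms]])
    show "integrable (Tm S) (\<lambda>\<omega>. \<bar>B\<bar> * \<bar>w \<omega>\<bar>)" using assms(1) by auto
    show "norm (w \<omega> * H (shp p \<omega>)) \<le> \<bar>B\<bar> * \<bar>w \<omega>\<bar>" for \<omega>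
      using mult_right_mono[OF order_trans[OF assms(3)[of "shp p \<omega>"] abs_ge_self[of B]], of "\<bar>w \<omega>\<bar>"]
      by (simp add: abs_mult mult.commute)
  qed
  then show ?thesis by (simp add: TT_def)
qed

lemma TT_cont:
  fixes H :: "'a::euclidean_space \<times> real \<Rightarrow> real"
  assumes w: "integrable (Tm S) w" and H: "continuous_on UNIV H" "\<And>q. \<bar>H q\<bar> \<le> B"
  shows "continuous_on UNIV (TT S w H)"
proof (rule continuous_on_sequentiallyI)
  fix X :: "nat \<Rightarrow> 'a \<times> real" and p assume X: "X \<longlonglongrightarrow> p"
  show "(\<lambda>n. TT S w H (X n)) \<longlonglongrightarrow> TT S w H p"
    unfolding TT_def
  proof (rule integral_dominated_convergence[where w="\<lambda>\<omega>. \<bar>B\<bar> * \<bar>w \<omega>\<bar>"])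
    show "(\<lambda>\<omega>. w \<omega> * H (shp p \<omega>)) \<in> borel_measurable (Tm S)" "(\<lambda>\<omega>. w \<omega> * H (shp (X n) \<omega>)) \<in> borel_measurable (Tm S)" for n
      using w meas_H[OF H(1)] by (auto intro!: borel_measurable_times)
    show "integrable (Tm S) (\<lambda>\<omega>. \<bar>B\<bar> * \<bar>w \<omega>\<bar>)" using w by auto
    show "AE \<omega> in Tm S. (\<lambda>n. w \<omega> * H (shp (X n) \<omega>)) \<longlonglongrightarrow> w \<omega> * H (shp p \<omega>)"
    proof (rule AE_I2)
      fix \<omega> :: "'a \<times> real"
      have a: "isCont H (shp p \<omega>)" using H(1) continuous_on_eq_continuous_at[OF open_UNIV] by blast
      have b: "(\<lambda>n. shp (X n) \<omega>) \<longlonglongrightarrow> shp p \<omega>" unfolding shp_def by (rule tendsto_diff[OF X tendsto_const])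
      show "(\<lambda>n. w \<omega> * H (shp (X n) \<omega>)) \<longlonglongrightarrow> w \<omega> * H (shp p \<omega>)"
        by (rule tendsto_mult_left[OF isCont_tendsto_compose[OF a b]])
    qed
    show "AE \<omega> in Tm S. norm (w \<omega> * H (shp (X n) \<omega>)) \<le> \<bar>B\<bar> * \<bar>w \<omega>\<bar>" for n
    proof (rule AE_I2)
      fix \<omega> show "norm (w \<omega> * H (shp (X n) \<omega>)) \<le> \<bar>B\<bar> * \<bar>w \<omega>\<bar>"
        using mult_right_mono[OF order_trans[OF H(2)[of "shp (X n) \<omega>"] abs_ge_self[of B]], of "\<bar>w \<omega>\<bar>"]
        by (simp add: abs_mult mult.commute)
    qed
  qed
qed

text \<open>\<open>shp\<close> commutes with translations of \<open>p\<close>, so a derivative in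
  \<open>p\<close> falls on \<open>H\<close> alone; dominated convergence allows it under the
  integral.\<close>

lemma TT_dd:
  fixes H :: "'a::euclidean_space \<times> real \<Rightarrow> real"
  assumes w: "integrable (Tm S) w" and H: "continuous_on UNIV H" "\<And>q. \<bar>H q\<bar> \<le> B"
    and H': "continuous_on UNIV H'" "\<And>q. \<bar>H' q\<bar> \<le> B" and d: "\<And>q. dd e H q (H' q)"
  shows "dd e (TT S w H) p (TT S w H' p)"
  unfolding dd_def has_field_derivative_iff tendsto_at_iff_sequentially comp_def
proof (intro allI impI)
  fix h :: "nat \<Rightarrow> real" assume h: "\<forall>n. h n \<in> UNIV - {0}" "h \<longlonglongrightarrow> 0"
  have h0: "h n \<noteq> 0" for n using h by auto
  have sh: "shp (p + s *\<^sub>R e) \<omega> = shp p \<omega> + s *\<^sub>R e" for s \<omega> by (simp add: shp_def)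
  have bound: "\<bar>(H (q + s *\<^sub>R e) - H q) / s\<bar> \<le> B" if "s \<noteq> 0" for q s
  proof (cases "s > 0")
    case True then show ?thesis using diff_quot_bound[of s e H q "\<lambda>s. H' (q + s *\<^sub>R e)" B] d H' by auto
  next
    case False
    then have "\<bar>(H (q + s *\<^sub>R e + (- s) *\<^sub>R e) - H (q + s *\<^sub>R e)) / (- s)\<bar> \<le> B"
      using diff_quot_bound[of "- s" e H "q + s *\<^sub>R e" "\<lambda>\<tau>. H' (q + s *\<^sub>R e + \<tau> *\<^sub>R e)" B] d H' that by auto
    then show ?thesis by (simp add: abs_divide abs_minus_commute)
  qed
  have "(\<lambda>n. \<integral>\<omega>. w \<omega> * ((H (shp p \<omega> + h n *\<^sub>R e) - H (shp p \<omega>)) / h n) \<partial>Tm S) \<longlonglongrightarrow> (\<integral>\<omega>. w \<omega> * H' (shp p \<omega>) \<partial>Tm S)"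
  proof (rule integral_dominated_convergence[where w="\<lambda>\<omega>. \<bar>B\<bar> * \<bar>w \<omega>\<bar>"])
    have m: "(\<lambda>\<omega>. H (shp p \<omega> + s *\<^sub>R e)) \<in> borel_measurable (Tm S)" for s
      using meas_H[OF H(1), of "p + s *\<^sub>R e" S] by (simp add: sh)
    show "(\<lambda>\<omega>. w \<omega> * H' (shp p \<omega>)) \<in> borel_measurable (Tm S)"
      using w meas_H[OF H'(1)] by (auto intro!: borel_measurable_times)
    show "(\<lambda>\<omega>. w \<omega> * ((H (shp p \<omega> + h n *\<^sub>R e) - H (shp p \<omega>)) / h n)) \<in> borel_measurable (Tm S)" for n
      using w m meas_H[OF H(1)] by (auto intro!: borel_measurable_times borel_measurable_divide borel_measurable_diff)
    show "integrable (Tm S) (\<lambda>\<omega>. \<bar>B\<bar> * \<bar>w \<omega>\<bar>)" using w by auto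
    show "AE \<omega> in Tm S. (\<lambda>n. w \<omega> * ((H (shp p \<omega> + h n *\<^sub>R e) - H (shp p \<omega>)) / h n)) \<longlonglongrightarrow> w \<omega> * H' (shp p \<omega>)"
    proof (rule AE_I2)
      fix \<omega> :: "'a \<times> real"
      have "((\<lambda>s. (H (shp p \<omega> + s *\<^sub>R e) - H (shp p \<omega> + 0 *\<^sub>R e)) / (s - 0)) \<longlongrightarrow> H' (shp p \<omega>)) (at 0)"
        using d[of "shp p \<omega>"] unfolding dd_def has_field_derivative_iff by simp
      moreover have "filterlim h (at 0) sequentially"
        using h by (auto simp: filterlim_at)
      ultimately have "(\<lambda>n. (H (shp p \<omega> + h n *\<^sub>R e) - H (shp p \<omega>)) / h n) \<longlonglongrightarrow> H' (shp p \<omega>)"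
        by (auto dest: filterlim_compose)
      then show "(\<lambda>n. w \<omega> * ((H (shp p \<omega> + h n *\<^sub>R e) - H (shp p \<omega>)) / h n)) \<longlonglongrightarrow> w \<omega> * H' (shp p \<omega>)"
        by (rule tendsto_mult_left)
    qed
    show "AE \<omega> in Tm S. norm (w \<omega> * ((H (shp p \<omega> + h n *\<^sub>R e) - H (shp p \<omega>)) / h n)) \<le> \<bar>B\<bar> * \<bar>w \<omega>\<bar>" for n
    proof (rule AE_I2)
      fix \<omega> show "norm (w \<omega> * ((H (shp p \<omega> + h n *\<^sub>R e) - H (shp p \<omega>)) / h n)) \<le> \<bar>B\<bar> * \<bar>w \<omega>\<bar>"
        using mult_right_mono[OF order_trans[OF bound[OF h0, of "shp p \<omega>" n] abs_ge_self[of B]], of "\<bar>w \<omega>\<bar>"]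
        by (simp add: abs_mult mult.commute)
    qed
  qed
  note conv = this
  have eq: "(TT S w H (p + h n *\<^sub>R e) - TT S w H p) / h n =
      (\<integral>\<omega>. w \<omega> * ((H (shp p \<omega> + h n *\<^sub>R e) - H (shp p \<omega>)) / h n) \<partial>Tm S)" for n
  proof -
    have "TT S w H (p + h n *\<^sub>R e) - TT S w H p =
        (\<integral>\<omega>. w \<omega> * H (shp (p + h n *\<^sub>R e) \<omega>) - w \<omega> * H (shp p \<omega>) \<partial>Tm S)"
      unfolding TT_def by (rule Bochner_Integration.integral_diff[symmetric]) (rule TT_integrable[OF w H])+
    then have "(TT S w H (p + h n *\<^sub>R e) - TT S w H p) / h n =
        (\<integral>\<omega>. (w \<omega> * H (shp (p + h n *\<^sub>R e) \<omega>) - w \<omega> * H (shp p \<omega>)) / h n \<partial>Tm S)"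
      by simp
    also have "\<dots> = (\<integral>\<omega>. w \<omega> * ((H (shp p \<omega> + h n *\<^sub>R e) - H (shp p \<omega>)) / h n) \<partial>Tm S)"
      by (rule Bochner_Integration.integral_cong[OF refl]) (simp add: sh right_diff_distrib diff_divide_distrib)
    finally show ?thesis .
  qed
  have "(\<lambda>n. (TT S w H (p + h n *\<^sub>R e) - TT S w H p) / h n) \<longlonglongrightarrow> TT S w H' p"
    unfolding eq TT_def[of S w H' p] by (rule conv)
  then show "(\<lambda>n. (TT S w H (p + h n *\<^sub>R e) - TT S w H (p + 0 *\<^sub>R e)) / (h n - 0)) \<longlonglongrightarrow> TT S w H' p"
    by simp
qed

lemma integrable_w1: "integrable (Tm S :: ('a::euclidean_space \<times> real) measure) snd"
proof (rule finite_measure.integrable_const_bound[OF finite_Tm, of "\<lambda>\<omega>. snd \<omega>" S])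
  show "AE \<omega> in (Tm S :: ('a \<times> real) measure). norm (snd \<omega>) \<le> S"
    by (rule AE_I2) (auto simp: Tm_def space_pair_measure space_restrict_space)
qed measurable

lemma integrable_wi:
  fixes i :: "'a::euclidean_space"
  assumes "i \<in> Basis" shows "integrable (Tm S) (\<lambda>\<omega>. - (fst \<omega> \<bullet> i))"
proof -
  interpret pair_sigma_finite "gm :: 'a measure" "restrict_space lborel {0..S::real}" by (rule pair_Tm)
  interpret B: finite_measure "restrict_space lborel {0..S::real}" by (rule finite_time)
  have "integrable (gm \<Otimes>\<^sub>M restrict_space lborel {0..S}) (\<lambda>\<omega>. fst \<omega> \<bullet> i)"
  proof (rule Fubini_integrable)
    have "(\<lambda>\<omega>. fst \<omega> \<bullet> i) \<in> borel_measurable (Tm S)" by measurable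
    then show "(\<lambda>\<omega>. fst \<omega> \<bullet> i) \<in> borel_measurable (gm \<Otimes>\<^sub>M restrict_space lborel {0..S})" by (simp add: Tm_def)
    show "integrable gm (\<lambda>z. \<integral>\<sigma>. norm (fst (z, \<sigma>) \<bullet> i) \<partial>restrict_space lborel {0..S})"
      using integrable_norm[OF integrable_gm_coord[OF assms]] by (simp del: real_norm_def)
  qed simp
  then show ?thesis by (simp add: Tm_def)
qed

text \<open>For fixed \<sigma>, differentiating \<open>H (shp p (z, \<sigma>))\<close> in
  \<open>z\<close> gives \<open>- \<sigma> * H'\<close>. Stein's identity in \<open>z\<close> thus
  removes the derivative together with the factor \<sigma>.\<close>

lemma TT_stein:
  fixes H :: "'a::euclidean_space \<times> real \<Rightarrow> real"
  assumes i: "i \<in> Basis" and H: "continuous_on UNIV H" "\<And>q. \<bar>H q\<bar> \<le> B"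
    and H': "continuous_on UNIV H'" "\<And>q. \<bar>H' q\<bar> \<le> B" and d: "\<And>q. dd (i,0) H q (H' q)"
    and supp: "\<And>q. norm (fst q) > R \<Longrightarrow> H q = 0 \<and> H' q = 0"
  shows "TT S snd H' p = TT S (\<lambda>\<omega>. - (fst \<omega> \<bullet> i)) H p"
proof -
  interpret pair_sigma_finite "gm :: 'a measure" "restrict_space lborel {0..S::real}" by (rule pair_Tm)
  have 1: "TT S snd H' p = (\<integral>\<sigma>. (\<integral>z. \<sigma> * H' (shp p (z, \<sigma>)) \<partial>gm) \<partial>restrict_space lborel {0..S})"
    using integral_snd[of "\<lambda>z \<sigma>. \<sigma> * H' (shp p (z, \<sigma>))"] TT_integrable[OF integrable_w1 H', of S p]
    by (simp add: TT_def Tm_def case_prod_unfold)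
  have 2: "TT S (\<lambda>\<omega>. - (fst \<omega> \<bullet> i)) H p = (\<integral>\<sigma>. (\<integral>z. - (z \<bullet> i) * H (shp p (z, \<sigma>)) \<partial>gm) \<partial>restrict_space lborel {0..S})"
    using integral_snd[of "\<lambda>z \<sigma>. - (z \<bullet> i) * H (shp p (z, \<sigma>))"] TT_integrable[OF integrable_wi[OF i] H, of S p]
    by (simp add: TT_def Tm_def case_prod_unfold)
  have "(\<integral>\<sigma>. (\<integral>z. \<sigma> * H' (shp p (z, \<sigma>)) \<partial>gm) \<partial>restrict_space lborel {0..S}) =
      (\<integral>\<sigma>. (\<integral>z. - (z \<bullet> i) * H (shp p (z, \<sigma>)) \<partial>gm) \<partial>restrict_space lborel {0..S})"
    unfolding integral_restrict_space[of "{0..S}" lborel, simplified]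
  proof (rule integral_cong_AE)
    have meas: "(\<lambda>\<sigma>. indicator {0..S} \<sigma> *\<^sub>R (\<integral>z. f z \<sigma> \<partial>gm)) \<in> borel_measurable lborel"
      if "integrable (Tm S) (case_prod f)" for f :: "'a \<Rightarrow> real \<Rightarrow> real"
      using integrable_snd[of f] that unfolding Tm_def
      by (auto dest: borel_measurable_integrable simp: integrable_restrict_space)
    show "(\<lambda>\<sigma>. indicator {0..S} \<sigma> *\<^sub>R (\<integral>z. \<sigma> * H' (shp p (z, \<sigma>)) \<partial>gm)) \<in> borel_measurable lborel"
      by (rule meas) (use TT_integrable[OF integrable_w1 H', of S p] in \<open>simp add: case_prod_unfold\<close>)
    show "(\<lambda>\<sigma>. indicator {0..S} \<sigma> *\<^sub>R (\<integral>z. - (z \<bullet> i) * H (shp p (z, \<sigma>)) \<partial>gm)) \<in> borel_measurable lborel"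
      by (rule meas) (use TT_integrable[OF integrable_wi[OF i] H, of S p] in \<open>simp add: case_prod_unfold\<close>)
    show "AE \<sigma> in lborel. indicator {0..S} \<sigma> *\<^sub>R (\<integral>z. \<sigma> * H' (shp p (z, \<sigma>)) \<partial>gm) =
        indicator {0..S} \<sigma> *\<^sub>R (\<integral>z. - (z \<bullet> i) * H (shp p (z, \<sigma>)) \<partial>gm)"
    \<comment> \<open>For \<open>\<sigma> = 0\<close> the function of \<open>z\<close> is constant
      and in general not compactly supported, so Stein's identity is applied off this null
      set.\<close>
    proof (rule AE_mp[OF AE_lborel_singleton[of 0]], rule AE_I2, rule impI)
      fix \<sigma> :: real assume \<sigma>: "\<sigma> \<noteq> 0"
      show "indicator {0..S} \<sigma> *\<^sub>R (\<integral>z. \<sigma> * H' (shp p (z, \<sigma>)) \<partial>gm) =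
        indicator {0..S} \<sigma> *\<^sub>R (\<integral>z. - (z \<bullet> i) * H (shp p (z, \<sigma>)) \<partial>gm)"
      proof (cases "\<sigma> \<in> {0..S}")
        case True
        then have \<sigma>: "\<sigma> > 0" using \<sigma> by auto
        \<comment> \<open>For fixed positive \<sigma> the shifted point leaves the spatial support
          of \<open>H\<close> once \<open>z\<close> is large; this is the compact support in
          \<open>z\<close> that Stein's identity asks for.\<close>
        define R' where "R' = (\<bar>R\<bar> + norm (fst p)) / \<sigma>"
        have far: "norm (fst (shp p (z, \<sigma>))) > R" if "norm z > R'" for z
        proof -
          have "\<sigma> * norm z > \<bar>R\<bar> + norm (fst p)" using that \<sigma> by (simp add: R'_def field_simps)
          moreover have "norm (\<sigma> *\<^sub>R z) \<le> norm (fst p - \<sigma> *\<^sub>R z) + norm (fst p)"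
            using norm_triangle_ineq4[of "fst p" "fst p - \<sigma> *\<^sub>R z"] by simp
          ultimately show ?thesis using \<sigma> by (simp add: shp_def)
        qed
        have "(\<integral>z. - \<sigma> * H' (shp p (z, \<sigma>)) \<partial>gm) = (\<integral>z. (z \<bullet> i) * H (shp p (z, \<sigma>)) \<partial>gm)"
        proof (rule stein[OF i, of _ _ R'])
          have c: "continuous_on UNIV (\<lambda>z. shp p (z, \<sigma>))" unfolding shp_def by (intro continuous_intros) auto
          show "continuous_on UNIV (\<lambda>z. H (shp p (z, \<sigma>)))"
            by (rule continuous_on_compose2[OF H(1) c]) auto
          show "continuous_on UNIV (\<lambda>z. - \<sigma> * H' (shp p (z, \<sigma>)))"
            by (intro continuous_intros continuous_on_compose2[OF H'(1) c]) auto
          show "dd i (\<lambda>z. H (shp p (z, \<sigma>))) z (- \<sigma> * H' (shp p (z, \<sigma>)))" for z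
          proof -
            have e: "shp p (z + s *\<^sub>R i, \<sigma>) = shp p (z, \<sigma>) + (- \<sigma> * s) *\<^sub>R (i, 0)" for s
              by (simp add: shp_def prod_eq_iff algebra_simps)
            have "((\<lambda>s. - \<sigma> * s) has_real_derivative - \<sigma>) (at 0)" by (auto intro!: derivative_eq_intros)
            from DERIV_chain2[of "\<lambda>s. H (shp p (z, \<sigma>) + s *\<^sub>R (i, 0))" "H' (shp p (z, \<sigma>))", OF _ this]
            show ?thesis using d[of "shp p (z, \<sigma>)"] unfolding dd_def e by (simp add: mult.commute)
          qed
          show "H (shp p (z, \<sigma>)) = 0" "- \<sigma> * H' (shp p (z, \<sigma>)) = 0" if "norm z > R'" for z
            using supp[OF far[OF that]] by auto
        qed
        then have "- (\<sigma> * (\<integral>z. H' (shp p (z, \<sigma>)) \<partial>gm)) = (\<integral>z. (z \<bullet> i) * H (shp p (z, \<sigma>)) \<partial>gm)" by simp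
        then have "\<sigma> * (\<integral>z. H' (shp p (z, \<sigma>)) \<partial>gm) = - (\<integral>z. (z \<bullet> i) * H (shp p (z, \<sigma>)) \<partial>gm)" by linarith
        then show ?thesis by simp
      qed simp
    qed
  qed
  then show ?thesis using 1 2 by simp
qed

text \<open>The combined integrand is minus the \<sigma>-derivative of
  \<open>F (shp p (z, \<sigma>))\<close>. Integrating in \<sigma> first leaves
  \<open>F p - F (shp p (z, S)) = F p\<close> for every \<open>z\<close>, and the Gaussian has mass
  1.\<close>

lemma TT_ftc:
  fixes F :: "'a::euclidean_space \<times> real \<Rightarrow> real"
  assumes F: "\<And>b. b \<in> Basis \<Longrightarrow> continuous_on UNIV (F' b)" "\<And>q b. b \<in> Basis \<Longrightarrow> dd b F q (F' b q)"
    and bd: "\<And>b q. b \<in> Basis \<Longrightarrow> \<bar>F' b q\<bar> \<le> B"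
    and S: "0 \<le> S" "\<And>z. F (shp p (z, S)) = 0"
  shows "TT S snd (F' (0,1)) p - (\<Sum>i\<in>Basis. TT S (\<lambda>\<omega>. - (fst \<omega> \<bullet> i)) (F' (i,0)) p) = F p"
proof -
  interpret pair_sigma_finite "gm :: 'a measure" "restrict_space lborel {0..S::real}" by (rule pair_Tm)
  interpret G: prob_space "gm :: 'a measure" by (rule prob_space_gm)
  have B1: "(i,0) \<in> Basis" if "i \<in> Basis" for i :: 'a using that by (auto simp: Basis_prod_def)
  have B2: "(0,1) \<in> (Basis :: ('a \<times> real) set)" by (auto simp: Basis_prod_def)
  have i1: "integrable (Tm S) (\<lambda>\<omega>. snd \<omega> * F' (0,1) (shp p \<omega>))"
    by (rule TT_integrable[OF integrable_w1 F(1)[OF B2] bd[OF B2]])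
  have i2: "integrable (Tm S) (\<lambda>\<omega>. - (fst \<omega> \<bullet> i) * F' (i,0) (shp p \<omega>))" if "i \<in> Basis" for i
    by (rule TT_integrable[OF integrable_wi[OF that] F(1)[OF B1[OF that]] bd[OF B1[OF that]]])
  define I where "I \<omega> = snd \<omega> * F' (0,1) (shp p \<omega>) - (\<Sum>i\<in>Basis. - (fst \<omega> \<bullet> i) * F' (i,0) (shp p \<omega>))" for \<omega>
  have "TT S snd (F' (0,1)) p - (\<Sum>i\<in>Basis. TT S (\<lambda>\<omega>. - (fst \<omega> \<bullet> i)) (F' (i,0)) p) = (\<integral>\<omega>. I \<omega> \<partial>Tm S)"
    unfolding I_def TT_def using i1 i2
    by (subst Bochner_Integration.integral_diff) (auto intro!: Bochner_Integration.integrable_sum Bochner_Integration.integral_sum[symmetric])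
  also have "\<dots> = (\<integral>z. (\<integral>\<sigma>. I (z, \<sigma>) \<partial>restrict_space lborel {0..S}) \<partial>gm)"
  proof -
    have "integrable (gm \<Otimes>\<^sub>M restrict_space lborel {0..S}) (\<lambda>(z, \<sigma>). I (z, \<sigma>))"
      using i1 i2 unfolding I_def Tm_def[symmetric] case_prod_unfold by (auto intro!: Bochner_Integration.integrable_diff Bochner_Integration.integrable_sum)
    from integral_fst[OF this] show ?thesis by (simp add: Tm_def case_prod_unfold)
  qed
  also have "\<dots> = (\<integral>z. F p \<partial>(gm :: 'a measure))"
  proof (rule Bochner_Integration.integral_cong[OF refl])
    fix z :: 'a
    have c: "continuous_on UNIV (\<lambda>\<sigma>. shp p (z, \<sigma>))" unfolding shp_def by (intro continuous_intros) auto
    have der: "((\<lambda>\<sigma>. - F (shp p (z, \<sigma>))) has_real_derivative I (z, \<sigma>)) (at \<sigma>)" for \<sigma>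
    proof -
      have "((\<lambda>\<sigma>. shp p (z, \<sigma>)) has_derivative (\<lambda>h. (- (h *\<^sub>R z), - (\<sigma> * h)))) (at \<sigma>)"
      proof -
        have "((\<lambda>\<sigma>. (fst p - \<sigma> *\<^sub>R z, snd p - \<sigma>\<^sup>2 / 2)) has_derivative (\<lambda>h. (- (h *\<^sub>R z), - (\<sigma> * h)))) (at \<sigma>)"
          by (auto intro!: derivative_eq_intros simp: fun_eq_iff)
        then show ?thesis by (simp add: shp_def[abs_def] minus_prod_def)
      qed
      from has_derivative_compose[OF this C1_has_derivative[OF F(2,1)]]
      have "((\<lambda>\<sigma>. F (shp p (z, \<sigma>))) has_derivative (\<lambda>h. \<Sum>b\<in>Basis. ((- (h *\<^sub>R z), - (\<sigma> * h)) \<bullet> b) * F' b (shp p (z, \<sigma>)))) (at \<sigma>)"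
        by simp
      moreover have "(\<lambda>h. \<Sum>b\<in>Basis. ((- (h *\<^sub>R z), - (\<sigma> * h)) \<bullet> b) * F' b (shp p (z, \<sigma>))) = (\<lambda>h. (- I (z, \<sigma>)) * h)"
        by (auto simp: fun_eq_iff sum_Basis_pair I_def sum_distrib_left sum_negf algebra_simps intro!: sum.cong)
      ultimately have "((\<lambda>\<sigma>. F (shp p (z, \<sigma>))) has_derivative (\<lambda>h. (- I (z, \<sigma>)) * h)) (at \<sigma>)" by argo
      then have "((\<lambda>\<sigma>. F (shp p (z, \<sigma>))) has_real_derivative - I (z, \<sigma>)) (at \<sigma>)"
        by (rule has_derivative_imp_has_field_derivative) simp
      from DERIV_minus[OF this] show ?thesis by simp
    qed
    have contI: "isCont (\<lambda>\<sigma>. I (z, \<sigma>)) \<sigma>" for \<sigma>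
    proof -
      have "continuous_on UNIV (\<lambda>\<sigma>. I (z, \<sigma>))"
        unfolding I_def fst_conv snd_conv
        by (intro continuous_intros continuous_on_compose2[OF F(1) c] B1 B2) auto
      then show ?thesis by (simp add: continuous_on_eq_continuous_at)
    qed
    have "(\<integral>\<sigma>. I (z, \<sigma>) \<partial>restrict_space lborel {0..S}) = (\<integral>\<sigma>. I (z, \<sigma>) * indicator {0..S} \<sigma> \<partial>lborel)"
      by (subst integral_restrict_space) (auto simp: mult.commute)
    also have "\<dots> = - F (shp p (z, S)) - (- F (shp p (z, 0)))"
      by (rule integral_FTC_Icc_real[OF S(1) der contI])
    also have "\<dots> = F p" using S(2)[of z] by (simp add: shp_def zero_prod_def[symmetric])
    finally show "(\<integral>\<sigma>. I (z, \<sigma>) \<partial>restrict_space lborel {0..S}) = F p" .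
  qed
  also have "\<dots> = F p" using G.prob_space by simp
  finally show ?thesis .
qed

text \<open>Of two space derivatives one is absorbed by the weight through \<open>TT_stein\<close>,
  and the other falls on \<open>F\<close>. In this way a right-hand side of class C^1 yields a
  potential with continuous second derivatives, without Hoelder estimates.\<close>

lemma heat_potential:
  fixes F :: "'a::euclidean_space \<times> real \<Rightarrow> real"
  assumes F: "continuous_on UNIV F" "\<And>b. b \<in> Basis \<Longrightarrow> continuous_on UNIV (F' b)"
      "\<And>q b. b \<in> Basis \<Longrightarrow> dd b F q (F' b q)"
    and K: "compact K" "\<And>q. q \<notin> K \<Longrightarrow> F q = 0" and \<delta>: "0 \<le> \<delta>" "\<And>q. snd q \<le> \<delta> \<Longrightarrow> F q = 0"
  obtains P where "C21_on UNIV P" "bounded (range P)" "\<And>p. snd p \<le> \<delta> \<Longrightarrow> P p = 0"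
    "\<And>p. snd p \<le> T \<Longrightarrow> hop P p (F p)"
proof -
  \<comment> \<open>From every time up to \<open>T\<close> the largest time lag
    \<open>S^2 / 2 = \<bar>T\<bar>\<close> reaches back to a time at most 0, where \<open>F\<close>
    vanishes; this is the condition on \<open>F (shp p (z, S))\<close> in
    \<open>TT_ftc\<close>.\<close>
  define S where "S = sqrt (2 * \<bar>T\<bar>)"
  have S: "S \<ge> 0" "S\<^sup>2 / 2 \<ge> T" by (auto simp: S_def)
  have F'0: "F' b q = 0" if "q \<notin> K" "b \<in> Basis" for q b
  proof -
    have "dd b F q 0"
      by (rule dd_cong_open[OF dd_const[of b 0 q], of "- K"]) (use that K in \<open>auto simp: compact_imp_closed\<close>)
    then show ?thesis using F(3)[OF that(2), of q] dd_unique by blast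
  qed
  have bnd: "\<exists>B. \<forall>q. \<bar>H q\<bar> \<le> B" if H: "continuous_on UNIV H" "\<And>q. q \<notin> K \<Longrightarrow> H q = 0" for H :: "'a \<times> real \<Rightarrow> real"
  proof -
    obtain B where "B > 0" "\<And>q. q \<in> K \<Longrightarrow> \<bar>H q\<bar> \<le> B"
      using compact_bound[OF K(1) continuous_on_subset[OF H(1) subset_UNIV]] by blast
    then have "\<bar>H q\<bar> \<le> B" for q using H(2)[of q] by (cases "q \<in> K") auto
    then show ?thesis by blast
  qed
  have "\<forall>b\<in>Basis. \<exists>B. \<forall>q. \<bar>F' b q\<bar> \<le> B" using bnd F(2) F'0 by blast
  then obtain Bf where Bf: "\<And>b q. b \<in> Basis \<Longrightarrow> \<bar>F' b q\<bar> \<le> Bf b" by metis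
  obtain B0 where B0: "\<And>q. \<bar>F q\<bar> \<le> B0" using bnd F(1) K(2) by blast
  define B where "B = \<bar>B0\<bar> + (\<Sum>b\<in>(Basis :: ('a \<times> real) set). \<bar>Bf b\<bar>)"
  have sum0: "(\<Sum>b\<in>(Basis :: ('a \<times> real) set). \<bar>Bf b\<bar>) \<ge> 0" by (intro sum_nonneg) auto
  have B: "\<bar>F q\<bar> \<le> B" "b \<in> Basis \<Longrightarrow> \<bar>F' b q\<bar> \<le> B" for q b
  proof -
    show "\<bar>F q\<bar> \<le> B" using B0[of q] sum0 unfolding B_def by linarith
    show "\<bar>F' b q\<bar> \<le> B" if "b \<in> Basis"
      using Bf[OF that, of q] member_le_sum[of b Basis "\<lambda>b. \<bar>Bf b\<bar>"] that by (simp add: B_def)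
  qed
  have B1: "(i,0) \<in> Basis" if "i \<in> Basis" for i :: 'a using that by (auto simp: Basis_prod_def)
  have B2: "(0,1) \<in> (Basis :: ('a \<times> real) set)" by (auto simp: Basis_prod_def)
  obtain R where R: "\<And>q. q \<in> K \<Longrightarrow> norm q \<le> R" using compact_imp_bounded[OF K(1)] unfolding bounded_iff by auto
  have far: "F q = 0" "b \<in> Basis \<Longrightarrow> F' b q = 0" if "norm (fst q) > R" for q b
  proof -
    have "norm (fst q) \<le> norm q" by (cases q) (simp add: norm_fst_le)
    then have "q \<notin> K" using R[of q] that by auto
    then show "F q = 0" "b \<in> Basis \<Longrightarrow> F' b q = 0" using K(2) F'0 by auto
  qed
  define w where "w i \<omega> = - (fst \<omega> \<bullet> i)" for i :: 'a and \<omega> :: "'a \<times> real"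
  define P where "P = TT S snd F"
  have wi: "integrable (Tm S) (w i)" if "i \<in> Basis" for i using integrable_wi[OF that] by (simp add: w_def[abs_def])
  have st: "TT S snd (F' (i,0)) p = TT S (w i) F p" if "i \<in> Basis" for i p
    unfolding w_def[abs_def]
    by (rule TT_stein[OF that F(1) B(1) F(2)[OF B1[OF that]] B(2)[OF B1[OF that]] F(3)[OF B1[OF that]]])
      (use far B1[OF that] in auto)
  have W: "W21 UNIV P (TT S snd (F' (0,1))) (\<lambda>i. TT S (w i) F) (\<lambda>i j. TT S (w i) (F' (j,0)))"
    unfolding W21_def
  proof (intro conjI ballI)
    show "continuous_on UNIV P" unfolding P_def by (rule TT_cont[OF integrable_w1 F(1) B(1)])
    show "continuous_on UNIV (TT S snd (F' (0,1)))" by (rule TT_cont[OF integrable_w1 F(2)[OF B2] B(2)[OF B2]])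
    show "continuous_on UNIV (TT S (w i) F)" if "i \<in> Basis" for i by (rule TT_cont[OF wi[OF that] F(1) B(1)])
    show "continuous_on UNIV (TT S (w i) (F' (j,0)))" if "i \<in> Basis" "j \<in> Basis" for i j
      by (rule TT_cont[OF wi[OF that(1)] F(2)[OF B1[OF that(2)]] B(2)[OF B1[OF that(2)]]])
    fix p :: "'a \<times> real"
    show "dd (0,1) P p (TT S snd (F' (0,1)) p)" unfolding P_def
      by (rule TT_dd[OF integrable_w1 F(1) B(1) F(2)[OF B2] B(2)[OF B2] F(3)[OF B2]])
    fix i :: 'a assume i: "i \<in> Basis"
    show "dd (i,0) P p (TT S (w i) F p)" unfolding P_def st[OF i, symmetric]
      by (rule TT_dd[OF integrable_w1 F(1) B(1) F(2)[OF B1[OF i]] B(2)[OF B1[OF i]] F(3)[OF B1[OF i]]])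
    fix j :: 'a assume j: "j \<in> Basis"
    show "dd (j,0) (TT S (w i) F) p (TT S (w i) (F' (j,0)) p)"
      by (rule TT_dd[OF wi[OF i] F(1) B(1) F(2)[OF B1[OF j]] B(2)[OF B1[OF j]] F(3)[OF B1[OF j]]])
  qed
  show ?thesis
  proof (rule that[of P])
    show "C21_on UNIV P" by (rule W21_C21[OF open_UNIV W])
    show "bounded (range P)"
      unfolding bounded_iff P_def using TT_bound[OF integrable_w1 F(1) B(1)] by auto
    show "P p = 0" if "snd p \<le> \<delta>" for p
    proof -
      have "F (shp p \<omega>) = 0" for \<omega>
      proof (rule \<delta>(2))
        have "snd (shp p \<omega>) = snd p - (snd \<omega>)\<^sup>2 / 2" "0 \<le> (snd \<omega>)\<^sup>2 / 2" by (simp_all add: shp_def)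
        then show "snd (shp p \<omega>) \<le> \<delta>" using that by linarith
      qed
      then show ?thesis by (simp add: P_def TT_def)
    qed
    show "hop P p (F p)" if "snd p \<le> T" for p
    proof -
      have "F (shp p (z, S)) = 0" for z using that S \<delta>(1) by (intro \<delta>(2)) (simp add: shp_def)
      from TT_ftc[OF F(2,3) B(2) S(1) this]
      have "hW (TT S snd (F' (0,1))) (\<lambda>i j. TT S (w i) (F' (j,0))) p = F p" by (simp add: w_def[abs_def])
      then show ?thesis using W21_hop[OF open_UNIV W, of p] by simp
    qed
  qed
qed

subsection \<open>The nonlinearity\<close>

text \<open>The power is continued by zero, which makes it monotone and continuously differentiable
  on the whole line for \<open>q > 1\<close>. Approximations may then become negative without harm,
  since the absorption switches off there.\<close>

definition gq :: "real \<Rightarrow> real \<Rightarrow> real" where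
  "gq q s = (max 0 s) powr q"

definition gq' :: "real \<Rightarrow> real \<Rightarrow> real" where
  "gq' q s = q * (max 0 s) powr (q - 1)"

lemma gq_nonneg: "gq q s \<ge> 0"
  by (simp add: gq_def)

lemma gq_neg: "s \<le> 0 \<Longrightarrow> gq q s = 0"
  by (simp add: gq_def max_absorb1)

lemma gq_mono: "q > 0 \<Longrightarrow> s \<le> t \<Longrightarrow> gq q s \<le> gq q t"
  unfolding gq_def by (intro powr_mono2) auto

lemma gq_pos_eq: "s \<ge> 0 \<Longrightarrow> gq q s = s powr q"
  by (simp add: gq_def max_absorb2)

lemma cont_gq': "q > 1 \<Longrightarrow> continuous_on UNIV (gq' q)"
  unfolding gq'_def by (intro continuous_intros continuous_on_powr') (auto intro!: continuous_intros)

lemma gq_deriv: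
  assumes "q > 1" shows "(gq q has_real_derivative gq' q s) (at s)"
proof -
  consider "s > 0" | "s < 0" | "s = 0" by linarith
  then show ?thesis
  proof cases
    case 1
    have "((\<lambda>s. s powr q) has_real_derivative q * s powr (q - 1)) (at s)"
      using 1 by (rule has_real_derivative_powr)
    moreover have "\<forall>\<^sub>F x in nhds s. x \<in> {0<..}" using 1 by (intro eventually_nhds_in_open) auto
    then have "\<forall>\<^sub>F x in nhds s. x powr q = gq q x"
      by eventually_elim (simp add: gq_def max_absorb2)
    ultimately show ?thesis
      using DERIV_cong_ev[OF refl _ refl, of "\<lambda>s. s powr q" "gq q" s] 1 by (simp add: gq'_def max_absorb2)
  next
    case 2
    have "\<forall>\<^sub>F x in nhds s. x \<in> {..<0}" using 2 by (intro eventually_nhds_in_open) auto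
    then have "\<forall>\<^sub>F x in nhds s. 0 = gq q x"
      by eventually_elim (simp add: gq_def max_absorb1)
    then show ?thesis
      using DERIV_cong_ev[OF refl _ refl, of "\<lambda>s. 0" "gq q" s 0] 2 by (simp add: gq'_def max_absorb1)
  next
    case 3
    have "isCont (\<lambda>h. \<bar>h\<bar> powr (q - 1)) 0"
    proof -
      have "continuous_on UNIV (\<lambda>h::real. \<bar>h\<bar> powr (q - 1))"
        using assms by (intro continuous_on_powr' continuous_intros) auto
      then show ?thesis by (simp add: continuous_on_eq_continuous_at)
    qed
    then have l: "((\<lambda>h. \<bar>h\<bar> powr (q - 1)) \<longlongrightarrow> 0) (at 0)" using assms by (simp add: isCont_def)
    have "((\<lambda>h. (gq q h - gq q 0) / (h - 0)) \<longlongrightarrow> 0) (at 0)"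
    proof (rule Lim_null_comparison[OF _ l])
      have "norm ((gq q h - gq q 0) / (h - 0)) \<le> \<bar>h\<bar> powr (q - 1)" for h
      proof (cases "h > 0")
        case True
        then have "gq q h / h = h powr (q - 1)" by (simp add: gq_def max_absorb2 powr_diff)
        then show ?thesis using True by (simp add: gq_neg)
      qed (simp add: gq_neg)
      then show "\<forall>\<^sub>F h in at 0. norm ((gq q h - gq q 0) / (h - 0)) \<le> \<bar>h\<bar> powr (q - 1)" by simp
    qed
    then show ?thesis using 3 assms by (simp add: has_field_derivative_iff gq'_def)
  qed
qed

text \<open>The derivative is nonnegative and increasing, so an upper bound on the arguments
  controls it. This fits the Picard iterates, for which only the upper bound is uniform from the
  outset.\<close>

lemma gq_lipschitz:
  assumes "q > 1" "a \<le> C" "b \<le> C"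
  shows "\<bar>gq q a - gq q b\<bar> \<le> gq' q C * \<bar>a - b\<bar>"
proof -
  have "norm (gq q a - gq q b) \<le> gq' q C * norm (a - b)"
  proof (rule field_differentiable_bound[of "{..C}" "gq q" "gq' q"])
    show "(gq q has_field_derivative gq' q z) (at z within {..C})" for z
      using gq_deriv[OF assms(1)] has_field_derivative_at_within by blast
    show "norm (gq' q z) \<le> gq' q C" if "z \<in> {..C}" for z
      using assms(1) that by (auto simp: gq'_def abs_mult intro!: mult_left_mono powr_mono2)
  qed (use assms in auto)
  then show ?thesis by simp
qed

subsection \<open>Smooth cut-off functions\<close>

text \<open>The quotient passes from 1 to 0 between \<open>s = 1\<close> and \<open>s = 2\<close>.
  It is built from \<open>gq 2\<close>, hence of class C^1, the smoothness that
  \<open>heat_potential\<close> asks of a right-hand side.\<close>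

definition bmp :: "real \<Rightarrow> real" where
  "bmp s = gq 2 (2 - s) / (gq 2 (2 - s) + gq 2 (s - 1))"

definition bmp' :: "real \<Rightarrow> real" where
  "bmp' s = (- gq' 2 (2 - s) * (gq 2 (2 - s) + gq 2 (s - 1)) - gq 2 (2 - s) * (- gq' 2 (2 - s) + gq' 2 (s - 1))) /
     ((gq 2 (2 - s) + gq 2 (s - 1)) * (gq 2 (2 - s) + gq 2 (s - 1)))"

lemma bmp_denom: "gq 2 (2 - s) + gq 2 (s - 1) > 0"
proof (cases "s < 2")
  case True
  then have "gq 2 (2 - s) > 0" by (simp add: gq_def max_absorb2)
  then show ?thesis using gq_nonneg[of 2 "s - 1"] by linarith
next
  case False
  then have "gq 2 (s - 1) > 0" by (simp add: gq_def max_absorb2)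
  then show ?thesis using gq_nonneg[of 2 "2 - s"] by linarith
qed

lemma bmp_deriv: "(bmp has_real_derivative bmp' s) (at s)"
proof -
  have a: "((\<lambda>s. gq 2 (2 - s)) has_real_derivative - gq' 2 (2 - s)) (at s)"
  proof -
    have "((\<lambda>s. 2 - s) has_real_derivative - 1) (at s)" by (auto intro!: derivative_eq_intros)
    from DERIV_chain2[of "gq 2" "gq' 2 (2 - s)" "\<lambda>s. 2 - s" s "- 1" UNIV, OF _ this] show ?thesis
      using gq_deriv[of 2 "2 - s"] by simp
  qed
  have b: "((\<lambda>s. gq 2 (s - 1)) has_real_derivative gq' 2 (s - 1)) (at s)"
  proof -
    have "((\<lambda>s. s - 1) has_real_derivative 1) (at s)" by (auto intro!: derivative_eq_intros)
    from DERIV_chain2[of "gq 2" "gq' 2 (s - 1)" "\<lambda>s. s - 1" s 1 UNIV, OF _ this] show ?thesis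
      using gq_deriv[of 2 "s - 1"] by simp
  qed
  show ?thesis unfolding bmp_def bmp'_def
    using bmp_denom[of s] by (intro DERIV_divide a DERIV_add b) auto
qed

lemma cont_bmp': "continuous_on UNIV bmp'"
proof -
  have c: "continuous_on UNIV (\<lambda>s. gq 2 (f s))" "continuous_on UNIV (\<lambda>s. gq' 2 (f s))"
    if "continuous_on UNIV f" for f :: "real \<Rightarrow> real"
  proof -
    have "continuous_on UNIV (gq 2)" using gq_deriv[of 2] by (intro DERIV_continuous_on) auto
    then show "continuous_on UNIV (\<lambda>s. gq 2 (f s))" by (rule continuous_on_compose2[OF _ that]) auto
    show "continuous_on UNIV (\<lambda>s. gq' 2 (f s))" by (rule continuous_on_compose2[OF cont_gq' that]) auto
  qed
  show ?thesis unfolding bmp'_def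
    using bmp_denom by (intro continuous_intros c) (auto simp: less_imp_neq[symmetric])
qed

lemma bmp_bounds: "0 \<le> bmp s" "bmp s \<le> 1" "s \<le> 1 \<Longrightarrow> bmp s = 1" "s \<ge> 2 \<Longrightarrow> bmp s = 0"
  using bmp_denom[of s] gq_nonneg[of 2 "2 - s"] gq_nonneg[of 2 "s - 1"]
  by (auto simp: bmp_def gq_neg divide_le_eq)

definition C1w :: "('e::euclidean_space \<Rightarrow> real) \<Rightarrow> ('e \<Rightarrow> 'e \<Rightarrow> real) \<Rightarrow> bool" where
  "C1w F F' \<longleftrightarrow> continuous_on UNIV F \<and> (\<forall>b\<in>Basis. continuous_on UNIV (F' b) \<and> (\<forall>q. dd b F q (F' b q)))"

lemma bump_C1:
  fixes y :: "'e::euclidean_space"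
  shows "C1w (\<lambda>q. bmp ((norm (q - y))\<^sup>2 / r\<^sup>2)) (\<lambda>b q. bmp' ((norm (q - y))\<^sup>2 / r\<^sup>2) * (2 * ((q - y) \<bullet> b) / r\<^sup>2))"
proof -
  have "continuous_on UNIV bmp" using bmp_deriv by (intro DERIV_continuous_on) auto
  then have 1: "continuous_on UNIV (\<lambda>q. bmp ((norm (q - y))\<^sup>2 / r\<^sup>2))"
    unfolding divide_inverse by (rule continuous_on_compose2) (auto intro!: continuous_intros)
  have 2: "continuous_on UNIV (\<lambda>q. bmp' ((norm (q - y))\<^sup>2 / r\<^sup>2))"
    unfolding divide_inverse by (rule continuous_on_compose2[OF cont_bmp']) (auto intro!: continuous_intros)
  have 3: "dd b (\<lambda>q. (norm (q - y))\<^sup>2 / r\<^sup>2) q (2 * ((q - y) \<bullet> b) / r\<^sup>2)" for b q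
  proof -
    have "(norm (q + s *\<^sub>R b - y))\<^sup>2 = (norm (q - y))\<^sup>2 + 2 * s * ((q - y) \<bullet> b) + s\<^sup>2 * (b \<bullet> b)" for s
    proof -
      have "q + s *\<^sub>R b - y = (q - y) + s *\<^sub>R b" by simp
      then show ?thesis
        by (simp only: power2_norm_eq_inner inner_add_left inner_add_right inner_scaleR_left
            inner_scaleR_right inner_commute[of b "q - y"]) (simp add: power2_eq_square algebra_simps)
    qed
    then show ?thesis unfolding dd_def divide_inverse by (auto intro!: derivative_eq_intros)
  qed
  show ?thesis unfolding C1w_def
    using 1 2 dd_compose[where G=bmp, OF bmp_deriv 3]
    by (auto simp: divide_inverse intro!: continuous_intros)
qed

text \<open>\<open>X n\<close> is \<open>1 - (\<Prod>j<n. 1 - \<eta> j)\<close>, written as a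
  recursion, for bumps \<eta> attached to a countable cover by balls. It increases with
  \<open>n\<close>, is supported in finitely many closed balls, and equals 1 on a ball as soon as
  the bump of that ball has entered the product.\<close>

lemma cutoff_exists:
  fixes D :: "'e::euclidean_space set"
  assumes D: "open D" "D \<noteq> {}"
  obtains \<kappa> \<kappa>' K where "\<And>n. C1w (\<kappa> n) (\<kappa>' n)" "\<And>n q. 0 \<le> \<kappa> n q \<and> \<kappa> n q \<le> 1" "\<And>n q. \<kappa> n q \<le> \<kappa> (Suc n) q"
    "\<And>n. compact (K n)" "\<And>n. K n \<subseteq> D" "\<And>n q. q \<notin> K n \<Longrightarrow> \<kappa> n q = 0"
    "\<And>p. p \<in> D \<Longrightarrow> \<exists>U N. open U \<and> p \<in> U \<and> (\<forall>n\<ge>N. \<forall>q\<in>U. \<kappa> n q = 1)"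
proof -
  have "\<forall>p\<in>D. \<exists>r>0. cball p (2 * r) \<subseteq> D"
  proof
    fix p assume "p \<in> D"
    then obtain e where "e > 0" "cball p e \<subseteq> D" using D open_contains_cball by blast
    then show "\<exists>r>0. cball p (2 * r) \<subseteq> D" by (intro exI[of _ "e / 2"]) auto
  qed
  then obtain r where r: "\<And>p. p \<in> D \<Longrightarrow> r p > 0" "\<And>p. p \<in> D \<Longrightarrow> cball p (2 * r p) \<subseteq> D" by metis
  obtain F' where F': "F' \<subseteq> (\<lambda>p. ball p (r p)) ` D" "countable F'" "\<Union>F' = \<Union>((\<lambda>p. ball p (r p)) ` D)"
    using Lindelof[of "(\<lambda>p. ball p (r p)) ` D"] by blast
  have cov: "D \<subseteq> \<Union>F'" unfolding F'(3) using r(1) by force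
  then have ne: "F' \<noteq> {}" using D by auto
  have "\<forall>n. \<exists>p\<in>D. from_nat_into F' n = ball p (r p)" using from_nat_into[OF ne] F'(1) by blast
  then obtain y where y: "\<And>n. y n \<in> D" "\<And>n. from_nat_into F' n = ball (y n) (r (y n))" by metis
  have covn: "\<exists>n. p \<in> ball (y n) (r (y n))" if "p \<in> D" for p
  proof -
    obtain B where "B \<in> F'" "p \<in> B" using cov \<open>p \<in> D\<close> by blast
    then show ?thesis using from_nat_into_surj[OF F'(2)] y(2) by metis
  qed
  define \<eta> where "\<eta> n q = bmp ((norm (q - y n))\<^sup>2 / (r (y n))\<^sup>2)" for n q
  define \<eta>' where "\<eta>' n b q = bmp' ((norm (q - y n))\<^sup>2 / (r (y n))\<^sup>2) * (2 * ((q - y n) \<bullet> b) / (r (y n))\<^sup>2)" for n b q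
  have \<eta>C: "C1w (\<eta> n) (\<eta>' n)" for n unfolding \<eta>_def[abs_def] \<eta>'_def[abs_def] by (rule bump_C1)
  have \<eta>01: "0 \<le> \<eta> n q" "\<eta> n q \<le> 1" for n q by (auto simp: \<eta>_def bmp_bounds)
  have \<eta>1: "\<eta> n q = 1" if "q \<in> ball (y n) (r (y n))" for n q
  proof -
    have "(norm (q - y n))\<^sup>2 \<le> (r (y n))\<^sup>2"
      using that by (intro power_mono) (auto simp: dist_norm norm_minus_commute)
    then show ?thesis using r(1)[OF y(1), of n] unfolding \<eta>_def by (intro bmp_bounds) (auto simp: divide_le_eq)
  qed
  have \<eta>0: "\<eta> n q = 0" if "q \<notin> cball (y n) (2 * r (y n))" for n q
  proof -
    have "(2 * r (y n))\<^sup>2 \<le> (norm (q - y n))\<^sup>2"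
      using that r(1)[OF y(1), of n] by (intro power_mono) (auto simp: dist_norm norm_minus_commute)
    moreover have "(r (y n))\<^sup>2 > 0" using r(1)[OF y(1), of n] by simp
    ultimately show ?thesis unfolding \<eta>_def by (intro bmp_bounds) (auto simp: le_divide_eq power2_eq_square)
  qed
  define X where "X = rec_nat ((\<lambda>q. 0) :: 'e \<Rightarrow> real) (\<lambda>n f q. f q + (1 - f q) * \<eta> n q)"
  define X' where "X' = rec_nat ((\<lambda>b q. 0) :: 'e \<Rightarrow> 'e \<Rightarrow> real) (\<lambda>n f b q. f b q + ((0 - f b q) * \<eta> n q + \<eta>' n b q * (1 - X n q)))"
  have X: "X 0 q = 0" "X (Suc n) q = X n q + (1 - X n q) * \<eta> n q" for n q by (simp_all add: X_def)
  have X': "X' 0 b q = 0" "X' (Suc n) b q = X' n b q + ((0 - X' n b q) * \<eta> n q + \<eta>' n b q * (1 - X n q))" for n q b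
    by (simp_all add: X'_def)
  have C: "C1w (X n) (X' n)" for n
  proof (induction n)
    case 0
    then show ?case using dd_const by (auto simp: C1w_def X X' fun_eq_iff[of "X 0"] cong: continuous_on_cong)
  next
    case (Suc n)
    have eq: "X (Suc n) = (\<lambda>q. X n q + (1 - X n q) * \<eta> n q)"
      "X' (Suc n) = (\<lambda>b q. X' n b q + ((0 - X' n b q) * \<eta> n q + \<eta>' n b q * (1 - X n q)))"
      by (auto simp: X X' fun_eq_iff)
    have c: "continuous_on UNIV (X n)" "continuous_on UNIV (\<eta> n)"
      "b \<in> Basis \<Longrightarrow> continuous_on UNIV (X' n b)" "b \<in> Basis \<Longrightarrow> continuous_on UNIV (\<eta>' n b)"
      "b \<in> Basis \<Longrightarrow> dd b (X n) q (X' n b q)" "b \<in> Basis \<Longrightarrow> dd b (\<eta> n) q (\<eta>' n b q)" for b q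
      using Suc \<eta>C[of n] unfolding C1w_def by blast+
    show ?case unfolding C1w_def eq
    proof (intro conjI ballI allI)
      show "dd b (\<lambda>q. X n q + (1 - X n q) * \<eta> n q) q (X' n b q + ((0 - X' n b q) * \<eta> n q + \<eta>' n b q * (1 - X n q)))"
        if "b \<in> Basis" for b q
        by (rule dd_add[OF c(5)[OF that] dd_mult[OF dd_diff[OF dd_const c(5)[OF that]] c(6)[OF that]]])
    qed (intro continuous_intros c; assumption)+
  qed
  have b: "0 \<le> X n q \<and> X n q \<le> 1" for n q
  proof (induction n)
    case (Suc n)
    have "(1 - X n q) * \<eta> n q \<le> (1 - X n q) * 1" using Suc \<eta>01 by (intro mult_left_mono) auto
    moreover have "(1 - X n q) * \<eta> n q \<ge> 0" using Suc \<eta>01 by simp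
    ultimately show ?case using Suc by (auto simp: X)
  qed (simp add: X)
  have m: "X n q \<le> X (Suc n) q" for n q using b[of n q] \<eta>01[of n q] by (simp add: X)
  define K where "K n = (\<Union>j<n. cball (y j) (2 * r (y j)))" for n
  have z: "X n q = 0" if "q \<notin> K n" for n q
    using that by (induction n) (auto simp: X K_def less_Suc_eq \<eta>0)
  have one: "X n q = 1" if "q \<in> ball (y j) (r (y j))" "n > j" for n q j
  proof -
    have "X (Suc j + k) q = 1" for k
      by (induction k) (auto simp: X \<eta>1[OF that(1)])
    from this[of "n - Suc j"] show ?thesis using that(2) by simp
  qed
  show ?thesis
  proof (rule that[of X X' K])
    show "compact (K n)" for n unfolding K_def by (intro compact_UN) auto
    show "K n \<subseteq> D" for n unfolding K_def using r(2) y(1) by blast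
    show "\<exists>U N. open U \<and> p \<in> U \<and> (\<forall>n\<ge>N. \<forall>q\<in>U. X n q = 1)" if pD: "p \<in> D" for p
    proof -
      obtain j where "p \<in> ball (y j) (r (y j))" using covn[OF pD] by blast
      then show ?thesis using one by (intro exI[of _ "ball (y j) (r (y j))"] exI[of _ "Suc j"]) auto
    qed
  qed (use C b m z in auto)
qed

text \<open>The open sets \<open>D\<close> and \<open>- K\<close> cover the space, and the extended
  function vanishes on the second; continuity and derivatives can be checked on each
  separately.\<close>

lemma C1_extend:
  fixes D :: "'e::euclidean_space set"
  assumes D: "open D" and K: "compact K" "K \<subseteq> D"
    and G: "continuous_on D G" "\<And>b. b \<in> Basis \<Longrightarrow> continuous_on D (G' b)"
      "\<And>b p. b \<in> Basis \<Longrightarrow> p \<in> D \<Longrightarrow> dd b G p (G' b p)"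
    and z: "\<And>p. p \<in> D \<Longrightarrow> p \<notin> K \<Longrightarrow> G p = 0"
  shows "C1w (\<lambda>p. if p \<in> D then G p else 0) (\<lambda>b p. if p \<in> D then G' b p else 0)"
proof -
  have oK: "open (- K)" using K(1) by (simp add: compact_imp_closed open_Compl)
  have z': "G' b p = 0" if "p \<in> D" "p \<notin> K" "b \<in> Basis" for b p
  proof -
    have "dd b G p 0"
      by (rule dd_cong_open[OF dd_const[of b 0 p], of "D \<inter> - K"]) (use that z D oK in auto)
    then show ?thesis using G(3)[OF that(3,1)] dd_unique by blast
  qed
  have c: "continuous_on UNIV (\<lambda>p. if p \<in> D then f p else 0)"
    if "continuous_on D f" "\<And>p. p \<in> D \<Longrightarrow> p \<notin> K \<Longrightarrow> f p = 0" for f :: "'e \<Rightarrow> real"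
  proof -
    have "continuous_on (D \<union> - K) (\<lambda>p. if p \<in> D then f p else 0)"
    proof (rule continuous_on_open_Un[OF D oK])
      show "continuous_on D (\<lambda>p. if p \<in> D then f p else 0)"
        by (rule continuous_on_eq[OF that(1)]) simp
      show "continuous_on (- K) (\<lambda>p. if p \<in> D then f p else 0)"
        by (rule continuous_on_eq[OF continuous_on_const[of _ 0]]) (use that(2) in auto)
    qed
    moreover have "D \<union> - K = UNIV" using K by auto
    ultimately show ?thesis by simp
  qed
  have d: "dd b (\<lambda>p. if p \<in> D then G p else 0) p (if p \<in> D then G' b p else 0)" if "b \<in> Basis" for b p
  proof (cases "p \<in> D")
    case True
    then show ?thesis using dd_cong_open[OF G(3)[OF that True] D True, of "\<lambda>p. if p \<in> D then G p else 0"] by simp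
  next
    case False
    then have "p \<in> - K" using K by auto
    then have "dd b (\<lambda>p. if p \<in> D then G p else 0) p 0"
      by (intro dd_cong_open[OF dd_const[of b 0 p] oK]) (use z in auto)
    then show ?thesis using False by simp
  qed
  show ?thesis unfolding C1w_def using c[OF G(1) z] c[OF G(2) z'] d by auto
qed

subsection \<open>Linear problems with constant initial data\<close>

text \<open>The heat potential \<open>P\<close> takes care of the right-hand side, and the
  homogeneous solution \<open>v\<close> from \<open>PWC\<close> corrects the lateral values.
  Constancy of \<open>h\<close> near time 0 makes the correction vanish there, as \<open>PWC\<close>
  requires.\<close>

lemma linear_solve:
  fixes \<Omega> :: "'a::euclidean_space set"
  assumes \<Omega>: "open \<Omega>" "PWC \<Omega>" and F: "C1w F F'" and K: "compact K" "\<And>p. p \<notin> K \<Longrightarrow> F p = 0"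
    and \<delta>: "0 < \<delta>" "\<And>p. snd p \<le> \<delta> \<Longrightarrow> F p = 0" and T: "0 < T"
    and h: "continuous_on (frontier \<Omega> \<times> {0<..}) h" "\<And>x t. t \<le> \<delta> \<Longrightarrow> h (x, t) = c"
  obtains u where "continuous_on (closure \<Omega> \<times> {0..}) u" "bounded (u ` (closure \<Omega> \<times> {0..}))"
    "C21_on (\<Omega> \<times> {0<..}) u" "\<And>p. p \<in> \<Omega> \<times> {0<..T} \<Longrightarrow> hop u p (F p)"
    "\<And>x t. x \<in> frontier \<Omega> \<Longrightarrow> 0 < t \<Longrightarrow> t \<le> T \<Longrightarrow> u (x, t) = h (x, t)"
    "\<And>x. x \<in> closure \<Omega> \<Longrightarrow> u (x, 0) = c"
proof -
  have D: "open (\<Omega> \<times> {0::real<..})" by (intro open_Times \<Omega>) auto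
  have F1: "continuous_on UNIV F" "\<And>b. b \<in> Basis \<Longrightarrow> continuous_on UNIV (F' b)"
    "\<And>q b. b \<in> Basis \<Longrightarrow> dd b F q (F' b q)" using F by (auto simp: C1w_def)
  obtain P where P: "C21_on UNIV P" "bounded (range P)" "\<And>p. snd p \<le> \<delta> \<Longrightarrow> P p = 0"
    "\<And>p. snd p \<le> T \<Longrightarrow> hop P p (F p)"
    using heat_potential[OF F1 K less_imp_le[OF \<delta>(1)] \<delta>(2), of T] by blast
  have Pc: "continuous_on A P" for A using P(1) continuous_on_subset unfolding C21_on_def by blast
  \<comment> \<open>\<zeta> is 1 up to time \<open>T\<close> and 0 from \<open>2 * T\<close> on: the
    datum handed to \<open>PWC\<close> must live in a bounded time window, while the lateral values
    are claimed up to \<open>T\<close>.\<close>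
  define \<zeta> where "\<zeta> t = max 0 (min 1 (2 - t / T))" for t :: real
  define g where "g p = \<zeta> (snd p) * (c + P p - h p)" for p
  have gc: "continuous_on (frontier \<Omega> \<times> {0<..}) g"
    unfolding g_def \<zeta>_def divide_inverse by (intro continuous_intros Pc h(1))
  have gz: "g (x, t) = 0" if "t \<le> \<delta> \<or> 2 * T \<le> t" for x t
    using that
  proof
    assume "t \<le> \<delta>" then show ?thesis using P(3)[of "(x,t)"] h(2)[of t x] by (simp add: g_def)
  next
    assume "2 * T \<le> t" then show ?thesis using T by (simp add: g_def \<zeta>_def field_simps)
  qed
  obtain v where v: "continuous_on (closure \<Omega> \<times> {0..}) v" "bounded (v ` (closure \<Omega> \<times> {0..}))"
    "C21_on (\<Omega> \<times> {0<..}) v" "\<forall>p\<in>\<Omega> \<times> {0<..}. pdt v p - lap v p = 0"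
    "\<forall>p\<in>frontier \<Omega> \<times> {0<..}. v p = g p" "\<forall>x\<in>closure \<Omega>. v (x, 0) = 0"
    using \<Omega>(2)[unfolded PWC_def, rule_format, of g \<delta> "2 * T"] gc gz \<delta>(1) by blast
  show ?thesis
  proof (rule that[of "\<lambda>p. c + P p - v p"])
    show "continuous_on (closure \<Omega> \<times> {0..}) (\<lambda>p. c + P p - v p)" by (intro continuous_intros Pc v)
    obtain B1 where B1: "\<And>p. \<bar>P p\<bar> \<le> B1" using P(2) unfolding bounded_iff by auto
    obtain B2 where B2: "\<And>p. p \<in> closure \<Omega> \<times> {0..} \<Longrightarrow> \<bar>v p\<bar> \<le> B2" using v(2) unfolding bounded_iff by auto
    show "bounded ((\<lambda>p. c + P p - v p) ` (closure \<Omega> \<times> {0..}))"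
      unfolding bounded_iff
    proof (intro exI ballI)
      fix z assume "z \<in> (\<lambda>p. c + P p - v p) ` (closure \<Omega> \<times> {0..})"
      then obtain p where p: "p \<in> closure \<Omega> \<times> {0..}" "z = c + P p - v p" by blast
      show "norm z \<le> \<bar>c\<bar> + B1 + B2" using B1[of p] B2[OF p(1)] p(2) by simp
    qed
    show "C21_on (\<Omega> \<times> {0<..}) (\<lambda>p. c + P p - v p)"
      by (intro C21_diff C21_add C21_const D v C21_subset[OF P(1)]) auto
    show "hop (\<lambda>p. c + P p - v p) p (F p)" if "p \<in> \<Omega> \<times> {0<..T}" for p
    proof -
      have p: "p \<in> \<Omega> \<times> {0<..}" "snd p \<le> T" using that by auto
      have "hop v p 0" using hop_iff_C21[OF D v(3) p(1)] v(4) p(1) by simp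
      from hop_diff[OF hop_add[OF hop_const[of c p] P(4)[OF p(2)]] this] show ?thesis by simp
    qed
    show "c + P (x, t) - v (x, t) = h (x, t)" if "x \<in> frontier \<Omega>" "0 < t" "t \<le> T" for x t
    proof -
      have "\<zeta> t = 1" using that T by (simp add: \<zeta>_def field_simps)
      then show ?thesis using v(5)[rule_format, of "(x,t)"] that by (simp add: g_def)
    qed
    show "c + P (x, 0) - v (x, 0) = c" if "x \<in> closure \<Omega>" for x
      using v(6) that P(3)[of "(x,0)"] \<delta>(1) by simp
  qed
qed

text \<open>The heat operators are compared only where \<open>u\<close> exceeds \<open>v\<close>;
  there a monotone absorption has the right sign, which is how the nonlinear terms enter all later
  comparisons.\<close>

lemma compare_sol:
  fixes u :: "'a::euclidean_space \<times> real \<Rightarrow> real"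
  assumes "open \<Omega>" and c: "continuous_on (closure \<Omega> \<times> {a..b}) u" "continuous_on (closure \<Omega> \<times> {a..b}) v"
    and bdd: "\<And>p. p \<in> closure \<Omega> \<times> {a..b} \<Longrightarrow> u p \<le> C" "\<And>p. p \<in> closure \<Omega> \<times> {a..b} \<Longrightarrow> - C \<le> v p"
    and init: "\<And>x. x \<in> closure \<Omega> \<Longrightarrow> u (x, a) \<le> v (x, a)"
    and lat: "\<And>x t. x \<in> frontier \<Omega> \<Longrightarrow> a < t \<Longrightarrow> t \<le> b \<Longrightarrow> u (x, t) \<le> v (x, t)"
    and eq: "\<And>x t. x \<in> \<Omega> \<Longrightarrow> a < t \<Longrightarrow> t \<le> b \<Longrightarrow> v (x, t) < u (x, t) \<Longrightarrow>
        \<exists>h k. hop u (x, t) h \<and> hop v (x, t) k \<and> h \<le> k"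
    and p: "p \<in> closure \<Omega> \<times> {a..b}"
  shows "u p \<le> v p"
proof -
  have "u p - v p \<le> 0"
  proof (rule comparison[OF assms(1), of a b "\<lambda>p. u p - v p" "2 * C"])
    show "continuous_on (closure \<Omega> \<times> {a..b}) (\<lambda>p. u p - v p)" by (intro continuous_intros c)
    show "u p - v p \<le> 2 * C" if "p \<in> closure \<Omega> \<times> {a..b}" for p using bdd[OF that] by simp
    show "u (x, a) - v (x, a) \<le> 0" if "x \<in> closure \<Omega>" for x using init[OF that] by simp
    show "u (x, t) - v (x, t) \<le> 0" if "x \<in> frontier \<Omega>" "a \<le> t" "t \<le> b" for x t
      using lat[OF that(1) _ that(3)] init[of x] that by (cases "t = a") (auto simp: frontier_def)
    show "\<exists>h\<le>0. hop (\<lambda>p. u p - v p) (x, t) h" if xt: "x \<in> \<Omega>" "a < t" "t \<le> b" "0 < u (x, t) - v (x, t)" for x t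
    proof -
      obtain h k where "hop u (x, t) h" "hop v (x, t) k" "h \<le> k" using eq[OF xt(1-3)] xt(4) by auto
      then show ?thesis using hop_diff[of u "(x,t)" h v k] by (intro exI[of _ "h - k"]) auto
    qed
  qed (rule p)
  then show ?thesis by simp
qed

subsection \<open>Picard iteration for the truncated absorption\<close>

text \<open>Each iterate stays below \<open>C\<close> because its right-hand side is nonpositive, so
  \<open>gq q\<close> has the Lipschitz constant \<open>L\<close> along the whole iteration.
  Iterates may be negative; nonnegativity is recovered for the limit, which satisfies the heat
  equation wherever it is negative. The cut-off \<kappa> makes the right-hand side vanish near the
  lateral boundary and near time 0, as the linear problem requires.\<close>

lemma picard:
  fixes \<Omega> :: "'a::euclidean_space set"
  assumes \<Omega>: "open \<Omega>" "PWC \<Omega>" and q: "q > 1" and \<delta>: "0 < \<delta>" and T: "0 < T" and c: "0 \<le> c" "c \<le> C"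
    and h: "continuous_on (frontier \<Omega> \<times> {0<..}) h" "\<And>x t. t \<le> \<delta> \<Longrightarrow> h (x, t) = c"
      "\<And>x t. x \<in> frontier \<Omega> \<Longrightarrow> 0 < t \<Longrightarrow> t \<le> T \<Longrightarrow> 0 \<le> h (x, t) \<and> h (x, t) \<le> C"
    and \<kappa>: "C1w \<kappa> \<kappa>'" "\<And>p. 0 \<le> \<kappa> p \<and> \<kappa> p \<le> 1"
    and K: "compact K" "K \<subseteq> \<Omega> \<times> {0<..}" "\<And>p. p \<notin> K \<Longrightarrow> \<kappa> p = 0"
  obtains u where "continuous_on (closure \<Omega> \<times> {0..T}) u" "C21_on (\<Omega> \<times> {0<..<T}) u"
    "\<And>p. p \<in> \<Omega> \<times> {0<..<T} \<Longrightarrow> hop u p (- (\<kappa> p * gq q (u p)))"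
    "\<And>x t. x \<in> frontier \<Omega> \<Longrightarrow> 0 < t \<Longrightarrow> t \<le> T \<Longrightarrow> u (x, t) = h (x, t)"
    "\<And>x. x \<in> closure \<Omega> \<Longrightarrow> u (x, 0) = c"
    "\<And>p. p \<in> closure \<Omega> \<times> {0..<T} \<Longrightarrow> 0 \<le> u p \<and> u p \<le> C"
proof -
  let ?D = "\<Omega> \<times> {0::real<..}"
  let ?S = "closure \<Omega> \<times> {0..T}"
  have D: "open ?D" by (intro open_Times \<Omega>) auto
  have gc: "continuous_on UNIV (gq q)" using gq_deriv[OF q] by (intro DERIV_continuous_on) auto
  have \<kappa>c: "continuous_on A \<kappa>" "b \<in> Basis \<Longrightarrow> continuous_on A (\<kappa>' b)" "b \<in> Basis \<Longrightarrow> dd b \<kappa> p (\<kappa>' b p)" for A b p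
  proof -
    have \<kappa>U: "continuous_on UNIV \<kappa>" "b \<in> Basis \<Longrightarrow> continuous_on UNIV (\<kappa>' b)" "b \<in> Basis \<Longrightarrow> dd b \<kappa> p (\<kappa>' b p)"
      using \<kappa>(1) unfolding C1w_def by blast+
    show "continuous_on A \<kappa>" "b \<in> Basis \<Longrightarrow> continuous_on A (\<kappa>' b)" "b \<in> Basis \<Longrightarrow> dd b \<kappa> p (\<kappa>' b p)"
      using continuous_on_subset[OF \<kappa>U(1) subset_UNIV] continuous_on_subset[OF \<kappa>U(2) subset_UNIV] \<kappa>U(3) by blast+
  qed
  \<comment> \<open>The compact set \<open>K\<close> keeps a positive distance from time 0, so
    \<kappa> vanishes during a short initial time.\<close>
  obtain \<delta>' where \<delta>': "0 < \<delta>'" "\<delta>' \<le> \<delta>" "\<And>p. snd p \<le> \<delta>' \<Longrightarrow> \<kappa> p = 0"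
  proof (cases "K = {}")
    case True
    then show ?thesis using that[of \<delta>] \<delta> K(3) by auto
  next
    case False
    have "\<exists>m\<in>K. \<forall>p\<in>K. snd m \<le> snd p"
      using continuous_attains_inf[OF K(1) False continuous_on_snd[OF continuous_on_id]] .
    then obtain m where m: "m \<in> K" "\<And>p. p \<in> K \<Longrightarrow> snd m \<le> snd p" by blast
    have "snd m > 0" using m(1) K(2) by auto
    show ?thesis
    proof (rule that[of "min \<delta> (snd m / 2)"])
      show "\<kappa> p = 0" if "snd p \<le> min \<delta> (snd m / 2)" for p
        using that m(2)[of p] \<open>snd m > 0\<close> K(3)[of p] by auto
    qed (use \<delta> \<open>snd m > 0\<close> in auto)
  qed
  have h': "\<And>x t. t \<le> \<delta>' \<Longrightarrow> h (x, t) = c" using h(2) \<delta>'(2) by auto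
  define I where "I u \<longleftrightarrow> continuous_on (closure \<Omega> \<times> {0..}) u \<and> bounded (u ` (closure \<Omega> \<times> {0..})) \<and> C21_on ?D u \<and>
    (\<forall>x t. x \<in> frontier \<Omega> \<longrightarrow> 0 < t \<longrightarrow> t \<le> T \<longrightarrow> u (x, t) = h (x, t)) \<and> (\<forall>x\<in>closure \<Omega>. u (x, 0) = c) \<and>
    (\<forall>p\<in>?S. u p \<le> C)" for u
  have base: "\<exists>u. I u \<and> (\<forall>p\<in>\<Omega> \<times> {0<..T}. hop u p (F p))"
    if F: "C1w F F'" "\<And>p. p \<notin> K \<Longrightarrow> F p = 0" "\<And>p. snd p \<le> \<delta>' \<Longrightarrow> F p = 0" "\<And>p. p \<in> ?D \<Longrightarrow> F p \<le> 0" for F F'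
  proof -
    obtain u where u: "continuous_on (closure \<Omega> \<times> {0..}) u" "bounded (u ` (closure \<Omega> \<times> {0..}))"
      "C21_on ?D u" "\<And>p. p \<in> \<Omega> \<times> {0<..T} \<Longrightarrow> hop u p (F p)"
      "\<And>x t. x \<in> frontier \<Omega> \<Longrightarrow> 0 < t \<Longrightarrow> t \<le> T \<Longrightarrow> u (x, t) = h (x, t)"
      "\<And>x. x \<in> closure \<Omega> \<Longrightarrow> u (x, 0) = c"
      using linear_solve[OF \<Omega> F(1) K(1) F(2) \<delta>'(1) F(3) T h(1) h'] by blast
    obtain B where B: "\<And>p. p \<in> closure \<Omega> \<times> {0..} \<Longrightarrow> \<bar>u p\<bar> \<le> B" using u(2) unfolding bounded_iff by auto
    have "u p \<le> C" if p: "p \<in> ?S" for p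
    proof (rule compare_sol[OF \<Omega>(1), of 0 T u "\<lambda>_. C" "\<bar>B\<bar>"])
      show "continuous_on ?S u" by (rule continuous_on_subset[OF u(1)]) auto
      show "u p \<le> \<bar>B\<bar>" if "p \<in> ?S" for p using B[of p] that by (cases p) auto
      show "- \<bar>B\<bar> \<le> C" using c by linarith
      show "\<exists>h k. hop u (x, t) h \<and> hop (\<lambda>_. C) (x, t) k \<and> h \<le> k" if "x \<in> \<Omega>" "0 < t" "t \<le> T" for x t
        using u(4)[of "(x,t)"] F(4)[of "(x,t)"] hop_const[of C "(x,t)"] that by (intro exI[of _ "F (x,t)"] exI[of _ 0]) auto
    qed (use u(5,6) h(3) c p in auto)
    then show ?thesis using u unfolding I_def by (intro exI[of _ u]) auto
  qed
  have step: "\<exists>u'. I u' \<and> (\<forall>p\<in>\<Omega> \<times> {0<..T}. hop u' p (- (\<kappa> p * gq q (u p))))" if u: "I u" for u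
  proof -
    have W: "W21 ?D u (pdt u) (\<lambda>i. pdx i u) (\<lambda>i j. pdx j (pdx i u))"
      using u C21_W21 unfolding I_def by blast
    define u' where "u' b = (if snd b = 0 then pdx (fst b) u else pdt u)" for b :: "'a \<times> real"
    have u': "continuous_on ?D (u' b)" "p \<in> ?D \<Longrightarrow> dd b u p (u' b p)" if "b \<in> Basis" for b p
      using W that unfolding W21_def u'_def Basis_prod_def by auto
    have uc: "continuous_on ?D u" using W by (simp add: W21_def)
    have gu: "continuous_on ?D (\<lambda>p. gq q (u p))" "continuous_on ?D (\<lambda>p. gq' q (u p))"
      using continuous_on_compose2[OF gc uc] continuous_on_compose2[OF cont_gq'[OF q] uc] by auto
    have "C1w (\<lambda>p. if p \<in> ?D then - (\<kappa> p * gq q (u p)) else 0)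
       (\<lambda>b p. if p \<in> ?D then - (\<kappa>' b p * gq q (u p) + (gq' q (u p) * u' b p) * \<kappa> p) else 0)"
    proof (rule C1_extend[OF D K(1,2)])
      show "continuous_on ?D (\<lambda>p. - (\<kappa> p * gq q (u p)))" by (intro continuous_intros \<kappa>c gu)
      fix b :: "'a \<times> real" assume b: "b \<in> Basis"
      show "continuous_on ?D (\<lambda>p. - (\<kappa>' b p * gq q (u p) + (gq' q (u p) * u' b p) * \<kappa> p))"
        by (intro continuous_intros \<kappa>c gu u' b)
      show "dd b (\<lambda>p. - (\<kappa> p * gq q (u p))) p (- (\<kappa>' b p * gq q (u p) + (gq' q (u p) * u' b p) * \<kappa> p))" if "p \<in> ?D" for p
        by (intro dd_minus dd_mult \<kappa>c(3) dd_compose gq_deriv q u'(2) b that)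
    qed (use K(3) in auto)
    from base[OF this] K(3) \<delta>'(3) \<kappa>(2) gq_nonneg
    have "\<exists>u2. I u2 \<and> (\<forall>p\<in>\<Omega> \<times> {0<..T}. hop u2 p (if p \<in> ?D then - (\<kappa> p * gq q (u p)) else 0))"
      by simp
    then obtain u2 where u2: "I u2"
      "\<forall>p\<in>\<Omega> \<times> {0<..T}. hop u2 p (if p \<in> ?D then - (\<kappa> p * gq q (u p)) else 0)" by blast
    have "hop u2 p (- (\<kappa> p * gq q (u p)))" if "p \<in> \<Omega> \<times> {0<..T}" for p
    proof -
      have "p \<in> ?D" using that by auto
      then show ?thesis using bspec[OF u2(2) that] by simp
    qed
    then show ?thesis using u2(1) by blast
  qed
  have "\<exists>u. I u"
    using base[of "\<lambda>_. 0" "\<lambda>_ _. 0"] dd_const by (auto simp: C1w_def)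
  then obtain X where X: "\<And>n. I (X n)" "\<And>n p. p \<in> \<Omega> \<times> {0<..T} \<Longrightarrow> hop (X (Suc n)) p (- (\<kappa> p * gq q (X n p)))"
    using dependent_nat_choice[of "\<lambda>_. I" "\<lambda>_ u u'. \<forall>p\<in>\<Omega> \<times> {0<..T}. hop u' p (- (\<kappa> p * gq q (u p)))"] step by metis
  have Xc: "continuous_on ?S (X n)" for n
    using X(1)[of n] unfolding I_def by (auto intro: continuous_on_subset)
  have XC: "X n p \<le> C" if "p \<in> ?S" for n p using X(1)[of n] that unfolding I_def by auto
  have Xb: "\<exists>B. \<forall>p\<in>?S. \<bar>X n p\<bar> \<le> B" for n
  proof -
    have "bounded (X n ` (closure \<Omega> \<times> {0..}))" using X(1)[of n] unfolding I_def by auto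
    then obtain B where "\<forall>z\<in>X n ` (closure \<Omega> \<times> {0..}). norm z \<le> B" unfolding bounded_iff by blast
    then show ?thesis by (intro exI[of _ B]) auto
  qed
  have Xlat: "X n (x, t) = h (x, t)" if "x \<in> frontier \<Omega>" "0 < t" "t \<le> T" for n x t
    using X(1)[of n] that unfolding I_def by auto
  have X0: "X n (x, 0) = c" if "x \<in> closure \<Omega>" for n x using X(1)[of n] that unfolding I_def by auto
  obtain B0 where B0: "\<And>p. p \<in> ?S \<Longrightarrow> \<bar>X 0 p\<bar> \<le> B0" using Xb by meson
  obtain B1 where B1: "\<And>p. p \<in> ?S \<Longrightarrow> \<bar>X (Suc 0) p\<bar> \<le> B1" using Xb by meson
  define A where "A = \<bar>B0\<bar> + \<bar>B1\<bar>"
  define L where "L = gq' q C"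
  have L: "L \<ge> 0" using q by (simp add: L_def gq'_def)
  have A: "A \<ge> 0" by (simp add: A_def)
  have est: "\<bar>X (Suc n) p - X n p\<bar> \<le> A * (L * snd p) ^ n / fact n" if "p \<in> ?S" for n p
    using that
  proof (induction n arbitrary: p)
    case 0
    then show ?case using B0[of p] B1[of p] by (simp add: A_def)
  next
    case (Suc n)
    \<comment> \<open>The time derivative of \<open>B\<close> is \<open>L\<close> times the bound
      for the preceding difference, so \<open>B\<close> dominates the next difference by comparison;
      the factorials arise as in Picard's theorem for ordinary differential equations.\<close>
    define B where "B t = A * (L * t) ^ Suc n / fact (Suc n)" for t
    have B': "(B has_real_derivative L * (A * (L * t) ^ n / fact n)) (at t)" for t
      unfolding B_def by (rule derivative_eq_intros refl | simp)+
    have Bn: "B t \<ge> 0" if "t \<ge> 0" for t using A L that by (simp add: B_def)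
    have Bc: "continuous_on UNIV B" using B' by (intro DERIV_continuous_on) auto
    obtain C1 where C1: "\<And>p. p \<in> ?S \<Longrightarrow> \<bar>X (Suc n) p\<bar> \<le> C1" using Xb by meson
    obtain C2 where C2: "\<And>p. p \<in> ?S \<Longrightarrow> \<bar>X (Suc (Suc n)) p\<bar> \<le> C2" using Xb by meson
    \<comment> \<open>The sign \<open>s\<close> lets one comparison bound the difference from both
      sides.\<close>
    have one: "s * (X (Suc (Suc n)) p - X (Suc n) p) - B (snd p) \<le> 0" if s: "s = 1 \<or> s = -1" for s
    proof (rule comparison[OF \<Omega>(1), of 0 T "\<lambda>p. s * (X (Suc (Suc n)) p - X (Suc n) p) - B (snd p)" "C1 + C2"])
      show "continuous_on ?S (\<lambda>p. s * (X (Suc (Suc n)) p - X (Suc n) p) - B (snd p))"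
        by (intro continuous_intros Xc continuous_on_compose2[OF Bc]) auto
      show "s * (X (Suc (Suc n)) p - X (Suc n) p) - B (snd p) \<le> C1 + C2" if "p \<in> ?S" for p
        using C1[OF that] C2[OF that] Bn[of "snd p"] s that by (auto simp: mem_Times_iff)
      show "s * (X (Suc (Suc n)) (x, 0) - X (Suc n) (x, 0)) - B (snd (x, 0)) \<le> 0" if "x \<in> closure \<Omega>" for x
        using X0[OF that] Bn[of 0] by simp
      show "s * (X (Suc (Suc n)) (x, t) - X (Suc n) (x, t)) - B (snd (x, t)) \<le> 0" if "x \<in> frontier \<Omega>" "0 \<le> t" "t \<le> T" for x t
        using Xlat[of x t] X0[of x] that Bn[of t] by (cases "t = 0") (auto simp: frontier_def)
      show "\<exists>h\<le>0. hop (\<lambda>p. s * (X (Suc (Suc n)) p - X (Suc n) p) - B (snd p)) (x, t) h" if xt: "x \<in> \<Omega>" "0 < t" "t \<le> T" for x t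
      proof -
        let ?p = "(x, t)"
        have p: "?p \<in> \<Omega> \<times> {0<..T}" "?p \<in> ?S" using xt closure_subset[of \<Omega>] by auto
        have 1: "hop (\<lambda>p. s * (X (Suc (Suc n)) p - X (Suc n) p) - B (snd p)) ?p
           (s * (- (\<kappa> ?p * gq q (X (Suc n) ?p)) - - (\<kappa> ?p * gq q (X n ?p))) - L * (A * (L * t) ^ n / fact n))"
          using hop_time[of B _ ?p, OF B'] by (intro hop_diff hop_cmult X(2) p) auto
        have "s * (- (\<kappa> ?p * gq q (X (Suc n) ?p)) - - (\<kappa> ?p * gq q (X n ?p))) \<le>
            \<kappa> ?p * \<bar>gq q (X (Suc n) ?p) - gq q (X n ?p)\<bar>"
        proof -
          have "s * (- (\<kappa> ?p * gq q (X (Suc n) ?p)) - - (\<kappa> ?p * gq q (X n ?p))) =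
             \<kappa> ?p * (- s * (gq q (X (Suc n) ?p) - gq q (X n ?p)))" by (simp add: algebra_simps)
          also have "\<dots> \<le> \<kappa> ?p * \<bar>gq q (X (Suc n) ?p) - gq q (X n ?p)\<bar>"
            using \<kappa>(2) s by (intro mult_left_mono) auto
          finally show ?thesis .
        qed
        also have "\<dots> \<le> 1 * \<bar>gq q (X (Suc n) ?p) - gq q (X n ?p)\<bar>" using \<kappa>(2) by (intro mult_right_mono) auto
        also have "\<dots> \<le> L * \<bar>X (Suc n) ?p - X n ?p\<bar>"
          unfolding L_def using gq_lipschitz[OF q XC[OF p(2)] XC[OF p(2)]] by simp
        also have "\<dots> \<le> L * (A * (L * t) ^ n / fact n)" using Suc.IH[OF p(2)] L by (intro mult_left_mono) auto
        finally show ?thesis using 1 by (intro exI conjI) auto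
      qed
    qed (rule Suc.prems)
    from one[of 1] one[of "- 1"] show ?case by (simp add: B_def abs_le_iff)
  qed
  define f where "f k p = X (Suc k) p - X k p" for k p
  define M where "M k = A * (L * T) ^ k / fact k" for k :: nat
  have fM: "norm (f k p) \<le> M k" if "p \<in> ?S" for k p
  proof -
    have "(L * snd p) ^ k \<le> (L * T) ^ k" using that L by (intro power_mono mult_left_mono) auto
    then have "A * (L * snd p) ^ k / fact k \<le> M k" unfolding M_def using A by (intro divide_right_mono mult_left_mono) auto
    then show ?thesis using est[OF that, of k] by (simp add: f_def)
  qed
  have sM: "summable M"
    unfolding M_def using summable_mult[OF summable_exp[of "L * T"], of A] by (simp add: field_simps)
  have ul: "uniform_limit ?S (\<lambda>n p. \<Sum>k<n. f k p) (\<lambda>p. \<Sum>k. f k p) sequentially"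
    by (rule Weierstrass_m_test[OF _ sM]) (use fM in auto)
  define u where "u p = X 0 p + (\<Sum>k. f k p)" for p
  have tel: "X n p = X 0 p + (\<Sum>k<n. f k p)" for n p
    unfolding f_def by (subst sum_lessThan_telescope) simp
  have uX: "uniform_limit ?S X u sequentially"
  proof -
    have "uniform_limit ?S (\<lambda>n p. X 0 p + (\<Sum>k<n. f k p)) (\<lambda>p. X 0 p + (\<Sum>k. f k p)) sequentially"
      by (intro uniform_limit_intros ul)
    moreover have "(\<lambda>n p. X 0 p + (\<Sum>k<n. f k p)) = X" by (intro ext) (rule tel[symmetric])
    ultimately have "uniform_limit ?S X (\<lambda>p. X 0 p + (\<Sum>k. f k p)) sequentially" by argo
    then show ?thesis unfolding u_def[abs_def] .
  qed
  have lim: "(\<lambda>n. X n p) \<longlonglongrightarrow> u p" if "p \<in> ?S" for p using tendsto_uniform_limitI[OF uX that] .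
  have uc: "continuous_on ?S u"
    by (rule uniform_limit_theorem[OF _ uX]) (auto intro!: always_eventually Xc)
  have uC: "u p \<le> C" if "p \<in> ?S" for p
    by (rule LIMSEQ_le_const2[OF lim[OF that]]) (use XC[OF that] in auto)
  have ulat: "u (x, t) = h (x, t)" if "x \<in> frontier \<Omega>" "0 < t" "t \<le> T" for x t
  proof -
    have "(\<lambda>n. X n (x, t)) \<longlonglongrightarrow> h (x, t)" using Xlat[OF that] by simp
    moreover have "(x, t) \<in> ?S" using that by (auto simp: frontier_def)
    ultimately show ?thesis using lim LIMSEQ_unique by blast
  qed
  have u0: "u (x, 0) = c" if "x \<in> closure \<Omega>" for x
  proof -
    have "(\<lambda>n. X n (x, 0)) \<longlonglongrightarrow> c" using X0[OF that] by simp
    moreover have "(x, 0) \<in> ?S" using that T by auto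
    ultimately show ?thesis using lim LIMSEQ_unique by blast
  qed
  let ?U = "\<Omega> \<times> {0<..<T}"
  have US: "?U \<subseteq> ?S" using closure_subset[of \<Omega>] by auto
  have oU: "open ?U" by (intro open_Times \<Omega>) auto
  have "C21_on ?U u \<and> (\<forall>p\<in>?U. hop u p (- (\<kappa> p * gq q (u p))))"
  proof (rule closure_nonlinear[where u=X and v=X and \<kappa>x="\<lambda>k. \<kappa>' (k,0)" and g="gq q" and g'="gq' q"])
    show "C21_on ?U (X n)" for n using X(1)[of n] unfolding I_def by (auto intro: C21_subset)
    show "lbd ?U X"
      unfolding lbd_def
    proof
      fix p assume "p \<in> ?U"
      then obtain e where e: "e > 0" "cyl p e \<subseteq> ?U" using open_contains_cyl[OF oU] by blast
      have "\<bar>X n q\<bar> \<le> \<bar>B0\<bar> + suminf M + 1" if "q \<in> cyl p e" for n q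
      proof -
        have qS: "q \<in> ?S" using that e(2) US by blast
        have "\<bar>\<Sum>k<n. f k q\<bar> \<le> (\<Sum>k<n. M k)" using fM[OF qS] by (intro order_trans[OF sum_abs] sum_mono) auto
        also have "\<dots> \<le> suminf M" using sM A L T by (intro sum_le_suminf[OF sM]) (auto simp: M_def)
        finally show ?thesis using tel[of n q] B0[OF qS] by simp
      qed
      moreover have "suminf M \<ge> 0" using sM A L T by (intro suminf_nonneg[OF sM]) (auto simp: M_def)
      ultimately show "\<exists>e>0. \<exists>C>0. cyl p e \<subseteq> ?U \<and> (\<forall>n. \<forall>q\<in>cyl p e. \<bar>X n q\<bar> \<le> C)"
        using e by (intro exI[of _ e] conjI exI[of _ "\<bar>B0\<bar> + suminf M + 1"]) auto
    qed
    show "hop (X (Suc n)) p (- (\<kappa> p * gq q (X n p)))" if "p \<in> ?U" for n p using that by (intro X(2)) auto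
    show "(\<lambda>n. X n p) \<longlonglongrightarrow> u p" if "p \<in> ?U" for p using lim US that by blast
  qed (use oU \<kappa>c gq_deriv[OF q] cont_gq'[OF q] in \<open>auto simp: Basis_prod_def\<close>)
  then have uU: "C21_on ?U u" "\<And>p. p \<in> ?U \<Longrightarrow> hop u p (- (\<kappa> p * gq q (u p)))" by blast+
  have pos: "0 \<le> u p" if p: "p \<in> closure \<Omega> \<times> {0..<T}" for p
  proof (rule compare_sol[OF \<Omega>(1), of 0 "snd p" "\<lambda>_. 0" u "\<bar>B0\<bar> + suminf M"])
    have sub: "closure \<Omega> \<times> {0..snd p} \<subseteq> ?S" using p by auto
    show "continuous_on (closure \<Omega> \<times> {0..snd p}) u" by (rule continuous_on_subset[OF uc sub])
    have M0: "suminf M \<ge> 0" using sM A L T by (intro suminf_nonneg[OF sM]) (auto simp: M_def)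
    then show "0 \<le> \<bar>B0\<bar> + suminf M" by simp
    show "- (\<bar>B0\<bar> + suminf M) \<le> u p'" if "p' \<in> closure \<Omega> \<times> {0..snd p}" for p'
    proof -
      have pS: "p' \<in> ?S" using that sub by blast
      have "\<bar>\<Sum>k. f k p'\<bar> \<le> suminf M"
        using norm_suminf_le[of "\<lambda>k. f k p'" M] fM[OF pS] sM by simp
      then show ?thesis using B0[OF pS] by (simp add: u_def)
    qed
    show "\<exists>h k. hop (\<lambda>_. 0) (x, t) h \<and> hop u (x, t) k \<and> h \<le> k" if "x \<in> \<Omega>" "0 < t" "t \<le> snd p" "u (x, t) < 0" for x t
      using uU(2)[of "(x,t)"] that p hop_const[of 0 "(x,t)"] by (auto simp: gq_neg intro!: exI[of _ 0])
  qed (use p u0 c ulat h(3) in \<open>auto simp: mem_Times_iff\<close>)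
  show ?thesis
    by (rule that[OF uc uU ulat u0]) (use pos uC in auto)
qed

text \<open>Used at boundary points, where interior estimates give nothing. The enclosing functions
  may depend on \<epsilon> and have to meet at \<open>p\<close> only up to \<epsilon>.\<close>

lemma squeeze_continuous:
  fixes f :: "'e::metric_space \<Rightarrow> real"
  assumes "p \<in> S" and sq: "\<And>\<epsilon>. \<epsilon> > 0 \<Longrightarrow> \<exists>lo hi. continuous (at p within S) lo \<and> continuous (at p within S) hi \<and>
      (\<forall>\<^sub>F x in at p within S. lo x \<le> f x \<and> f x \<le> hi x) \<and> lo p \<le> f p \<and> f p \<le> hi p \<and> hi p - lo p \<le> \<epsilon>"
  shows "continuous (at p within S) f"
  unfolding continuous_within
proof (rule tendstoI)
  fix \<epsilon> :: real assume \<epsilon>: "\<epsilon> > 0"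
  obtain lo hi where lh: "continuous (at p within S) lo" "continuous (at p within S) hi"
    "\<forall>\<^sub>F x in at p within S. lo x \<le> f x \<and> f x \<le> hi x" "lo p \<le> f p" "f p \<le> hi p" "hi p - lo p \<le> \<epsilon> / 2"
    using sq[of "\<epsilon> / 2"] \<epsilon> by auto
  have "\<forall>\<^sub>F x in at p within S. dist (lo x) (lo p) < \<epsilon> / 2" "\<forall>\<^sub>F x in at p within S. dist (hi x) (hi p) < \<epsilon> / 2"
    using tendstoD[OF lh(1)[unfolded continuous_within] half_gt_zero[OF \<epsilon>]]
      tendstoD[OF lh(2)[unfolded continuous_within] half_gt_zero[OF \<epsilon>]] by blast+
  with lh(3) show "\<forall>\<^sub>F x in at p within S. dist (f x) (f p) < \<epsilon>"
  proof eventually_elim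
    case (elim x)
    then show ?case using lh(4-6) unfolding dist_real_def by linarith
  qed
qed

text \<open>The cut-offs increase, so the absorption grows and the solutions decrease. Near each
  interior point the cut-off is eventually 1, and \<open>closure_nonlinear\<close> gives the full
  equation in the limit. A monotone limit need not be continuous up to the boundary; there the first
  solution \<open>u 0\<close> encloses it from above, and barriers enclose it from below.\<close>

lemma nonlinear_solve:
  fixes \<Omega> :: "'a::euclidean_space set"
  assumes \<Omega>: "open \<Omega>" "\<Omega> \<noteq> {}" "PWC \<Omega>" and q: "q > 1" and \<delta>: "0 < \<delta>" and T: "0 < T" and c: "0 \<le> c" "c \<le> C"
    and h: "continuous_on (frontier \<Omega> \<times> {0<..}) h" "\<And>x t. t \<le> \<delta> \<Longrightarrow> h (x, t) = c"
      "\<And>x t. x \<in> frontier \<Omega> \<Longrightarrow> 0 < t \<Longrightarrow> t \<le> T \<Longrightarrow> 0 \<le> h (x, t) \<and> h (x, t) \<le> C"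
  obtains u where "continuous_on (closure \<Omega> \<times> {0..<T}) u" "C21_on (\<Omega> \<times> {0<..<T}) u"
    "\<And>p. p \<in> \<Omega> \<times> {0<..<T} \<Longrightarrow> hop u p (- gq q (u p))"
    "\<And>x t. x \<in> frontier \<Omega> \<Longrightarrow> 0 < t \<Longrightarrow> t < T \<Longrightarrow> u (x, t) = h (x, t)"
    "\<And>x. x \<in> closure \<Omega> \<Longrightarrow> u (x, 0) = c"
    "\<And>p. p \<in> closure \<Omega> \<times> {0..<T} \<Longrightarrow> 0 \<le> u p \<and> u p \<le> C"
proof -
  let ?D = "\<Omega> \<times> {0::real<..}"
  let ?S = "closure \<Omega> \<times> {0..<T}"
  let ?U = "\<Omega> \<times> {0<..<T}"
  have D: "open ?D" "?D \<noteq> {}" using \<Omega> by (auto intro!: open_Times)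
  have oU: "open ?U" by (intro open_Times \<Omega>) auto
  obtain \<kappa> \<kappa>' K where \<kappa>: "\<And>n. C1w (\<kappa> n) (\<kappa>' n)" "\<And>n q. 0 \<le> \<kappa> n q \<and> \<kappa> n q \<le> 1" "\<And>n q. \<kappa> n q \<le> \<kappa> (Suc n) q"
    "\<And>n. compact (K n)" "\<And>n. K n \<subseteq> ?D" "\<And>n q. q \<notin> K n \<Longrightarrow> \<kappa> n q = 0"
    "\<And>p. p \<in> ?D \<Longrightarrow> \<exists>U N. open U \<and> p \<in> U \<and> (\<forall>n\<ge>N. \<forall>q\<in>U. \<kappa> n q = 1)"
    by (rule cutoff_exists[OF D]) (rule that)
  have "\<forall>n. \<exists>u. continuous_on (closure \<Omega> \<times> {0..T}) u \<and> C21_on ?U u \<and>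
    (\<forall>p\<in>?U. hop u p (- (\<kappa> n p * gq q (u p)))) \<and>
    (\<forall>x t. x \<in> frontier \<Omega> \<longrightarrow> 0 < t \<longrightarrow> t \<le> T \<longrightarrow> u (x, t) = h (x, t)) \<and>
    (\<forall>x\<in>closure \<Omega>. u (x, 0) = c) \<and> (\<forall>p\<in>?S. 0 \<le> u p \<and> u p \<le> C)"
  proof
    fix n
    obtain u where "continuous_on (closure \<Omega> \<times> {0..T}) u" "C21_on ?U u"
      "\<And>p. p \<in> ?U \<Longrightarrow> hop u p (- (\<kappa> n p * gq q (u p)))"
      "\<And>x t. x \<in> frontier \<Omega> \<Longrightarrow> 0 < t \<Longrightarrow> t \<le> T \<Longrightarrow> u (x, t) = h (x, t)"
      "\<And>x. x \<in> closure \<Omega> \<Longrightarrow> u (x, 0) = c" "\<And>p. p \<in> ?S \<Longrightarrow> 0 \<le> u p \<and> u p \<le> C"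
      by (rule picard[OF \<Omega>(1,3) q \<delta> T c h \<kappa>(1)[of n] \<kappa>(2)[of n] \<kappa>(4)[of n] \<kappa>(5)[of n] \<kappa>(6)[of _ n]]; (assumption | (rule that; assumption)))
    then show "\<exists>u. continuous_on (closure \<Omega> \<times> {0..T}) u \<and> C21_on ?U u \<and>
      (\<forall>p\<in>?U. hop u p (- (\<kappa> n p * gq q (u p)))) \<and>
      (\<forall>x t. x \<in> frontier \<Omega> \<longrightarrow> 0 < t \<longrightarrow> t \<le> T \<longrightarrow> u (x, t) = h (x, t)) \<and>
      (\<forall>x\<in>closure \<Omega>. u (x, 0) = c) \<and> (\<forall>p\<in>?S. 0 \<le> u p \<and> u p \<le> C)"
      by (intro exI[of _ u]) simp
  qed
  from choice[OF this] obtain u where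
    "\<forall>n. continuous_on (closure \<Omega> \<times> {0..T}) (u n) \<and> C21_on ?U (u n) \<and>
      (\<forall>p\<in>?U. hop (u n) p (- (\<kappa> n p * gq q (u n p)))) \<and>
      (\<forall>x t. x \<in> frontier \<Omega> \<longrightarrow> 0 < t \<longrightarrow> t \<le> T \<longrightarrow> u n (x, t) = h (x, t)) \<and>
      (\<forall>x\<in>closure \<Omega>. u n (x, 0) = c) \<and> (\<forall>p\<in>?S. 0 \<le> u n p \<and> u n p \<le> C)" by blast
  then have u: "\<And>n. continuous_on (closure \<Omega> \<times> {0..T}) (u n)" "\<And>n. C21_on ?U (u n)"
      "\<And>n p. p \<in> ?U \<Longrightarrow> hop (u n) p (- (\<kappa> n p * gq q (u n p)))"
      "\<And>n x t. x \<in> frontier \<Omega> \<Longrightarrow> 0 < t \<Longrightarrow> t \<le> T \<Longrightarrow> u n (x, t) = h (x, t)"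
      "\<And>n x. x \<in> closure \<Omega> \<Longrightarrow> u n (x, 0) = c" "\<And>n p. p \<in> ?S \<Longrightarrow> 0 \<le> u n p \<and> u n p \<le> C"
    by blast+
  have g0: "0 < q" using q by simp
  have ucb: "continuous_on (closure \<Omega> \<times> {0..b}) (u n)" if "b < T" for n b
    by (rule continuous_on_subset[OF u(1)]) (use that in auto)
  have dec: "u (Suc n) p \<le> u n p" if p: "p \<in> ?S" for n p
  proof (rule compare_sol[OF \<Omega>(1), of 0 "snd p" "u (Suc n)" "u n" C])
    show "\<exists>h k. hop (u (Suc n)) (x, t) h \<and> hop (u n) (x, t) k \<and> h \<le> k"
      if xt: "x \<in> \<Omega>" "0 < t" "t \<le> snd p" "u n (x, t) < u (Suc n) (x, t)" for x t
    proof (intro exI conjI)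
      have "(x, t) \<in> ?U" using xt p by auto
      then show "hop (u (Suc n)) (x, t) (- (\<kappa> (Suc n) (x, t) * gq q (u (Suc n) (x, t))))"
        "hop (u n) (x, t) (- (\<kappa> n (x, t) * gq q (u n (x, t))))" by (auto intro: u(3))
      have "\<kappa> n (x, t) * gq q (u n (x, t)) \<le> \<kappa> (Suc n) (x, t) * gq q (u (Suc n) (x, t))"
        using \<kappa>(2,3) gq_nonneg gq_mono[OF g0] xt(4) by (intro mult_mono) auto
      then show "- (\<kappa> (Suc n) (x, t) * gq q (u (Suc n) (x, t))) \<le> - (\<kappa> n (x, t) * gq q (u n (x, t)))" by simp
    qed
    show "u (Suc n) p' \<le> C" "- C \<le> u n p'" if "p' \<in> closure \<Omega> \<times> {0..snd p}" for p'
      using u(6)[of p' n] u(6)[of p' "Suc n"] that p c by (force simp: mem_Times_iff)+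
  qed (use p u(4,5) ucb in \<open>auto simp: mem_Times_iff\<close>)
  define w where "w p = lim (\<lambda>n. u n p)" for p
  have lim: "(\<lambda>n. u n p) \<longlonglongrightarrow> w p" if p: "p \<in> ?S" for p
  proof -
    have "convergent (\<lambda>n. u n p)"
    proof (rule Bseq_monoseq_convergent)
      show "Bseq (\<lambda>n. u n p)" by (rule BseqI'[of _ C]) (use u(6)[OF p] in auto)
      show "monoseq (\<lambda>n. u n p)" using dec[OF p] by (intro decseq_imp_monoseq decseq_SucI)
    qed
    then show ?thesis by (simp add: w_def convergent_LIMSEQ_iff)
  qed
  have wle: "w p \<le> u n p" if p: "p \<in> ?S" for n p
    using decseq_ge[OF decseq_SucI lim[OF p]] dec[OF p] by blast
  have w0C: "0 \<le> w p \<and> w p \<le> C" if p: "p \<in> ?S" for p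
    using LIMSEQ_le_const[OF lim[OF p], of 0] LIMSEQ_le_const2[OF lim[OF p], of C] u(6)[OF p] by auto
  have US: "?U \<subseteq> ?S" using closure_subset[of \<Omega>] by auto
  have loc: "\<exists>V. open V \<and> p \<in> V \<and> C21_on V w \<and> (\<forall>p\<in>V. hop w p (- gq q (w p)))" if p: "p \<in> ?U" for p
  proof -
    obtain V N where V: "open V" "p \<in> V" "\<And>n q. n \<ge> N \<Longrightarrow> q \<in> V \<Longrightarrow> \<kappa> n q = 1" using \<kappa>(7)[of p] p by fastforce
    \<comment> \<open>From the index \<open>N\<close> on the cut-off is the constant 1 on
      \<open>V\<close>, so the tail of the sequence satisfies one fixed equation there.\<close>
    let ?V = "V \<inter> ?U"
    have oV: "open ?V" using V oU by auto
    have "C21_on ?V w \<and> (\<forall>p\<in>?V. hop w p (- ((\<lambda>_. 1) p * gq q (w p))))"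
    proof (rule closure_nonlinear[where u="\<lambda>n. u (n + N)" and v="\<lambda>n. u (Suc n + N)" and \<kappa>x="\<lambda>_ _. 0" and g="gq q" and g'="gq' q"])
      show "C21_on ?V (u (n + N))" for n using u(2) by (rule C21_subset) auto
      show "lbd ?V (\<lambda>n. u (n + N))"
        unfolding lbd_def
      proof
        fix p assume "p \<in> ?V"
        then obtain e where e: "e > 0" "cyl p e \<subseteq> ?V" using open_contains_cyl[OF oV] by blast
        have "\<bar>u (n + N) q\<bar> \<le> C + 1" if "q \<in> cyl p e" for n q
          using u(6)[of q "n + N"] that e(2) US by fastforce
        then show "\<exists>e>0. \<exists>C>0. cyl p e \<subseteq> ?V \<and> (\<forall>n. \<forall>q\<in>cyl p e. \<bar>u (n + N) q\<bar> \<le> C)"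
          using e c by (intro exI[of _ e] conjI exI[of _ "C + 1"]) auto
      qed
      show "hop (u (Suc n + N)) p (- (1 * gq q (u (Suc n + N) p)))" if "p \<in> ?V" for n p
        using u(3)[of p "Suc n + N"] V(3)[of "Suc n + N" p] that by simp
      show "(\<lambda>n. u (n + N) p) \<longlonglongrightarrow> w p" if "p \<in> ?V" for p
        by (rule LIMSEQ_ignore_initial_segment[OF lim]) (use that US in auto)
    qed (use oV dd_const gq_deriv[OF q] cont_gq'[OF q] in auto)
    then show ?thesis using oV p V(2) by (intro exI[of _ ?V]) auto
  qed
  have wC: "C21_on ?U w" by (rule C21_local) (use loc in blast)
  have weq: "hop w p (- gq q (w p))" if "p \<in> ?U" for p using loc[OF that] by blast
  have wlat: "w (x, t) = h (x, t)" if "x \<in> frontier \<Omega>" "0 < t" "t < T" for x t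
  proof -
    have "(\<lambda>n. u n (x, t)) \<longlonglongrightarrow> h (x, t)" using u(4)[of x t] that by simp
    moreover have "(x, t) \<in> ?S" using that by (auto simp: frontier_def)
    ultimately show ?thesis using lim LIMSEQ_unique by blast
  qed
  have w0: "w (x, 0) = c" if "x \<in> closure \<Omega>" for x
  proof -
    have "(\<lambda>n. u n (x, 0)) \<longlonglongrightarrow> c" using u(5)[OF that] by simp
    moreover have "(x, 0) \<in> ?S" using that T by auto
    ultimately show ?thesis using lim LIMSEQ_unique by blast
  qed
  define G where "G = gq q C"
  have G: "G \<ge> 0" by (simp add: G_def gq_nonneg)
  \<comment> \<open>Since \<open>u n\<close> solves the heat equation up to an error of at most \<open>G\<close>, this caloric function
    minus \<open>G t\<close> is a lower barrier which misses the boundary values by at most \<open>G d\<close>.\<close>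
  have barrier: "\<exists>B. continuous_on ?S B \<and> (\<forall>p\<in>?S. B p \<le> w p) \<and> (\<forall>x\<in>closure \<Omega>. B (x, 0) = c) \<and>
      (\<forall>x t. x \<in> frontier \<Omega> \<longrightarrow> 0 < t \<longrightarrow> t < T \<longrightarrow> h (x, t) - G * d \<le> B (x, t))" if d: "0 < d" "d \<le> \<delta>" for d
  proof -
    have C0: "C1w (\<lambda>_. 0) (\<lambda>_ _. 0)" using dd_const by (auto simp: C1w_def)
    \<comment> \<open>Once \<open>G * snd p\<close> is subtracted, the lateral values become
      \<open>h - G * min t d\<close>. The kink at \<open>d\<close> keeps the datum equal to
      \<open>c\<close> up to time \<open>d\<close>, as \<open>linear_solve\<close> demands.\<close>
    have hc: "continuous_on (frontier \<Omega> \<times> {0<..}) (\<lambda>p. h p + G * max 0 (snd p - d))"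
      by (intro continuous_intros h(1))
    have hd: "h (x, t) + G * max 0 (snd (x, t) - d) = c" if "t \<le> d" for x t
      using h(2)[of t x] that d by simp
    obtain b where b: "continuous_on (closure \<Omega> \<times> {0..}) b" "bounded (b ` (closure \<Omega> \<times> {0..}))"
      "C21_on (\<Omega> \<times> {0<..}) b" "\<And>p. p \<in> \<Omega> \<times> {0<..T} \<Longrightarrow> hop b p 0"
      "\<And>x t. x \<in> frontier \<Omega> \<Longrightarrow> 0 < t \<Longrightarrow> t \<le> T \<Longrightarrow> b (x, t) = h (x, t) + G * max 0 (snd (x, t) - d)"
      "\<And>x. x \<in> closure \<Omega> \<Longrightarrow> b (x, 0) = c"
      using linear_solve[OF \<Omega>(1,3) C0 compact_empty refl d(1) refl T hc hd] by blast
    define B where "B p = b p - G * snd p" for p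
    have Bc: "continuous_on A B" if "A \<subseteq> closure \<Omega> \<times> {0..}" for A
      unfolding B_def by (intro continuous_intros continuous_on_subset[OF b(1) that])
    obtain B0 where B0: "\<And>p. p \<in> closure \<Omega> \<times> {0..} \<Longrightarrow> \<bar>b p\<bar> \<le> B0" using b(2) unfolding bounded_iff by auto
    have Bu: "B p \<le> u n p" if p: "p \<in> ?S" for n p
    proof (rule compare_sol[OF \<Omega>(1), of 0 "snd p" B "u n" "max B0 C"])
      show "continuous_on (closure \<Omega> \<times> {0..snd p}) B" by (rule Bc) auto
      show "continuous_on (closure \<Omega> \<times> {0..snd p}) (u n)" by (rule ucb) (use p in auto)
      show "B p' \<le> max B0 C" if "p' \<in> closure \<Omega> \<times> {0..snd p}" for p'
      proof -
        have "0 \<le> G * snd p'" using that G by auto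
        moreover have "\<bar>b p'\<bar> \<le> B0" using that by (intro B0) auto
        ultimately show ?thesis by (simp add: B_def)
      qed
      show "- max B0 C \<le> u n p'" if "p' \<in> closure \<Omega> \<times> {0..snd p}" for p'
        using u(6)[of p' n] that p c by (force simp: mem_Times_iff)
      show "B (x, 0) \<le> u n (x, 0)" if "x \<in> closure \<Omega>" for x using that b(6) u(5) by (simp add: B_def)
      show "B (x, t) \<le> u n (x, t)" if "x \<in> frontier \<Omega>" "0 < t" "t \<le> snd p" for x t
      proof -
        have tT: "t \<le> T" using that p by auto
        have "G * max 0 (t - d) \<le> G * t" using G d that by (intro mult_left_mono) auto
        then show ?thesis using b(5)[OF that(1,2) tT] u(4)[OF that(1,2) tT] by (simp add: B_def)
      qed
      show "\<exists>h k. hop B (x, t) h \<and> hop (u n) (x, t) k \<and> h \<le> k" if xt: "x \<in> \<Omega>" "0 < t" "t \<le> snd p" for x t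
      proof (intro exI conjI)
        have xU: "(x, t) \<in> ?U" "(x, t) \<in> ?S" using xt p closure_subset[of \<Omega>] by auto
        have "hop (\<lambda>p. G * snd p) (x, t) G" using hop_time[of "\<lambda>s. G * s" G "(x,t)"] by (auto intro!: derivative_eq_intros)
        then show "hop B (x, t) (0 - G)" unfolding B_def[abs_def] using xU by (intro hop_diff b(4)) auto
        show "hop (u n) (x, t) (- (\<kappa> n (x, t) * gq q (u n (x, t))))" by (rule u(3)[OF xU(1)])
        have "\<kappa> n (x, t) * gq q (u n (x, t)) \<le> 1 * G"
          unfolding G_def using \<kappa>(2) u(6)[OF xU(2)] gq_nonneg gq_mono[OF g0] by (intro mult_mono) auto
        then show "0 - G \<le> - (\<kappa> n (x, t) * gq q (u n (x, t)))" by simp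
      qed
    qed (use p in \<open>auto simp: mem_Times_iff\<close>)
    show ?thesis
    proof (intro exI[of _ B] conjI ballI allI impI)
      show "continuous_on ?S B" by (rule Bc) auto
      show "B p \<le> w p" if "p \<in> ?S" for p
        by (rule LIMSEQ_le_const[OF lim[OF that]]) (use Bu[OF that] in auto)
      show "B (x, 0) = c" if "x \<in> closure \<Omega>" for x using b(6)[OF that] by (simp add: B_def)
      show "h (x, t) - G * d \<le> B (x, t)" if "x \<in> frontier \<Omega>" "0 < t" "t < T" for x t
      proof -
        have "G * (t - d) \<le> G * max 0 (t - d)" using G by (intro mult_left_mono) auto
        then show ?thesis using b(5)[of x t] that by (simp add: B_def algebra_simps)
      qed
    qed
  qed
  have "continuous_on ?S w"
    unfolding continuous_on_eq_continuous_within
  proof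
    fix p assume p: "p \<in> ?S"
    obtain x t where xt: "p = (x, t)" by (cases p)
    show "continuous (at p within ?S) w"
    proof (cases "p \<in> ?U")
      case True
      then have "isCont w p" using wC oU continuous_on_eq_continuous_at unfolding C21_on_def by blast
      then show ?thesis by (rule continuous_at_imp_continuous_at_within)
    next
      case False
      then have bp: "t = 0 \<or> x \<in> frontier \<Omega> \<and> 0 < t" using p xt \<Omega>(1) by (auto simp: frontier_def interior_open)
      show ?thesis
      proof (rule squeeze_continuous[OF p])
        fix \<epsilon> :: real assume \<epsilon>: "\<epsilon> > 0"
        define d where "d = min \<delta> (\<epsilon> / (G + 1))"
        have d: "0 < d" "d \<le> \<delta>" using \<delta> \<epsilon> G by (auto simp: d_def)
        have Gd: "G * d \<le> \<epsilon>"
        proof -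
          have "G * d \<le> (G + 1) * (\<epsilon> / (G + 1))" using G d by (intro mult_mono) (auto simp: d_def)
          then show ?thesis using G by simp
        qed
        obtain B where B: "continuous_on ?S B" "\<forall>p\<in>?S. B p \<le> w p" "\<forall>x\<in>closure \<Omega>. B (x, 0) = c"
          "\<forall>x t. x \<in> frontier \<Omega> \<longrightarrow> 0 < t \<longrightarrow> t < T \<longrightarrow> h (x, t) - G * d \<le> B (x, t)" using barrier[OF d] by blast
        have "continuous_on ?S (u 0)" by (rule continuous_on_subset[OF u(1)]) auto
        moreover have "\<forall>\<^sub>F x in at p within ?S. B x \<le> w x \<and> w x \<le> u 0 x"
          unfolding eventually_at_filter using B(2) wle by (auto intro!: always_eventually)
        moreover have "u 0 p - B p \<le> \<epsilon>"
          using bp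
        proof
          assume "t = 0" then show ?thesis using u(5)[of x 0] B(3) p xt \<epsilon> by auto
        next
          assume "x \<in> frontier \<Omega> \<and> 0 < t"
          then show ?thesis using u(4)[of x t 0] B(4)[rule_format, of x t] p xt Gd by auto
        qed
        ultimately show "\<exists>lo hi. continuous (at p within ?S) lo \<and> continuous (at p within ?S) hi \<and>
          (\<forall>\<^sub>F x in at p within ?S. lo x \<le> w x \<and> w x \<le> hi x) \<and> lo p \<le> w p \<and> w p \<le> hi p \<and> hi p - lo p \<le> \<epsilon>"
          using B(1,2) p wle[OF p] unfolding continuous_on_eq_continuous_within by (intro exI[of _ B] exI[of _ "u 0"]) blast
      qed
    qed
  qed
  then show ?thesis
    using that[of w] wC weq wlat w0 w0C by blast
qed

subsection \<open>Explicit barriers\<close>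

text \<open>Split \<open>(a + b) * (a + b) powr (q - 1)\<close> along its first factor: each part
  dominates the corresponding power. This is what makes the sum of a nonnegative solution and a
  nonnegative supersolution a supersolution.\<close>

lemma powr_superadditive:
  fixes a b q :: real
  assumes "0 \<le> a" "0 \<le> b" "1 \<le> q"
  shows "a powr q + b powr q \<le> (a + b) powr q"
proof -
  have e: "x powr q = x * x powr (q - 1)" if "x \<ge> 0" for x :: real
    using powr_mult_base[OF that, of "q - 1"] by simp
  have "a * a powr (q - 1) \<le> a * (a + b) powr (q - 1)" "b * b powr (q - 1) \<le> b * (a + b) powr (q - 1)"
    using assms by (auto intro!: mult_left_mono powr_mono2)
  then show ?thesis using assms e[of a] e[of b] e[of "a + b"] by (simp add: algebra_simps)
qed

text \<open>The ansatz \<open>\<Lambda> * (R^2 - (norm x)^2) powr (- \<alpha>)\<close> explodes on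
  the sphere of radius \<open>R\<close>, so on slightly smaller spheres it exceeds any bound,
  whatever solutions do at infinity. At the fixed point \<open>x1\<close> it is at most a multiple
  of \<open>R powr (- \<alpha>)\<close> for large \<open>R\<close>, hence as small as
  desired.\<close>

lemma keller_osserman:
  fixes x1 :: "'a::euclidean_space"
  assumes q: "q > 1" and \<epsilon>: "\<epsilon> > 0"
  obtains R \<psi> where "norm x1 < R" "\<And>x. norm x < R \<Longrightarrow> \<psi> x \<ge> 0" "continuous_on (ball 0 R) \<psi>" "\<psi> x1 \<le> \<epsilon>"
    "\<And>(x::'a) t. norm x < R \<Longrightarrow> \<exists>h\<ge>- (\<psi> x powr q). hop (\<lambda>p. \<psi> (fst p)) (x, t) h"
    "\<And>C. \<exists>R'. norm x1 < R' \<and> R' < R \<and> (\<forall>x. norm x = R' \<longrightarrow> C \<le> \<psi> x)"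
proof -
  define N where "N = real DIM('a)"
  \<comment> \<open>This exponent satisfies \<open>\<alpha> * q = \<alpha> + 2\<close>, so
    \<open>\<psi> powr q\<close> is singular of the same order as the Laplacian of \<psi>.\<close>
  define \<alpha> where "\<alpha> = 2 / (q - 1)"
  have \<alpha>: "\<alpha> > 0" using q by (simp add: \<alpha>_def)
  have N: "N > 0" by (simp add: N_def)
  \<comment> \<open>Up to common factors the Laplacian has the terms
    \<open>4 \<alpha> (\<alpha> + 1) (norm x)^2\<close> and \<open>2 N \<alpha> D\<close>, where
    both \<open>(norm x)^2\<close> and \<open>D = Y - (norm x)^2\<close> are at most
    \<open>Y\<close>; so \<open>c * Y\<close> is the required value of
    \<open>\<Lambda> powr (q - 1)\<close>.\<close>
  define c where "c = 4 * \<alpha> * (\<alpha> + 1) + 2 * N * \<alpha>"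
  have c: "c > 0" unfolding c_def using \<alpha> N by (intro add_pos_pos mult_pos_pos) auto
  define k where "k = c powr (\<alpha> / 2) * (1 / 2) powr (- \<alpha>)"
  have k: "k > 0" using c by (simp add: k_def)
  \<comment> \<open>\<open>Y > 2 (norm x1)^2\<close> leaves at least half of \<open>Y\<close> at
    \<open>x1\<close>, whence \<open>\<psi> x1 \<le> k * Y powr (- \<alpha> / 2)\<close>; the last
    summand makes this at most \<epsilon>.\<close>
  define Y where "Y = 1 + 2 * (norm x1)\<^sup>2 + (\<epsilon> / k) powr (- 2 / \<alpha>)"
  have Y: "Y > 0" "Y > 2 * (norm x1)\<^sup>2" "Y \<ge> (\<epsilon> / k) powr (- 2 / \<alpha>)"
  proof -
    have "0 \<le> (norm x1)\<^sup>2" "0 \<le> (\<epsilon> / k) powr (- 2 / \<alpha>)" by simp_all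
    then show "Y > 0" "Y > 2 * (norm x1)\<^sup>2" "Y \<ge> (\<epsilon> / k) powr (- 2 / \<alpha>)" unfolding Y_def by linarith+
  qed
  define R where "R = sqrt Y"
  have R: "R > 0" "R\<^sup>2 = Y" using Y by (auto simp: R_def)
  have ltR: "norm x < R \<longleftrightarrow> (norm x)\<^sup>2 < Y" for x :: 'a
    using real_less_rsqrt[of "norm x" Y] R by (auto simp: R_def) (metis R(1) R_def norm_ge_zero R(2) power_strict_mono zero_less_numeral)
  define \<Lambda> where "\<Lambda> = (c * Y) powr (\<alpha> / 2)"
  have \<Lambda>: "\<Lambda> > 0" using c Y by (simp add: \<Lambda>_def)
  define \<psi> where "\<psi> x = \<Lambda> * (Y - (norm (x - 0))\<^sup>2) powr (- \<alpha>)" for x :: 'a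
  have \<psi>e: "\<psi> x = \<Lambda> * (Y - (norm x)\<^sup>2) powr (- \<alpha>)" for x by (simp add: \<psi>_def)
  show ?thesis
  proof (rule that[of R \<psi>])
    have "0 \<le> (norm x1)\<^sup>2" by simp
    then show x1R: "norm x1 < R" unfolding ltR using Y by linarith
    show "\<psi> x \<ge> 0" for x using \<Lambda> by (simp add: \<psi>e)
    show "continuous_on (ball 0 R) \<psi>"
      unfolding \<psi>e[abs_def] using ltR by (intro continuous_intros) (auto simp: less_imp_neq[symmetric])
    show "\<psi> x1 \<le> \<epsilon>"
    proof -
      have "(Y - (norm x1)\<^sup>2) powr (- \<alpha>) \<le> (Y * (1 / 2)) powr (- \<alpha>)"
        using \<alpha> Y by (intro powr_mono2') auto
      then have "\<psi> x1 \<le> (c * Y) powr (\<alpha> / 2) * (Y * (1 / 2)) powr (- \<alpha>)"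
        unfolding \<psi>e \<Lambda>_def by (intro mult_left_mono) auto
      also have "\<dots> = k * (Y powr (\<alpha> / 2) * Y powr (- \<alpha>))"
        unfolding k_def using powr_mult[of c Y "\<alpha> / 2"] powr_mult[of Y "1 / 2" "- \<alpha>"] c Y by (simp only: mult_ac)
      also have "Y powr (\<alpha> / 2) * Y powr (- \<alpha>) = Y powr (- \<alpha> / 2)"
        using Y by (simp add: powr_add[symmetric])
      also have "\<dots> \<le> ((\<epsilon> / k) powr (- 2 / \<alpha>)) powr (- \<alpha> / 2)"
        using Y \<alpha> \<epsilon> k by (intro powr_mono2') auto
      also have "\<dots> = \<epsilon> / k" using \<alpha> \<epsilon> k by (simp add: powr_powr)
      finally show ?thesis using k by (simp add: field_simps)
    qed
    show "\<exists>h\<ge>- (\<psi> x powr q). hop (\<lambda>p. \<psi> (fst p)) (x, t) h" if x: "norm x < R" for x :: 'a and t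
    proof -
      define D where "D = Y - (norm x)\<^sup>2"
      have D: "D > 0" using x ltR by (simp add: D_def)
      let ?K = "\<lambda>(r::real) (s::real). \<Lambda> * (Y - r) powr (- \<alpha>)"
      let ?K1 = "\<lambda>(r::real) (s::real). \<Lambda> * (\<alpha> * (Y - r) powr (- \<alpha> - 1))"
      have der: "((\<lambda>r. (Y - r) powr a) has_real_derivative - (a * (Y - r) powr (a - 1))) (at r)" if "r < Y" for a r
      proof -
        have "((\<lambda>r. Y - r) has_real_derivative - 1) (at r)" by (auto intro!: derivative_eq_intros)
        moreover have "((\<lambda>s. s powr a) has_real_derivative a * (Y - r) powr (a - 1)) (at (Y - r))"
          using that by (intro has_real_derivative_powr) auto
        ultimately show ?thesis
          using DERIV_chain2[of "\<lambda>s. s powr a" "a * (Y - r) powr (a - 1)" "\<lambda>r. Y - r" r "- 1" UNIV] by simp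
      qed
      have "hop (\<lambda>q. ?K ((norm (fst q - 0))\<^sup>2) (snd q)) (x, t)
        (0 - 4 * (norm (x - 0))\<^sup>2 * (\<Lambda> * (\<alpha> * ((\<alpha> + 1) * D powr (- \<alpha> - 2)))) - 2 * real DIM('a) * ?K1 ((norm (x - 0))\<^sup>2) t)"
      proof (rule hop_radial[of "ball 0 R \<times> UNIV"])
        show "open (ball (0::'a) R \<times> (UNIV :: real set))" by (intro open_Times) auto
        show "(x, t) \<in> ball 0 R \<times> UNIV" using x by simp
        show "((\<lambda>r. ?K r s) has_real_derivative ?K1 ((norm (z - 0))\<^sup>2) s) (at ((norm (z - 0))\<^sup>2))"
          if "(z, s) \<in> ball 0 R \<times> UNIV" for z :: 'a and s
          using DERIV_cmult[OF der[of "(norm z)\<^sup>2" "- \<alpha>"], of \<Lambda>] that ltR by simp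
        show "((\<lambda>r. ?K1 r t) has_real_derivative \<Lambda> * (\<alpha> * ((\<alpha> + 1) * D powr (- \<alpha> - 2)))) (at ((norm (x - 0))\<^sup>2))"
        proof -
          have "- ((- \<alpha> - 1) * (Y - (norm x)\<^sup>2) powr (- \<alpha> - 1 - 1)) = (\<alpha> + 1) * D powr (- \<alpha> - 2)"
            by (simp add: D_def algebra_simps)
          then show ?thesis
            using DERIV_cmult[OF DERIV_cmult[OF der[of "(norm x)\<^sup>2" "- \<alpha> - 1"], of \<alpha>], of \<Lambda>] x ltR by simp
        qed
      qed simp
      then have "hop (\<lambda>p. \<psi> (fst p)) (x, t) (- (4 * (norm x)\<^sup>2 * (\<Lambda> * (\<alpha> * ((\<alpha> + 1) * D powr (- \<alpha> - 2)))) + 2 * N * (\<Lambda> * (\<alpha> * D powr (- \<alpha> - 1)))))"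
        by (simp only: \<psi>_def N_def D_def diff_conv_add_uminus minus_zero add_0_left add_0_right minus_add_distrib)
      moreover have "4 * (norm x)\<^sup>2 * (\<Lambda> * (\<alpha> * ((\<alpha> + 1) * D powr (- \<alpha> - 2)))) + 2 * N * (\<Lambda> * (\<alpha> * D powr (- \<alpha> - 1))) \<le> \<psi> x powr q"
      proof -
        define E where "E = D powr (- \<alpha> - 2)"
        have E: "E > 0" using D by (simp add: E_def)
        have D1: "D powr (- \<alpha> - 1) = E * D" 
        proof -
          have "- \<alpha> - 1 = 1 + (- \<alpha> - 2)" by simp
          then show ?thesis unfolding E_def using powr_mult_base[of D "- \<alpha> - 2"] D by (simp only: mult.commute less_imp_le)
        qed
        have "(norm x)\<^sup>2 \<le> Y" using D by (simp add: D_def)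
        then have a1: "4 * (norm x)\<^sup>2 * (\<Lambda> * (\<alpha> * ((\<alpha> + 1) * E))) \<le> 4 * Y * (\<Lambda> * (\<alpha> * ((\<alpha> + 1) * E)))"
          using \<Lambda> \<alpha> E by (intro mult_right_mono) auto
        have "D \<le> Y" by (simp add: D_def)
        then have a2: "2 * N * (\<Lambda> * (\<alpha> * (E * D))) \<le> 2 * N * (\<Lambda> * (\<alpha> * (E * Y)))"
          using \<Lambda> \<alpha> E N by (intro mult_left_mono) auto
        have "\<psi> x powr q = \<Lambda> powr q * (D powr (- \<alpha>)) powr q"
          unfolding \<psi>e D_def[symmetric] using \<Lambda> by (simp add: powr_mult)
        also have "(D powr (- \<alpha>)) powr q = E"
        proof -
          have "- \<alpha> * q = - \<alpha> - 2" using q by (simp add: \<alpha>_def field_simps)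
          then show ?thesis unfolding E_def powr_powr by simp
        qed
        also have "\<Lambda> powr q = \<Lambda> * (c * Y)"
        proof -
          have "\<alpha> / 2 * (q - 1) = 1" using q by (simp add: \<alpha>_def)
          then have "\<Lambda> powr (q - 1) = c * Y" unfolding \<Lambda>_def powr_powr using c Y by simp
          then show ?thesis using powr_mult_base[of \<Lambda> "q - 1"] \<Lambda> by simp
        qed
        finally have "\<psi> x powr q = 4 * Y * (\<Lambda> * (\<alpha> * ((\<alpha> + 1) * E))) + 2 * N * (\<Lambda> * (\<alpha> * (E * Y)))"
          by (simp add: c_def algebra_simps)
        then show ?thesis using a1 a2 unfolding D1 E_def[symmetric] by linarith
      qed
      ultimately show ?thesis by (intro exI conjI[rotated]) auto
    qed
    show "\<exists>R'. norm x1 < R' \<and> R' < R \<and> (\<forall>x::'a. norm x = R' \<longrightarrow> C \<le> \<psi> x)" for C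
    proof -
      define C1 where "C1 = max C 1 / \<Lambda>"
      have C1: "C1 > 0" using \<Lambda> by (simp add: C1_def)
      define D where "D = min (C1 powr (- 1 / \<alpha>)) ((Y - (norm x1)\<^sup>2) / 2)"
      have D: "D > 0" "D < Y - (norm x1)\<^sup>2" using C1 x1R ltR[of x1] by (auto simp: D_def min_less_iff_disj)
      have YD: "(norm x1)\<^sup>2 < Y - D" using D by simp
      have "0 \<le> (norm x1)\<^sup>2" by simp
      then have YD0: "Y - D > 0" using YD by linarith
      show ?thesis
      proof (intro exI[of _ "sqrt (Y - D)"] conjI allI impI)
        show "norm x1 < sqrt (Y - D)" using YD by (rule real_less_rsqrt)
        show "sqrt (Y - D) < R" unfolding R_def using D by simp
        fix x :: 'a assume "norm x = sqrt (Y - D)"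
        then have "Y - (norm x)\<^sup>2 = D" using YD0 by simp
        moreover have "D powr (- \<alpha>) \<ge> (C1 powr (- 1 / \<alpha>)) powr (- \<alpha>)"
          using D \<alpha> by (intro powr_mono2') (auto simp: D_def)
        moreover have "(C1 powr (- 1 / \<alpha>)) powr (- \<alpha>) = C1" using C1 \<alpha> by (simp add: powr_powr)
        ultimately have "\<Lambda> * C1 \<le> \<psi> x" unfolding \<psi>e using \<Lambda> by simp
        then show "C \<le> \<psi> x" using \<Lambda> by (simp add: C1_def)
      qed
    qed
  qed
qed

text \<open>The heat kernel centred at \<open>y\<close> and started at time
  \<open>- \<rho>^2\<close>, up to a constant factor. The factor \<open>exp (1 / 4)\<close> makes it
  at least 1 on the ball of radius \<rho> at time 0, and the factor \<open>\<rho> ^ DIM('a)\<close>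
  bounds its size at later times by a multiple of the volume of that ball.\<close>

definition gauss :: "'a::euclidean_space \<Rightarrow> real \<Rightarrow> 'a \<times> real \<Rightarrow> real" where
  "gauss y \<rho> p = exp (1 / 4) * \<rho> ^ DIM('a) *
     ((snd p + \<rho>\<^sup>2) powr (- real DIM('a) / 2) * exp (- (norm (fst p - y))\<^sup>2 / (4 * (snd p + \<rho>\<^sup>2))))"

lemma hop_gauss:
  fixes y :: "'a::euclidean_space"
  assumes "t > - \<rho>\<^sup>2" shows "hop (gauss y \<rho>) (x, t) 0"
proof -
  define N where "N = real DIM('a)"
  define c where "c = \<rho>\<^sup>2"
  have c: "t + c > 0" using assms by (simp add: c_def)
  let ?K = "\<lambda>r s. (s + c) powr (- N / 2) * exp (- r / (4 * (s + c)))"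
  let ?K1 = "\<lambda>r s. - 1 / (4 * (s + c)) * ?K r s"
  have dr: "((\<lambda>r. ?K r s) has_real_derivative ?K1 r s) (at r)" for r s
  proof -
    have "((\<lambda>r. A * exp (k * r)) has_real_derivative k * (A * exp (k * r))) (at r)" for A k :: real
      by (auto intro!: derivative_eq_intros)
    from this[of "(s + c) powr (- N / 2)" "- 1 / (4 * (s + c))"] show ?thesis by simp
  qed
  have d2: "((\<lambda>r. ?K1 r t) has_real_derivative 1 / (16 * (t + c)\<^sup>2) * ?K r t) (at r)" for r
  proof -
    have "1 / (16 * a\<^sup>2) * k = - 1 / (4 * a) * (- 1 / (4 * a) * k)" for a k :: real by (simp add: power2_eq_square)
    from this[of "t + c" "?K r t"] show ?thesis by (simp only: DERIV_cmult[OF dr])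
  qed
  have dt: "((\<lambda>s. ?K r s) has_real_derivative (- N / (2 * (t + c)) + r / (4 * (t + c)\<^sup>2)) * ?K r t) (at t)" for r
  proof -
    have 1: "((\<lambda>s. (s + c) powr (- N / 2)) has_real_derivative - N / 2 * (t + c) powr (- N / 2 - 1)) (at t)"
    proof -
      have "((\<lambda>s. s + c) has_real_derivative 1) (at t)" by (auto intro!: derivative_eq_intros)
      moreover have "((\<lambda>s. s powr (- N / 2)) has_real_derivative - N / 2 * (t + c) powr (- N / 2 - 1)) (at (t + c))"
        using c by (rule has_real_derivative_powr)
      ultimately show ?thesis
        using DERIV_chain2[of "\<lambda>s. s powr (- N / 2)" "- N / 2 * (t + c) powr (- N / 2 - 1)" "\<lambda>s. s + c" t 1 UNIV] by simp
    qed
    have 2: "((\<lambda>s. exp (- r / (4 * (s + c)))) has_real_derivative exp (- r / (4 * (t + c))) * (r / (4 * (t + c)\<^sup>2))) (at t)"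
    proof -
      have "((\<lambda>s. s + c) has_real_derivative 1) (at t)" by (auto intro!: derivative_eq_intros)
      then have "((\<lambda>s. - r / 4 * inverse (s + c)) has_real_derivative - r / 4 * - (inverse (t + c) * 1 * inverse (t + c))) (at t)"
        using c by (intro DERIV_cmult DERIV_inverse') auto
      moreover have "- r / 4 * - (inverse a * 1 * inverse a) = r / (4 * a\<^sup>2)" for a
        by (simp add: inverse_eq_divide power2_eq_square)
      moreover have "- r / 4 * inverse s = - r / (4 * s)" for s by (simp add: inverse_eq_divide)
      ultimately have "((\<lambda>s. - r / (4 * (s + c))) has_real_derivative r / (4 * (t + c)\<^sup>2)) (at t)"
        by (simp only:)
      then show ?thesis by (rule DERIV_fun_exp)
    qed
    have 3: "(t + c) powr (- N / 2 - 1) = (t + c) powr (- N / 2) / (t + c)"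
      using c by (simp add: powr_diff)
    from DERIV_mult[OF 1 2] show ?thesis unfolding 3 using c by (simp add: field_simps)
  qed
  have "hop (\<lambda>q. ?K ((norm (fst q - y))\<^sup>2) (snd q)) (x, t)
     ((- N / (2 * (t + c)) + (norm (x - y))\<^sup>2 / (4 * (t + c)\<^sup>2)) * ?K ((norm (x - y))\<^sup>2) t
      - 4 * (norm (x - y))\<^sup>2 * (1 / (16 * (t + c)\<^sup>2) * ?K ((norm (x - y))\<^sup>2) t)
      - 2 * real DIM('a) * ?K1 ((norm (x - y))\<^sup>2) t)"
    by (rule hop_radial[of UNIV]) (auto simp del: mult_minus_left minus_divide_left intro: dr[simplified] d2[simplified] dt[simplified] dr d2 dt)
  moreover have "(- N / (2 * a) + \<rho>' / (4 * a\<^sup>2)) * E - 4 * \<rho>' * (1 / (16 * a\<^sup>2) * E)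
      - 2 * N * (- 1 / (4 * a) * E) = 0" for \<rho>' E a
    by (simp add: algebra_simps)
  ultimately have "hop (\<lambda>q. ?K ((norm (fst q - y))\<^sup>2) (snd q)) (x, t) 0" by (simp only: N_def[symmetric])
  from hop_cmult[OF this, of "exp (1 / 4) * \<rho> ^ DIM('a)"] show ?thesis
    by (simp add: gauss_def[abs_def] N_def c_def)
qed

lemma gauss_props:
  fixes y :: "'a::euclidean_space"
  assumes \<rho>: "\<rho> > 0"
  shows "gauss y \<rho> p \<ge> 0" "x \<in> ball y \<rho> \<Longrightarrow> gauss y \<rho> (x, 0) \<ge> 1"
    "t > 0 \<Longrightarrow> gauss y \<rho> (x, t) \<le> exp (1 / 4) * t powr (- real DIM('a) / 2) * \<rho> ^ DIM('a)"
    "continuous_on (UNIV \<times> {0..}) (gauss y \<rho>)"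
proof -
  show "gauss y \<rho> p \<ge> 0" using \<rho> by (simp add: gauss_def)
  show "gauss y \<rho> (x, 0) \<ge> 1" if x: "x \<in> ball y \<rho>"
  proof -
    have 1: "(\<rho>\<^sup>2) powr (- real DIM('a) / 2) = inverse (\<rho> ^ DIM('a))"
    proof -
      have "\<rho>\<^sup>2 = \<rho> powr 2" using \<rho> by (simp add: powr_numeral)
      then have "(\<rho>\<^sup>2) powr (- real DIM('a) / 2) = \<rho> powr (- real DIM('a))" by (simp add: powr_powr)
      then show ?thesis using \<rho> by (simp add: powr_minus powr_realpow)
    qed
    have "(norm (x - y))\<^sup>2 \<le> \<rho>\<^sup>2" using x by (intro power_mono) (auto simp: dist_norm norm_minus_commute)
    then have "- (norm (x - y))\<^sup>2 / (4 * \<rho>\<^sup>2) \<ge> - 1 / 4" using \<rho> by (simp add: field_simps)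
    then have "exp (- (norm (x - y))\<^sup>2 / (4 * \<rho>\<^sup>2)) \<ge> exp (- 1 / 4)" by simp
    then have "exp (1 / 4) * exp (- (norm (x - y))\<^sup>2 / (4 * \<rho>\<^sup>2)) \<ge> exp (1 / 4) * exp (- 1 / 4)" by (intro mult_left_mono) auto
    also have "exp (1 / 4) * exp (- 1 / 4 :: real) = 1" by (simp add: exp_add[symmetric])
    finally have e: "exp (1 / 4) * exp (- (norm (x - y))\<^sup>2 / (4 * \<rho>\<^sup>2)) \<ge> 1" .
    have "gauss y \<rho> (x, 0) = exp (1 / 4) * exp (- (norm (x - y))\<^sup>2 / (4 * \<rho>\<^sup>2)) * (\<rho> ^ DIM('a) * inverse (\<rho> ^ DIM('a)))"
      by (simp only: gauss_def 1 fst_conv snd_conv add_0_left mult_ac)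
    also have "\<rho> ^ DIM('a) * inverse (\<rho> ^ DIM('a)) = 1" using \<rho> by simp
    finally show ?thesis using e by simp
  qed
  show "gauss y \<rho> (x, t) \<le> exp (1 / 4) * t powr (- real DIM('a) / 2) * \<rho> ^ DIM('a)" if t: "t > 0"
  proof -
    have "(t + \<rho>\<^sup>2) powr (- real DIM('a) / 2) \<le> t powr (- real DIM('a) / 2)" using t by (intro powr_mono2') auto
    moreover have "exp (- (norm (x - y))\<^sup>2 / (4 * (t + \<rho>\<^sup>2))) \<le> 1" using t by (simp add: add_pos_nonneg)
    ultimately have "(t + \<rho>\<^sup>2) powr (- real DIM('a) / 2) * exp (- (norm (x - y))\<^sup>2 / (4 * (t + \<rho>\<^sup>2))) \<le>
        t powr (- real DIM('a) / 2) * 1" by (intro mult_mono) auto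
    then have "exp (1 / 4) * \<rho> ^ DIM('a) * ((t + \<rho>\<^sup>2) powr (- real DIM('a) / 2) * exp (- (norm (x - y))\<^sup>2 / (4 * (t + \<rho>\<^sup>2))))
       \<le> exp (1 / 4) * \<rho> ^ DIM('a) * (t powr (- real DIM('a) / 2) * 1)"
      using \<rho> by (intro mult_left_mono) auto
    then show ?thesis by (simp add: gauss_def mult_ac)
  qed
  show "continuous_on (UNIV \<times> {0..}) (gauss y \<rho>)"
    unfolding gauss_def using \<rho>
    by (intro continuous_intros) (auto simp: add_nonneg_pos less_imp_neq[symmetric])
qed

text \<open>Vitali's covering argument: among balls contained in \<open>U\<close> that cover
  \<open>Z\<close>, a disjoint subfamily has total volume at most that of \<open>U\<close>, and
  enlarging its radii five times restores the cover. The sum of \<open>\<rho> y ^ DIM('a)\<close> is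
  what the corresponding Gaussians cost.\<close>

lemma finite_ball_cover:
  fixes Z :: "'a::euclidean_space set"
  assumes Z: "compact Z" "Z \<subseteq> U" "open U" and m: "U \<in> lmeasurable"
  obtains Y \<rho> where "finite Y" "\<And>y. y \<in> Y \<Longrightarrow> \<rho> y > 0" "Z \<subseteq> (\<Union>y\<in>Y. ball y (\<rho> y))"
    "(\<Sum>y\<in>Y. \<rho> y ^ DIM('a)) \<le> 5 ^ DIM('a) * measure lebesgue U / unit_ball_vol (real DIM('a))"
proof -
  have "\<forall>z\<in>Z. \<exists>r>0. cball z r \<subseteq> U" using Z open_contains_cball by blast
  then obtain r where r: "\<And>z. z \<in> Z \<Longrightarrow> r z > 0" "\<And>z. z \<in> Z \<Longrightarrow> cball z (r z) \<subseteq> U" by metis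
  obtain Z0 where Z0: "Z0 \<subseteq> Z" "finite Z0" "Z \<subseteq> (\<Union>z\<in>Z0. ball z (r z))"
    by (rule compactE_image[OF Z(1), of Z "\<lambda>z. ball z (r z)"]) (use r(1) in force)+
  define B where "B = Max (insert 1 (r ` Z0))"
  have "0 < r i \<and> r i \<le> B" if "i \<in> Z0" for i
    using that Z0 r(1) by (auto simp: B_def intro!: Max_ge)
  then obtain C where C: "countable C" "C \<subseteq> Z0" "pairwise (\<lambda>i j. disjnt (cball i (r i)) (cball j (r j))) C"
    "\<And>i. i \<in> Z0 \<Longrightarrow> \<exists>j. j \<in> C \<and> \<not> disjnt (cball i (r i)) (cball j (r j)) \<and> cball i (r i) \<subseteq> ball j (5 * r j)"
    using Vitali_covering_lemma_cballs_balls[of Z0 r B "\<lambda>x. x"] by blast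
  have finC: "finite C" using C(2) Z0(2) finite_subset by blast
  have rC: "r y > 0" "cball y (r y) \<subseteq> U" if "y \<in> C" for y using that C(2) Z0(1) r by blast+
  define v where "v = unit_ball_vol (real DIM('a))"
  have v: "v > 0" by (simp add: v_def unit_ball_vol_pos)
  have "(\<Sum>y\<in>C. v * r y ^ DIM('a)) = (\<Sum>y\<in>C. measure lebesgue (cball y (r y)))"
    using rC(1) by (intro sum.cong refl) (simp add: content_cball less_imp_le v_def)
  also have "\<dots> = measure lebesgue (\<Union>y\<in>C. cball y (r y))"
    by (rule measure_UNION'[symmetric, OF finC]) (use C(3) in \<open>auto intro: lmeasurable_cball\<close>)
  also have "\<dots> \<le> measure lebesgue U"
  proof (rule measure_mono_fmeasurable[OF _ _ m])
    show "(\<Union>y\<in>C. cball y (r y)) \<subseteq> U" using rC(2) by blast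
    show "(\<Union>y\<in>C. cball y (r y)) \<in> sets lebesgue" using finC by (intro sets.finite_UN) auto
  qed
  finally have s: "v * (\<Sum>y\<in>C. r y ^ DIM('a)) \<le> measure lebesgue U" by (simp add: sum_distrib_left)
  show ?thesis
  proof (rule that[of C "\<lambda>y. 5 * r y"])
    show "Z \<subseteq> (\<Union>y\<in>C. ball y (5 * r y))"
    proof
      fix z assume "z \<in> Z"
      then obtain i where "i \<in> Z0" "z \<in> ball i (r i)" using Z0(3) by blast
      then show "z \<in> (\<Union>y\<in>C. ball y (5 * r y))" using C(4)[of i] ball_subset_cball[of i "r i"] by blast
    qed
    have "(\<Sum>y\<in>C. (5 * r y) ^ DIM('a)) = 5 ^ DIM('a) * (\<Sum>y\<in>C. r y ^ DIM('a))"
      by (simp add: power_mult_distrib sum_distrib_left)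
    also have "\<dots> \<le> 5 ^ DIM('a) * (measure lebesgue U / v)" using s v by (intro mult_left_mono) (auto simp: field_simps)
    finally show "(\<Sum>y\<in>C. (5 * r y) ^ DIM('a)) \<le> 5 ^ DIM('a) * measure lebesgue U / unit_ball_vol (real DIM('a))"
      by (simp add: v_def)
  qed (use finC rC in auto)
qed

subsection \<open>Uniqueness\<close>

definition solution :: "real \<Rightarrow> 'a::euclidean_space set \<Rightarrow> ('a \<times> real \<Rightarrow> real) \<Rightarrow> ('a \<times> real \<Rightarrow> real) \<Rightarrow> bool" where
  "solution q \<Omega> f u \<longleftrightarrow> (\<forall>p\<in>\<Omega> \<times> {0<..}. u p > 0) \<and>
     continuous_on (closure \<Omega> \<times> {0<..}) u \<and> C21_on (\<Omega> \<times> {0<..}) u \<and>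
     (\<forall>p\<in>\<Omega> \<times> {0<..}. pdt u p - lap u p + \<bar>u p\<bar> powr (q - 1) * u p = 0) \<and>
     (\<forall>p\<in>frontier \<Omega> \<times> {0<..}. u p = f p) \<and>
     (\<forall>K M. compact K \<and> K \<subseteq> \<Omega> \<longrightarrow>
        (\<exists>\<delta>>0. \<forall>x\<in>K. \<forall>t. 0 < t \<and> t < \<delta> \<longrightarrow> M \<le> u (x, t)))"

lemma absorption_gq: "s > 0 \<Longrightarrow> \<bar>s\<bar> powr (q - 1) * s = gq q s"
  using powr_mult_base[of s "q - 1"] by (simp add: gq_pos_eq mult.commute)

lemma solution_hop:
  assumes "open \<Omega>" "solution q \<Omega> f u" "p \<in> \<Omega> \<times> {0<..}"
  shows "hop u p (- gq q (u p))"
proof -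
  have D: "open (\<Omega> \<times> {0::real<..})" by (intro open_Times assms(1)) auto
  have "C21_on (\<Omega> \<times> {0<..}) u" "u p > 0" "pdt u p - lap u p + \<bar>u p\<bar> powr (q - 1) * u p = 0"
    using assms(2,3) unfolding solution_def by blast+
  then show ?thesis using hop_iff_C21[OF D _ assms(3)] absorption_gq[of "u p" q] by auto
qed

text \<open>The layers decrease to the empty set, because a point at distance 0 from the frontier
  lies on it and not in the open set \<Omega>; the ball makes their measure finite. The frontier
  itself may have positive measure, but only the part of a layer inside \<Omega> is
  measured.\<close>

lemma thin_boundary_layer:
  fixes \<Omega> :: "'a::euclidean_space set"
  assumes "open \<Omega>" "frontier \<Omega> \<noteq> {}" "\<eta> > 0"
  obtains \<delta> where "\<delta> > 0" "open {x \<in> \<Omega> \<inter> ball 0 R. infdist x (frontier \<Omega>) < \<delta>}"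
    "{x \<in> \<Omega> \<inter> ball 0 R. infdist x (frontier \<Omega>) < \<delta>} \<in> lmeasurable"
    "measure lebesgue {x \<in> \<Omega> \<inter> ball 0 R. infdist x (frontier \<Omega>) < \<delta>} < \<eta>"
proof -
  define A where "A n = {x \<in> \<Omega> \<inter> ball 0 R. infdist x (frontier \<Omega>) < 1 / real (Suc n)}" for n
  have oA: "open (A n)" for n
  proof -
    have "open {x. infdist x (frontier \<Omega>) < 1 / real (Suc n)}"
      by (intro open_Collect_less continuous_intros)
    then have "open ((\<Omega> \<inter> ball 0 R) \<inter> {x. infdist x (frontier \<Omega>) < 1 / real (Suc n)})"
      by (intro open_Int assms(1)) auto
    then show ?thesis unfolding A_def Int_def by simp
  qed
  have mA: "A n \<in> lmeasurable" for n
    by (intro lmeasurable_open oA bounded_subset[OF bounded_ball[of 0 R]]) (auto simp: A_def)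
  have "(\<lambda>n. measure lebesgue (A n)) \<longlonglongrightarrow> measure lebesgue (\<Inter>n. A n)"
  proof (rule Lim_measure_decseq)
    show "range A \<subseteq> sets lebesgue" using mA by auto
    have "1 / real (Suc n) \<le> 1 / real (Suc m)" if "m \<le> n" for m n using that by (intro frac_le) auto
    then show "decseq A" unfolding decseq_def A_def by force
    show "emeasure lebesgue (A n) \<noteq> \<infinity>" for n 
      unfolding infinity_ennreal_def by (rule fmeasurableD2[OF mA])
  qed
  moreover have "(\<Inter>n. A n) = {}"
  proof (rule ccontr)
    assume "(\<Inter>n. A n) \<noteq> {}"
    then obtain x where x: "\<And>n. x \<in> A n" by auto
    have "infdist x (frontier \<Omega>) \<le> 0"
    proof (rule field_le_epsilon)
      fix e :: real assume "e > 0"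
      then obtain n where "1 / real (Suc n) < e" using nat_approx_posE by blast
      then show "infdist x (frontier \<Omega>) \<le> 0 + e" using x[of n] by (auto simp: A_def)
    qed
    then have "x \<in> frontier \<Omega>"
      using in_closed_iff_infdist_zero[OF frontier_closed assms(2), of x] infdist_nonneg[of x "frontier \<Omega>"] by auto
    moreover have "x \<in> \<Omega>" using x[of 0] by (simp add: A_def)
    ultimately show False using assms(1) by (simp add: frontier_def interior_open)
  qed
  ultimately have "(\<lambda>n. measure lebesgue (A n)) \<longlonglongrightarrow> 0" by simp
  then obtain n where "measure lebesgue (A n) < \<eta>"
    using order_tendstoD(2)[of _ 0 sequentially \<eta>] assms(3) by (auto simp: eventually_sequentially)
  then show ?thesis using that[of "1 / real (Suc n)"] oA[of n] mA[of n] by (simp add: A_def)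
qed

text \<open>The starting time \<open>s\<close> is chosen after the bound \<open>C\<close> of the
  shifted solution and after the layer, because the explosion of \<open>u\<close> is uniform only on
  the compact set \<open>K\<close> which the layer leaves over. Of the final
  \<open>4 * \<epsilon>\<close>, one part comes from the stationary barrier, one from the Gaussians
  and two from the constant in \<open>Bar\<close>.\<close>

lemma shifted_comparison:
  fixes \<Omega> :: "'a::euclidean_space set"
  assumes \<Omega>: "open \<Omega>" "frontier \<Omega> \<noteq> {}" and q: "q > 1" and f: "\<forall>p\<in>frontier \<Omega> \<times> {0..}. f p \<ge> 0"
    and u: "solution q \<Omega> f u" and v: "solution q \<Omega> f v"
    and x1: "x1 \<in> closure \<Omega>" and t1: "t1 > 0" and \<tau>: "\<tau> > 0" and \<epsilon>: "\<epsilon> > 0"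
    and osc: "\<And>x t. x \<in> frontier \<Omega> \<Longrightarrow> 0 < t \<Longrightarrow> t \<le> t1 \<Longrightarrow> f (x, t + \<tau>) \<le> f (x, t) + \<epsilon>"
  shows "v (x1, t1 + \<tau>) \<le> u (x1, t1) + 4 * \<epsilon>"
proof -
  let ?S = "closure \<Omega> \<times> {0::real<..}"
  have uc: "continuous_on ?S u" and vc: "continuous_on ?S v" using u v unfolding solution_def by blast+
  have nn: "0 \<le> w p" if "solution q \<Omega> f w" "p \<in> ?S" for w p
  proof (cases "fst p \<in> \<Omega>")
    case True
    then have "p \<in> \<Omega> \<times> {0<..}" using that(2) by (auto simp: mem_Times_iff)
    then show ?thesis using that(1) unfolding solution_def by (meson less_imp_le)
  next
    case False
    then have "p \<in> frontier \<Omega> \<times> {0<..}" using that(2) \<Omega>(1) by (auto simp: mem_Times_iff frontier_def interior_open)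
    then have "w p = f p" "p \<in> frontier \<Omega> \<times> {0..}" using that(1) unfolding solution_def by auto
    then show ?thesis using f by auto
  qed
  have lat: "w (x, t) = f (x, t)" if "solution q \<Omega> f w" "x \<in> frontier \<Omega>" "t > 0" for w x t
    using that unfolding solution_def by auto
  obtain R \<psi> where R: "norm x1 < R" "\<And>x. norm x < R \<Longrightarrow> \<psi> x \<ge> 0" "continuous_on (ball 0 R) \<psi>" "\<psi> x1 \<le> \<epsilon>"
    "\<And>(x::'a) t. norm x < R \<Longrightarrow> \<exists>h\<ge>- (\<psi> x powr q). hop (\<lambda>p. \<psi> (fst p)) (x, t) h"
    "\<And>C. \<exists>R'. norm x1 < R' \<and> R' < R \<and> (\<forall>x. norm x = R' \<longrightarrow> C \<le> \<psi> x)"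
    using keller_osserman[OF q \<epsilon>, of x1] by blast
  have cK: "compact (closure \<Omega> \<inter> cball 0 R)" by (intro closed_Int_compact closed_closure compact_cball)
  have cv: "continuous_on ((closure \<Omega> \<inter> cball 0 R) \<times> {\<tau>..t1 + \<tau>}) v"
    by (rule continuous_on_subset[OF vc]) (use \<tau> in auto)
  \<comment> \<open>The shift keeps \<open>v\<close> away from its singular time, so compactness
    bounds it on the ball of radius \<open>R\<close>. The bound depends on \<open>R\<close>, which
    is why the stationary barrier is fixed before.\<close>
  obtain C where C: "C > 0" "\<And>p. p \<in> (closure \<Omega> \<inter> cball 0 R) \<times> {\<tau>..t1 + \<tau>} \<Longrightarrow> \<bar>v p\<bar> \<le> C"
    using compact_bound[OF compact_Times[OF cK compact_Icc] cv] by blast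
  define N where "N = real DIM('a)"
  define E where "E = exp (1 / 4) * (t1 / 2) powr (- N / 2)"
  have E: "E > 0" using t1 by (simp add: E_def)
  define V where "V = unit_ball_vol N"
  have V: "V > 0" by (simp add: V_def N_def)
  \<comment> \<open>Chosen such that Gaussians covering a set of measure below \<eta>, multiplied by
    \<open>C\<close>, amount to at most \<epsilon> at time \<open>t1\<close>:
    \<open>5 ^ DIM('a)\<close> is the loss in the covering lemma and \<open>E\<close> bounds a
    Gaussian of unit radius after time \<open>t1 / 2\<close>.\<close>
  define \<eta> where "\<eta> = \<epsilon> * V / (C * E * 5 ^ DIM('a))"
  have \<eta>: "\<eta> > 0" using \<epsilon> C E V by (simp add: \<eta>_def)
  obtain \<delta> where \<delta>: "\<delta> > 0" "open {x \<in> \<Omega> \<inter> ball 0 (R + 1). infdist x (frontier \<Omega>) < \<delta>}"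
    "{x \<in> \<Omega> \<inter> ball 0 (R + 1). infdist x (frontier \<Omega>) < \<delta>} \<in> lmeasurable"
    "measure lebesgue {x \<in> \<Omega> \<inter> ball 0 (R + 1). infdist x (frontier \<Omega>) < \<delta>} < \<eta>"
    using thin_boundary_layer[OF \<Omega> \<eta>] by blast
  define L where "L = {x \<in> \<Omega> \<inter> ball 0 (R + 1). infdist x (frontier \<Omega>) < \<delta>}"
  define K where "K = (closure \<Omega> \<inter> cball 0 R) \<inter> {x. \<delta> \<le> infdist x (frontier \<Omega>)}"
  have Kc: "compact K" unfolding K_def
    by (intro compact_Int_closed cK closed_Collect_le continuous_intros)
  have K\<Omega>: "K \<subseteq> \<Omega>"
  proof
    fix x assume x: "x \<in> K"
    show "x \<in> \<Omega>"
    proof (rule ccontr)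
      assume "x \<notin> \<Omega>"
      then have "x \<in> frontier \<Omega>" using x \<Omega>(1) by (auto simp: K_def frontier_def interior_open)
      then show False using x \<delta>(1) by (simp add: K_def)
    qed
  qed
  obtain \<delta>0 where \<delta>0: "\<delta>0 > 0" "\<And>x t. x \<in> K \<Longrightarrow> 0 < t \<Longrightarrow> t < \<delta>0 \<Longrightarrow> C \<le> u (x, t)"
    using u Kc K\<Omega> unfolding solution_def by meson
  \<comment> \<open>Before \<delta>0 \<open>u\<close> is at least \<open>C\<close> on
    \<open>K\<close>, and \<open>s \<le> t1 / 2\<close> leaves the Gaussians at least half of
    \<open>t1\<close> to decay.\<close>
  define s where "s = min \<delta>0 t1 / 2"
  have s: "0 < s" "s < \<delta>0" "s \<le> t1 / 2" using \<delta>0 t1 by (auto simp: s_def)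
  define W where "W x = v (x, s + \<tau>) - u (x, s)" for x
  have Wc: "continuous_on (closure \<Omega>) W"
    unfolding W_def using s \<tau>
    by (intro continuous_intros continuous_on_compose2[OF vc] continuous_on_compose2[OF uc]) auto
  \<comment> \<open>At time \<open>s\<close> the excess is at most \<epsilon> on the frontier and at
    most 0 on \<open>K\<close>, so the compact set where it reaches \<open>2 * \<epsilon>\<close>
    lies in the layer. The layer was taken in the ball of radius \<open>R + 1\<close> so that it is
    an open set around \<open>Z\<close>.\<close>
  define Z where "Z = (closure \<Omega> \<inter> cball 0 R) \<inter> W -` {2 * \<epsilon>..}"
  have "closed Z" unfolding Z_def
    by (intro continuous_closed_preimage continuous_on_subset[OF Wc] compact_imp_closed[OF cK]) auto
  then have Zc: "compact Z" using compact_Int_closed[OF cK, of Z] by (simp add: Z_def Int_absorb1 Int_left_absorb inf.absorb2 le_infI1)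
  have vC: "v (x, t + \<tau>) \<le> C" if "x \<in> closure \<Omega>" "norm x \<le> R" "0 \<le> t" "t \<le> t1" for x t
  proof -
    have "(x, t + \<tau>) \<in> (closure \<Omega> \<inter> cball 0 R) \<times> {\<tau>..t1 + \<tau>}" using that by simp
    from C(2)[OF this] show ?thesis by (simp add: abs_le_iff)
  qed
  have ZL: "Z \<subseteq> L"
  proof
    fix x assume x: "x \<in> Z"
    then have xc: "x \<in> closure \<Omega>" "norm x \<le> R" "2 * \<epsilon> \<le> W x" by (auto simp: Z_def)
    have "x \<notin> frontier \<Omega>"
    proof
      assume xf: "x \<in> frontier \<Omega>"
      have "W x \<le> \<epsilon>" unfolding W_def
        using lat[OF v xf, of "s + \<tau>"] lat[OF u xf, of s] osc[OF xf, of s] s \<tau> t1 by simp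
      then show False using xc \<epsilon> by simp
    qed
    then have "x \<in> \<Omega>" using xc(1) \<Omega>(1) by (auto simp: frontier_def interior_open)
    moreover have "x \<notin> K"
    proof
      assume "x \<in> K"
      then have "W x \<le> 0" unfolding W_def using \<delta>0(2)[of x s] s vC[OF xc(1,2), of s] t1 by simp
      then show False using xc \<epsilon> by simp
    qed
    ultimately show "x \<in> L" using xc by (auto simp: L_def K_def)
  qed
  obtain Y \<rho> where Y: "finite Y" "\<And>y. y \<in> Y \<Longrightarrow> \<rho> y > 0" "Z \<subseteq> (\<Union>y\<in>Y. ball y (\<rho> y))"
    "(\<Sum>y\<in>Y. \<rho> y ^ DIM('a)) \<le> 5 ^ DIM('a) * measure lebesgue L / unit_ball_vol (real DIM('a))"
    using finite_ball_cover[OF Zc ZL] \<delta>(2,3) unfolding L_def[symmetric] by blast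
  define H where "H p = (\<Sum>y\<in>Y. gauss y (\<rho> y) (p + (0, - s)))" for p
  have H0: "H p \<ge> 0" for p unfolding H_def by (intro sum_nonneg gauss_props(1) Y(2))
  have H1: "H (x, s) \<ge> 1" if xZ: "x \<in> Z" for x
  proof -
    obtain y where y: "y \<in> Y" "x \<in> ball y (\<rho> y)" using Y(3) xZ by blast
    have "1 \<le> gauss y (\<rho> y) (x, 0)" by (rule gauss_props(2)[OF Y(2)[OF y(1)] y(2)])
    also have "\<dots> \<le> (\<Sum>y\<in>Y. gauss y (\<rho> y) (x, 0))"
      by (rule member_le_sum[OF y(1)]) (use Y(1,2) in \<open>auto intro: gauss_props(1)\<close>)
    finally show ?thesis by (simp add: H_def)
  qed
  have H2: "C * H (x1, t1) \<le> \<epsilon>"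
  proof -
    have "H (x1, t1) \<le> (\<Sum>y\<in>Y. E * \<rho> y ^ DIM('a))"
      unfolding H_def
    proof (rule sum_mono)
      fix y assume y: "y \<in> Y"
      have "gauss y (\<rho> y) (x1, t1 - s) \<le> exp (1 / 4) * (t1 - s) powr (- real DIM('a) / 2) * \<rho> y ^ DIM('a)"
        by (rule gauss_props(3)[OF Y(2)[OF y]]) (use s t1 in simp)
      also have "(t1 - s) powr (- real DIM('a) / 2) \<le> (t1 / 2) powr (- real DIM('a) / 2)"
        using s t1 by (intro powr_mono2') auto
      then have "exp (1 / 4) * (t1 - s) powr (- real DIM('a) / 2) * \<rho> y ^ DIM('a) \<le> E * \<rho> y ^ DIM('a)"
        unfolding E_def N_def using Y(2)[OF y] by (intro mult_right_mono mult_left_mono) auto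
      finally show "gauss y (\<rho> y) ((x1, t1) + (0, - s)) \<le> E * \<rho> y ^ DIM('a)" by simp
    qed
    also have "\<dots> = E * (\<Sum>y\<in>Y. \<rho> y ^ DIM('a))" by (simp add: sum_distrib_left)
    also have "\<dots> \<le> E * (5 ^ DIM('a) * \<eta> / V)"
    proof (rule mult_left_mono)
      have "5 ^ DIM('a) * measure lebesgue L / V \<le> 5 ^ DIM('a) * \<eta> / V"
        using \<delta>(4) V unfolding L_def[symmetric] by (intro divide_right_mono mult_left_mono) auto
      then show "(\<Sum>y\<in>Y. \<rho> y ^ DIM('a)) \<le> 5 ^ DIM('a) * \<eta> / V" using Y(4) unfolding V_def N_def by linarith
    qed (use E in simp)
    finally have "C * H (x1, t1) \<le> C * (E * (5 ^ DIM('a) * \<eta> / V))" using C by (intro mult_left_mono) auto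
    also have "\<dots> = \<epsilon>" unfolding \<eta>_def using C E V by simp
    finally show ?thesis .
  qed
  \<comment> \<open>On this sphere \<psi> is at least \<open>C\<close> and dominates the shifted
    \<open>v\<close>; the comparison takes place inside it, where \<psi> is still bounded.\<close>
  obtain R' where R': "norm x1 < R'" "R' < R" "\<And>x. norm x = R' \<Longrightarrow> C \<le> \<psi> x" using R(6)[of C] by blast
  have R'0: "R' > 0" using R'(1) norm_ge_zero[of x1] by linarith
  let ?O = "\<Omega> \<inter> ball 0 R'"
  have oO: "open ?O" by (intro open_Int \<Omega>(1)) auto
  have clO: "closure ?O \<subseteq> closure \<Omega> \<inter> cball 0 R'"
  proof -
    have "closure ?O \<subseteq> closure \<Omega> \<inter> closure (ball 0 R')" by (intro Int_greatest closure_mono) auto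
    then show ?thesis using R'0 by (simp add: closure_ball)
  qed
  have clb: "x \<in> closure \<Omega>" "norm x \<le> R'" "norm x < R" if "x \<in> closure ?O" for x
    using clO that R'(2) by (auto simp: subset_iff)
  define Bar where "Bar p = \<psi> (fst p) + C * H p + 2 * \<epsilon>" for p
  have Barn: "Bar p \<ge> 0" "Bar p \<ge> \<psi> (fst p)" if "norm (fst p) < R" for p
    using R(2)[OF that] H0[of p] C \<epsilon> by (auto simp: Bar_def)
  have "v ((x1, t1) + (0, \<tau>)) \<le> u (x1, t1) + Bar (x1, t1)"
  proof (rule compare_sol[OF oO, of s t1 "\<lambda>p. v (p + (0, \<tau>))" "\<lambda>p. u p + Bar p" C])
    have sub: "closure ?O \<times> {s..t1} \<subseteq> ?S" using clb s by auto
    show "continuous_on (closure ?O \<times> {s..t1}) (\<lambda>p. v (p + (0, \<tau>)))"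
      by (rule continuous_on_compose2[OF vc]) (use clb s \<tau> in \<open>auto intro!: continuous_intros\<close>)
    show "continuous_on (closure ?O \<times> {s..t1}) (\<lambda>p. u p + Bar p)"
      unfolding Bar_def H_def
    proof (intro continuous_intros continuous_on_subset[OF uc sub])
      show "continuous_on (closure ?O \<times> {s..t1}) (\<lambda>p. \<psi> (fst p))"
        by (rule continuous_on_compose2[OF R(3)]) (use clb in \<open>auto intro!: continuous_intros\<close>)
      show "continuous_on (closure ?O \<times> {s..t1}) (\<lambda>p. gauss y (\<rho> y) (p + (0, - s)))" if "y \<in> Y" for y
        by (rule continuous_on_compose2[OF gauss_props(4)[OF Y(2)[OF that]]]) (auto intro!: continuous_intros)
    qed
    show "v (p + (0, \<tau>)) \<le> C" if "p \<in> closure ?O \<times> {s..t1}" for p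
      using vC[of "fst p" "snd p"] clb[of "fst p"] that s by (cases p) auto
    show "- C \<le> u p + Bar p" if "p \<in> closure ?O \<times> {s..t1}" for p
      using nn[OF u, of p] Barn(1)[of p] clb[of "fst p"] that sub C by (cases p) force
    show "v ((x, s) + (0, \<tau>)) \<le> u (x, s) + Bar (x, s)" if x: "x \<in> closure ?O" for x
    proof (cases "x \<in> Z")
      case True
      have "C * 1 \<le> C * H (x, s)" using H1[OF True] C by (intro mult_left_mono) auto
      moreover have "v (x, s + \<tau>) \<le> C" using vC[of x s] clb[OF x] s t1 by simp
      moreover have "0 \<le> u (x, s)" using nn[OF u, of "(x, s)"] clb[OF x] s by simp
      ultimately show ?thesis using R(2)[of x] clb[OF x] \<epsilon> by (simp add: Bar_def)
    next
      case False
      then have "W x < 2 * \<epsilon>" using clb[OF x] R'(2) by (auto simp: Z_def not_le)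
      moreover have "0 \<le> C * H (x, s)" using H0[of "(x, s)"] C by simp
      ultimately show ?thesis using R(2)[of x] clb[OF x] by (simp add: Bar_def W_def)
    qed
    show "v ((x, t) + (0, \<tau>)) \<le> u (x, t) + Bar (x, t)" if x: "x \<in> frontier ?O" "s < t" "t \<le> t1" for x t
    proof -
      have xc: "x \<in> closure ?O" using x(1) by (simp add: frontier_def)
      have HC: "0 \<le> C * H (x, t)" using H0[of "(x, t)"] C by simp
      have "x \<in> frontier \<Omega> \<or> x \<in> frontier (ball 0 R')" using x(1) frontier_Int_subset by blast
      then show ?thesis
      proof
        assume xf: "x \<in> frontier \<Omega>"
        show ?thesis
          using lat[OF v xf, of "t + \<tau>"] lat[OF u xf, of t] osc[OF xf, of t] x s \<tau> HC R(2)[of x] clb[OF xc] \<epsilon>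
          by (simp add: Bar_def)
      next
        assume "x \<in> frontier (ball 0 R')"
        then have "norm x = R'" using R'0 by (simp add: frontier_ball)
        then show ?thesis using R'(3)[of x] vC[of x t] clb[OF xc] x s HC \<epsilon> nn[OF u, of "(x, t)"] by (simp add: Bar_def)
      qed
    qed
    show "\<exists>h k. hop (\<lambda>p. v (p + (0, \<tau>))) (x, t) h \<and> hop (\<lambda>p. u p + Bar p) (x, t) k \<and> h \<le> k"
      if x: "x \<in> ?O" "s < t" "t \<le> t1" "u (x, t) + Bar (x, t) < v ((x, t) + (0, \<tau>))" for x t
    proof -
      have xR: "norm x < R" using x(1) R'(2) by auto
      have p1: "(x, t) \<in> \<Omega> \<times> {0<..}" "(x, t) + (0, \<tau>) \<in> \<Omega> \<times> {0<..}" using x s \<tau> by auto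
      have hv: "hop (\<lambda>p. v (p + (0, \<tau>))) (x, t) (- gq q (v ((x, t) + (0, \<tau>))))"
        by (rule hop_translate[OF solution_hop[OF \<Omega>(1) v p1(2)]])
      have hu: "hop u (x, t) (- gq q (u (x, t)))" by (rule solution_hop[OF \<Omega>(1) u p1(1)])
      obtain h where h: "h \<ge> - (\<psi> x powr q)" "hop (\<lambda>p. \<psi> (fst p)) (x, t) h" using R(5)[OF xR] by blast
      have "hop H (x, t) (\<Sum>y\<in>Y. 0)"
        unfolding H_def[abs_def]
      proof (rule hop_sum[OF Y(1)])
        fix y assume y: "y \<in> Y"
        have "hop (gauss y (\<rho> y)) (x, t - s) 0"
        proof (rule hop_gauss)
          have "0 \<le> (\<rho> y)\<^sup>2" by simp
          then show "- (\<rho> y)\<^sup>2 < t - s" using x(2) by linarith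
        qed
        then show "hop (\<lambda>q. gauss y (\<rho> y) (q + (0, - s))) (x, t) 0" by (intro hop_translate) simp
      qed
      then have "hop Bar (x, t) (h + C * 0 + 0)"
        unfolding Bar_def[abs_def] by (intro hop_add hop_cmult hop_const h(2)) simp
      from hop_add[OF hu this] have hub: "hop (\<lambda>p. u p + Bar p) (x, t) (- gq q (u (x, t)) + h)" by simp
      have u0: "0 \<le> u (x, t)" using nn[OF u, of "(x, t)"] p1(1) closure_subset[of \<Omega>] by auto
      \<comment> \<open>The Gaussians and the constant contribute nothing to the heat operator and
        only raise \<open>Bar\<close> above \<psi>, so superadditivity for \<open>u + \<psi>\<close>
        and monotonicity of \<open>gq q\<close> suffice.\<close>
      have "gq q (u (x, t)) + \<psi> x powr q \<le> (u (x, t) + \<psi> x) powr q"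
        using powr_superadditive[OF u0 R(2)[OF xR], of q] q u0 by (simp add: gq_pos_eq)
      also have "\<dots> = gq q (u (x, t) + \<psi> x)" using u0 R(2)[OF xR] by (simp add: gq_pos_eq)
      also have "\<dots> \<le> gq q (v ((x, t) + (0, \<tau>)))"
        using x(4) Barn(2)[of "(x, t)"] xR q by (intro gq_mono) auto
      finally have "- gq q (v ((x, t) + (0, \<tau>))) \<le> - gq q (u (x, t)) + h" using h(1) by linarith
      then show ?thesis using hv hub by blast
    qed
    have "x1 \<in> closure ?O" using open_Int_closure_subset[of "ball 0 R'" \<Omega>] x1 R'(1) by (auto simp: Int_commute)
    then show "(x1, t1) \<in> closure ?O \<times> {s..t1}" using s t1 by simp
  qed
  then show ?thesis using H2 R(4) by (simp add: Bar_def)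
qed

text \<open>Boundedness of the frontier makes \<open>f\<close> uniformly continuous on
  \<open>frontier \<Omega> \<times> {0..t1 + 1}\<close>, so small shifts change the lateral data
  little, uniformly down to time 0. The shift tends to 0 for a fixed \<epsilon>, and \<epsilon> is
  removed afterwards.\<close>

lemma solution_le:
  fixes \<Omega> :: "'a::euclidean_space set"
  assumes \<Omega>: "open \<Omega>" "frontier \<Omega> \<noteq> {}" "bounded (frontier \<Omega>)" and q: "q > 1"
    and f: "continuous_on (frontier \<Omega> \<times> {0..}) f" "\<forall>p\<in>frontier \<Omega> \<times> {0..}. f p \<ge> 0"
    and u: "solution q \<Omega> f u" and v: "solution q \<Omega> f v" and p: "p \<in> closure \<Omega> \<times> {0<..}"
  shows "v p \<le> u p"
proof -
  obtain x1 t1 where xt: "p = (x1, t1)" "x1 \<in> closure \<Omega>" "t1 > 0" using p by auto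
  have "v (x1, t1) \<le> u (x1, t1) + e" if e: "e > 0" for e
  proof -
    define \<epsilon> where "\<epsilon> = e / 4"
    have \<epsilon>: "\<epsilon> > 0" using e by (simp add: \<epsilon>_def)
    have "compact (frontier \<Omega> \<times> {0..t1 + 1})"
      using \<Omega>(3) by (intro compact_Times) (auto simp: compact_eq_bounded_closed)
    then have "uniformly_continuous_on (frontier \<Omega> \<times> {0..t1 + 1}) f"
      by (intro compact_uniformly_continuous continuous_on_subset[OF f(1)]) auto
    then obtain d where d: "d > 0" "\<And>a b. a \<in> frontier \<Omega> \<times> {0..t1 + 1} \<Longrightarrow> b \<in> frontier \<Omega> \<times> {0..t1 + 1} \<Longrightarrow>
        dist b a < d \<Longrightarrow> dist (f b) (f a) < \<epsilon>"
      using \<epsilon> unfolding uniformly_continuous_on_def by metis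
    \<comment> \<open>The denominator \<open>n + 2\<close> makes the shift strictly smaller than
      \<open>d\<close> from the first index on; shifts of at most 1 keep the shifted times below
      \<open>t1 + 1\<close>.\<close>
    define \<tau> where "\<tau> n = min 1 d / real (n + 2)" for n
    have \<tau>: "\<tau> n > 0" "\<tau> n < d" "\<tau> n \<le> 1" for n
    proof -
      show "\<tau> n > 0" using d by (simp add: \<tau>_def)
      have "min 1 d * 1 < min 1 d * real (n + 2)" using d by (intro mult_strict_left_mono) auto
      then have "\<tau> n < min 1 d" unfolding \<tau>_def by (subst pos_divide_less_eq) auto
      then show "\<tau> n < d" "\<tau> n \<le> 1" by auto
    qed
    have "v (x1, t1 + \<tau> n) \<le> u (x1, t1) + 4 * \<epsilon>" for n
    proof (rule shifted_comparison[OF \<Omega>(1,2) q f(2) u v xt(2,3) \<tau>(1) \<epsilon>])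
      fix x t assume x: "x \<in> frontier \<Omega>" "0 < t" "t \<le> t1"
      have "dist (f (x, t + \<tau> n)) (f (x, t)) < \<epsilon>"
        by (rule d(2)) (use x \<tau>[of n] in \<open>auto simp: dist_Pair_Pair dist_real_def\<close>)
      then show "f (x, t + \<tau> n) \<le> f (x, t) + \<epsilon>" by (simp add: dist_real_def abs_less_iff)
    qed
    moreover have "(\<lambda>n. v (x1, t1 + \<tau> n)) \<longlonglongrightarrow> v (x1, t1)"
    proof -
      have "\<tau> \<longlonglongrightarrow> 0"
        unfolding \<tau>_def using LIMSEQ_ignore_initial_segment[OF lim_const_over_n[of "min 1 d"], of 2] by simp
      then have "(\<lambda>n. (x1, t1 + \<tau> n)) \<longlonglongrightarrow> (x1, t1 + 0)" by (intro tendsto_intros)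
      moreover have "continuous_on (closure \<Omega> \<times> {0<..}) v" using v unfolding solution_def by blast
      moreover have "(x1, t1 + \<tau> n) \<in> closure \<Omega> \<times> {0<..}" for n using xt \<tau>(1)[of n] by auto
      ultimately show ?thesis
        using continuous_on_tendsto_compose[of "closure \<Omega> \<times> {0<..}" v "\<lambda>n. (x1, t1 + \<tau> n)" "(x1, t1)" sequentially] xt by auto
    qed
    ultimately have "v (x1, t1) \<le> u (x1, t1) + 4 * \<epsilon>" by (intro LIMSEQ_le_const2) auto
    then show ?thesis by (simp add: \<epsilon>_def)
  qed
  then show ?thesis unfolding xt(1) by (rule field_le_epsilon)
qed

subsection \<open>Existence\<close>

definition blowup :: "real \<Rightarrow> real \<Rightarrow> real" where
  "blowup q t = ((q - 1) * t) powr (- 1 / (q - 1))"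

lemma blowup_pos: "q > 1 \<Longrightarrow> t > 0 \<Longrightarrow> blowup q t > 0"
  by (simp add: blowup_def)

lemma blowup_antimono:
  assumes "q > 1" "0 < s" "s \<le> t" shows "blowup q t \<le> blowup q s"
  unfolding blowup_def using assms by (intro powr_mono2') auto

lemma blowup_large:
  assumes q: "q > 1" obtains d where "d > 0" "\<And>t. 0 < t \<Longrightarrow> t \<le> d \<Longrightarrow> M \<le> blowup q t"
proof -
  define K where "K = max M 1"
  define d where "d = K powr (- (q - 1)) / (q - 1)"
  have K: "K > 0" "M \<le> K" by (auto simp: K_def)
  have d: "d > 0" using q K by (simp add: d_def)
  have "(q - 1) * d = K powr (- (q - 1))" using q by (simp add: d_def)
  then have "blowup q d = K powr (- (q - 1) * (- 1 / (q - 1)))" unfolding blowup_def by (simp only: powr_powr)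
  also have "- (q - 1) * (- 1 / (q - 1)) = 1" using q by (simp add: field_simps)
  finally have "blowup q d = K" using K by simp
  then have "M \<le> blowup q t" if "0 < t" "t \<le> d" for t using blowup_antimono[OF q that] K by simp
  then show ?thesis using that d by blast
qed

lemma blowup_deriv:
  assumes q: "q > 1" and t: "t > 0"
  shows "(blowup q has_real_derivative - (blowup q t powr q)) (at t)"
proof -
  define a where "a = - 1 / (q - 1)"
  have a: "a * (q - 1) = - 1" using q by (simp add: a_def)
  have y: "(q - 1) * t > 0" using q t by simp
  have "((\<lambda>s. (q - 1) * s) has_real_derivative (q - 1)) (at t)" by (auto intro!: derivative_eq_intros)
  moreover have "((\<lambda>s. s powr a) has_real_derivative a * ((q - 1) * t) powr (a - 1)) (at ((q - 1) * t))"
    using y by (rule has_real_derivative_powr)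
  ultimately have "((\<lambda>s. ((q - 1) * s) powr a) has_real_derivative a * ((q - 1) * t) powr (a - 1) * (q - 1)) (at t)"
    using DERIV_chain2[of "\<lambda>s. s powr a" "a * ((q - 1) * t) powr (a - 1)" "\<lambda>s. (q - 1) * s" t "q - 1" UNIV] by blast
  moreover have "a * ((q - 1) * t) powr (a - 1) * (q - 1) = - (blowup q t powr q)"
  proof -
    have "a * q = a - 1" using a by (simp add: algebra_simps)
    then have "blowup q t powr q = ((q - 1) * t) powr (a - 1)" unfolding blowup_def powr_powr a_def[symmetric] by simp
    moreover have "a * z * (q - 1) = - z" for z
    proof -
      have "a * z * (q - 1) = a * (q - 1) * z" by (simp only: mult_ac)
      then show ?thesis unfolding a by simp
    qed
    ultimately show ?thesis by simp
  qed
  ultimately show ?thesis unfolding blowup_def[abs_def] a_def[symmetric] by simp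
qed

text \<open>With \<open>\<eta> = 1 - (norm (x - y))^2 / r^2\<close>, this is the flat solution times
  \<open>\<eta>^2\<close> and an exponential damping. The Laplacian and the damping together
  contribute a quadratic in \<eta>, which already has the favourable sign on the sphere, where
  \<open>\<eta> = 0\<close>; the rate is the value for which the quadratic has a double root and so
  keeps this sign.\<close>

definition ball_sub :: "real \<Rightarrow> 'a::euclidean_space \<Rightarrow> real \<Rightarrow> 'a \<times> real \<Rightarrow> real" where
  "ball_sub q y r p = exp (- ((8 + 4 * real DIM('a))\<^sup>2 / (32 * r\<^sup>2)) * snd p) * blowup q (snd p) *
     (1 - (norm (fst p - y))\<^sup>2 / r\<^sup>2)\<^sup>2"

lemma ball_sub_props:
  fixes y :: "'a::euclidean_space"
  assumes q: "q > 1" and r: "r > 0"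
  shows "continuous_on (UNIV \<times> {0<..}) (ball_sub q y r)"
    "t > 0 \<Longrightarrow> norm (x - y) \<le> r \<Longrightarrow> 0 \<le> ball_sub q y r (x, t) \<and> ball_sub q y r (x, t) \<le> blowup q t"
    "norm (x - y) = r \<Longrightarrow> ball_sub q y r (x, t) = 0"
    "ball_sub q y r (y, t) = exp (- ((8 + 4 * real DIM('a))\<^sup>2 / (32 * r\<^sup>2)) * t) * blowup q t"
    "t > 0 \<Longrightarrow> norm (x - y) < r \<Longrightarrow> \<exists>h\<le>- (ball_sub q y r (x, t) powr q). hop (ball_sub q y r) (x, t) h"
proof -
  show "continuous_on (UNIV \<times> {0<..}) (ball_sub q y r)"
    unfolding ball_sub_def blowup_def using q r by (intro continuous_intros) auto
  show "ball_sub q y r (x, t) = 0" if "norm (x - y) = r" using that r by (simp add: ball_sub_def)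
  show "ball_sub q y r (y, t) = exp (- ((8 + 4 * real DIM('a))\<^sup>2 / (32 * r\<^sup>2)) * t) * blowup q t"
    by (simp add: ball_sub_def)
  have eta: "0 \<le> 1 - (norm (x - y))\<^sup>2 / r\<^sup>2" "1 - (norm (x - y))\<^sup>2 / r\<^sup>2 \<le> 1" if "norm (x - y) \<le> r" for x
    using power_mono[OF that, of 2] r by (auto simp: divide_le_eq)
  define lam where "lam = (8 + 4 * real DIM('a))\<^sup>2 / (32 * r\<^sup>2)"
  have lam: "lam \<ge> 0" by (simp add: lam_def)
  show "0 \<le> ball_sub q y r (x, t) \<and> ball_sub q y r (x, t) \<le> blowup q t" if "t > 0" "norm (x - y) \<le> r"
  proof -
    have p: "blowup q t > 0" by (rule blowup_pos[OF q that(1)])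
    have e: "exp (- lam * t) \<le> 1" using lam that by simp
    have sq: "(1 - (norm (x - y))\<^sup>2 / r\<^sup>2)\<^sup>2 \<le> 1" using eta[OF that(2)] by (intro power_le_one)
    have "exp (- lam * t) * blowup q t \<le> 1 * blowup q t" using e p by (intro mult_right_mono) auto
    then have "exp (- lam * t) * blowup q t * (1 - (norm (x - y))\<^sup>2 / r\<^sup>2)\<^sup>2 \<le> (1 * blowup q t) * 1"
      using sq p by (intro mult_mono) auto
    then show ?thesis using p by (simp add: ball_sub_def lam_def)
  qed
  show "\<exists>h\<le>- (ball_sub q y r (x, t) powr q). hop (ball_sub q y r) (x, t) h" if t: "t > 0" and x: "norm (x - y) < r"
  proof -
    define N where "N = real DIM('a)"
    define \<eta> where "\<eta> = 1 - (norm (x - y))\<^sup>2 / r\<^sup>2"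
    have \<eta>: "0 \<le> \<eta>" "\<eta> \<le> 1" using eta[of x] x by (auto simp: \<eta>_def)
    define e where "e = exp (- lam * t)"
    have e: "0 < e" "e \<le> 1" using lam t by (auto simp: e_def)
    define \<phi> where "\<phi> = blowup q t"
    have \<phi>: "\<phi> > 0" unfolding \<phi>_def by (rule blowup_pos[OF q t])
    define w where "w = 1 / r\<^sup>2"
    have w: "w > 0" using r by (simp add: w_def)
    let ?K = "\<lambda>\<rho> s. exp (- lam * s) * blowup q s * (1 - \<rho> * w)\<^sup>2"
    let ?K1 = "\<lambda>\<rho> s. exp (- lam * s) * blowup q s * (- (2 * w) * (1 - \<rho> * w))"
    have d1: "((\<lambda>\<rho>. A * (1 - \<rho> * w)\<^sup>2) has_real_derivative A * (- (2 * w) * (1 - \<rho> * w))) (at \<rho>)" for A \<rho>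
      by (auto intro!: derivative_eq_intros)
    have d2: "((\<lambda>\<rho>. A * (- (2 * w) * (1 - \<rho> * w))) has_real_derivative A * (2 * w\<^sup>2)) (at \<rho>)" for A \<rho>
      by (auto intro!: derivative_eq_intros simp: power2_eq_square)
    have dt: "((\<lambda>s. ?K \<rho> s) has_real_derivative (e * - (\<phi> powr q) + - lam * e * \<phi>) * (1 - \<rho> * w)\<^sup>2) (at t)" for \<rho>
    proof -
      have "((\<lambda>s. exp (- lam * s)) has_real_derivative - lam * e) (at t)"
        by (auto intro!: derivative_eq_intros simp: e_def)
      from DERIV_mult[OF this blowup_deriv[OF q t]]
      have "((\<lambda>s. exp (- lam * s) * blowup q s) has_real_derivative e * - (\<phi> powr q) + - lam * e * \<phi>) (at t)"
        by (simp add: e_def \<phi>_def algebra_simps)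
      then show ?thesis by (rule DERIV_cmult_right)
    qed
    have "hop (\<lambda>p. ?K ((norm (fst p - y))\<^sup>2) (snd p)) (x, t)
      ((e * - (\<phi> powr q) + - lam * e * \<phi>) * (1 - (norm (x - y))\<^sup>2 * w)\<^sup>2
       - 4 * (norm (x - y))\<^sup>2 * (exp (- lam * t) * blowup q t * (2 * w\<^sup>2)) - 2 * real DIM('a) * ?K1 ((norm (x - y))\<^sup>2) t)"
      by (rule hop_radial[of UNIV, where K="?K" and ?K1.0="?K1"]) (rule open_UNIV UNIV_I d1 d2 dt)+
    moreover have "1 - (norm (x - y))\<^sup>2 * w = \<eta>" by (simp add: \<eta>_def w_def)
    moreover have "(\<lambda>p. ?K ((norm (fst p - y))\<^sup>2) (snd p)) = ball_sub q y r"
      by (rule ext) (simp add: ball_sub_def lam_def w_def)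
    ultimately have hop: "hop (ball_sub q y r) (x, t) ((e * - (\<phi> powr q) + - lam * e * \<phi>) * \<eta>\<^sup>2
       - 4 * (norm (x - y))\<^sup>2 * (e * \<phi> * (2 * w\<^sup>2)) - 2 * N * (e * \<phi> * (- (2 * w) * \<eta>)))"
      by (simp only: N_def e_def \<phi>_def)
    have "4 * (norm (x - y))\<^sup>2 * (e * \<phi> * (2 * w\<^sup>2)) = 8 * (e * \<phi> * w) * ((norm (x - y))\<^sup>2 * w)"
      by (simp add: power2_eq_square)
    also have "\<dots> = 8 * (e * \<phi> * w) * (1 - \<eta>)" by (simp add: \<eta>_def w_def)
    finally have s1: "4 * (norm (x - y))\<^sup>2 * (e * \<phi> * (2 * w\<^sup>2)) = 8 * (e * \<phi> * w) * (1 - \<eta>)" .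
    have lw: "lam = (8 + 4 * N)\<^sup>2 / 32 * w" by (simp add: lam_def w_def N_def)
    \<comment> \<open>The constant in \<open>ball_sub\<close> makes the spatial part a negative perfect square.\<close>
    have "(e * - (\<phi> powr q) + - lam * e * \<phi>) * \<eta>\<^sup>2 - 8 * (e * \<phi> * w) * (1 - \<eta>) - 2 * N * (e * \<phi> * (- (2 * w) * \<eta>))
      = - (e * \<phi> powr q * \<eta>\<^sup>2) - e * \<phi> * w * (((8 + 4 * N) * \<eta> - 16)\<^sup>2 / 32)"
      unfolding lw by (simp add: field_simps power2_eq_square)
    also have "\<dots> \<le> - (e * \<phi> powr q * \<eta>\<^sup>2)" using e \<phi> w by simp
    also have "\<dots> \<le> - (ball_sub q y r (x, t) powr q)"
    proof -
      \<comment> \<open>The multiplier \<open>e * \<eta>^2\<close> of the flat solution lies between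
        0 and 1, where raising to the power \<open>q > 1\<close> does not increase it. So the time
        derivative of the flat factor still pays for the absorption of the product.\<close>
      have small: "z powr q \<le> z" if "0 \<le> z" "z \<le> 1" for z :: real
        using powr_mono'[of 1 q z] that q by simp
      have "ball_sub q y r (x, t) = (e * \<eta>\<^sup>2) * \<phi>" by (simp add: ball_sub_def e_def lam_def \<eta>_def \<phi>_def)
      then have "ball_sub q y r (x, t) powr q = (e * \<eta>\<^sup>2) powr q * \<phi> powr q" using e \<phi> by (simp add: powr_mult)
      also have "\<dots> \<le> (e * \<eta>\<^sup>2) * \<phi> powr q"
        using small[of "e * \<eta>\<^sup>2"] e \<eta> by (intro mult_right_mono) (auto simp: mult_le_one power_le_one)
      finally show ?thesis by (simp add: mult_ac)
    qed
    finally show ?thesis using hop unfolding s1 by blast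
  qed
qed

text \<open>A time shift of \<open>nonlinear_solve\<close>, with lateral data that first stay at
  \<open>c\<close> and then pass to \<open>f\<close>: the constant phase removes any compatibility
  condition between \<open>c\<close> and \<open>f\<close> at the starting time. Later comparisons
  need the blending only through a coefficient \<theta> between 0 and 1.\<close>

lemma start_solve:
  fixes \<Omega> :: "'a::euclidean_space set"
  assumes \<Omega>: "open \<Omega>" "frontier \<Omega> \<noteq> {}" "bounded (frontier \<Omega>)" "PWC \<Omega>" and q: "q > 1"
    and f: "continuous_on (frontier \<Omega> \<times> {0..}) f" "\<forall>p\<in>frontier \<Omega> \<times> {0..}. f p \<ge> 0"
    and a: "0 \<le> a" "a < b" and \<sigma>: "0 < \<sigma>" and c: "0 \<le> c"
  obtains U C where "continuous_on (closure \<Omega> \<times> {a..<b}) U" "C21_on (\<Omega> \<times> {a<..<b}) U"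
    "\<And>p. p \<in> \<Omega> \<times> {a<..<b} \<Longrightarrow> hop U p (- gq q (U p))"
    "\<And>x t. x \<in> frontier \<Omega> \<Longrightarrow> a < t \<Longrightarrow> t < b \<Longrightarrow>
       \<exists>\<theta>\<ge>0. \<theta> \<le> 1 \<and> (a + \<sigma> \<le> t \<longrightarrow> \<theta> = 1) \<and> U (x, t) = (1 - \<theta>) * c + \<theta> * f (x, t)"
    "\<And>x. x \<in> closure \<Omega> \<Longrightarrow> U (x, a) = c"
    "\<And>p. p \<in> closure \<Omega> \<times> {a..<b} \<Longrightarrow> 0 \<le> U p \<and> U p \<le> C"
proof -
  have ne: "\<Omega> \<noteq> {}" using \<Omega>(2) by auto
  \<comment> \<open>Rises linearly from 0 at \<open>\<sigma> / 2\<close> to 1 at \<sigma>, so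
    \<open>\<sigma> / 2\<close> is the length of the constant phase.\<close>
  define \<theta> where "\<theta> s = max 0 (min 1 (2 * s / \<sigma> - 1))" for s
  have \<theta>: "0 \<le> \<theta> s" "\<theta> s \<le> 1" for s by (auto simp: \<theta>_def)
  have \<theta>0: "\<theta> s = 0" if "s \<le> \<sigma> / 2" for s using that \<sigma> by (simp add: \<theta>_def field_simps)
  have \<theta>1: "\<theta> s = 1" if "\<sigma> \<le> s" for s using that \<sigma> by (simp add: \<theta>_def field_simps)
  define h where "h p = (1 - \<theta> (snd p)) * c + \<theta> (snd p) * f (p + (0, a))" for p
  have "compact (frontier \<Omega> \<times> {0..b})"
    using \<Omega>(3) by (intro compact_Times) (auto simp: compact_eq_bounded_closed)
  moreover have "continuous_on (frontier \<Omega> \<times> {0..b}) f" by (rule continuous_on_subset[OF f(1)]) auto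
  ultimately obtain B where B: "B > 0" "\<And>z. z \<in> frontier \<Omega> \<times> {0..b} \<Longrightarrow> \<bar>f z\<bar> \<le> B"
    by (rule compact_bound) (rule that)
  define C where "C = max c B"
  have cC: "c \<le> C" by (simp add: C_def)
  have T: "0 < b - a" using a by simp
  have \<sigma>2: "0 < \<sigma> / 2" using \<sigma> by simp
  have h1: "continuous_on (frontier \<Omega> \<times> {0<..}) h"
  proof -
    have "continuous_on (frontier \<Omega> \<times> {0<..}) (\<lambda>p. f (p + (0, a)))"
      by (rule continuous_on_compose2[OF f(1)]) (use a in \<open>auto intro!: continuous_intros\<close>)
    then show ?thesis unfolding h_def \<theta>_def using \<sigma> by (intro continuous_intros) auto
  qed
  have h2: "h (x, t) = c" if "t \<le> \<sigma> / 2" for x t using \<theta>0[OF that] by (simp add: h_def)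
  have h3: "0 \<le> h (x, t) \<and> h (x, t) \<le> C" if "x \<in> frontier \<Omega>" "0 < t" "t \<le> b - a" for x t
  proof -
    have "(x, t + a) \<in> frontier \<Omega> \<times> {0..b}" using that a by auto
    from B(2)[OF this] have 1: "f (x, t + a) \<le> C" by (simp add: C_def)
    have "(x, t + a) \<in> frontier \<Omega> \<times> {0..}" using that a by auto
    then have 2: "0 \<le> f (x, t + a)" using f(2) by blast
    have "(1 - \<theta> t) * c + \<theta> t * f (x, t + a) \<le> C"
      by (rule convex_bound_le[OF cC 1]) (use \<theta>[of t] in auto)
    then show ?thesis using 2 c \<theta>[of t] by (simp add: h_def)
  qed
  obtain u where u: "continuous_on (closure \<Omega> \<times> {0..<b - a}) u" "C21_on (\<Omega> \<times> {0<..<b - a}) u"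
    "\<And>p. p \<in> \<Omega> \<times> {0<..<b - a} \<Longrightarrow> hop u p (- gq q (u p))"
    "\<And>x t. x \<in> frontier \<Omega> \<Longrightarrow> 0 < t \<Longrightarrow> t < b - a \<Longrightarrow> u (x, t) = h (x, t)"
    "\<And>x. x \<in> closure \<Omega> \<Longrightarrow> u (x, 0) = c"
    "\<And>p. p \<in> closure \<Omega> \<times> {0..<b - a} \<Longrightarrow> 0 \<le> u p \<and> u p \<le> C"
    by (rule nonlinear_solve[OF \<Omega>(1) ne \<Omega>(4) q \<sigma>2 T c cC h1 h2 h3]; (assumption | (rule that; assumption)))
  define U where "U p = u (p + (0, - a))" for p
  show ?thesis
  proof (rule that[of U C])
    show "continuous_on (closure \<Omega> \<times> {a..<b}) U"
      unfolding U_def by (rule continuous_on_compose2[OF u(1)]) (auto intro!: continuous_intros)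
    have "open (\<Omega> \<times> {0<..<b - a})" by (intro open_Times \<Omega>(1)) auto
    from C21_translate[OF this u(2), of "(0, - a)"]
    show "C21_on (\<Omega> \<times> {a<..<b}) U" unfolding U_def[abs_def] by (rule C21_subset) auto
    show "hop U p (- gq q (U p))" if "p \<in> \<Omega> \<times> {a<..<b}" for p
    proof -
      have "p + (0, - a) \<in> \<Omega> \<times> {0<..<b - a}" using that by auto
      from hop_translate[OF u(3)[OF this]] show ?thesis unfolding U_def[abs_def] .
    qed
    show "\<exists>\<theta>\<ge>0. \<theta> \<le> 1 \<and> (a + \<sigma> \<le> t \<longrightarrow> \<theta> = 1) \<and> U (x, t) = (1 - \<theta>) * c + \<theta> * f (x, t)"
      if "x \<in> frontier \<Omega>" "a < t" "t < b" for x t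
      using u(4)[of x "t - a"] that \<theta>[of "t - a"] \<theta>1[of "t - a"]
      by (intro exI[of _ "\<theta> (t - a)"]) (auto simp: U_def h_def)
    show "U (x, a) = c" if "x \<in> closure \<Omega>" for x using u(5)[OF that] by (simp add: U_def)
    show "0 \<le> U p \<and> U p \<le> C" if "p \<in> closure \<Omega> \<times> {a..<b}" for p
    proof -
      have "p + (0, - a) \<in> closure \<Omega> \<times> {0..<b - a}" using that by auto
      from u(6)[OF this] show ?thesis unfolding U_def .
    qed
  qed
qed

text \<open>The solution is the decreasing limit of the solutions \<open>U n\<close> started at time
  \<open>\<tau> n = 1 / (n + 2)\<close> with the constant value \<open>c n\<close>. On the frontier \<open>U n\<close> is blended into \<open>f\<close>
  before the starting time of \<open>U (n - 1)\<close>, and \<open>c n\<close> dominates the flat supersolution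
  \<open>blowup\<close> of \<open>U (n + 1)\<close> at time \<open>\<tau> n\<close>; this is what makes the sequence decrease.\<close>

lemma existence:
  fixes \<Omega> :: "'a::euclidean_space set"
  assumes \<Omega>: "open \<Omega>" "frontier \<Omega> \<noteq> {}" "bounded (frontier \<Omega>)" "PWC \<Omega>" and q: "q > 1"
    and f: "continuous_on (frontier \<Omega> \<times> {0..}) f" "\<forall>p\<in>frontier \<Omega> \<times> {0..}. f p \<ge> 0"
  shows "\<exists>u. solution q \<Omega> f u"
proof -
  have q0: "0 < q" using q by simp
  have fnn: "0 \<le> f (x, t)" if "x \<in> frontier \<Omega>" "0 \<le> t" for x t using f(2) that by auto
  have "compact (frontier \<Omega> \<times> {0..1::real})"
    using \<Omega>(3) by (intro compact_Times) (auto simp: compact_eq_bounded_closed)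
  moreover have "continuous_on (frontier \<Omega> \<times> {0..1}) f" by (rule continuous_on_subset[OF f(1)]) auto
  ultimately obtain M where M: "M > 0" "\<And>z. z \<in> frontier \<Omega> \<times> {0..1} \<Longrightarrow> \<bar>f z\<bar> \<le> M"
    by (rule compact_bound) (rule that)
  have fM: "f (x, t) \<le> M" if "x \<in> frontier \<Omega>" "0 \<le> t" "t \<le> 1" for x t
  proof -
    have "(x, t) \<in> frontier \<Omega> \<times> {0..1}" using that by simp
    from M(2)[OF this] show ?thesis by simp
  qed
  define \<tau> where "\<tau> n = 1 / real (n + 2)" for n
  \<comment> \<open>For \<open>n > 0\<close> the number \<open>1 / real (n + 1)\<close> is
    \<open>\<tau> (n - 1)\<close>, so the blending of \<open>U n\<close> ends halfway to the
    starting time of its predecessor. Hence \<open>\<tau> (n + 1) + \<sigma> (n + 1)\<close>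
    precedes \<open>\<tau> n\<close> by exactly \<open>\<sigma> (n + 1)\<close>, the argument of
    \<open>blowup\<close> in \<open>c n\<close>.\<close>
  define \<sigma> where "\<sigma> n = (1 / real (n + 1) - \<tau> n) / 2" for n
  define E where "E n = real n + 2" for n
  define c where "c n = blowup q (\<sigma> (Suc n)) + M" for n
  have \<tau>: "0 < \<tau> n" "\<tau> n < 1" for n by (auto simp: \<tau>_def)
  have \<sigma>: "0 < \<sigma> n" for n by (simp add: \<sigma>_def \<tau>_def frac_less2)
  have s1: "\<tau> n + \<sigma> n < 1 / real (n + 1)" for n
  proof -
    have "2 * \<sigma> n = 1 / real (n + 1) - \<tau> n" by (simp add: \<sigma>_def)
    then show ?thesis using \<sigma>[of n] by linarith
  qed
  have ss: "\<tau> n - (\<tau> (Suc n) + \<sigma> (Suc n)) = \<sigma> (Suc n)" for n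
  proof -
    have "1 / real (Suc n + 1) = \<tau> n" by (simp add: \<tau>_def)
    then show ?thesis unfolding \<sigma>_def by (simp add: field_simps)
  qed
  have s\<tau>: "\<tau> (Suc n) + \<sigma> (Suc n) < \<tau> n" for n using ss[of n] \<sigma>[of "Suc n"] by linarith
  have s11: "\<tau> n + \<sigma> n < 1" for n
  proof -
    have "1 / real (n + 1) \<le> 1" by simp
    then show ?thesis using s1[of n] by linarith
  qed
  have c: "0 \<le> c n" "M \<le> c n" for n using blowup_pos[OF q \<sigma>, of "Suc n"] M by (auto simp: c_def)
  have \<tau>E: "\<tau> n < E n" for n using \<tau>[of n] by (simp add: E_def)
  have \<tau>a: "\<tau> (n + k) \<le> \<tau> n" for n k unfolding \<tau>_def by (intro frac_le) auto
  have Sk: "closure \<Omega> \<times> {\<tau> n..<E n} \<subseteq> closure \<Omega> \<times> {\<tau> (n + k)..<E (n + k)}" for n k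
    using \<tau>a[of n k] by (auto simp: E_def)
  have "\<forall>n. \<exists>U C. continuous_on (closure \<Omega> \<times> {\<tau> n..<E n}) U \<and> C21_on (\<Omega> \<times> {\<tau> n<..<E n}) U \<and>
    (\<forall>p\<in>\<Omega> \<times> {\<tau> n<..<E n}. hop U p (- gq q (U p))) \<and>
    (\<forall>x t. x \<in> frontier \<Omega> \<longrightarrow> \<tau> n < t \<longrightarrow> t < E n \<longrightarrow>
       (\<exists>\<theta>\<ge>0. \<theta> \<le> 1 \<and> (\<tau> n + \<sigma> n \<le> t \<longrightarrow> \<theta> = 1) \<and> U (x, t) = (1 - \<theta>) * c n + \<theta> * f (x, t))) \<and>
    (\<forall>x\<in>closure \<Omega>. U (x, \<tau> n) = c n) \<and> (\<forall>p\<in>closure \<Omega> \<times> {\<tau> n..<E n}. 0 \<le> U p \<and> U p \<le> C)"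
  proof
    fix n
    obtain U C where *: "continuous_on (closure \<Omega> \<times> {\<tau> n..<E n}) U" "C21_on (\<Omega> \<times> {\<tau> n<..<E n}) U"
      "\<And>p. p \<in> \<Omega> \<times> {\<tau> n<..<E n} \<Longrightarrow> hop U p (- gq q (U p))"
      "\<And>x t. x \<in> frontier \<Omega> \<Longrightarrow> \<tau> n < t \<Longrightarrow> t < E n \<Longrightarrow>
         \<exists>\<theta>\<ge>0. \<theta> \<le> 1 \<and> (\<tau> n + \<sigma> n \<le> t \<longrightarrow> \<theta> = 1) \<and> U (x, t) = (1 - \<theta>) * c n + \<theta> * f (x, t)"
      "\<And>x. x \<in> closure \<Omega> \<Longrightarrow> U (x, \<tau> n) = c n"
      "\<And>p. p \<in> closure \<Omega> \<times> {\<tau> n..<E n} \<Longrightarrow> 0 \<le> U p \<and> U p \<le> C"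
      by (rule start_solve[OF \<Omega> q f less_imp_le[OF \<tau>(1)[of n]] \<tau>E[of n] \<sigma>[of n] c(1)[of n]]; (assumption | (rule that; assumption)))
    show "\<exists>U C. continuous_on (closure \<Omega> \<times> {\<tau> n..<E n}) U \<and> C21_on (\<Omega> \<times> {\<tau> n<..<E n}) U \<and>
      (\<forall>p\<in>\<Omega> \<times> {\<tau> n<..<E n}. hop U p (- gq q (U p))) \<and>
      (\<forall>x t. x \<in> frontier \<Omega> \<longrightarrow> \<tau> n < t \<longrightarrow> t < E n \<longrightarrow>
         (\<exists>\<theta>\<ge>0. \<theta> \<le> 1 \<and> (\<tau> n + \<sigma> n \<le> t \<longrightarrow> \<theta> = 1) \<and> U (x, t) = (1 - \<theta>) * c n + \<theta> * f (x, t))) \<and>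
      (\<forall>x\<in>closure \<Omega>. U (x, \<tau> n) = c n) \<and> (\<forall>p\<in>closure \<Omega> \<times> {\<tau> n..<E n}. 0 \<le> U p \<and> U p \<le> C)"
      by (rule exI[of _ U], rule exI[of _ C], intro conjI ballI allI impI) (use * in blast)+
  qed
  from choice[OF this] obtain U where "\<forall>n. \<exists>C. continuous_on (closure \<Omega> \<times> {\<tau> n..<E n}) (U n) \<and> C21_on (\<Omega> \<times> {\<tau> n<..<E n}) (U n) \<and>
    (\<forall>p\<in>\<Omega> \<times> {\<tau> n<..<E n}. hop (U n) p (- gq q (U n p))) \<and>
    (\<forall>x t. x \<in> frontier \<Omega> \<longrightarrow> \<tau> n < t \<longrightarrow> t < E n \<longrightarrow>
       (\<exists>\<theta>\<ge>0. \<theta> \<le> 1 \<and> (\<tau> n + \<sigma> n \<le> t \<longrightarrow> \<theta> = 1) \<and> U n (x, t) = (1 - \<theta>) * c n + \<theta> * f (x, t))) \<and>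
    (\<forall>x\<in>closure \<Omega>. U n (x, \<tau> n) = c n) \<and> (\<forall>p\<in>closure \<Omega> \<times> {\<tau> n..<E n}. 0 \<le> U n p \<and> U n p \<le> C)" ..
  from choice[OF this] obtain C where UC: "\<forall>n. continuous_on (closure \<Omega> \<times> {\<tau> n..<E n}) (U n) \<and> C21_on (\<Omega> \<times> {\<tau> n<..<E n}) (U n) \<and>
    (\<forall>p\<in>\<Omega> \<times> {\<tau> n<..<E n}. hop (U n) p (- gq q (U n p))) \<and>
    (\<forall>x t. x \<in> frontier \<Omega> \<longrightarrow> \<tau> n < t \<longrightarrow> t < E n \<longrightarrow>
       (\<exists>\<theta>\<ge>0. \<theta> \<le> 1 \<and> (\<tau> n + \<sigma> n \<le> t \<longrightarrow> \<theta> = 1) \<and> U n (x, t) = (1 - \<theta>) * c n + \<theta> * f (x, t))) \<and>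
    (\<forall>x\<in>closure \<Omega>. U n (x, \<tau> n) = c n) \<and> (\<forall>p\<in>closure \<Omega> \<times> {\<tau> n..<E n}. 0 \<le> U n p \<and> U n p \<le> C n)" ..
  have Uc: "continuous_on (closure \<Omega> \<times> {\<tau> n..<E n}) (U n)" and UC21: "C21_on (\<Omega> \<times> {\<tau> n<..<E n}) (U n)"
    and Ulat: "x \<in> frontier \<Omega> \<Longrightarrow> \<tau> n < t \<Longrightarrow> t < E n \<Longrightarrow>
       \<exists>\<theta>\<ge>0. \<theta> \<le> 1 \<and> (\<tau> n + \<sigma> n \<le> t \<longrightarrow> \<theta> = 1) \<and> U n (x, t) = (1 - \<theta>) * c n + \<theta> * f (x, t)"
    and Uinit: "x \<in> closure \<Omega> \<Longrightarrow> U n (x, \<tau> n) = c n" for n x t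
    using UC by blast+
  have Uhop: "hop (U n) (x, t) (- gq q (U n (x, t)))" if "x \<in> \<Omega>" "\<tau> n < t" "t < E n" for n x t
  proof -
    have "(x, t) \<in> \<Omega> \<times> {\<tau> n<..<E n}" using that by simp
    then show ?thesis using UC by blast
  qed
  have Ub: "0 \<le> U n p" "U n p \<le> \<bar>C n\<bar>" if "p \<in> closure \<Omega> \<times> {\<tau> n..<E n}" for n p
  proof -
    have "0 \<le> U n p \<and> U n p \<le> C n" using UC that by blast
    then show "0 \<le> U n p" "U n p \<le> \<bar>C n\<bar>" by auto
  qed
  have Uf: "U n (x, t) = f (x, t)" if "x \<in> frontier \<Omega>" "\<tau> n + \<sigma> n \<le> t" "t < E n" for n x t
    using Ulat[OF that(1) _ that(3)] that(2) \<sigma>[of n] by force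
  have Ugef: "f (x, t) \<le> U n (x, t)" if xt: "x \<in> frontier \<Omega>" "\<tau> n < t" "t < E n" for n x t
  proof (cases "\<tau> n + \<sigma> n \<le> t")
    case True
    then show ?thesis using Uf[OF xt(1) _ xt(3)] by simp
  next
    case False
    obtain \<theta> where \<theta>: "0 \<le> \<theta>" "\<theta> \<le> 1" "U n (x, t) = (1 - \<theta>) * c n + \<theta> * f (x, t)" using Ulat[OF xt] by blast
    have "f (x, t) \<le> c n" using fM[OF xt(1), of t] False xt(2) \<tau>(1)[of n] s11[of n] c(2)[of n] by linarith
    then have "(1 - \<theta>) * f (x, t) \<le> (1 - \<theta>) * c n" using \<theta> by (intro mult_left_mono) auto
    then show ?thesis unfolding \<theta>(3) by (simp add: algebra_simps)
  qed
  \<comment> \<open>The flat solution started at the end of the blending, plus \<open>M\<close>, is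
    a supersolution: \<open>M\<close> bounds \<open>f\<close> up to time 1, and adding it only
    strengthens the absorption. The comparison begins slightly later, at a time when
    \<open>blowup\<close> still exceeds the bound \<open>C n\<close> of \<open>U n\<close>.\<close>
  have upper: "U n (x, t) \<le> blowup q (t - (\<tau> n + \<sigma> n)) + M"
    if xt: "x \<in> closure \<Omega>" "\<tau> n + \<sigma> n < t" "t \<le> 1" for n x t
  proof -
    define s where "s = \<tau> n + \<sigma> n"
    obtain d where d: "d > 0" "\<And>t. 0 < t \<Longrightarrow> t \<le> d \<Longrightarrow> C n \<le> blowup q t" using blowup_large[OF q] by blast
    define d' where "d' = min d (t - s)"
    have d': "0 < d'" "d' \<le> d" "s + d' \<le> t" using d xt by (auto simp: d'_def s_def)
    have s: "\<tau> n < s" using \<sigma>[of n] by (simp add: s_def)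
    have tE: "t < E n" using xt by (simp add: E_def)
    have sub: "closure \<Omega> \<times> {s + d'..t} \<subseteq> closure \<Omega> \<times> {\<tau> n..<E n}" using s d' tE by auto
    define B where "B p = blowup q (snd p - s) + M" for p :: "'a \<times> real"
    have B0: "0 \<le> B p" if "snd p > s" for p using blowup_pos[OF q, of "snd p - s"] M that by (simp add: B_def)
    have "U n (x, t) \<le> B (x, t)"
    proof (rule compare_sol[OF \<Omega>(1), of "s + d'" t "U n" B "\<bar>C n\<bar>"])
      show "continuous_on (closure \<Omega> \<times> {s + d'..t}) (U n)" by (rule continuous_on_subset[OF Uc sub])
      show "continuous_on (closure \<Omega> \<times> {s + d'..t}) B"
        unfolding B_def blowup_def using q d' by (intro continuous_intros) auto
      show "U n p \<le> \<bar>C n\<bar>" if "p \<in> closure \<Omega> \<times> {s + d'..t}" for p using Ub(2) that sub by blast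
      show "- \<bar>C n\<bar> \<le> B p" if "p \<in> closure \<Omega> \<times> {s + d'..t}" for p
      proof -
        have "snd p > s" using that d'(1) by auto
        from B0[OF this] show ?thesis by linarith
      qed
      show "U n (x, s + d') \<le> B (x, s + d')" if "x \<in> closure \<Omega>" for x
      proof -
        have "(x, s + d') \<in> closure \<Omega> \<times> {\<tau> n..<E n}" using that s d' tE by simp
        then have "U n (x, s + d') \<le> C n" using UC by blast
        also have "\<dots> \<le> blowup q d'" by (rule d(2)) (use d' in auto)
        finally show ?thesis using M by (simp add: B_def)
      qed
      show "U n (x, t') \<le> B (x, t')" if "x \<in> frontier \<Omega>" "s + d' < t'" "t' \<le> t" for x t'
      proof -
        have "U n (x, t') = f (x, t')" by (rule Uf) (use that d' tE s_def in auto)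
        also have "\<dots> \<le> M" by (rule fM) (use that d' s \<tau>[of n] xt in auto)
        finally show ?thesis using blowup_pos[OF q, of "t' - s"] that d' by (simp add: B_def)
      qed
      show "\<exists>h k. hop (U n) (x, t') h \<and> hop B (x, t') k \<and> h \<le> k"
        if x: "x \<in> \<Omega>" "s + d' < t'" "t' \<le> t" "B (x, t') < U n (x, t')" for x t'
      proof (intro exI conjI)
        show "hop (U n) (x, t') (- gq q (U n (x, t')))" by (rule Uhop) (use x s d' tE in auto)
        have ts: "0 < t' - s" using x d' by simp
        have "((\<lambda>r. blowup q (r - s)) has_real_derivative - (blowup q (t' - s) powr q)) (at (snd (x, t')))"
          using blowup_deriv[OF q ts] DERIV_shift[of "blowup q" _ t' "- s"] by simp
        from hop_add[OF hop_time[OF this] hop_const[of M]]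
        show "hop B (x, t') (- (blowup q (t' - s) powr q) + 0)" unfolding B_def[abs_def] .
        have "blowup q (t' - s) powr q = gq q (blowup q (t' - s))" using blowup_pos[OF q ts] by (simp add: gq_pos_eq)
        also have "\<dots> \<le> gq q (U n (x, t'))" using x(4) M by (intro gq_mono[OF q0]) (simp add: B_def)
        finally show "- gq q (U n (x, t')) \<le> - (blowup q (t' - s) powr q) + 0" by simp
      qed
      show "(x, t) \<in> closure \<Omega> \<times> {s + d'..t}" using xt d' by simp
    qed
    then show ?thesis by (simp add: B_def s_def)
  qed
  \<comment> \<open>At the starting time \<open>\<tau> n\<close> of \<open>U n\<close>, its value
    \<open>c n\<close> is exactly the bound \<open>upper\<close> for \<open>U (Suc n)\<close>; on
    the frontier \<open>U (Suc n)\<close> already equals \<open>f\<close>, which never exceeds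
    \<open>U n\<close>.\<close>
  have dec: "U (Suc n) p \<le> U n p" if p: "p \<in> closure \<Omega> \<times> {\<tau> n..<E n}" for n p
  proof (rule compare_sol[OF \<Omega>(1), of "\<tau> n" "snd p" "U (Suc n)" "U n" "\<bar>C (Suc n)\<bar>"])
    have sub: "closure \<Omega> \<times> {\<tau> n..snd p} \<subseteq> closure \<Omega> \<times> {\<tau> n..<E n}" using p by auto
    have sub': "closure \<Omega> \<times> {\<tau> n..snd p} \<subseteq> closure \<Omega> \<times> {\<tau> (Suc n)..<E (Suc n)}" using sub Sk[of n 1] by auto
    have pE: "snd p < E n" using p by auto
    have E': "E n < E (Suc n)" by (simp add: E_def)
    show "continuous_on (closure \<Omega> \<times> {\<tau> n..snd p}) (U (Suc n))" by (rule continuous_on_subset[OF Uc sub'])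
    show "continuous_on (closure \<Omega> \<times> {\<tau> n..snd p}) (U n)" by (rule continuous_on_subset[OF Uc sub])
    show "U (Suc n) p' \<le> \<bar>C (Suc n)\<bar>" if "p' \<in> closure \<Omega> \<times> {\<tau> n..snd p}" for p' using Ub(2) that sub' by blast
    show "- \<bar>C (Suc n)\<bar> \<le> U n p'" if "p' \<in> closure \<Omega> \<times> {\<tau> n..snd p}" for p'
    proof -
      have "0 \<le> U n p'" using Ub(1) that sub by blast
      then show ?thesis by linarith
    qed
    show "U (Suc n) (x, \<tau> n) \<le> U n (x, \<tau> n)" if "x \<in> closure \<Omega>" for x
      using upper[OF that s\<tau>[of n]] \<tau>(2)[of n] ss[of n] Uinit[OF that, of n] by (simp add: c_def)
    show "U (Suc n) (x, t) \<le> U n (x, t)" if "x \<in> frontier \<Omega>" "\<tau> n < t" "t \<le> snd p" for x t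
    proof -
      have "U (Suc n) (x, t) = f (x, t)" by (rule Uf) (use that s\<tau>[of n] pE E' in auto)
      also have "\<dots> \<le> U n (x, t)" by (rule Ugef) (use that pE in auto)
      finally show ?thesis .
    qed
    show "\<exists>h k. hop (U (Suc n)) (x, t) h \<and> hop (U n) (x, t) k \<and> h \<le> k"
      if "x \<in> \<Omega>" "\<tau> n < t" "t \<le> snd p" "U n (x, t) < U (Suc n) (x, t)" for x t
    proof (intro exI conjI)
      show "hop (U (Suc n)) (x, t) (- gq q (U (Suc n) (x, t)))"
        by (rule Uhop) (use that s\<tau>[of n] \<sigma>[of "Suc n"] pE E' in auto)
      show "hop (U n) (x, t) (- gq q (U n (x, t)))" by (rule Uhop) (use that pE in auto)
      show "- gq q (U (Suc n) (x, t)) \<le> - gq q (U n (x, t))" using gq_mono[OF q0] that(4) by simp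
    qed
    show "p \<in> closure \<Omega> \<times> {\<tau> n..snd p}" using p by (auto simp: mem_Times_iff)
  qed
  define w where "w p = lim (\<lambda>n. U n p)" for p
  have dec': "decseq (\<lambda>k. U (n + k) p)" if p: "p \<in> closure \<Omega> \<times> {\<tau> n..<E n}" for n p
  proof (rule decseq_SucI)
    fix k
    have "p \<in> closure \<Omega> \<times> {\<tau> (n + k)..<E (n + k)}" using p Sk by blast
    from dec[OF this] show "U (n + Suc k) p \<le> U (n + k) p" by simp
  qed
  have lim: "(\<lambda>k. U (n + k) p) \<longlonglongrightarrow> w p" if p: "p \<in> closure \<Omega> \<times> {\<tau> n..<E n}" for n p
  proof -
    have "0 \<le> U (n + k) p" for k
    proof -
      have "p \<in> closure \<Omega> \<times> {\<tau> (n + k)..<E (n + k)}" using p Sk by blast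
      from Ub(1)[OF this] show ?thesis .
    qed
    then have "\<forall>k. 0 \<le> U (n + k) p" by blast
    from decseq_convergent[OF dec'[OF p] this] obtain L where L: "(\<lambda>k. U (n + k) p) \<longlonglongrightarrow> L" .
    then have "(\<lambda>k. U k p) \<longlonglongrightarrow> L"
      using LIMSEQ_offset[of "\<lambda>k. U k p" n L] by (simp only: add.commute)
    then have "w p = L" unfolding w_def by (rule limI)
    then show ?thesis using L by simp
  qed
  have wU: "w p \<le> U n p" if p: "p \<in> closure \<Omega> \<times> {\<tau> n..<E n}" for n p
    using decseq_ge[OF dec'[OF p] lim[OF p], of 0] by simp
  have UU: "U (n + k) p \<le> U n p" if p: "p \<in> closure \<Omega> \<times> {\<tau> n..<E n}" for n k p
    using decseqD[OF dec'[OF p], of 0 k] by simp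
  have lw: "b \<le> w p" if p: "p \<in> closure \<Omega> \<times> {\<tau> n..<E n}" and b: "\<And>k. b \<le> U (n + k) p" for n b p
    by (rule LIMSEQ_le_const[OF lim[OF p]]) (use b in auto)
  \<comment> \<open>Provides an index for which the blending is over well before \<open>t\<close>
    and the solution lives well beyond \<open>t\<close>, so that near \<open>t\<close> its lateral
    values are exactly \<open>f\<close>.\<close>
  have big: "\<exists>n. \<tau> n + \<sigma> n < t / 2 \<and> 2 * t < E n" if t: "t > 0" for t
  proof -
    have "0 < t / 2" using t by simp
    then obtain n1 where n1: "1 / real (Suc n1) < t / 2" using nat_approx_posE by blast
    obtain n2 where n2: "2 * t < real n2" using reals_Archimedean2 by blast
    have "1 / real (n1 + n2 + 1) \<le> 1 / real (Suc n1)" by (intro frac_le) auto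
    then have "\<tau> (n1 + n2) + \<sigma> (n1 + n2) < t / 2" using s1[of "n1 + n2"] n1 by linarith
    moreover have "2 * t < E (n1 + n2)" using n2 by (simp add: E_def)
    ultimately show ?thesis by blast
  qed
  \<comment> \<open>At time \<open>\<tau> n\<close> the subsolution is at most
    \<open>blowup q (\<tau> n)\<close>, which is below \<open>c n\<close> because
    \<open>\<sigma> (Suc n) \<le> \<tau> n\<close>. The lower bound does not depend on
    \<open>n\<close>, so it survives the limit.\<close>
  have ball: "ball_sub q y r (x, t) \<le> U n (x, t)"
    if r: "r > 0" "ball y r \<subseteq> \<Omega>" and x: "x \<in> cball y r" and t: "\<tau> n \<le> t" "t < E n" for n x t y r
  proof (rule compare_sol[OF open_ball, of y r "\<tau> n" t "ball_sub q y r" "U n" "blowup q (\<tau> n)"])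
    have cl: "closure (ball y r) = cball y r" using r by simp
    have clO: "cball y r \<subseteq> closure \<Omega>" using closure_mono[OF r(2)] cl by simp
    have sub: "closure (ball y r) \<times> {\<tau> n..t} \<subseteq> closure \<Omega> \<times> {\<tau> n..<E n}" using clO cl t by auto
    show "continuous_on (closure (ball y r) \<times> {\<tau> n..t}) (ball_sub q y r)"
      by (rule continuous_on_subset[OF ball_sub_props(1)[OF q r(1)]]) (use \<tau>(1)[of n] in auto)
    show "continuous_on (closure (ball y r) \<times> {\<tau> n..t}) (U n)" by (rule continuous_on_subset[OF Uc sub])
    show "ball_sub q y r p \<le> blowup q (\<tau> n)" if p: "p \<in> closure (ball y r) \<times> {\<tau> n..t}" for p
    proof -
      obtain z s where zs: "p = (z, s)" "norm (z - y) \<le> r" "\<tau> n \<le> s"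
        using p cl by (auto simp: dist_norm norm_minus_commute)
      have "ball_sub q y r (z, s) \<le> blowup q s" using ball_sub_props(2)[OF q r(1), of s z y] zs \<tau>(1)[of n] by auto
      also have "\<dots> \<le> blowup q (\<tau> n)" by (rule blowup_antimono[OF q \<tau>(1) zs(3)])
      finally show ?thesis by (simp add: zs)
    qed
    show "- blowup q (\<tau> n) \<le> U n p" if p: "p \<in> closure (ball y r) \<times> {\<tau> n..t}" for p
    proof -
      have "0 \<le> U n p" using Ub(1) sub p by blast
      then show ?thesis using blowup_pos[OF q \<tau>(1)[of n]] by linarith
    qed
    show "ball_sub q y r (z, \<tau> n) \<le> U n (z, \<tau> n)" if z: "z \<in> closure (ball y r)" for z
    proof -
      have "norm (z - y) \<le> r" "z \<in> closure \<Omega>" using z cl clO by (auto simp: dist_norm norm_minus_commute)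
      then have "ball_sub q y r (z, \<tau> n) \<le> blowup q (\<tau> n)" "U n (z, \<tau> n) = c n"
        using ball_sub_props(2)[OF q r(1) \<tau>(1)] Uinit by blast+
      moreover have "blowup q (\<tau> n) \<le> blowup q (\<sigma> (Suc n))"
        by (rule blowup_antimono[OF q \<sigma>]) (use ss[of n] \<tau>(1)[of "Suc n"] \<sigma>[of "Suc n"] in linarith)
      ultimately show ?thesis using M by (simp add: c_def)
    qed
    show "ball_sub q y r (z, s) \<le> U n (z, s)" if z: "z \<in> frontier (ball y r)" "\<tau> n < s" "s \<le> t" for z s
    proof -
      have "norm (z - y) = r" using z(1) r(1) by (simp add: frontier_ball dist_norm norm_minus_commute)
      moreover have "(z, s) \<in> closure (ball y r) \<times> {\<tau> n..t}" using z unfolding frontier_def by simp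
      then have "(z, s) \<in> closure \<Omega> \<times> {\<tau> n..<E n}" using sub by blast
      ultimately have "ball_sub q y r (z, s) = 0" "0 \<le> U n (z, s)" 
        by (auto simp only: ball_sub_props(3)[OF q r(1)] intro: Ub(1))
      then show ?thesis by simp
    qed
    show "\<exists>h k. hop (ball_sub q y r) (z, s) h \<and> hop (U n) (z, s) k \<and> h \<le> k"
      if z: "z \<in> ball y r" "\<tau> n < s" "s \<le> t" "U n (z, s) < ball_sub q y r (z, s)" for z s
    proof -
      have zy: "norm (z - y) < r" using z(1) by (simp add: dist_norm norm_minus_commute)
      have s0: "0 < s" using z(2) \<tau>(1)[of n] by linarith
      obtain h where h: "h \<le> - (ball_sub q y r (z, s) powr q)" "hop (ball_sub q y r) (z, s) h"
        using ball_sub_props(5)[OF q r(1) s0 zy] by blast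
      have "0 \<le> ball_sub q y r (z, s)" using ball_sub_props(2)[OF q r(1) s0, of z y] zy by auto
      then have "ball_sub q y r (z, s) powr q = gq q (ball_sub q y r (z, s))" by (simp add: gq_pos_eq)
      moreover have "gq q (U n (z, s)) \<le> gq q (ball_sub q y r (z, s))" using z(4) by (intro gq_mono[OF q0]) simp
      ultimately have "h \<le> - gq q (U n (z, s))" using h(1) by linarith
      moreover have "hop (U n) (z, s) (- gq q (U n (z, s)))" by (rule Uhop) (use z r t in auto)
      ultimately show ?thesis using h(2) by blast
    qed
    show "(x, t) \<in> closure (ball y r) \<times> {\<tau> n..t}" using x t cl by simp
  qed
  have wball: "ball_sub q y r (y, t) \<le> w (y, t)" if r: "r > 0" "ball y r \<subseteq> \<Omega>" and t: "t > 0" for y r t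
  proof -
    obtain n where n: "\<tau> n + \<sigma> n < t / 2" "2 * t < E n" using big[OF t] by blast
    have tn: "\<tau> n < t" "t < E n" using n \<sigma>[of n] t by auto
    have "y \<in> \<Omega>" using r by auto
    then have "y \<in> closure \<Omega>" using closure_subset by blast
    then have p: "(y, t) \<in> closure \<Omega> \<times> {\<tau> n..<E n}" using tn by simp
    show ?thesis
    proof (rule lw[OF p])
      fix k
      have "(y, t) \<in> closure \<Omega> \<times> {\<tau> (n + k)..<E (n + k)}" using p Sk by blast
      then show "ball_sub q y r (y, t) \<le> U (n + k) (y, t)" using r by (intro ball) auto
    qed
  qed
  \<comment> \<open>On the cylinder of \<open>U n\<close> all later solutions are defined and lie
    between 0 and \<open>U n\<close>, which gives the local bound for
    \<open>closure_nonlinear\<close>.\<close>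
  have loc: "\<exists>V. open V \<and> p \<in> V \<and> C21_on V w \<and> (\<forall>p\<in>V. hop w p (- gq q (w p)))" if p: "p \<in> \<Omega> \<times> {0<..}" for p
  proof -
    have "snd p > 0" using p by auto
    then obtain n where n: "\<tau> n + \<sigma> n < snd p / 2" "2 * snd p < E n" using big by blast
    let ?V = "\<Omega> \<times> {\<tau> n<..<E n}"
    have pV: "p \<in> ?V" using p n \<sigma>[of n] by (auto simp: mem_Times_iff)
    have oV: "open ?V" by (intro open_Times \<Omega>(1)) auto
    have VS: "?V \<subseteq> closure \<Omega> \<times> {\<tau> n..<E n}" using closure_subset[of \<Omega>] by auto
    have Vk: "?V \<subseteq> \<Omega> \<times> {\<tau> (n + k)<..<E (n + k)}" for k using \<tau>a[of n k] by (auto simp: E_def)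
    have "C21_on ?V w \<and> (\<forall>p\<in>?V. hop w p (- ((\<lambda>_. 1) p * gq q (w p))))"
    proof (rule closure_nonlinear[where u="\<lambda>k. U (n + k)" and v="\<lambda>k. U (n + Suc k)" and \<kappa>x="\<lambda>_ _. 0" and g="gq q" and g'="gq' q"])
      show "C21_on ?V (U (n + k))" for k using UC21 Vk by (rule C21_subset)
      show "lbd ?V (\<lambda>k. U (n + k))"
        unfolding lbd_def
      proof
        fix p assume "p \<in> ?V"
        then obtain e where e: "e > 0" "cyl p e \<subseteq> ?V" using open_contains_cyl[OF oV] by blast
        have "\<bar>U (n + k) z\<bar> \<le> \<bar>C n\<bar> + 1" if "z \<in> cyl p e" for k z
        proof -
          have z: "z \<in> closure \<Omega> \<times> {\<tau> n..<E n}" using that e(2) VS by blast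
          then have "z \<in> closure \<Omega> \<times> {\<tau> (n + k)..<E (n + k)}" using Sk by blast
          from Ub(1)[OF this] UU[OF z, of k] Ub(2)[OF z] show ?thesis by linarith
        qed
        then show "\<exists>e>0. \<exists>C>0. cyl p e \<subseteq> ?V \<and> (\<forall>k. \<forall>q\<in>cyl p e. \<bar>U (n + k) q\<bar> \<le> C)"
          using e by (intro exI[of _ e] conjI exI[of _ "\<bar>C n\<bar> + 1"]) auto
      qed
      show "hop (U (n + Suc k)) p (- (1 * gq q (U (n + Suc k) p)))" if "p \<in> ?V" for k p
      proof -
        have pk: "p \<in> \<Omega> \<times> {\<tau> (n + Suc k)<..<E (n + Suc k)}" using that Vk[of "Suc k"] by blast
        obtain z s where zs: "p = (z, s)" by (cases p)
        have "hop (U (n + Suc k)) (z, s) (- gq q (U (n + Suc k) (z, s)))" by (rule Uhop) (use pk zs in auto)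
        then show ?thesis by (simp only: zs mult_1_left)
      qed
      show "(\<lambda>k. U (n + k) p) \<longlonglongrightarrow> w p" if "p \<in> ?V" for p using lim VS that by blast
    qed (use oV dd_const gq_deriv[OF q] cont_gq'[OF q] in auto)
    then show ?thesis using oV pV by (intro exI[of _ ?V]) auto
  qed
  have wC: "C21_on (\<Omega> \<times> {0<..}) w" by (rule C21_local) (use loc in blast)
  have whop: "hop w p (- gq q (w p))" if "p \<in> \<Omega> \<times> {0<..}" for p using loc[OF that] by blast
  have wpos: "w p > 0" if p: "p \<in> \<Omega> \<times> {0<..}" for p
  proof -
    obtain y t where yt: "p = (y, t)" "y \<in> \<Omega>" "t > 0" using p by auto
    obtain r where r: "r > 0" "ball y r \<subseteq> \<Omega>" using \<Omega>(1) yt(2) open_contains_ball by blast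
    have "0 < ball_sub q y r (y, t)" unfolding ball_sub_props(4)[OF q r(1)] using blowup_pos[OF q yt(3)] by simp
    then show ?thesis using wball[OF r yt(3)] yt(1) by simp
  qed
  have wlat: "w (x, t) = f (x, t)" if xt: "x \<in> frontier \<Omega>" "0 < t" for x t
  proof -
    obtain n where n: "\<tau> n + \<sigma> n < t / 2" "2 * t < E n" using big[OF xt(2)] by blast
    have xc: "x \<in> closure \<Omega>" using xt(1) by (simp add: frontier_def)
    have p: "(x, t) \<in> closure \<Omega> \<times> {\<tau> n..<E n}" using n xc xt(2) \<sigma>[of n] by auto
    have "w (x, t) \<le> U n (x, t)" by (rule wU[OF p])
    also have "U n (x, t) = f (x, t)" by (rule Uf) (use xt n in auto)
    finally have "w (x, t) \<le> f (x, t)" .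
    moreover have "f (x, t) \<le> w (x, t)"
    proof (rule lw[OF p])
      fix k
      show "f (x, t) \<le> U (n + k) (x, t)"
        by (rule Ugef) (use xt n \<sigma>[of n] \<tau>a[of n k] in \<open>auto simp: E_def\<close>)
    qed
    ultimately show ?thesis by simp
  qed
  have wc: "continuous_on (closure \<Omega> \<times> {0<..}) w"
    unfolding continuous_on_eq_continuous_within
  proof
    let ?S = "closure \<Omega> \<times> {0::real<..}"
    fix p assume p: "p \<in> ?S"
    show "continuous (at p within ?S) w"
    proof (cases "p \<in> \<Omega> \<times> {0<..}")
      case True
      have "open (\<Omega> \<times> {0::real<..})" by (intro open_Times \<Omega>(1)) auto
      then have "isCont w p" using wC True continuous_on_eq_continuous_at unfolding C21_on_def by blast
      then show ?thesis by (rule continuous_at_imp_continuous_at_within)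
    next
      case False
      obtain y t where yt: "p = (y, t)" "y \<in> frontier \<Omega>" "t > 0"
        using p False \<Omega>(1) by (auto simp: frontier_def interior_open)
      have yc: "y \<in> closure \<Omega>" using yt by (simp add: frontier_def)
      obtain n where n: "\<tau> n + \<sigma> n < t / 2" "2 * t < E n" using big[OF yt(3)] by blast
      have n': "\<tau> n < t / 2" "3 * t / 2 < E n" using n \<sigma>[of n] yt(3) by auto
      have t2: "0 \<le> t / 2" "t / 2 < 3 * t / 2" "0 < t / 4" using yt(3) by auto
      \<comment> \<open>Lower barrier at a frontier point: the solution started from 0 at time
        \<open>t / 2\<close> and blended into \<open>f\<close> by time \<open>3 t / 4\<close>. The
        upper barrier is \<open>U n\<close>; at \<open>p\<close> both equal \<open>f p\<close>, so
        the two meet exactly.\<close>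
      obtain b Cb where b: "continuous_on (closure \<Omega> \<times> {t / 2..<3 * t / 2}) b" "C21_on (\<Omega> \<times> {t / 2<..<3 * t / 2}) b"
        "\<And>p. p \<in> \<Omega> \<times> {t / 2<..<3 * t / 2} \<Longrightarrow> hop b p (- gq q (b p))"
        "\<And>x s. x \<in> frontier \<Omega> \<Longrightarrow> t / 2 < s \<Longrightarrow> s < 3 * t / 2 \<Longrightarrow>
           \<exists>\<theta>\<ge>0. \<theta> \<le> 1 \<and> (t / 2 + t / 4 \<le> s \<longrightarrow> \<theta> = 1) \<and> b (x, s) = (1 - \<theta>) * 0 + \<theta> * f (x, s)"
        "\<And>x. x \<in> closure \<Omega> \<Longrightarrow> b (x, t / 2) = 0"
        "\<And>p. p \<in> closure \<Omega> \<times> {t / 2..<3 * t / 2} \<Longrightarrow> 0 \<le> b p \<and> b p \<le> Cb"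
        by (rule start_solve[OF \<Omega> q f t2 order_refl]; (assumption | (rule that; assumption)))
      have bU: "b (x, s) \<le> U (n + k) (x, s)" if xs: "x \<in> closure \<Omega>" "t / 2 \<le> s" "s < 3 * t / 2" for x s k
      proof (rule compare_sol[OF \<Omega>(1), of "t / 2" s b "U (n + k)" "\<bar>Cb\<bar>"])
        have nk: "\<tau> (n + k) < t / 2" "3 * t / 2 < E (n + k)" using n' \<tau>a[of n k] by (auto simp: E_def)
        have sub: "closure \<Omega> \<times> {t / 2..s} \<subseteq> closure \<Omega> \<times> {\<tau> (n + k)..<E (n + k)}" using nk xs by auto
        have sub': "closure \<Omega> \<times> {t / 2..s} \<subseteq> closure \<Omega> \<times> {t / 2..<3 * t / 2}" using xs by auto
        show "continuous_on (closure \<Omega> \<times> {t / 2..s}) b" by (rule continuous_on_subset[OF b(1) sub'])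
        show "continuous_on (closure \<Omega> \<times> {t / 2..s}) (U (n + k))" by (rule continuous_on_subset[OF Uc sub])
        show "b p \<le> \<bar>Cb\<bar>" if "p \<in> closure \<Omega> \<times> {t / 2..s}" for p
        proof -
          have "b p \<le> Cb" using b(6) that sub' by blast
          then show ?thesis by linarith
        qed
        have U0: "0 \<le> U (n + k) p" if "p \<in> closure \<Omega> \<times> {t / 2..s}" for p using Ub(1) that sub by blast
        show "- \<bar>Cb\<bar> \<le> U (n + k) p" if "p \<in> closure \<Omega> \<times> {t / 2..s}" for p using U0[OF that] by linarith
        show "b (x, t / 2) \<le> U (n + k) (x, t / 2)" if "x \<in> closure \<Omega>" for x
        proof -
          have "(x, t / 2) \<in> closure \<Omega> \<times> {t / 2..s}" using that xs by simp
          from U0[OF this] show ?thesis using b(5)[OF that] by simp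
        qed
        show "b (x, s') \<le> U (n + k) (x, s')" if xf: "x \<in> frontier \<Omega>" "t / 2 < s'" "s' \<le> s" for x s'
        proof -
          have "s' < 3 * t / 2" using xf xs by simp
          then obtain \<theta> where \<theta>: "0 \<le> \<theta>" "\<theta> \<le> 1" "b (x, s') = \<theta> * f (x, s')" using b(4)[OF xf(1,2)] by auto
          have "\<theta> * f (x, s') \<le> 1 * f (x, s')" using \<theta> fnn[OF xf(1), of s'] xf yt(3) by (intro mult_right_mono) auto
          also have "1 * f (x, s') \<le> U (n + k) (x, s')" using Ugef[OF xf(1), of "n + k" s'] nk xf xs by simp
          finally show ?thesis using \<theta>(3) by simp
        qed
        show "\<exists>h j. hop b (x, s') h \<and> hop (U (n + k)) (x, s') j \<and> h \<le> j"
          if x: "x \<in> \<Omega>" "t / 2 < s'" "s' \<le> s" "U (n + k) (x, s') < b (x, s')" for x s'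
        proof (intro exI conjI)
          show "hop b (x, s') (- gq q (b (x, s')))" by (rule b(3)) (use x xs in auto)
          show "hop (U (n + k)) (x, s') (- gq q (U (n + k) (x, s')))" by (rule Uhop) (use x nk xs in auto)
          show "- gq q (b (x, s')) \<le> - gq q (U (n + k) (x, s'))" using gq_mono[OF q0] x(4) by simp
        qed
        show "(x, s) \<in> closure \<Omega> \<times> {t / 2..s}" using xs by simp
      qed
      have pO: "p \<in> UNIV \<times> {t / 2<..<3 * t / 2}" using yt by simp
      have oO: "open (UNIV \<times> {t / 2<..<3 * t / 2} :: ('a \<times> real) set)" by (intro open_Times) auto
      have within: "continuous (at p within ?S) g" if g: "continuous_on (closure \<Omega> \<times> {t / 2<..<3 * t / 2}) g" for g :: "'a \<times> real \<Rightarrow> real"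
      proof -
        have "p \<in> closure \<Omega> \<times> {t / 2<..<3 * t / 2}" using yt yc by simp
        then have "continuous (at p within closure \<Omega> \<times> {t / 2<..<3 * t / 2}) g"
          using g continuous_on_eq_continuous_within by blast
        moreover have "at p within ?S = at p within closure \<Omega> \<times> {t / 2<..<3 * t / 2}"
          by (rule at_within_nhd[OF pO oO]) (use yt(3) in auto)
        ultimately show ?thesis by simp
      qed
      have near: "(y', s) \<in> closure \<Omega> \<times> {\<tau> n..<E n}" if "y' \<in> closure \<Omega>" "t / 2 < s" "s < 3 * t / 2" for y' s
        using that n' by simp
      show ?thesis
      proof (rule squeeze_continuous[OF p])
        fix \<epsilon> :: real assume \<epsilon>: "\<epsilon> > 0"
        have sand: "b z \<le> w z \<and> w z \<le> U n z" if z0: "z \<in> ?S" "z \<in> UNIV \<times> {t / 2<..<3 * t / 2}" for z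
        proof -
          obtain y' s where z: "z = (y', s)" "y' \<in> closure \<Omega>" "t / 2 < s" "s < 3 * t / 2" using z0 by auto
          have "b (y', s) \<le> w (y', s)" by (rule lw[OF near[OF z(2-4)]]) (use bU z in auto)
          then show ?thesis using wU[OF near[OF z(2-4)]] z(1) by simp
        qed
        show "\<exists>lo hi. continuous (at p within ?S) lo \<and> continuous (at p within ?S) hi \<and>
          (\<forall>\<^sub>F z in at p within ?S. lo z \<le> w z \<and> w z \<le> hi z) \<and> lo p \<le> w p \<and> w p \<le> hi p \<and> hi p - lo p \<le> \<epsilon>"
        proof (rule exI[of _ b], rule exI[of _ "U n"], intro conjI)
          show "continuous (at p within ?S) b" by (intro within continuous_on_subset[OF b(1)]) auto
          show "continuous (at p within ?S) (U n)" by (intro within continuous_on_subset[OF Uc]) (use n' in auto)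
          show "\<forall>\<^sub>F z in at p within ?S. b z \<le> w z \<and> w z \<le> U n z"
            unfolding eventually_at_topological using oO pO sand by blast
          show "b p \<le> w p" "w p \<le> U n p" using sand[OF p pO] by auto
          have "U n p = f p" unfolding yt(1) by (rule Uf) (use yt n n' in auto)
          moreover have "b p = f p" using b(4)[OF yt(2), of t] yt(1,3) by auto
          ultimately show "U n p - b p \<le> \<epsilon>" using \<epsilon> by simp
        qed
      qed
    qed
  qed
  have wblow: "\<exists>\<delta>>0. \<forall>x\<in>K. \<forall>t. 0 < t \<and> t < \<delta> \<longrightarrow> L \<le> w (x, t)" if K: "compact K" "K \<subseteq> \<Omega>" for K L
  proof -
    obtain r where r: "r > 0" "(\<Union>x\<in>K. ball x r) \<subseteq> \<Omega>"
      using compact_subset_open_imp_ball_epsilon_subset[OF K(1) \<Omega>(1) K(2)] by blast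
    define lam where "lam = (8 + 4 * real DIM('a))\<^sup>2 / (32 * r\<^sup>2)"
    have lam: "lam \<ge> 0" by (simp add: lam_def)
    \<comment> \<open>For \<open>t < 1\<close> the damping factor at the centre of a ball is at
      least \<open>exp (- lam)\<close>, which the enlarged threshold \<open>L * exp lam\<close>
      compensates; one radius \<open>r\<close> serves all centres in \<open>K\<close>.\<close>
    obtain d where d: "d > 0" "\<And>t. 0 < t \<Longrightarrow> t \<le> d \<Longrightarrow> L * exp lam \<le> blowup q t" using blowup_large[OF q] by blast
    have "L \<le> w (x, t)" if x: "x \<in> K" and t: "0 < t" "t < min d 1" for x t
    proof -
      have "lam * t \<le> lam * 1" using lam t by (intro mult_left_mono) auto
      then have e: "exp (- lam) \<le> exp (- lam * t)" by simp
      have "L = exp (- lam) * (L * exp lam)" by (simp add: exp_minus field_simps)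
      also have "\<dots> \<le> exp (- lam) * blowup q t" using d(2)[of t] t by (intro mult_left_mono) auto
      also have "\<dots> \<le> exp (- lam * t) * blowup q t" using e blowup_pos[OF q t(1)] by (intro mult_right_mono) auto
      also have "\<dots> = ball_sub q x r (x, t)" unfolding ball_sub_props(4)[OF q r(1)] lam_def ..
      also have "\<dots> \<le> w (x, t)" by (rule wball) (use r x t in auto)
      finally show ?thesis .
    qed
    then show ?thesis using d(1) by (intro exI[of _ "min d 1"]) auto
  qed
  have "pdt w p - lap w p + \<bar>w p\<bar> powr (q - 1) * w p = 0" if "p \<in> \<Omega> \<times> {0<..}" for p
    using hop_pdt_lap[OF whop[OF that]] absorption_gq[OF wpos[OF that], of q] by simp
  then have "solution q \<Omega> f w"
    unfolding solution_def using wpos wc wC wlat wblow by (intro conjI ballI allI impI) auto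
  then show ?thesis by blast
qed

theorem theorem3p5:
  fixes q :: real and \<Omega> :: "'a::euclidean_space set" and f :: "'a \<times> real \<Rightarrow> real"
  assumes "q > 1"
    and "open \<Omega>" and "connected \<Omega>"
    and "frontier \<Omega> \<noteq> {}" and "bounded (frontier \<Omega>)"
    and "PWC \<Omega>"
    and "continuous_on (frontier \<Omega> \<times> {0..}) f"
    and "\<forall>p\<in>frontier \<Omega> \<times> {0..}. f p \<ge> 0"
  shows "(\<exists>u. (\<forall>p\<in>\<Omega> \<times> {0<..}. u p > 0) \<and>
              continuous_on (closure \<Omega> \<times> {0<..}) u \<and> C21_on (\<Omega> \<times> {0<..}) u \<and>
              (\<forall>p\<in>\<Omega> \<times> {0<..}. pdt u p - lap u p + \<bar>u p\<bar> powr (q - 1) * u p = 0) \<and>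
              (\<forall>p\<in>frontier \<Omega> \<times> {0<..}. u p = f p) \<and>
              (\<forall>K M. compact K \<and> K \<subseteq> \<Omega> \<longrightarrow>
                 (\<exists>\<delta>>0. \<forall>x\<in>K. \<forall>t. 0 < t \<and> t < \<delta> \<longrightarrow> M \<le> u (x, t))))
       \<and> (\<forall>u v. ((\<forall>p\<in>\<Omega> \<times> {0<..}. u p > 0) \<and>
              continuous_on (closure \<Omega> \<times> {0<..}) u \<and> C21_on (\<Omega> \<times> {0<..}) u \<and>
              (\<forall>p\<in>\<Omega> \<times> {0<..}. pdt u p - lap u p + \<bar>u p\<bar> powr (q - 1) * u p = 0) \<and>
              (\<forall>p\<in>frontier \<Omega> \<times> {0<..}. u p = f p) \<and>
              (\<forall>K M. compact K \<and> K \<subseteq> \<Omega> \<longrightarrow>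
                 (\<exists>\<delta>>0. \<forall>x\<in>K. \<forall>t. 0 < t \<and> t < \<delta> \<longrightarrow> M \<le> u (x, t))))
            \<and> ((\<forall>p\<in>\<Omega> \<times> {0<..}. v p > 0) \<and>
              continuous_on (closure \<Omega> \<times> {0<..}) v \<and> C21_on (\<Omega> \<times> {0<..}) v \<and>
              (\<forall>p\<in>\<Omega> \<times> {0<..}. pdt v p - lap v p + \<bar>v p\<bar> powr (q - 1) * v p = 0) \<and>
              (\<forall>p\<in>frontier \<Omega> \<times> {0<..}. v p = f p) \<and>
              (\<forall>K M. compact K \<and> K \<subseteq> \<Omega> \<longrightarrow>
                 (\<exists>\<delta>>0. \<forall>x\<in>K. \<forall>t. 0 < t \<and> t < \<delta> \<longrightarrow> M \<le> v (x, t))))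
            \<longrightarrow> (\<forall>p\<in>closure \<Omega> \<times> {0<..}. u p = v p))"
proof -
  have "\<exists>u. solution q \<Omega> f u" by (rule existence[OF assms(2,4,5,6,1,7,8)])
  moreover have "\<forall>u v. solution q \<Omega> f u \<and> solution q \<Omega> f v \<longrightarrow> (\<forall>p\<in>closure \<Omega> \<times> {0<..}. u p = v p)"
    using solution_le[OF assms(2,4,5,1,7,8)] by (intro allI impI ballI antisym) blast+
  ultimately show ?thesis unfolding solution_def by (rule conjI)
qed

end
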